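(* Suppose that one of the following two conditions holds: (Condition 1) $n$ is odd and the eigenvalues of the matrix $C=\int_0^1P_2(x)\,dx$ are simple; (Condition 2) $n$ is even, the eigenvalues of $C$ are simple, and $\operatorname{Re}\int_0^1p_1(x)\,dx\neq 0$. Then for each $f\in L_2^m(-\infty,\infty)$ the following equality holds: $$f(x)=\frac1{2\pi}\int_{(-\pi,\pi]}\sum_{k\le N_1}a_k(t)\Psi_{k,t}(x)\,dt+\frac1{2\pi}\sum_{k>N_1}\int_{(-\pi,\pi]}a_k(t)\Psi_{k,t}(x)\,dt .$$ The series converges in the norm of $L_2^m(a,b)$ for every $a,b\in\mathbb{R}$.
   Context: Let $n\ge 2$, $m\ge 1$. Let $p_1$ be a scalar complex-valued $(n-1)$ times continuously differentiable function with $p_1(x+1)=p_1(x)$, and let $P_2,\dots,P_n$ be $m\times m$ matrix functions with complex-valued entries summable on $[0,1]$ and $P_\nu(x+1)=P_\nu(x)$. $I_m$ is the unit matrix. For vector-valued $y=(y_1,\dots,y_m)$ put $$l(y)=y^{(n)}+p_1I_my^{(n-1)}+P_2y^{(n-2)}+\dots+P_ny .$$ $L_2^m(a,b)$ is the space of $\mathbb{C}^m$-valued square integrable functions on $(a,b)$ with its usual norm and inner product $(f,g)_{(a,b)}=\int_a^b\langle f(x),g(x)\rangle dx$; $(\cdot,\cdot)$ and $\|\cdot\|$ without index refer to $L_2^m(0,1)$. $T^{(m)}$ is the operator generated by $l$ in $L_2^m(-\infty,\infty)$; for $t\in\mathbb{C}$, $T^{(m)}_t$ is the operator generated in $L_2^m(0,1)$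 by $l$ and the boundary conditions $y^{(\nu)}(1)=e^{it}y^{(\nu)}(0)$, $\nu=0,\dots,n-1$. "The eigenvalues of $C$ are simple" means that $C$ has $m$ distinct eigenvalues $\mu_1,\dots,\mu_m$; $v_j$ are corresponding normalized eigenvectors, and $u_j$ is the eigenvector of $C^*$ for $\overline{\mu_j}$ with $\langle u_j,v_j\rangle=1$. Known facts and notation (under Condition 1 or Condition 2). Put $r=\frac1n\int_0^1p_1(x)dx$, $h(x)=\exp\left(rx-\frac1n\int_0^xp_1(s)ds\right)$ (a 1-periodic function), $\kappa=-\frac{n-1}{2n}\int_0^1p_1(x)^2dx$. There is a positive integer $N_0$, fixed from now on, such that for all $t\in(-\pi,\pi]$ the eigenvalues of $T_t^{(m)}$ (counted with multiplicity) consist of simple eigenvalues $\lambda_{k,j}(t)$, $k\in\mathbb{Z}$, $|k|\ge N_0$, $j=1,\dots,m$, with $$\lambda_{k,j}(t)=(2\pi ki+ti+r)^n+(\mu_j+\kappa)(2\pi ki+ti+r)^{n-2}+O(k^{n-3}\ln|k|),$$ together with $N_1:=(2N_0-1)m$ further eigenvalues; and such that the (suitably phased) normalized eigenfunction $\Psi_{k,j,t}$ of $T_t^{(m)}$ for $\lambda_{k,j}(t)$ and the eigenfunction $X_{k,j,t}$ of $(T_t^{(m)})^*$ for $\overline{\lambda_{k,j}(t)}$ with $(X_{k,j,t},\Psi_{k,j,t})=1$ satisfy $$\Psi_{k,j,t}(x)=\|h\|^{-1}h(x)v_je^{i(2\pi k+t)x}+O(k^{-1}\ln|k|),\quad X_{k,j,t}(x)=\|h\|\,\overline{h(x)}^{\,-1}u_je^{i(2\pi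 k+t)x}+O(k^{-1}\ln|k|),$$ where $\|h\|^2=\int_0^1|h|^2$, all $O$-terms being uniform in $t\in(-\pi,\pi]$, $x\in[0,1]$ for $|k|\ge N_0$. The eigenvalues can be numbered $\lambda_1(t),\lambda_2(t),\dots$ so that every $\lambda_p$ is continuous on $(-\pi,\pi]$ and, for $|k|\ge N_0$, $\lambda_{p(k,j)}(t)=\lambda_{k,j}(t)$ with $p(k,j)=2|k|m+j$ if $k>0$ and $p(k,j)=(2|k|-1)m+j$ if $k<0$; thus the indices $p>N_1$ are exactly those coming from $|k|\ge N_0$. Let $a_1,\dots,a_p$ be the (finitely many) numbers that are multiple eigenvalues of $T_t^{(m)}$ for some $t\in(-\pi,\pi]$, and let $A$ be the finite set of $t\in(-\pi,\pi]$ for which some $a_i$ is an eigenvalue of $T_t^{(m)}$. For $t\in(-\pi,\pi]\setminus A$ all eigenvalues are simple. For $t\in(-\pi,\pi]\setminus A$, $k\in\mathbb{N}=\{1,2,\dots\}$: $\Psi_{k,t}$ is the normalized eigenfunction of $T_t^{(m)}$ for $\lambda_k(t)$, $\Psi_{k,t}^*$ the normalized eigenfunction of $(T_t^{(m)})^*$ for $\overline{\lambda_k(t)}$, $\alpha_k(t)=(\Psi_{k,t},\Psi^*_{k,t})$, and $X_{k,t}=\Psi_{k,t}^*/\overline{\alpha_k(t)}$. They are extended to $\mathbb{R}$ by $\Psi_{k,t}(x+1)=e^{it}\Psi_{k,t}(x)$, $X_{k,t}(x+1)=e^{it}X_{k,t}(x)$. For $f\in L_2^m(-\infty,\infty)$,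 $f_t$ is its Gelfand transform $f_t(x)=\sum_{q\in\mathbb{Z}}f(x+q)e^{-iqt}$, so that $f=\frac1{2\pi}\int_0^{2\pi}f_t\,dt$, $f_t(x+1)=e^{it}f_t(x)$ and $\int_{\mathbb{R}}|f|^2dx=\frac1{2\pi}\int_0^{2\pi}\int_0^1|f_t(x)|^2dx\,dt$; and $$a_k(t)=(f_t,X_{k,t})=\int_0^1\langle f_t(x),X_{k,t}(x)\rangle dx .$$ Integrals over $t$ are taken over the complement of the finite set $A$. *)

theory Defs
  imports "HOL-Analysis.Analysis"
begin

section \<open>Vectors, matrices and square integrable functions\<close>

text \<open>The Hermitian inner product, linear in the first argument. The library's \<^const>\<open>inner\<close> on
  \<open>complex ^ 'm\<close> is its real part; the induced norms agree.\<close>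

definition cinner :: "complex ^ 'm \<Rightarrow> complex ^ 'm \<Rightarrow> complex" where
  "cinner x y = (\<Sum>i\<in>UNIV. x $ i * cnj (y $ i))"

definition adjoint_matrix :: "complex ^ 'm ^ 'm \<Rightarrow> complex ^ 'm ^ 'm" where
  "adjoint_matrix M = (\<chi> i j. cnj (M $ j $ i))"

definition matrix_eigenvector :: "complex ^ 'm ^ 'm \<Rightarrow> complex \<Rightarrow> complex ^ 'm \<Rightarrow> bool" where
  "matrix_eigenvector M z w \<longleftrightarrow> w \<noteq> 0 \<and> M *v w = z *s w"

definition matrix_eigenvalues :: "complex ^ 'm ^ 'm \<Rightarrow> complex set" where
  "matrix_eigenvalues M = {z. \<exists>w. matrix_eigenvector M z w}"

definition simple_matrix_eigenvalues :: "complex ^ 'm ^ 'm \<Rightarrow> bool" where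
  "simple_matrix_eigenvalues M \<longleftrightarrow> card (matrix_eigenvalues M) = CARD('m)"

text \<open>Elements of an \<open>L\<^sub>2\<close> space are represented by functions; only their values on \<open>S\<close> matter.\<close>

definition L2_on :: "real set \<Rightarrow> (real \<Rightarrow> 'a::euclidean_space) \<Rightarrow> bool" where
  "L2_on S f \<longleftrightarrow> set_borel_measurable lebesgue S f \<and> set_integrable lebesgue S (\<lambda>x. (norm (f x))\<^sup>2)"

definition L2_norm :: "real set \<Rightarrow> (real \<Rightarrow> 'a::euclidean_space) \<Rightarrow> real" where
  "L2_norm S f = sqrt (LINT x:S|lebesgue. (norm (f x))\<^sup>2)"

definition L2_inner :: "real set \<Rightarrow> (real \<Rightarrow> complex ^ 'm) \<Rightarrow> (real \<Rightarrow> complex ^ 'm) \<Rightarrow> complex" where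
  "L2_inner S f g = (LINT x:S|lebesgue. cinner (f x) (g x))"

section \<open>Operators in \<open>L\<^sub>2(0,1)\<close>\<close>

text \<open>Unbounded operators are given by their graphs: \<open>T y w\<close> means that \<open>y\<close> is in the domain of \<open>T\<close>
  and \<open>T y = w\<close> almost everywhere on \<open>[0,1]\<close>.\<close>

type_synonym 'm operator = "(real \<Rightarrow> complex ^ 'm) \<Rightarrow> (real \<Rightarrow> complex ^ 'm) \<Rightarrow> bool"

definition adjoint_operator :: "'m::finite operator \<Rightarrow> 'm operator" where
  "adjoint_operator T g w \<longleftrightarrow> L2_on {0..1} g \<and> L2_on {0..1} w \<and>
     (\<forall>y z. T y z \<longrightarrow> L2_inner {0..1} z g = L2_inner {0..1} y w)"

definition eigenfunction :: "'m::finite operator \<Rightarrow> complex \<Rightarrow> (real \<Rightarrow> complex ^ 'm) \<Rightarrow> bool" where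
  "eigenfunction T z y \<longleftrightarrow> T y (\<lambda>x. z *s y x) \<and> L2_norm {0..1} y \<noteq> 0"

definition normalized_eigenfunction ::
  "'m::finite operator \<Rightarrow> complex \<Rightarrow> (real \<Rightarrow> complex ^ 'm) \<Rightarrow> bool" where
  "normalized_eigenfunction T z y \<longleftrightarrow> eigenfunction T z y \<and> L2_norm {0..1} y = 1"

definition eigenvalue :: "'m::finite operator \<Rightarrow> complex \<Rightarrow> bool" where
  "eigenvalue T z \<longleftrightarrow> (\<exists>y. eigenfunction T z y)"

text \<open>\<open>power_kernel T z k y\<close> says \<open>(T - z)\<^sup>k y = 0\<close>.\<close>

primrec power_kernel :: "'m::finite operator \<Rightarrow> complex \<Rightarrow> nat \<Rightarrow> (real \<Rightarrow> complex ^ 'm) \<Rightarrow> bool" where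
  "power_kernel T z 0 y \<longleftrightarrow> (AE x\<in>{0..1} in lebesgue. y x = 0)"
| "power_kernel T z (Suc k) y \<longleftrightarrow>
     (\<exists>w. T y (\<lambda>x. z *s y x + w x) \<and> power_kernel T z k w)"

definition root_function :: "'m::finite operator \<Rightarrow> complex \<Rightarrow> (real \<Rightarrow> complex ^ 'm) \<Rightarrow> bool" where
  "root_function T z y \<longleftrightarrow> (\<exists>k. power_kernel T z k y)"

text \<open>The algebraic multiplicity of \<open>z\<close> is \<open>N\<close>: the root space has a basis with \<open>N\<close> elements.
  It is \<open>0\<close> exactly if \<open>z\<close> is not an eigenvalue.\<close>

definition has_multiplicity :: "'m::finite operator \<Rightarrow> complex \<Rightarrow> nat \<Rightarrow> bool" where
  "has_multiplicity T z N \<longleftrightarrow>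
     (\<exists>b. (\<forall>i<N. root_function T z (b i)) \<and>
          (\<forall>y. root_function T z y \<longrightarrow>
             (\<exists>!c. (\<forall>i\<ge>N. c i = 0) \<and>
                   (AE x\<in>{0..1} in lebesgue. y x = (\<Sum>i<N. c i *s b i x)))))"

definition multiple_eigenvalue :: "'m::finite operator \<Rightarrow> complex \<Rightarrow> bool" where
  "multiple_eigenvalue T z \<longleftrightarrow> eigenvalue T z \<and> \<not> has_multiplicity T z 1"

section \<open>The differential operators\<close>

definition times_cont_diff :: "nat \<Rightarrow> (real \<Rightarrow> complex) \<Rightarrow> bool" where
  "times_cont_diff k f \<longleftrightarrow>
     (\<exists>D. D 0 = f \<and> (\<forall>i<k. \<forall>x. (D i has_vector_derivative D (Suc i) x) (at x)) \<and>
          continuous_on UNIV (D k))"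

text \<open>\<open>D 0, \<dots>, D n\<close> are the derivatives of \<open>y\<close> up to order \<open>n\<close> on \<open>[0,1]\<close>, where the derivative of
  order \<open>n - 1\<close> is absolutely continuous, that is, the indefinite integral of a summable function,
  which is then its derivative almost everywhere.\<close>

definition derivatives_up_to ::
  "nat \<Rightarrow> (real \<Rightarrow> complex ^ 'm) \<Rightarrow> (nat \<Rightarrow> real \<Rightarrow> complex ^ 'm) \<Rightarrow> bool" where
  "derivatives_up_to n y D \<longleftrightarrow>
     (\<forall>x\<in>{0..1}. D 0 x = y x) \<and>
     (\<forall>i<n - 1. \<forall>x\<in>{0..1}. (D i has_vector_derivative D (Suc i) x) (at x within {0..1})) \<and>
     set_integrable lebesgue {0..1} (D n) \<and>
     (\<forall>x\<in>{0..1}. D (n - 1) x = D (n - 1) 0 + (LINT s:{0..x}|lebesgue. D n s))"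

text \<open>The operator \<open>T\<^sub>t\<close> generated in \<open>L\<^sub>2(0,1)\<close> by
  \<open>l(y) = y\<^sup>(\<^sup>n\<^sup>) + p\<^sub>1 y\<^sup>(\<^sup>n\<^sup>-\<^sup>1\<^sup>) + P\<^sub>2 y\<^sup>(\<^sup>n\<^sup>-\<^sup>2\<^sup>) + \<dots> + P\<^sub>n y\<close> and quasiperiodic boundary conditions, on its
  maximal domain.\<close>

definition bloch_operator ::
  "nat \<Rightarrow> (real \<Rightarrow> complex) \<Rightarrow> (nat \<Rightarrow> real \<Rightarrow> complex ^ 'm ^ 'm) \<Rightarrow> complex \<Rightarrow> 'm::finite operator" where
  "bloch_operator n p1 P t y w \<longleftrightarrow> L2_on {0..1} y \<and> L2_on {0..1} w \<and>
     (\<exists>D. derivatives_up_to n y D \<and>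
          (\<forall>\<nu><n. D \<nu> 1 = exp (\<i> * t) *s D \<nu> 0) \<and>
          (AE x\<in>{0..1} in lebesgue.
             w x = D n x + p1 x *s D (n - 1) x + (\<Sum>\<nu>=2..n. P \<nu> x *v D (n - \<nu>) x)))"

definition mean_matrix :: "(real \<Rightarrow> complex ^ 'm ^ 'm) \<Rightarrow> complex ^ 'm ^ 'm" where
  "mean_matrix Q = (\<chi> i j. LINT x:{0..1}|lebesgue. Q x $ i $ j)"

definition exponent_shift :: "nat \<Rightarrow> (real \<Rightarrow> complex) \<Rightarrow> complex" where
  "exponent_shift n p1 = (LINT x:{0..1}|lebesgue. p1 x) / of_nat n"

definition kappa :: "nat \<Rightarrow> (real \<Rightarrow> complex) \<Rightarrow> complex" where
  "kappa n p1 = - (of_nat (n - 1) / (2 * of_nat n)) * (LINT x:{0..1}|lebesgue. (p1 x)\<^sup>2)"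

text \<open>Used only for \<open>x\<close> in \<open>[0,1]\<close>.\<close>

definition gauge :: "nat \<Rightarrow> (real \<Rightarrow> complex) \<Rightarrow> real \<Rightarrow> complex" where
  "gauge n p1 x =
     exp (exponent_shift n p1 * of_real x - (LINT s:{0..x}|lebesgue. p1 s) / of_nat n)"

definition characteristic_exponent ::
  "nat \<Rightarrow> (real \<Rightarrow> complex) \<Rightarrow> int \<Rightarrow> real \<Rightarrow> complex" where
  "characteristic_exponent n p1 k t =
     2 * of_real pi * of_int k * \<i> + of_real t * \<i> + exponent_shift n p1"

section \<open>Numbering and asymptotics of the spectrum\<close>

abbreviation quasimomenta :: "real set" where
  "quasimomenta \<equiv> {- pi<..pi}"

definition eigenvalue_index :: "nat \<Rightarrow> int \<Rightarrow> nat \<Rightarrow> nat" where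
  "eigenvalue_index m k j =
     (if k > 0 then 2 * nat \<bar>k\<bar> * m + j else (2 * nat \<bar>k\<bar> - 1) * m + j)"

definition num_exceptional :: "nat \<Rightarrow> nat \<Rightarrow> nat" where
  "num_exceptional m N0 = (2 * N0 - 1) * m"

text \<open>\<open>lam p\<close>, \<open>p \<ge> 1\<close>, are continuous and enumerate the eigenvalues with multiplicity; those with
  index above \<open>num_exceptional m N0\<close>, which are the ones whose index is \<open>eigenvalue_index m k j\<close>
  with \<open>\<bar>k\<bar> \<ge> N0\<close>, are simple.\<close>

definition eigenvalue_numbering ::
  "(real \<Rightarrow> 'm::finite operator) \<Rightarrow> nat \<Rightarrow> (nat \<Rightarrow> real \<Rightarrow> complex) \<Rightarrow> bool" where
  "eigenvalue_numbering T N0 lam \<longleftrightarrow>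
     (\<forall>p\<ge>1. continuous_on quasimomenta (lam p)) \<and>
     (\<forall>t\<in>quasimomenta. \<forall>z. finite {p. p \<ge> 1 \<and> lam p t = z} \<and>
        has_multiplicity (T t) z (card {p. p \<ge> 1 \<and> lam p t = z})) \<and>
     (\<forall>t\<in>quasimomenta. \<forall>p>num_exceptional CARD('m) N0. has_multiplicity (T t) (lam p t) 1)"

text \<open>In the error bounds below, \<open>1 + ln \<bar>k\<bar>\<close> is used instead of \<open>ln \<bar>k\<bar>\<close>. This is equivalent for
  \<open>\<bar>k\<bar> \<ge> 2\<close>, up to the constant, and only avoids that the error is required to vanish for
  \<open>\<bar>k\<bar> = 1\<close>.\<close>

definition eigenvalue_asymptotics ::
  "nat \<Rightarrow> (real \<Rightarrow> complex) \<Rightarrow> nat \<Rightarrow> (nat \<Rightarrow> complex) \<Rightarrow> nat \<Rightarrow> (nat \<Rightarrow> real \<Rightarrow> complex) \<Rightarrow> bool" where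
  "eigenvalue_asymptotics n p1 m mu N0 lam \<longleftrightarrow>
     (\<exists>c::real. \<forall>t\<in>quasimomenta. \<forall>k. \<bar>k\<bar> \<ge> int N0 \<longrightarrow> (\<forall>j\<in>{1..m}.
        norm (lam (eigenvalue_index m k j) t
              - (characteristic_exponent n p1 k t ^ n
                 + (mu j + kappa n p1) * characteristic_exponent n p1 k t ^ (n - 2)))
          \<le> c * (of_int \<bar>k\<bar> powi (int n - 3) * (1 + ln (of_int \<bar>k\<bar>)))))"

definition eigenfunction_asymptotics ::
  "nat \<Rightarrow> (real \<Rightarrow> complex) \<Rightarrow> (real \<Rightarrow> 'm::finite operator) \<Rightarrow> (nat \<Rightarrow> complex ^ 'm) \<Rightarrow>
   (nat \<Rightarrow> complex ^ 'm) \<Rightarrow> nat \<Rightarrow> (nat \<Rightarrow> real \<Rightarrow> complex) \<Rightarrow> bool" where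
  "eigenfunction_asymptotics n p1 T v u N0 lam \<longleftrightarrow>
     (\<exists>Psi X. \<exists>c::real. \<forall>t\<in>quasimomenta. \<forall>k. \<bar>k\<bar> \<ge> int N0 \<longrightarrow> (\<forall>j\<in>{1..CARD('m)}.
        let z = lam (eigenvalue_index CARD('m) k j) t;
            e = (\<lambda>x. exp (\<i> * of_real ((2 * pi * of_int k + t) * x)));
            h = gauge n p1; a = complex_of_real (L2_norm {0..1} h);
            err = c * ((1 + ln (of_int \<bar>k\<bar>)) / of_int \<bar>k\<bar>)
        in normalized_eigenfunction (T t) z (Psi k j t) \<and>
           eigenfunction (adjoint_operator (T t)) (cnj z) (X k j t) \<and>
           L2_inner {0..1} (X k j t) (Psi k j t) = 1 \<and>
           (\<forall>x\<in>{0..1}. norm (Psi k j t x - (h x / a * e x) *s v j) \<le> err \<and>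
                       norm (X k j t x - (a / cnj (h x) * e x) *s u j) \<le> err)))"

definition all_multiple_eigenvalues :: "(real \<Rightarrow> 'm::finite operator) \<Rightarrow> complex set" where
  "all_multiple_eigenvalues T = {a. \<exists>t\<in>quasimomenta. multiple_eigenvalue (T t) a}"

definition exceptional_quasimomenta :: "(real \<Rightarrow> 'm::finite operator) \<Rightarrow> real set" where
  "exceptional_quasimomenta T =
     {t\<in>quasimomenta. \<exists>a\<in>all_multiple_eigenvalues T. eigenvalue (T t) a}"

section \<open>Gelfand transform and expansion\<close>

text \<open>\<open>F t x = (\<Sum>q\<in>\<int>. f (x + q) e\<^sup>-\<^sup>i\<^sup>q\<^sup>t)\<close> on the fundamental cell. For a general \<open>f\<close> in \<open>L\<^sub>2\<close> the
  series need not converge absolutely at any point; it converges in \<open>L\<^sub>2\<close> of the cell, which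
  determines \<open>F\<close> almost everywhere.\<close>

definition gelfand_transform ::
  "(real \<Rightarrow> complex ^ 'm::finite) \<Rightarrow> (real \<Rightarrow> real \<Rightarrow> complex ^ 'm) \<Rightarrow> bool" where
  "gelfand_transform f F \<longleftrightarrow>
     set_borel_measurable lebesgue (quasimomenta \<times> {0..1}) (\<lambda>(t, x). F t x) \<and>
     (\<lambda>Q::nat. \<integral>\<^sup>+ (t, x) \<in> quasimomenta \<times> {0..1}.
        ennreal ((norm (F t x - (\<Sum>q = - int Q..int Q.
          exp (- \<i> * of_int q * of_real t) *s f (x + of_int q))))\<^sup>2) \<partial>lebesgue) \<longlonglongrightarrow> 0"

text \<open>The extension of a function on \<open>[0,1)\<close> satisfying \<open>y (x + 1) = e\<^sup>i\<^sup>t y x\<close>.\<close>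

definition quasiperiodic_extension ::
  "real \<Rightarrow> (real \<Rightarrow> complex ^ 'm) \<Rightarrow> real \<Rightarrow> complex ^ 'm" where
  "quasiperiodic_extension t y x = exp (\<i> * of_real t * of_int \<lfloor>x\<rfloor>) *s y (frac x)"

definition dual_eigenfunction ::
  "(real \<Rightarrow> complex ^ 'm) \<Rightarrow> (real \<Rightarrow> complex ^ 'm) \<Rightarrow> real \<Rightarrow> complex ^ 'm" where
  "dual_eigenfunction psi psi_star x = (1 / cnj (L2_inner {0..1} psi psi_star)) *s psi_star x"

text \<open>The function \<open>a\<^sub>k(t) \<Psi>\<^sub>k\<^sub>,\<^sub>t(x)\<close>. It does not depend on the phases of the two normalized
  eigenfunctions.\<close>

definition expansion_term ::
  "(real \<Rightarrow> real \<Rightarrow> complex ^ 'm) \<Rightarrow> (nat \<Rightarrow> real \<Rightarrow> real \<Rightarrow> complex ^ 'm) \<Rightarrow>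
   (nat \<Rightarrow> real \<Rightarrow> real \<Rightarrow> complex ^ 'm) \<Rightarrow> nat \<Rightarrow> real \<Rightarrow> real \<Rightarrow> complex ^ 'm" where
  "expansion_term F Psi Psi_star k t x =
     L2_inner {0..1} (F t) (dual_eigenfunction (Psi k t) (Psi_star k t))
       *s quasiperiodic_extension t (Psi k t) x"

end

theory Submission
  imports Defs
begin

text \<open>For \<open>k > N\<^sub>1\<close> the eigenfunctions are square summably close, uniformly in \<open>t\<close>, to the explicit Riesz
  basis \<open>\<parallel>h\<parallel>\<^sup>-\<^sup>1 h v\<^sub>j e\<^bsup>i(2\<pi>k+t)x\<^esup>\<close>, whose frame bounds come from Bessel's inequality and Parseval's
  identity. The tail of the biorthogonal expansion is therefore bounded in each fibre uniformly in \<open>t\<close>,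
  and, since the discarded part of the explicit basis has as many elements as the omitted
  eigenfunctions, a dimension count gives completeness in each fibre. The inverse Gelfand transform
  maps \<open>L\<^sub>2(J \<times> [0,1])\<close> boundedly into \<open>L\<^sub>2(a,b)\<close>, so dominated convergence in \<open>t\<close> yields the theorem. Only
  the individual \<open>k \<le> N\<^sub>1\<close> may have projections that are unbounded near the exceptional \<open>t\<close>; their sum is the
  difference of two bounded quantities. Nothing is known about how \<open>\<Psi>\<^sub>k\<^sub>,\<^sub>t\<close> depends on \<open>t\<close>; measurability of
  \<open>a\<^sub>k(t) \<Psi>\<^sub>k\<^sub>,\<^sub>t\<close> follows from compactness of bounded sets of solutions of the differential equation, which makes
  the phase independent products of values of \<open>\<Psi>\<^sub>k\<^sub>,\<^sub>t\<close> jointly continuous.\<close>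

section \<open>Square integrable functions\<close>

text \<open>The operators need not be self-adjoint, so completeness in a fibre does not come from a
  spectral theorem, and the pairing of an eigenfunction with its adjoint partner might vanish, in
  which case the quotient in \<open>dual_eigenfunction\<close> would be the default value 0. One
  argument settles both: the dual functions furnished by the asymptotics exist only beyond
  \<open>N1\<close>, but they annihilate every other eigenfunction, also the first ones, which are
  known only to be independent. Completeness then forces the pairings to be nonzero. The asymptotics
  concern suitably phased eigenfunctions, whereas \<open>Psi\<close> is an arbitrary choice for each
  t. Hence only quantities blind to a factor of modulus 1 are compared: projections and the kernels
  \<open>cnj (Psi p t q $ i) *s Psi p t x\<close>. The adjoint eigenfunctions are never followed in
  t: projections are evaluated by biorthogonality on finite combinations of eigenfunctions and
  extended by approximation. \<open>f\<close> and \<open>F\<close> are fixed only up to null sets,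
  while the integrals over t are taken at each x; the Borel versions therefore agree for almost
  every t and then for all x at once.\<close>

lemma cinner_add_left: "cinner (x + y) z = cinner x z + cinner y z"
  and cinner_add_right: "cinner z (x + y) = cinner z x + cinner z y"
  and cinner_diff_left: "cinner (x - y) z = cinner x z - cinner y z"
  and cinner_diff_right: "cinner z (x - y) = cinner z x - cinner z y"
  and cinner_scale_left: "cinner (c *s x) z = c * cinner x z"
  and cinner_scale_right: "cinner z (c *s x) = cnj c * cinner z x"
  and cinner_zero_left [simp]: "cinner 0 z = 0"
  and cinner_zero_right [simp]: "cinner z 0 = 0"
  and cinner_commute: "cinner x z = cnj (cinner z x)"
  by (simp_all add: cinner_def algebra_simps sum.distrib sum_subtractf sum_distrib_left)

lemma norm_vec_complex_squared: "(norm (x :: complex ^ 'm))\<^sup>2 = (\<Sum>i\<in>UNIV. (cmod (x $ i))\<^sup>2)"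
  by (simp add: norm_vec_def L2_set_def sum_nonneg)

lemma cinner_self: "cinner x x = complex_of_real ((norm x)\<^sup>2)"
  by (simp add: cinner_def norm_vec_complex_squared complex_norm_square [symmetric] del: of_real_power)

lemma norm_cinner_le: "cmod (cinner x y) \<le> norm x * norm y"
proof -
  have "cmod (cinner x y) \<le> (\<Sum>i\<in>UNIV. \<bar>cmod (x $ i)\<bar> * \<bar>cmod (y $ i)\<bar>)"
    unfolding cinner_def by (rule sum_norm_le) (simp add: norm_mult)
  also have "\<dots> \<le> L2_set (\<lambda>i. cmod (x $ i)) UNIV * L2_set (\<lambda>i. cmod (y $ i)) UNIV"
    by (rule L2_set_mult_ineq)
  finally show ?thesis by (simp add: norm_vec_def)
qed

lemma norm_smult_vec: "norm (c *s (x :: complex ^ 'm)) = cmod c * norm x"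
proof (rule power2_eq_imp_eq)
  show "(norm (c *s x))\<^sup>2 = (cmod c * norm x)\<^sup>2"
    by (simp add: norm_vec_complex_squared power_mult_distrib norm_mult sum_distrib_left)
qed auto

text \<open>Complex multiples \<open>*s\<close> are not the real scaling of the normed space;
  limits, continuity and measurability of such products all pass through this bilinearity.\<close>

lemma bounded_bilinear_smult: "bounded_bilinear ((*s) :: complex \<Rightarrow> complex ^ 'm \<Rightarrow> _)"
proof
  show "\<exists>K. \<forall>a b. norm (a *s b :: complex ^ 'm) \<le> norm a * norm b * K"
    by (rule exI [of _ 1]) (simp add: norm_smult_vec)
qed (simp_all add: vec_eq_iff vector_scaleR_component algebra_simps)

lemma bounded_bilinear_cinner: "bounded_bilinear (cinner :: complex ^ 'm \<Rightarrow> _)"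
proof
  show "\<exists>K. \<forall>a b. norm (cinner (a :: complex ^ 'm) b) \<le> norm a * norm b * K"
    by (rule exI [of _ 1]) (simp add: norm_cinner_le)
qed (simp_all add: cinner_def vector_scaleR_component algebra_simps sum.distrib scaleR_sum_right)

lemma borel_measurable_smult [measurable]:
  assumes [measurable]: "c \<in> borel_measurable M" "(f :: _ \<Rightarrow> complex ^ 'm::finite) \<in> borel_measurable M"
  shows "(\<lambda>x. c x *s f x) \<in> borel_measurable M"
  using bounded_bilinear.continuous_on[OF bounded_bilinear_smult continuous_on_fst[OF continuous_on_id]
      continuous_on_snd[OF continuous_on_id], of UNIV]
  by (auto intro!: borel_measurable_continuous_Pair[OF assms] simp: split_beta)

lemma borel_measurable_cinner [measurable]:
  assumes [measurable]: "(f :: _ \<Rightarrow> complex ^ 'm::finite) \<in> borel_measurable M" "g \<in> borel_measurable M"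
  shows "(\<lambda>x. cinner (f x) (g x)) \<in> borel_measurable M"
  using bounded_bilinear.continuous_on[OF bounded_bilinear_cinner continuous_on_fst[OF continuous_on_id]
      continuous_on_snd[OF continuous_on_id], of UNIV]
  by (auto intro!: borel_measurable_continuous_Pair[OF assms] simp: split_beta)

lemma continuous_on_smult [continuous_intros]:
  "continuous_on S c \<Longrightarrow> continuous_on S f \<Longrightarrow> continuous_on S (\<lambda>x. c x *s (f x :: complex ^ 'm))"
  by (rule bounded_bilinear.continuous_on[OF bounded_bilinear_smult])

section \<open>L2 seminorm and inner product over a measurable set\<close>

context
  fixes S :: "real set"
  assumes S: "S \<in> sets lebesgue"
begin

lemma L2_on_iff:
  "L2_on S f \<longleftrightarrow> f \<in> borel_measurable (lebesgue_on S) \<and> integrable (lebesgue_on S) (\<lambda>x. (norm (f x))\<^sup>2)"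
  using S by (simp add: L2_on_def set_borel_measurable_def borel_measurable_restrict_space_iff
      set_integrable_def integrable_restrict_space)

lemma L2_norm_eq: "L2_norm S f = sqrt (\<integral>x. (norm (f x))\<^sup>2 \<partial>lebesgue_on S)"
  using S by (simp add: L2_norm_def set_lebesgue_integral_def integral_restrict_space)

lemma L2_inner_eq: "L2_inner S f g = (\<integral>x. cinner (f x) (g x) \<partial>lebesgue_on S)"
  using S by (simp add: L2_inner_def set_lebesgue_integral_def integral_restrict_space)

lemma L2_norm_squared: "(L2_norm S f)\<^sup>2 = (\<integral>x. (norm (f x))\<^sup>2 \<partial>lebesgue_on S)"
  by (simp add: L2_norm_eq integral_nonneg_AE)

lemma L2_norm_nonneg [simp]: "0 \<le> L2_norm S f"
  by (simp add: L2_norm_eq integral_nonneg_AE)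

lemma AE_on_iff: "(AE x\<in>S in lebesgue. Q x) \<longleftrightarrow> (AE x in lebesgue_on S. Q x)"
  using S by (simp add: AE_restrict_space_iff)

lemma L2_on_add:
  assumes "L2_on S f" "L2_on S g" shows "L2_on S (\<lambda>x. f x + g x)"
proof -
  have [measurable]: "f \<in> borel_measurable (lebesgue_on S)" "g \<in> borel_measurable (lebesgue_on S)"
    using assms by (auto simp: L2_on_iff)
  have "integrable (lebesgue_on S) (\<lambda>x. 2 * (norm (f x))\<^sup>2 + 2 * (norm (g x))\<^sup>2)"
    using assms by (auto simp: L2_on_iff)
  moreover have "(norm (f x + g x))\<^sup>2 \<le> 2 * (norm (f x))\<^sup>2 + 2 * (norm (g x))\<^sup>2" for x
  proof -
    have "(norm (f x + g x))\<^sup>2 \<le> (norm (f x) + norm (g x))\<^sup>2"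
      by (rule power_mono[OF norm_triangle_ineq]) auto
    also have "\<dots> \<le> 2 * (norm (f x))\<^sup>2 + 2 * (norm (g x))\<^sup>2"
      using sum_squares_ge_zero[of "norm (f x) - norm (g x)" 0] by (simp add: power2_eq_square algebra_simps)
    finally show ?thesis .
  qed
  ultimately have "integrable (lebesgue_on S) (\<lambda>x. (norm (f x + g x))\<^sup>2)"
    by (elim Bochner_Integration.integrable_bound) (auto simp: abs_of_nonneg)
  thus ?thesis by (auto simp: L2_on_iff)
qed

lemma L2_on_scale:
  assumes "L2_on S f" shows "L2_on S (\<lambda>x. c *s (f x :: complex ^ 'm::finite))"
proof -
  have [measurable]: "f \<in> borel_measurable (lebesgue_on S)" using assms by (auto simp: L2_on_iff)
  show ?thesis using assms by (auto simp: L2_on_iff norm_smult_vec power_mult_distrib)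
qed

lemma L2_on_zero [simp]: "L2_on S (\<lambda>x. 0)"
  by (auto simp: L2_on_iff)

lemma L2_on_diff:
  assumes "L2_on S f" "L2_on S g" shows "L2_on S (\<lambda>x. f x - g x)"
proof -
  have "L2_on S (\<lambda>x. - g x)" using assms by (auto simp: L2_on_iff)
  from L2_on_add[OF assms(1) this] show ?thesis by simp
qed

lemma L2_on_sum:
  assumes "\<And>i. i \<in> I \<Longrightarrow> L2_on S (f i)" shows "L2_on S (\<lambda>x. \<Sum>i\<in>I. f i x)"
  using assms by (induction I rule: infinite_finite_induct) (auto intro: L2_on_add)

lemma L2_on_lincomb:
  fixes f :: "'b \<Rightarrow> real \<Rightarrow> complex ^ 'm::finite"
  assumes "\<And>i. i \<in> I \<Longrightarrow> L2_on S (f i)" shows "L2_on S (\<lambda>x. \<Sum>i\<in>I. c i *s f i x)"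
  using assms by (intro L2_on_sum L2_on_scale) auto

text \<open>Completeness of Lebesgue measure carries measurability over to an almost everywhere
  equal function; the indicator moves the question from \<open>S\<close> to the whole line.\<close>

lemma L2_on_cong_AE:
  assumes "L2_on S f" "AE x\<in>S in lebesgue. f x = g x" shows "L2_on S g"
proof -
  have f: "f \<in> borel_measurable (lebesgue_on S)" "integrable (lebesgue_on S) (\<lambda>x. (norm (f x))\<^sup>2)"
    using assms by (auto simp: L2_on_iff)
  have ae: "AE x in lebesgue_on S. f x = g x" using assms(2) by (simp add: AE_on_iff)
  have F0: "(\<lambda>x. indicator S x *\<^sub>R f x) \<in> borel_measurable lebesgue"
    using f(1) S by (simp add: borel_measurable_restrict_space_iff)
  have "AE x in lebesgue. indicator S x *\<^sub>R f x = indicator S x *\<^sub>R g x"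
    using assms(2) by eventually_elim (auto simp: indicator_def)
  hence "(\<lambda>x. indicator S x *\<^sub>R g x) \<in> borel_measurable lebesgue"
    by (rule borel_measurable_AE[OF F0])
  hence g: "g \<in> borel_measurable (lebesgue_on S)" using S by (simp add: borel_measurable_restrict_space_iff)
  have "integrable (lebesgue_on S) (\<lambda>x. (norm (g x))\<^sup>2)"
    by (rule iffD1[OF integrable_cong_AE f(2)]) (use f g ae in \<open>auto elim: eventually_mono\<close>)
  with g show ?thesis by (simp add: L2_on_iff)
qed

lemma integrable_norm_mult_L2:
  fixes f g :: "real \<Rightarrow> 'a::euclidean_space"
  assumes "L2_on S f" "L2_on S g"
  shows "integrable (lebesgue_on S) (\<lambda>x. norm (f x) * norm (g x))"
proof -
  have [measurable]: "f \<in> borel_measurable (lebesgue_on S)" "g \<in> borel_measurable (lebesgue_on S)"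
    using assms by (auto simp: L2_on_iff)
  have i: "integrable (lebesgue_on S) (\<lambda>x. (norm (f x))\<^sup>2 + (norm (g x))\<^sup>2)"
    using assms by (auto simp: L2_on_iff)
  have *: "norm (f x) * norm (g x) \<le> (norm (f x))\<^sup>2 + (norm (g x))\<^sup>2" for x
    using sum_squares_bound[of "norm (f x)" "norm (g x)"] zero_le_mult_iff[of "norm (f x)" "norm (g x)"]
      norm_ge_zero[of "f x"] norm_ge_zero[of "g x"] by linarith
  show "integrable (lebesgue_on S) (\<lambda>x. norm (f x) * norm (g x))"
    by (rule Bochner_Integration.integrable_bound[OF i]) (use * in \<open>auto simp: abs_of_nonneg\<close>)
qed

lemma integrable_cinner:
  assumes "L2_on S f" "L2_on S g"
  shows "integrable (lebesgue_on S) (\<lambda>x. cinner (f x) (g x))"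
proof -
  have [measurable]: "f \<in> borel_measurable (lebesgue_on S)" "g \<in> borel_measurable (lebesgue_on S)"
    using assms by (auto simp: L2_on_iff)
  show ?thesis
    by (rule Bochner_Integration.integrable_bound[OF integrable_norm_mult_L2[OF assms]])
      (auto simp: norm_cinner_le)
qed

text \<open>The integral of (r |f| - s |g|)^2 is a nonnegative quadratic form in r and s, so its
  discriminant is not positive.\<close>

lemma Cauchy_Schwarz_L2:
  fixes f g :: "real \<Rightarrow> 'a::euclidean_space"
  assumes "L2_on S f" "L2_on S g"
  shows "(\<integral>x. norm (f x) * norm (g x) \<partial>lebesgue_on S) \<le> L2_norm S f * L2_norm S g"
proof -
  let ?M = "lebesgue_on S"
  define a b c where "a = (\<integral>x. (norm (f x))\<^sup>2 \<partial>?M)" and "b = (\<integral>x. norm (f x) * norm (g x) \<partial>?M)"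
    and "c = (\<integral>x. (norm (g x))\<^sup>2 \<partial>?M)"
  have i: "integrable ?M (\<lambda>x. (norm (f x))\<^sup>2)" "integrable ?M (\<lambda>x. (norm (g x))\<^sup>2)"
    "integrable ?M (\<lambda>x. norm (f x) * norm (g x))"
    using assms integrable_norm_mult_L2[OF assms] by (auto simp: L2_on_iff)
  have nn: "0 \<le> a" "0 \<le> b" "0 \<le> c" by (auto simp: a_def b_def c_def)
  have q: "0 \<le> r\<^sup>2 * a - 2 * r * b * s + s\<^sup>2 * c" for r s
  proof -
    have "0 \<le> (\<integral>x. (r * norm (f x) - s * norm (g x))\<^sup>2 \<partial>?M)" by simp
    also have "\<dots> = (\<integral>x. r\<^sup>2 * (norm (f x))\<^sup>2 - (2 * r * s) * (norm (f x) * norm (g x)) + s\<^sup>2 * (norm (g x))\<^sup>2 \<partial>?M)"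
      by (rule Bochner_Integration.integral_cong) (auto simp: power2_eq_square algebra_simps)
    also have "\<dots> = r\<^sup>2 * a - (2 * r * s) * b + s\<^sup>2 * c"
      unfolding a_def b_def c_def using i by simp
    finally show ?thesis by (simp add: mult_ac)
  qed
  have "b\<^sup>2 \<le> a * c"
  proof (cases "c = 0")
    case True
    have "b = 0"
    proof (rule ccontr)
      assume "b \<noteq> 0"
      \<comment> \<open>For \<open>c = 0\<close> the form is affine in s, and this s gives it the
        value -1.\<close>
      with q[of "1" "(a + 1) / (2*b)"] True show False by (simp add: field_simps)
    qed
    with nn show ?thesis by simp
  next
    case False
    \<comment> \<open>At r = c, s = b the form becomes c (a c - b^2).\<close>
    with q[of c b] have "0 \<le> c * (a * c - b\<^sup>2)" by (simp add: power2_eq_square algebra_simps)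
    with False nn show ?thesis by (simp add: zero_le_mult_iff)
  qed
  hence "b\<^sup>2 \<le> (L2_norm S f * L2_norm S g)\<^sup>2"
    by (simp add: power_mult_distrib L2_norm_squared a_def c_def)
  thus ?thesis unfolding b_def[symmetric] by (rule power2_le_imp_le) simp
qed

lemma norm_L2_inner_le:
  assumes "L2_on S f" "L2_on S g"
  shows "cmod (L2_inner S f g) \<le> L2_norm S f * L2_norm S g"
proof -
  have "cmod (L2_inner S f g) \<le> (\<integral>x. norm (f x) * norm (g x) \<partial>lebesgue_on S)"
    unfolding L2_inner_eq
    by (rule Bochner_Integration.integral_norm_bound_integral[OF integrable_cinner[OF assms]
          integrable_norm_mult_L2[OF assms]]) (simp add: norm_cinner_le)
  with Cauchy_Schwarz_L2[OF assms] show ?thesis by simp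
qed

lemma L2_norm_triangle:
  fixes f g :: "real \<Rightarrow> 'a::euclidean_space"
  assumes "L2_on S f" "L2_on S g"
  shows "L2_norm S (\<lambda>x. f x + g x) \<le> L2_norm S f + L2_norm S g"
proof (rule power2_le_imp_le)
  let ?M = "lebesgue_on S"
  have i: "integrable ?M (\<lambda>x. (norm (f x))\<^sup>2)" "integrable ?M (\<lambda>x. (norm (g x))\<^sup>2)"
    "integrable ?M (\<lambda>x. norm (f x) * norm (g x))" "integrable ?M (\<lambda>x. (norm (f x + g x))\<^sup>2)"
    using assms integrable_norm_mult_L2[OF assms] L2_on_add[OF assms] by (auto simp: L2_on_iff)
  have "(L2_norm S (\<lambda>x. f x + g x))\<^sup>2 \<le> (\<integral>x. (norm (f x))\<^sup>2 + 2 * (norm (f x) * norm (g x)) + (norm (g x))\<^sup>2 \<partial>?M)"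
    unfolding L2_norm_squared
  proof (rule integral_mono)
    fix x
    have "(norm (f x + g x))\<^sup>2 \<le> (norm (f x) + norm (g x))\<^sup>2"
      by (rule power_mono[OF norm_triangle_ineq]) auto
    thus "(norm (f x + g x))\<^sup>2 \<le> (norm (f x))\<^sup>2 + 2 * (norm (f x) * norm (g x)) + (norm (g x))\<^sup>2"
      by (simp add: power2_eq_square algebra_simps)
  qed (use i in auto)
  also have "\<dots> \<le> (L2_norm S f)\<^sup>2 + 2 * (L2_norm S f * L2_norm S g) + (L2_norm S g)\<^sup>2"
    using i Cauchy_Schwarz_L2[OF assms] by (simp add: L2_norm_squared)
  also have "\<dots> = (L2_norm S f + L2_norm S g)\<^sup>2" by (simp add: power2_eq_square algebra_simps)
  finally show "(L2_norm S (\<lambda>x. f x + g x))\<^sup>2 \<le> (L2_norm S f + L2_norm S g)\<^sup>2" .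
qed simp

lemma L2_norm_cong_AE:
  assumes "AE x\<in>S in lebesgue. norm (f x) = norm (g x)"
    "f \<in> borel_measurable (lebesgue_on S)" "g \<in> borel_measurable (lebesgue_on S)"
  shows "L2_norm S f = L2_norm S g"
  unfolding L2_norm_eq using assms by (intro arg_cong[where f = sqrt] integral_cong_AE) (auto simp: AE_on_iff)

lemma L2_norm_cong: "(\<And>x. x \<in> S \<Longrightarrow> f x = g x) \<Longrightarrow> L2_norm S f = L2_norm S g"
  unfolding L2_norm_eq by (intro arg_cong[where f = sqrt] Bochner_Integration.integral_cong) auto

lemma L2_inner_cong_AE:
  assumes "AE x\<in>S in lebesgue. f x = f' x" "AE x\<in>S in lebesgue. g x = g' x" "L2_on S f" "L2_on S g"
  shows "L2_inner S f g = L2_inner S f' g'"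
proof -
  have L: "L2_on S f'" "L2_on S g'" using assms L2_on_cong_AE by blast+
  have "AE x in lebesgue_on S. cinner (f x) (g x) = cinner (f' x) (g' x)"
    using assms(1,2) unfolding AE_on_iff by eventually_elim simp
  thus ?thesis unfolding L2_inner_eq
    using borel_measurable_integrable[OF integrable_cinner] assms(3,4) L by (intro integral_cong_AE)
qed

lemma L2_norm_scale: "L2_norm S (\<lambda>x. c *s (f x :: complex ^ 'm::finite)) = cmod c * L2_norm S f"
  by (simp add: L2_norm_eq norm_smult_vec power_mult_distrib real_sqrt_mult)

lemma L2_norm_minus: "L2_norm S (\<lambda>x. - f x) = L2_norm S f"
  by (simp add: L2_norm_eq)

lemma L2_norm_zero [simp]: "L2_norm S (\<lambda>x. 0) = 0"
  by (simp add: L2_norm_eq)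

lemma L2_norm_triangle_diff:
  fixes f g :: "real \<Rightarrow> 'a::euclidean_space"
  assumes "L2_on S f" "L2_on S g"
  shows "L2_norm S (\<lambda>x. f x - g x) \<le> L2_norm S f + L2_norm S g"
proof -
  have "L2_on S (\<lambda>x. - g x)" using assms(2) by (auto simp: L2_on_iff)
  from L2_norm_triangle[OF assms(1) this] show ?thesis by (simp add: L2_norm_minus)
qed

lemma L2_norm_sum_le:
  fixes f :: "'b \<Rightarrow> real \<Rightarrow> 'a::euclidean_space"
  assumes "\<And>i. i \<in> I \<Longrightarrow> L2_on S (f i)"
  shows "L2_norm S (\<lambda>x. \<Sum>i\<in>I. f i x) \<le> (\<Sum>i\<in>I. L2_norm S (f i))"
  using assms
proof (induction I rule: infinite_finite_induct)
  case (insert i I)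
  have "L2_norm S (\<lambda>x. f i x + (\<Sum>i\<in>I. f i x)) \<le> L2_norm S (f i) + L2_norm S (\<lambda>x. \<Sum>i\<in>I. f i x)"
    using insert by (intro L2_norm_triangle L2_on_sum) auto
  with insert show ?case by fastforce
qed auto

lemma L2_norm_eq_0_iff:
  assumes "L2_on S f" shows "L2_norm S f = 0 \<longleftrightarrow> (AE x\<in>S in lebesgue. f x = 0)"
  using assms by (simp add: L2_norm_eq L2_on_iff AE_on_iff integral_nonneg_eq_0_iff_AE)

lemma L2_inner_self: "L2_inner S f f = complex_of_real ((L2_norm S f)\<^sup>2)"
  unfolding L2_norm_squared L2_inner_eq cinner_self by (rule integral_complex_of_real)

lemma L2_inner_commute: "L2_inner S f g = cnj (L2_inner S g f)"
  unfolding L2_inner_eq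
  by (subst Bochner_Integration.integral_cnj[symmetric]) (rule Bochner_Integration.integral_cong[OF refl cinner_commute])

lemma L2_inner_add_left:
  assumes "L2_on S f" "L2_on S g" "L2_on S h"
  shows "L2_inner S (\<lambda>x. f x + g x) h = L2_inner S f h + L2_inner S g h"
  unfolding L2_inner_eq using assms by (simp add: cinner_add_left integrable_cinner)

lemma L2_inner_diff_left:
  assumes "L2_on S f" "L2_on S g" "L2_on S h"
  shows "L2_inner S (\<lambda>x. f x - g x) h = L2_inner S f h - L2_inner S g h"
  unfolding L2_inner_eq using assms by (simp add: cinner_diff_left integrable_cinner)

lemma L2_inner_diff_right:
  assumes "L2_on S f" "L2_on S g" "L2_on S h"
  shows "L2_inner S h (\<lambda>x. f x - g x) = L2_inner S h f - L2_inner S h g"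
  unfolding L2_inner_eq using assms by (simp add: cinner_diff_right integrable_cinner)

lemma L2_inner_scale_left: "L2_inner S (\<lambda>x. c *s f x) g = c * L2_inner S f g"
  unfolding L2_inner_eq by (simp add: cinner_scale_left)

lemma L2_inner_scale_right: "L2_inner S f (\<lambda>x. c *s g x) = cnj c * L2_inner S f g"
  unfolding L2_inner_eq by (simp add: cinner_scale_right)

lemma L2_inner_zero_left [simp]: "L2_inner S (\<lambda>x. 0) g = 0"
  unfolding L2_inner_eq by simp

lemma L2_inner_lincomb_left:
  fixes f :: "'b \<Rightarrow> real \<Rightarrow> complex ^ 'm::finite"
  assumes "\<And>i. i \<in> I \<Longrightarrow> L2_on S (f i)" "L2_on S g"
  shows "L2_inner S (\<lambda>x. \<Sum>i\<in>I. c i *s f i x) g = (\<Sum>i\<in>I. c i * L2_inner S (f i) g)"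
  using assms(1)
proof (induction I rule: infinite_finite_induct)
  case (insert i I)
  have "L2_inner S (\<lambda>x. c i *s f i x + (\<Sum>i\<in>I. c i *s f i x)) g
        = L2_inner S (\<lambda>x. c i *s f i x) g + L2_inner S (\<lambda>x. \<Sum>i\<in>I. c i *s f i x) g"
    using insert assms(2) by (intro L2_inner_add_left L2_on_lincomb L2_on_scale) auto
  with insert show ?case by (simp add: L2_inner_scale_left)
qed auto

end

lemma L2_on_continuous:
  assumes "continuous_on {0..1} f" shows "L2_on {0..1} (f :: real \<Rightarrow> 'a::euclidean_space)"
proof -
  have "f \<in> borel_measurable (lebesgue_on {0..1})"
    by (rule continuous_imp_measurable_on_sets_lebesgue[OF assms]) auto
  moreover have "integrable (lebesgue_on {0..1}) (\<lambda>x. (norm (f x))\<^sup>2)"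
    by (rule continuous_imp_integrable_real) (intro continuous_intros assms)
  ultimately show ?thesis by (simp add: L2_on_iff)
qed

lemma L2_norm_le_bound:
  assumes "\<And>x. x \<in> {0..1} \<Longrightarrow> norm (f x) \<le> B" "L2_on {0..1} f" "0 \<le> B"
  shows "L2_norm {0..1} f \<le> B"
proof -
  have "(\<integral>x. (norm (f x))\<^sup>2 \<partial>lebesgue_on {0..1}) \<le> (\<integral>x. B\<^sup>2 \<partial>lebesgue_on {0..1::real})"
    using assms(2) by (intro integral_mono) (auto simp: L2_on_iff intro!: power_mono assms(1))
  also have "\<dots> = B\<^sup>2" by (simp add: measure_restrict_space)
  finally have "(L2_norm {0..1} f)\<^sup>2 \<le> B\<^sup>2" by (simp add: L2_norm_squared)
  thus ?thesis using assms(3) by (rule power2_le_imp_le)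
qed

section \<open>Fourier series on the unit interval\<close>

text \<open>The trigonometric system modulated by e^{itx}: orthonormal for each fixed t, and every
  member is quasiperiodic with quasimomentum t.\<close>

definition wave :: "real \<Rightarrow> int \<Rightarrow> real \<Rightarrow> complex" where
  "wave t k x = exp (\<i> * of_real ((2 * pi * of_int k + t) * x))"

definition wave_coeff :: "real \<Rightarrow> int \<Rightarrow> (real \<Rightarrow> complex) \<Rightarrow> complex" where
  "wave_coeff t k g = (\<integral>x. g x * cnj (wave t k x) \<partial>lebesgue_on {0..1})"

lemma unit_interval_sets: "{0..1::real} \<in> sets lebesgue"
  by simp

lemma norm_wave [simp]: "cmod (wave t k x) = 1"
  by (simp add: wave_def)

lemma continuous_on_wave [continuous_intros]: "continuous_on A (wave t k)"
  unfolding wave_def by (intro continuous_intros)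

lemma wave_mult_cnj: "wave t k x * cnj (wave s l x) = wave (t - s) (k - l) x"
  unfolding wave_def exp_cnj exp_add[symmetric] by (simp add: algebra_simps)

lemma wave_mult: "wave t k x * wave s l x = wave (t + s) (k + l) x"
  unfolding wave_def exp_add[symmetric] by (simp add: algebra_simps)

lemma cnj_wave: "cnj (wave t k x) = wave (- t) (- k) x"
  unfolding wave_def exp_cnj by (simp add: algebra_simps)

lemma integrable_continuous_unit:
  fixes f :: "real \<Rightarrow> 'a::euclidean_space"
  assumes "continuous_on {0..1} f" shows "integrable (lebesgue_on {0..1}) f"
  using continuous_imp_integrable_real[OF assms] .

lemma integral_wave: "(\<integral>x. wave 0 k x \<partial>lebesgue_on {0..1}) = (if k = 0 then 1 else 0)"
proof (cases "k = 0")
  case True thus ?thesis by (simp add: wave_def measure_restrict_space)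
next
  case False
  define c where "c = \<i> * of_real (2 * pi * of_int k)"
  have c: "c \<noteq> 0" using False by (simp add: c_def)
  have w: "wave 0 k x = exp (c * of_real x)" for x by (simp add: wave_def c_def mult.assoc)
  have "((\<lambda>x. exp (c * of_real x) / c) has_vector_derivative exp (c * of_real x)) (at x within {0..1})" for x :: real
  proof -
    have "((\<lambda>z. exp (c * z) / c) has_field_derivative exp (c * of_real x)) (at (of_real x))"
      using c by (auto intro!: derivative_eq_intros)
    thus ?thesis using has_vector_derivative_real_field has_vector_derivative_at_within by blast
  qed
  hence "((\<lambda>x. exp (c * of_real x)) has_integral (exp (c * of_real 1) / c - exp (c * of_real 0) / c)) {0..1}"
    by (intro fundamental_theorem_of_calculus) auto
  moreover have "exp c = 1" unfolding exp_eq_1 using False by (auto simp: c_def)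
  ultimately have "integral {0..1} (wave 0 k) = 0" by (simp add: w[abs_def] has_integral_iff)
  moreover have "integral {0..1} (wave 0 k) = (\<integral>x. wave 0 k x \<partial>lebesgue_on {0..1})"
    by (rule lebesgue_integral_eq_integral[symmetric]) (auto intro!: integrable_continuous_unit continuous_intros)
  ultimately show ?thesis using False by simp
qed

lemma wave_orthonormal:
  "(\<integral>x. wave t k x * cnj (wave t l x) \<partial>lebesgue_on {0..1}) = (if k = l then 1 else 0)"
  by (simp add: wave_mult_cnj integral_wave)

lemma L2_on_wave_sum: "L2_on {0..1} (\<lambda>x. \<Sum>k\<in>S. c k * wave t k x)"
  by (intro L2_on_continuous continuous_intros)

lemma integrable_mult_L2:
  fixes f g :: "real \<Rightarrow> complex"
  assumes S: "S \<in> sets lebesgue" and "L2_on S f" "L2_on S g"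
  shows "integrable (lebesgue_on S) (\<lambda>x. f x * g x)"
proof -
  have [measurable]: "f \<in> borel_measurable (lebesgue_on S)" "g \<in> borel_measurable (lebesgue_on S)"
    using assms by (auto simp: L2_on_iff)
  show ?thesis
    by (rule Bochner_Integration.integrable_bound[OF integrable_norm_mult_L2[OF assms]])
      (auto simp: norm_mult)
qed

text \<open>Expand the square and complete it coefficient by coefficient. One identity serves three
  purposes: the choice of the true coefficients gives Bessel's inequality, arbitrary
  \<open>c\<close> bounds the distance from below, and \<open>g = 0\<close> gives the norm of a
  finite sum.\<close>

lemma L2_norm_diff_wave_sum:
  assumes g: "L2_on {0..1} g" and S: "finite S"
  shows "(L2_norm {0..1} (\<lambda>x. g x - (\<Sum>k\<in>S. c k * wave t k x)))\<^sup>2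
     = (L2_norm {0..1} g)\<^sup>2 - (\<Sum>k\<in>S. (cmod (wave_coeff t k g))\<^sup>2) + (\<Sum>k\<in>S. (cmod (wave_coeff t k g - c k))\<^sup>2)"
proof -
  let ?M = "lebesgue_on {0..1::real}"
  define s where "s x = (\<Sum>k\<in>S. c k * wave t k x)" for x
  have L2w: "L2_on {0..1} (\<lambda>x. cnj (wave t k x))" "L2_on {0..1} (wave t k)" for k
    by (auto intro!: L2_on_continuous continuous_intros)
  have cs: "L2_on {0..1} s" unfolding s_def by (rule L2_on_wave_sum)
  have cs': "L2_on {0..1} (\<lambda>x. cnj (s x))" unfolding s_def
    by (auto intro!: L2_on_continuous continuous_intros)
  have igs: "integrable ?M (\<lambda>x. g x * cnj (s x))" and iss: "integrable ?M (\<lambda>x. s x * cnj (s x))"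
    using g cs cs' by (auto intro!: integrable_mult_L2)
  have igw: "integrable ?M (\<lambda>x. g x * cnj (wave t k x))" for k
    using g L2w by (auto intro!: integrable_mult_L2)
  have isw: "integrable ?M (\<lambda>x. s x * cnj (wave t k x))" for k
    using cs L2w by (auto intro!: integrable_mult_L2)
  have iww: "integrable ?M (\<lambda>x. wave t l x * cnj (wave t k x))" for k l
    using L2w by (auto intro!: integrable_mult_L2)
  have 1: "(\<integral>x. g x * cnj (s x) \<partial>?M) = (\<Sum>k\<in>S. cnj (c k) * wave_coeff t k g)"
  proof -
    have "(\<integral>x. g x * cnj (s x) \<partial>?M) = (\<integral>x. (\<Sum>k\<in>S. cnj (c k) * (g x * cnj (wave t k x))) \<partial>?M)"
      by (simp add: s_def sum_distrib_left mult_ac)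
    thus ?thesis using igw by (simp add: wave_coeff_def)
  qed
  have 2: "(\<integral>x. s x * cnj (wave t k x) \<partial>?M) = c k" if "k \<in> S" for k
  proof -
    have "(\<integral>x. s x * cnj (wave t k x) \<partial>?M) = (\<integral>x. (\<Sum>l\<in>S. c l * (wave t l x * cnj (wave t k x))) \<partial>?M)"
      by (simp add: s_def sum_distrib_right mult.assoc)
    also have "\<dots> = (\<Sum>l\<in>S. c l * (if l = k then 1 else 0))" using iww by (simp add: wave_orthonormal)
    finally show ?thesis using that S by (simp add: if_distrib cong: if_cong)
  qed
  have 3: "(\<integral>x. s x * cnj (s x) \<partial>?M) = (\<Sum>k\<in>S. cnj (c k) * c k)"
  proof -
    have "(\<integral>x. s x * cnj (s x) \<partial>?M) = (\<integral>x. (\<Sum>k\<in>S. cnj (c k) * (s x * cnj (wave t k x))) \<partial>?M)"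
      by (subst (2) s_def) (simp add: sum_distrib_left mult_ac)
    thus ?thesis using isw 2 by simp
  qed
  define a b where "a x = Re (g x * cnj (s x))" and "b x = Re (s x * cnj (s x))" for x
  have ab: "integrable ?M a" "integrable ?M b"
    "integral\<^sup>L ?M a = Re (\<Sum>k\<in>S. cnj (c k) * wave_coeff t k g)" "integral\<^sup>L ?M b = Re (\<Sum>k\<in>S. cnj (c k) * c k)"
    unfolding a_def b_def using integrable_Re[OF igs] integrable_Re[OF iss] integral_Re[OF igs] integral_Re[OF iss] 1 3
    by simp_all
  have "(L2_norm {0..1} (\<lambda>x. g x - s x))\<^sup>2 = (\<integral>x. (cmod (g x))\<^sup>2 - 2 * a x + b x \<partial>?M)"
    unfolding L2_norm_squared[OF unit_interval_sets] a_def b_def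
    by (rule Bochner_Integration.integral_cong[OF refl])
      (simp only: cmod_power2, simp add: power2_eq_square algebra_simps)
  also have "\<dots> = (L2_norm {0..1} g)\<^sup>2 - 2 * Re (\<Sum>k\<in>S. cnj (c k) * wave_coeff t k g) + Re (\<Sum>k\<in>S. cnj (c k) * c k)"
    using g ab by (simp add: L2_norm_squared L2_on_iff del: Re_sum)
  also have "\<dots> = (L2_norm {0..1} g)\<^sup>2 + (\<Sum>k\<in>S. (cmod (wave_coeff t k g - c k))\<^sup>2 - (cmod (wave_coeff t k g))\<^sup>2)"
  proof -
    have "(\<Sum>k\<in>S. (cmod (wave_coeff t k g - c k))\<^sup>2 - (cmod (wave_coeff t k g))\<^sup>2)
        = (\<Sum>k\<in>S. Re (cnj (c k) * c k) - 2 * Re (cnj (c k) * wave_coeff t k g))"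
      by (intro sum.cong refl) (simp only: cmod_power2, simp add: power2_eq_square algebra_simps)
    also have "\<dots> = Re (\<Sum>k\<in>S. cnj (c k) * c k) - 2 * Re (\<Sum>k\<in>S. cnj (c k) * wave_coeff t k g)"
      by (simp only: sum_subtractf Re_sum sum_distrib_left)
    finally show ?thesis by simp
  qed
  finally show ?thesis by (simp add: s_def sum_subtractf)
qed

lemma Bessel_wave:
  assumes g: "L2_on {0..1} g" and S: "finite S"
  shows "(\<Sum>k\<in>S. (cmod (wave_coeff t k g))\<^sup>2) \<le> (L2_norm {0..1} g)\<^sup>2"
  using L2_norm_diff_wave_sum[OF assms, of "\<lambda>k. wave_coeff t k g" t]
    zero_le_power2[of "L2_norm {0..1} (\<lambda>x. g x - (\<Sum>k\<in>S. wave_coeff t k g * wave t k x))"]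
  by (simp del: zero_le_power2)

lemma wave_sum_dist_ge:
  assumes g: "L2_on {0..1} g" and S: "finite S"
  shows "(L2_norm {0..1} g)\<^sup>2 \<le> (\<Sum>k\<in>S. (cmod (wave_coeff t k g))\<^sup>2)
           + (L2_norm {0..1} (\<lambda>x. g x - (\<Sum>k\<in>S. c k * wave t k x)))\<^sup>2"
  using L2_norm_diff_wave_sum[OF assms, of c t] by (simp add: sum_nonneg)

lemma L2_norm_wave_sum:
  assumes S: "finite S"
  shows "(L2_norm {0..1} (\<lambda>x. \<Sum>k\<in>S. c k * wave t k x))\<^sup>2 = (\<Sum>k\<in>S. (cmod (c k))\<^sup>2)"
proof -
  have "wave_coeff t k (\<lambda>x. 0) = 0" for k by (simp add: wave_coeff_def)
  with L2_norm_diff_wave_sum[OF L2_on_zero S, of c t] show ?thesis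
    by (simp add: L2_norm_minus)
qed

section \<open>Uniform approximation by trigonometric polynomials\<close>

definition trig_poly :: "(real \<Rightarrow> complex) \<Rightarrow> bool" where
  "trig_poly p \<longleftrightarrow> (\<exists>S c. finite S \<and> p = (\<lambda>x. \<Sum>k\<in>S. c k * wave 0 k x))"

lemma trig_poly_wave: "trig_poly (\<lambda>x. c * wave 0 k x)"
  unfolding trig_poly_def by (rule exI[of _ "{k}"], rule exI[of _ "\<lambda>_. c"]) auto

lemma trig_poly_add:
  assumes "trig_poly p" "trig_poly q" shows "trig_poly (\<lambda>x. p x + q x)"
proof -
  obtain S c T d where *: "finite S" "p = (\<lambda>x. \<Sum>k\<in>S. c k * wave 0 k x)" "finite T" "q = (\<lambda>x. \<Sum>k\<in>T. d k * wave 0 k x)"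
    using assms by (auto simp: trig_poly_def)
  define e where "e k = (if k \<in> S then c k else 0) + (if k \<in> T then d k else 0)" for k
  have "p x + q x = (\<Sum>k\<in>S \<union> T. e k * wave 0 k x)" for x
  proof -
    have "p x = (\<Sum>k\<in>S \<union> T. (if k \<in> S then c k else 0) * wave 0 k x)"
      unfolding * by (rule sum.mono_neutral_cong_left) (use * in auto)
    moreover have "q x = (\<Sum>k\<in>S \<union> T. (if k \<in> T then d k else 0) * wave 0 k x)"
      unfolding * by (rule sum.mono_neutral_cong_left) (use * in auto)
    ultimately show ?thesis by (simp add: e_def sum.distrib algebra_simps)
  qed
  thus ?thesis using * unfolding trig_poly_def by (intro exI[of _ "S \<union> T"] exI[of _ e]) auto
qed

lemma trig_poly_sum: "(\<And>i. i \<in> I \<Longrightarrow> trig_poly (p i)) \<Longrightarrow> trig_poly (\<lambda>x. \<Sum>i\<in>I. p i x)"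
proof (induction I rule: infinite_finite_induct)
  case (insert i I) thus ?case by (simp add: trig_poly_add)
qed (use trig_poly_wave[of 0] in auto)

lemma trig_poly_mult:
  assumes "trig_poly p" "trig_poly q" shows "trig_poly (\<lambda>x. p x * q x)"
proof -
  obtain S c T d where *: "finite S" "p = (\<lambda>x. \<Sum>k\<in>S. c k * wave 0 k x)" "finite T" "q = (\<lambda>x. \<Sum>k\<in>T. d k * wave 0 k x)"
    using assms by (auto simp: trig_poly_def)
  have "p x * q x = (\<Sum>k\<in>S. \<Sum>l\<in>T. (c k * d l) * wave 0 (k + l) x)" for x
    unfolding * sum_product using wave_mult[of 0 _ x 0] by (intro sum.cong) (auto simp: mult_ac)
  moreover have "trig_poly (\<lambda>x. \<Sum>k\<in>S. \<Sum>l\<in>T. (c k * d l) * wave 0 (k + l) x)"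
    by (intro trig_poly_sum trig_poly_wave)
  ultimately show ?thesis by presburger
qed

lemma trig_poly_scale: "trig_poly p \<Longrightarrow> trig_poly (\<lambda>x. c * p x)"
  using trig_poly_mult[of "\<lambda>x. c * wave 0 0 x" p] trig_poly_wave[of c 0] by (simp add: wave_def)

text \<open>Polynomial functions on the plane are generated by linear forms, which are combinations
  of Re w and Im w, hence of w and \<open>cnj w\<close>; on the circle conjugation turns the
  frequency 1 into -1.\<close>

lemma trig_poly_real_polynomial:
  assumes "real_polynomial_function q"
  shows "trig_poly (\<lambda>x. complex_of_real (q (wave 0 1 x)))"
  using assms
proof induction
  case (linear h)
  have "h z = Re z * h 1 + Im z * h \<i>" for z
  proof -
    have "h z = h (Re z *\<^sub>R 1 + Im z *\<^sub>R \<i>)" by (rule arg_cong[where f = h]) (simp add: complex_eq_iff)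
    also have "\<dots> = Re z * h 1 + Im z * h \<i>"
      using bounded_linear.linear[OF linear] by (simp only: linear_add linear_scale real_scaleR_def)
    finally show ?thesis .
  qed
  hence hw: "complex_of_real (h w) = of_real (h 1) * of_real (Re w) + of_real (h \<i>) * of_real (Im w)" for w
    by (metis mult.commute of_real_add of_real_mult)
  have re: "complex_of_real (Re w) = (w + cnj w) / 2" and im: "complex_of_real (Im w) = (w - cnj w) / (2 * \<i>)" for w
    by (simp_all add: complex_eq_iff)
  have alg: "A * ((w + w') / 2) + H * ((w - w') / j) = A / 2 * w + A / 2 * w' + (H / j * w + - (H / j) * w')"
    for A H w w' j :: complex
    by (simp add: add_divide_distrib diff_divide_distrib algebra_simps)
  have "complex_of_real (h (wave 0 1 x)) = of_real (h 1) / 2 * wave 0 1 x + of_real (h 1) / 2 * wave 0 (-1) x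
        + (of_real (h \<i>) / (2 * \<i>) * wave 0 1 x + - (of_real (h \<i>) / (2 * \<i>)) * wave 0 (-1) x)" for x
    by (subst hw) (simp only: re im cnj_wave alg minus_zero)
  thus ?case by (simp only:) (intro trig_poly_add trig_poly_wave)
next
  case (const c)
  show ?case using trig_poly_wave[of "of_real c" 0] by (simp add: wave_def)
next
  case (add f g) thus ?case by (simp add: trig_poly_add)
next
  case (mult f g) thus ?case by (simp add: trig_poly_mult)
qed

lemma trig_poly_polynomial:
  fixes q :: "complex \<Rightarrow> complex"
  assumes "polynomial_function q"
  shows "trig_poly (\<lambda>x. q (wave 0 1 x))"
proof -
  have "real_polynomial_function (\<lambda>z. Re (q z))" "real_polynomial_function (\<lambda>z. Im (q z))"
    using assms unfolding polynomial_function_def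
    by (auto dest!: spec[of _ Re] spec[of _ Im] simp: o_def bounded_linear_Re bounded_linear_Im)
  from this[THEN trig_poly_real_polynomial]
  have "trig_poly (\<lambda>x. of_real (Re (q (wave 0 1 x))) + \<i> * of_real (Im (q (wave 0 1 x))))"
    by (intro trig_poly_add trig_poly_scale)
  thus ?thesis by (simp add: complex_eq[symmetric])
qed

text \<open>A continuous function with equal end values descends to the unit circle, where
  Stone-Weierstrass gives a polynomial; pulling it back by e^{2 pi i x} gives the
  approximant.\<close>

lemma trig_poly_uniform_approx:
  assumes g: "continuous_on {0..1} g" "g 0 = g (1::real)" and e: "0 < e"
  shows "\<exists>p. trig_poly p \<and> (\<forall>x\<in>{0..1}. cmod (g x - p x) < e)"
proof -
  \<comment> \<open>The trivial homotopy of the loop \<open>g\<close> is a device: its circle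
    version contains the continuity of the descended map across the branch cut of the
    argument.\<close>
  have "homotopic_loops UNIV g g"
    using g by (simp add: homotopic_loops_refl path_def pathstart_def pathfinish_def)
  hence "homotopic_with_canon (\<lambda>h. True) (sphere 0 1) UNIV
     (g \<circ> (\<lambda>z. Arg2pi z / (2 * pi))) (g \<circ> (\<lambda>z. Arg2pi z / (2 * pi)))"
    by (rule homotopic_loops_imp_homotopic_circlemaps)
  hence "continuous_on (sphere 0 1) (g \<circ> (\<lambda>z. Arg2pi z / (2 * pi)))"
    by (rule homotopic_with_imp_continuous[THEN conjunct1])
  from Stone_Weierstrass_polynomial_function[OF compact_sphere this e]
  obtain q where q: "polynomial_function q" "\<And>z. z \<in> sphere 0 1 \<Longrightarrow> cmod (g (Arg2pi z / (2 * pi)) - q z) < e"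
    by (auto simp: o_def)
  have "cmod (g x - q (wave 0 1 x)) < e" if x: "x \<in> {0..1}" for x
  proof -
    have "g (Arg2pi (wave 0 1 x) / (2 * pi)) = g x"
    \<comment> \<open>At x = 1 the argument is 0 and not 2 pi; the equality of the end values of
      \<open>g\<close> covers this point.\<close>
    proof (cases "x = 1")
      case True
      hence "wave 0 1 x = 1" by (simp add: wave_def mult.commute)
      moreover have "Arg2pi 1 = 0" by (rule Arg2pi_unique[of 1]) auto
      ultimately show ?thesis using True g(2) by simp
    next
      case False
      have "Arg2pi (wave 0 1 x) = 2 * pi * x"
        by (rule Arg2pi_unique[of 1]) (use False x in \<open>auto simp: wave_def exp_Euler mult_ac\<close>)
      thus ?thesis by simp
    qed
    with q(2)[of "wave 0 1 x"] show ?thesis by simp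
  qed
  thus ?thesis using trig_poly_polynomial[OF q(1)] by blast
qed

section \<open>Density of continuous functions and Parseval's identity\<close>

lemma L2_norm_dominated_convergence:
  fixes f :: "real \<Rightarrow> 'a::euclidean_space"
  assumes S: "S \<in> sets lebesgue" and f: "f \<in> borel_measurable (lebesgue_on S)"
    and s: "\<And>n. s n \<in> borel_measurable (lebesgue_on S)"
    and lim: "AE x\<in>S in lebesgue. (\<lambda>n. s n x) \<longlonglongrightarrow> f x"
    and w: "integrable (lebesgue_on S) (\<lambda>x. (w x)\<^sup>2)"
    and bd: "\<And>n. AE x\<in>S in lebesgue. norm (f x - s n x) \<le> w x"
  shows "(\<lambda>n. L2_norm S (\<lambda>x. f x - s n x)) \<longlonglongrightarrow> 0"
proof -
  have [measurable]: "f \<in> borel_measurable (lebesgue_on S)" "s n \<in> borel_measurable (lebesgue_on S)" for n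
    using f s by auto
  have "(\<lambda>n. \<integral>x. (norm (f x - s n x))\<^sup>2 \<partial>lebesgue_on S) \<longlonglongrightarrow> (\<integral>x. 0 \<partial>lebesgue_on S)"
  proof (rule integral_dominated_convergence[OF _ _ w])
    show "AE x in lebesgue_on S. (\<lambda>n. (norm (f x - s n x))\<^sup>2) \<longlonglongrightarrow> 0"
      using lim unfolding AE_on_iff[OF S]
      by eventually_elim (auto intro!: tendsto_eq_intros)
    show "AE x in lebesgue_on S. norm ((norm (f x - s n x))\<^sup>2) \<le> (w x)\<^sup>2" for n
      using bd[of n] unfolding AE_on_iff[OF S] by eventually_elim (auto intro: power_mono)
  qed auto
  hence "(\<lambda>n. sqrt (\<integral>x. (norm (f x - s n x))\<^sup>2 \<partial>lebesgue_on S)) \<longlonglongrightarrow> sqrt 0"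
    by (intro tendsto_real_sqrt) simp
  thus ?thesis by (simp add: L2_norm_eq[OF S])
qed

text \<open>For B > 0 the radial retraction onto the disc of radius B. Being continuous, it can be
  imposed on continuous approximants as well.\<close>

definition clip :: "real \<Rightarrow> complex \<Rightarrow> complex" where
  "clip B z = of_real (B / max B (cmod z)) * z"

lemma norm_clip_le: "0 < B \<Longrightarrow> cmod (clip B z) \<le> B"
  by (auto simp: clip_def norm_mult norm_divide max_def divide_simps)

lemma norm_diff_clip_le: "0 < B \<Longrightarrow> cmod (z - clip B z) \<le> cmod z"
proof -
  assume B: "0 < B"
  have "z - clip B z = of_real (1 - B / max B (cmod z)) * z" by (simp add: clip_def algebra_simps)
  moreover have "\<bar>1 - B / max B (cmod z)\<bar> \<le> 1" using B by (auto simp: max_def divide_simps)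
  ultimately show ?thesis using mult_right_mono[of "\<bar>1 - B / max B (cmod z)\<bar>" 1 "cmod z"]
    by (simp only: norm_mult norm_of_real) simp
qed

lemma continuous_on_clip: "0 < B \<Longrightarrow> continuous_on UNIV (clip B)"
  unfolding clip_def by (intro continuous_intros) (auto simp: max_def)

lemma clip_eventually: "(\<lambda>n. clip (real (Suc n)) z) \<longlonglongrightarrow> z"
proof (rule tendsto_eventually)
  obtain N where "cmod z \<le> real N" using real_arch_simple by blast
  hence "clip (real (Suc n)) z = z" if "N \<le> n" for n
    using that by (auto simp: clip_def max_def)
  thus "\<forall>\<^sub>F n in sequentially. clip (real (Suc n)) z = z"
    using eventually_sequentially by blast
qed

text \<open>Truncation makes \<open>g\<close> bounded. Measurability provides continuous functions
  converging to it off a negligible set; clipped to the same bound they are dominated by the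
  constant 2 B, so they converge in norm.\<close>

lemma L2_approx_continuous:
  fixes g :: "real \<Rightarrow> complex"
  assumes g: "L2_on {0..1} g" and e: "0 < e"
  shows "\<exists>h. continuous_on {0..1} h \<and> h 0 = h 1 \<and> L2_norm {0..1} (\<lambda>x. g x - h x) < e"
proof -
  let ?M = "lebesgue_on {0..1::real}"
  have gm [measurable]: "g \<in> borel_measurable ?M" and gi: "integrable ?M (\<lambda>x. (cmod (g x))\<^sup>2)"
    using g by (auto simp: L2_on_iff)
  have clipm: "(\<lambda>x. clip (real (Suc n)) (u x)) \<in> borel_measurable ?M"
    if "u \<in> borel_measurable ?M" for n and u :: "real \<Rightarrow> complex"
    using measurable_compose[OF that borel_measurable_continuous_onI[OF continuous_on_clip]] by simp
  have "(\<lambda>n. L2_norm {0..1} (\<lambda>x. g x - clip (real (Suc n)) (g x))) \<longlonglongrightarrow> 0"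
    by (rule L2_norm_dominated_convergence[OF unit_interval_sets gm clipm[OF gm] _ gi])
      (auto intro!: AE_I2 clip_eventually norm_diff_clip_le simp del: of_nat_Suc)
  from order_tendstoD(2)[OF this, of "e/2"] e
  obtain n where n: "L2_norm {0..1} (\<lambda>x. g x - clip (real (Suc n)) (g x)) < e / 2"
    by (auto simp: eventually_sequentially)
  define B where "B = real (Suc n)"
  have B: "0 < B" by (simp add: B_def)
  have "g measurable_on {0..1}" using gm by (simp add: measurable_on_iff_borel_measurable)
  then obtain N h where N: "negligible N" and h: "\<And>k. continuous_on UNIV (h k)"
    and lim: "\<And>x. x \<notin> N \<Longrightarrow> (\<lambda>k. h k x) \<longlonglongrightarrow> (if x \<in> {0..1} then g x else 0)"
    unfolding measurable_on_def by auto
  \<comment> \<open>This cutoff vanishes at 0 and 1, which forces equal end values, and is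
    eventually 1 at each interior point.\<close>
  define c where "c k x = min 1 (real k * (x * (1 - x)))" for k and x :: real
  define s where "s k x = of_real (c k x) * clip B (h k x)" for k x
  have sc: "continuous_on UNIV (s k)" for k
    unfolding s_def c_def
    by (intro continuous_intros continuous_on_compose2[OF continuous_on_clip[OF B] h]) auto
  have s01: "s k 0 = s k 1" for k by (simp add: s_def c_def)
  have sB: "cmod (s k x) \<le> B" if "x \<in> {0..1}" for k x
  proof -
    have "\<bar>c k x\<bar> \<le> 1" using that mult_nonneg_nonneg[of "real k" "x * (1 - x)"] by (auto simp: c_def)
    thus ?thesis using norm_clip_le[OF B, of "h k x"] B mult_mono[of "\<bar>c k x\<bar>" 1 "cmod (clip B (h k x))" B]
      by (simp add: s_def norm_mult)
  qed
  have "(\<lambda>k. L2_norm {0..1} (\<lambda>x. clip B (g x) - s k x)) \<longlonglongrightarrow> 0"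
  proof (rule L2_norm_dominated_convergence[where w = "\<lambda>_. 2 * B"])
    show "(\<lambda>x. clip B (g x)) \<in> borel_measurable ?M" using clipm[OF gm] by (simp add: B_def)
    show "s k \<in> borel_measurable ?M" for k
      using continuous_on_subset[OF sc] by (intro continuous_imp_measurable_on_sets_lebesgue) auto
    show "AE x\<in>{0..1} in lebesgue. norm (clip B (g x) - s k x) \<le> 2 * B" for k
    proof (intro AE_I2 impI)
      fix x :: real assume "x \<in> {0..1}"
      thus "norm (clip B (g x) - s k x) \<le> 2 * B"
        using norm_triangle_ineq4[of "clip B (g x)" "s k x"] norm_clip_le[OF B, of "g x"] sB[of x k] by linarith
    qed
    \<comment> \<open>The end points, where the cutoff spoils the limit, join the null set.\<close>
    have "N \<union> {0, 1} \<in> null_sets lebesgue" using N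
      unfolding negligible_iff_null_sets[symmetric] by (intro negligible_Un) auto
    hence "AE x in lebesgue. x \<notin> N \<union> {0, 1}" by (rule AE_not_in)
    thus "AE x\<in>{0..1} in lebesgue. (\<lambda>k. s k x) \<longlonglongrightarrow> clip B (g x)"
    proof eventually_elim
      case (elim x)
      show ?case
      proof
        assume x: "x \<in> {0..1}"
        with elim have p: "0 < x * (1 - x)" by auto
        have "(\<lambda>k. clip B (h k x)) \<longlonglongrightarrow> clip B (g x)"
          using lim[of x] elim x continuous_on_tendsto_compose[OF continuous_on_clip[OF B]] by auto
        moreover have "(\<lambda>k. c k x) \<longlonglongrightarrow> 1"
        proof (rule tendsto_eventually)
          obtain K where K: "1 / (x * (1 - x)) \<le> real K" using real_arch_simple by blast
          have "c k x = 1" if "K \<le> k" for k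
          proof -
            have "1 / (x * (1 - x)) \<le> real k" using K that by linarith
            hence "1 \<le> real k * (x * (1 - x))" using p by (simp add: pos_divide_le_eq)
            thus ?thesis by (simp add: c_def)
          qed
          thus "\<forall>\<^sub>F k in sequentially. c k x = 1" using eventually_sequentially by blast
        qed
        ultimately show "(\<lambda>k. s k x) \<longlonglongrightarrow> clip B (g x)"
          unfolding s_def by (auto intro!: tendsto_eq_intros)
      qed
    qed
  qed auto
  from order_tendstoD(2)[OF this, of "e/2"] e
  obtain k where k: "L2_norm {0..1} (\<lambda>x. clip B (g x) - s k x) < e / 2"
    by (auto simp: eventually_sequentially)
  have Ls: "L2_on {0..1} (s k)" using continuous_on_subset[OF sc] by (intro L2_on_continuous) auto
  have Lc: "L2_on {0..1} (\<lambda>x. g x - clip B (g x))"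
    unfolding L2_on_iff[OF unit_interval_sets]
  proof
    show m: "(\<lambda>x. g x - clip B (g x)) \<in> borel_measurable ?M"
      using borel_measurable_diff[OF gm clipm[OF gm]] by (simp add: B_def)
    show "integrable ?M (\<lambda>x. (cmod (g x - clip B (g x)))\<^sup>2)"
      by (rule Bochner_Integration.integrable_bound[OF gi])
        (use m norm_diff_clip_le[OF B] in \<open>auto intro!: power_mono\<close>)
  qed
  have Lc': "L2_on {0..1} (\<lambda>x. clip B (g x) - s k x)"
    using L2_on_diff[OF unit_interval_sets L2_on_diff[OF unit_interval_sets g Lc] Ls] by simp
  have "L2_norm {0..1} (\<lambda>x. g x - s k x) \<le> L2_norm {0..1} (\<lambda>x. g x - clip B (g x)) + L2_norm {0..1} (\<lambda>x. clip B (g x) - s k x)"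
    using L2_norm_triangle[OF unit_interval_sets Lc Lc'] by simp
  with n k have "L2_norm {0..1} (\<lambda>x. g x - s k x) < e" by (simp add: B_def)
  with s01 continuous_on_subset[OF sc, of "{0..1}" k] show ?thesis by blast
qed

text \<open>Only this half of Parseval's identity is wanted, with a bound on all finite partial sums
  in place of a series. Multiplication by e^{-itx} reduces to t = 0, where trigonometric polynomials
  are dense and \<open>wave_sum_dist_ge\<close> compares.\<close>

lemma Parseval_wave:
  assumes g: "L2_on {0..1} g" and B: "\<And>S. finite S \<Longrightarrow> (\<Sum>k\<in>S. (cmod (wave_coeff t k g))\<^sup>2) \<le> B"
  shows "(L2_norm {0..1} g)\<^sup>2 \<le> B"
proof -
  define g0 where "g0 x = g x * cnj (wave t 0 x)" for x
  have [measurable]: "g \<in> borel_measurable (lebesgue_on {0..1})" using g by (simp add: L2_on_iff)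
  have [measurable]: "(\<lambda>x. cnj (wave t 0 x)) \<in> borel_measurable (lebesgue_on {0..1})"
    by (intro continuous_imp_measurable_on_sets_lebesgue continuous_intros) auto
  have g0m: "g0 \<in> borel_measurable (lebesgue_on {0..1})" unfolding g0_def by measurable
  have n0: "cmod (g0 x) = cmod (g x)" for x by (simp add: g0_def norm_mult)
  have g0: "L2_on {0..1} g0" using g g0m by (simp add: L2_on_iff n0)
  have nn: "L2_norm {0..1} g0 = L2_norm {0..1} g" by (simp add: L2_norm_eq n0)
  have "g0 x * cnj (wave 0 k x) = g x * cnj (wave t k x)" for x k
    using wave_mult[of t 0 x 0 k] by (simp add: g0_def mult.assoc flip: complex_cnj_mult)
  hence cf: "wave_coeff 0 k g0 = wave_coeff t k g" for k by (simp add: wave_coeff_def)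
  have "(L2_norm {0..1} g0)\<^sup>2 \<le> B + e" if e: "0 < e" for e
  proof -
    define d where "d = sqrt e / 2"
    have d: "0 < d" using e by (simp add: d_def)
    obtain h where h: "continuous_on {0..1} h" "h 0 = h 1" "L2_norm {0..1} (\<lambda>x. g0 x - h x) < d"
      using L2_approx_continuous[OF g0 d] by blast
    obtain p where p: "trig_poly p" "\<And>x. x \<in> {0..1} \<Longrightarrow> cmod (h x - p x) < d"
      using trig_poly_uniform_approx[OF h(1,2) d] by blast
    obtain S c where S: "finite S" "p = (\<lambda>x. \<Sum>k\<in>S. c k * wave 0 k x)" using p(1) by (auto simp: trig_poly_def)
    have Lh: "L2_on {0..1} h" using h by (intro L2_on_continuous)
    have Lp: "L2_on {0..1} p" unfolding S by (rule L2_on_wave_sum)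
    have L1: "L2_on {0..1} (\<lambda>x. g0 x - h x)" "L2_on {0..1} (\<lambda>x. h x - p x)"
      by (intro L2_on_diff unit_interval_sets g0 Lh Lp)+
    have "L2_norm {0..1} (\<lambda>x. h x - p x) \<le> d"
      using p(2) d L1 by (intro L2_norm_le_bound) (auto intro: less_imp_le)
    with h(3) L2_norm_triangle[OF unit_interval_sets L1] 
    have "L2_norm {0..1} (\<lambda>x. g0 x - p x) \<le> sqrt e" by (simp add: d_def)
    hence "(L2_norm {0..1} (\<lambda>x. g0 x - p x))\<^sup>2 \<le> e"
      using power_mono[of "L2_norm {0..1} (\<lambda>x. g0 x - p x)" "sqrt e" 2] e by simp
    with wave_sum_dist_ge[OF g0 S(1), of 0 c] B[OF S(1)] show ?thesis by (simp add: S cf)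
  qed
  hence "(L2_norm {0..1} g0)\<^sup>2 \<le> B" by (rule field_le_epsilon)
  thus ?thesis by (simp add: nn)
qed

section \<open>Linear systems with summable coefficients\<close>

lemma set_dominated_convergence:
  fixes f :: "nat \<Rightarrow> real \<Rightarrow> 'a::euclidean_space"
  assumes A: "A \<in> sets lebesgue" and f: "\<And>i. set_borel_measurable lebesgue A (f i)"
    and lim: "\<And>x. x \<in> A \<Longrightarrow> (\<lambda>i. f i x) \<longlonglongrightarrow> g x"
    and bd: "\<And>i x. x \<in> A \<Longrightarrow> norm (f i x) \<le> w x" and w: "set_integrable lebesgue A w"
  shows "(\<lambda>i. LINT x:A|lebesgue. f i x) \<longlonglongrightarrow> (LINT x:A|lebesgue. g x)" "set_integrable lebesgue A g"
proof -
  have lim': "AE x in lebesgue. (\<lambda>i. indicator A x *\<^sub>R f i x) \<longlonglongrightarrow> indicator A x *\<^sub>R g x"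
    by (rule AE_I2) (use lim in \<open>auto simp: indicator_def\<close>)
  have g: "(\<lambda>x. indicator A x *\<^sub>R g x) \<in> borel_measurable lebesgue"
    by (rule borel_measurable_LIMSEQ_metric[where f = "\<lambda>i x. indicator A x *\<^sub>R f i x"])
      (use lim f in \<open>auto simp: indicator_def set_borel_measurable_def\<close>)
  have bd': "AE x in lebesgue. norm (indicator A x *\<^sub>R f i x) \<le> indicator A x *\<^sub>R w x" for i
    by (rule AE_I2) (use bd in \<open>auto simp: indicator_def\<close>)
  show "(\<lambda>i. LINT x:A|lebesgue. f i x) \<longlonglongrightarrow> (LINT x:A|lebesgue. g x)"
    unfolding set_lebesgue_integral_def
    by (rule integral_dominated_convergence[OF g _ _ lim' bd'])
      (use f w in \<open>auto simp: set_integrable_def set_borel_measurable_def\<close>)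
  show "set_integrable lebesgue A g"
    unfolding set_integrable_def
    by (rule integrable_dominated_convergence[OF g _ _ lim' bd'])
      (use f w in \<open>auto simp: set_integrable_def set_borel_measurable_def\<close>)
qed

lemma set_integrable_unit_subset:
  fixes f :: "real \<Rightarrow> 'a::euclidean_space"
  shows "set_integrable lebesgue {0..1} f \<Longrightarrow> x \<le> 1 \<Longrightarrow> set_integrable lebesgue {0..x} f"
  by (rule set_integrable_subset) auto

lemma set_integrable_continuous:
  fixes f :: "real \<Rightarrow> 'a::euclidean_space"
  assumes "continuous_on {a..b} f" shows "set_integrable lebesgue {a..b} f"
  using continuous_imp_integrable_real[OF assms] by (simp add: set_integrable_def integrable_restrict_space)

lemma set_integrable_mult_continuous:
  fixes a u :: "real \<Rightarrow> real"
  assumes a: "set_integrable lebesgue {0..1} a" and u: "continuous_on {0..1} u"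
  shows "set_integrable lebesgue {0..1} (\<lambda>s. a s * u s)"
proof -
  obtain C where C: "\<And>x. x \<in> {0..1} \<Longrightarrow> \<bar>u x\<bar> \<le> C"
    using compact_imp_bounded[OF compact_continuous_image[OF u compact_Icc]]
    by (metis bounded_iff image_eqI real_norm_def)
  have "set_borel_measurable lebesgue {0..1} (\<lambda>s. a s * u s)"
  proof -
    have "u \<in> borel_measurable (lebesgue_on {0..1})"
      by (rule continuous_imp_measurable_on_sets_lebesgue[OF u]) auto
    moreover have "a \<in> borel_measurable (lebesgue_on {0..1})"
      using a by (simp add: set_integrable_def borel_measurable_restrict_space_iff)
    ultimately have "(\<lambda>s. a s * u s) \<in> borel_measurable (lebesgue_on {0..1})" by measurable
    thus ?thesis by (simp add: set_borel_measurable_def borel_measurable_restrict_space_iff)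
  qed
  moreover have "norm (a s * u s) \<le> norm (C * a s)" if "s \<in> {0..1}" for s
    using mult_mono[OF order_trans[OF C[OF that] abs_ge_self] order_refl, of "\<bar>a s\<bar>"] by (simp add: abs_mult mult.commute)
  ultimately show ?thesis
    by (intro set_integrable_bound[OF set_integrable_mult_right[of C, OF a]]) (auto intro!: AE_I2)
qed

lemma integral_exp_le:
  assumes "0 < L" "0 \<le> x" shows "(LINT s:{0..x}|lebesgue. exp (L * s)) \<le> exp (L * x) / (L::real)"
proof -
  have "((\<lambda>s. exp (L * s)) has_integral exp (L * x) / L - exp (L * 0) / L) {0..x}"
    using assms by (intro fundamental_theorem_of_calculus)
      (auto intro!: derivative_eq_intros simp: has_real_derivative_iff_has_vector_derivative[symmetric])
  moreover have "set_integrable lebesgue {0..x} (\<lambda>s. exp (L * s))"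
    by (intro set_integrable_continuous continuous_intros)
  ultimately have "(LINT s:{0..x}|lebesgue. exp (L * s)) = exp (L * x) / L - exp (L * 0) / L"
    by (simp add: set_lebesgue_integral_eq_integral has_integral_iff)
  thus ?thesis using assms by simp
qed

text \<open>Splitting \<open>a\<close> into a bounded part \<open>\<le> B\<close> and a part of integral at most \<open>1/4\<close> makes the Volterra
  operator a contraction with factor \<open>1/2\<close> for the sup norm weighted by \<open>exp (- 4 B x)\<close>.\<close>

lemma Gronwall_L1:
  fixes a :: "real \<Rightarrow> real"
  assumes a: "set_integrable lebesgue {0..1} a" and a0: "\<And>x. x \<in> {0..1} \<Longrightarrow> 0 \<le> a x"
  obtains G where "0 \<le> G" "\<And>u K x. continuous_on {0..1} u \<Longrightarrow> (\<And>x. x \<in> {0..1} \<Longrightarrow> 0 \<le> u x) \<Longrightarrow>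
    (\<And>x. x \<in> {0..1} \<Longrightarrow> u x \<le> K + (LINT s:{0..x}|lebesgue. a s * u s)) \<Longrightarrow> x \<in> {0..1} \<Longrightarrow> u x \<le> G * K"
proof -
  have am: "set_borel_measurable lebesgue {0..1} (\<lambda>s. a s - min (a s) (real n))" for n
  proof -
    have "a \<in> borel_measurable (lebesgue_on {0..1})"
      using a by (simp add: set_integrable_def borel_measurable_restrict_space_iff)
    hence "(\<lambda>s. a s - min (a s) (real n)) \<in> borel_measurable (lebesgue_on {0..1})" by measurable
    thus ?thesis by (simp add: set_borel_measurable_def borel_measurable_restrict_space_iff)
  qed
  have "(\<lambda>n. LINT s:{0..1}|lebesgue. a s - min (a s) (real n)) \<longlonglongrightarrow> (LINT s:{0..1::real}|lebesgue. 0)"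
  proof (rule set_dominated_convergence(1)[where w = a])
    fix x :: real assume "x \<in> {0..1}"
    obtain N where "a x \<le> real N" using real_arch_simple by blast
    hence "\<forall>\<^sub>F n in sequentially. a x - min (a x) (real n) = 0"
      unfolding eventually_sequentially by (intro exI[of _ N]) auto
    thus "(\<lambda>n. a x - min (a x) (real n)) \<longlonglongrightarrow> 0" by (rule tendsto_eventually)
  qed (use a a0 am in auto)
  hence "\<forall>\<^sub>F n in sequentially. (LINT s:{0..1}|lebesgue. a s - min (a s) (real n)) < 1 / 4"
    by (intro order_tendstoD) auto
  then obtain n where n: "n \<ge> 1" "(LINT s:{0..1}|lebesgue. a s - min (a s) (real n)) < 1 / 4"
    unfolding eventually_sequentially by (metis nat_le_linear order_refl)
  define B L where "B = real n" and "L = 4 * B"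
  have B: "0 < B" "0 < L" using n by (auto simp: B_def L_def)
  define r where "r s = a s - min (a s) B" for s
  have r: "set_integrable lebesgue {0..1} r"
    by (rule set_integrable_bound[OF a]) (use am[of n] a0 B in \<open>auto simp: r_def[abs_def] B_def intro!: AE_I2\<close>)
  have r14: "(LINT s:{0..1}|lebesgue. r s) \<le> 1 / 4" using n by (simp add: r_def B_def)
  have r0: "0 \<le> r s" for s by (simp add: r_def)
  show thesis
  proof (rule that[of "2 * exp L"])
    fix u :: "real \<Rightarrow> real" and K x :: real
    assume u: "continuous_on {0..1} u" and u0: "\<And>x. x \<in> {0..1} \<Longrightarrow> 0 \<le> u x"
      and uK: "\<And>x. x \<in> {0..1} \<Longrightarrow> u x \<le> K + (LINT s:{0..x}|lebesgue. a s * u s)" and x: "x \<in> {0..1}"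
    have "\<exists>y\<in>{0..1}. \<forall>x\<in>{0..1}. exp (- L * x) * u x \<le> exp (- L * y) * u y"
      by (rule continuous_attains_sup) (auto intro!: continuous_intros u)
    then obtain y where y: "y \<in> {0..1}" and ymax: "\<And>x. x \<in> {0..1} \<Longrightarrow> exp (- L * x) * u x \<le> exp (- L * y) * u y"
      by blast
    define w where "w = exp (- L * y) * u y"
    have w0: "0 \<le> w" using u0[OF y] by (simp add: w_def)
    have uw: "u s \<le> w * exp (L * s)" if "s \<in> {0..1}" for s
      using ymax[OF that] unfolding w_def[symmetric] by (simp add: exp_minus divide_simps mult.commute)
    have I1: "set_integrable lebesgue {0..y} (\<lambda>s. a s * u s)"
      using y by (intro set_integrable_unit_subset[OF set_integrable_mult_continuous[OF a u]]) auto
    have I2: "set_integrable lebesgue {0..y} (\<lambda>s. (B * w) * exp (L * s))"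
      by (intro set_integrable_continuous continuous_intros)
    have I3: "set_integrable lebesgue {0..y} (\<lambda>s. (w * exp (L * y)) * r s)"
      using y by (intro set_integrable_mult_right set_integrable_unit_subset[OF r]) auto
    have "(LINT s:{0..y}|lebesgue. a s * u s) \<le> (LINT s:{0..y}|lebesgue. (B * w) * exp (L * s) + (w * exp (L * y)) * r s)"
    proof (rule set_integral_mono[OF I1 set_integral_add(1)[OF I2 I3]])
      fix s assume s: "s \<in> {0..y}"
      hence s1: "s \<in> {0..1}" using y by auto
      have "a s * u s \<le> a s * (w * exp (L * s))" by (rule mult_left_mono[OF uw[OF s1] a0[OF s1]])
      also have "\<dots> \<le> (B + r s) * (w * exp (L * s))"
        using w0 by (intro mult_right_mono) (auto simp: r_def)
      also have "\<dots> = (B * w) * exp (L * s) + (w * exp (L * s)) * r s" by (simp add: algebra_simps)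
      also have "\<dots> \<le> (B * w) * exp (L * s) + (w * exp (L * y)) * r s"
        using s B w0 r0 by (intro add_left_mono mult_right_mono mult_left_mono) auto
      finally show "a s * u s \<le> (B * w) * exp (L * s) + (w * exp (L * y)) * r s" .
    qed
    also have "\<dots> = (B * w) * (LINT s:{0..y}|lebesgue. exp (L * s)) + (w * exp (L * y)) * (LINT s:{0..y}|lebesgue. r s)"
      using set_integral_add(2)[OF I2 I3] by simp
    also have "\<dots> \<le> (B * w) * (exp (L * y) / L) + (w * exp (L * y)) * (1 / 4)"
    proof (intro add_mono mult_left_mono integral_exp_le)
      have "(LINT s:{0..y}|lebesgue. r s) \<le> (LINT s:{0..1}|lebesgue. r s)"
        unfolding set_lebesgue_integral_def
        using y r set_integrable_unit_subset[OF r, of y]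
        by (intro integral_mono) (auto simp: set_integrable_def r0 indicator_def)
      with r14 show "(LINT s:{0..y}|lebesgue. r s) \<le> 1 / 4" by simp
    qed (use B w0 y in auto)
    also have "\<dots> = w * exp (L * y) / 2" using B by (simp add: L_def)
    \<comment> \<open>At the maximum point \<open>y\<close> the left side is
      \<open>w * exp (L * y)\<close>, so half of it absorbs the integral. The constant that results
      depends on \<open>a\<close> alone, not on \<open>u\<close> or \<open>K\<close>.\<close>
    finally have "u y \<le> K + w * exp (L * y) / 2" using uK[OF y] by simp
    moreover have "u y = w * exp (L * y)" by (simp add: w_def exp_minus)
    ultimately have 1: "w * exp (L * y) \<le> 2 * K" by simp
    have "w * 1 \<le> w * exp (L * y)" using w0 B y by (intro mult_left_mono) auto
    with 1 have wK: "w \<le> 2 * K" by simp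
    have "u x \<le> w * exp (L * x)" by (rule uw[OF x])
    also have "\<dots> \<le> (2 * K) * exp L" using wK w0 B x by (intro mult_mono) auto
    finally show "u x \<le> 2 * exp L * K" by (simp add: mult_ac)
  qed simp
qed

lemma norm_matrix_vector_mult_le:
  fixes A :: "complex ^ 'n ^ 'm"
  shows "norm (A *v w) \<le> (\<Sum>i\<in>UNIV. \<Sum>j\<in>UNIV. cmod (A $ i $ j)) * norm w"
proof -
  have "norm (A *v w) \<le> (\<Sum>i\<in>UNIV. cmod ((A *v w) $ i))" unfolding norm_vec_def by (rule L2_set_le_sum) simp
  also have "\<dots> \<le> (\<Sum>i\<in>UNIV. \<Sum>j\<in>UNIV. cmod (A $ i $ j) * norm w)"
    unfolding matrix_vector_mult_def
    by (auto intro!: sum_mono order_trans[OF norm_sum] mult_left_mono Finite_Cartesian_Product.norm_nth_le simp: norm_mult)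
  finally show ?thesis by (simp add: sum_distrib_right)
qed

text \<open>Bolzano-Weierstrass for one member after the other, each time along a further
  subsequence.\<close>

lemma finite_family_convergent_subseq:
  fixes s :: "'i \<Rightarrow> nat \<Rightarrow> 'a::heine_borel"
  assumes "finite I" "\<And>i. i \<in> I \<Longrightarrow> bounded (range (s i))"
  shows "\<exists>r. strict_mono (r :: nat \<Rightarrow> nat) \<and> (\<forall>i\<in>I. convergent (s i \<circ> r))"
  using assms
proof (induction I)
  case empty show ?case by (rule exI[of _ id]) (auto simp: strict_mono_def)
next
  case (insert i I)
  obtain r where r: "strict_mono (r :: nat \<Rightarrow> nat)" "\<forall>i\<in>I. convergent (s i \<circ> r)"
    using insert.IH[OF insert.prems[OF insertI2]] by blast
  have "bounded (range (s i \<circ> r))"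
    using insert.prems[of i] by (rule bounded_subset) auto
  then obtain l r' where r': "strict_mono (r' :: nat \<Rightarrow> nat)" "((s i \<circ> r) \<circ> r') \<longlonglongrightarrow> l"
    using bounded_imp_convergent_subsequence by blast
  have "convergent (s j \<circ> (r \<circ> r'))" if "j \<in> I" for j
    using r(2) that r'(1) convergent_subseq_convergent[of "s j \<circ> r" r'] by (auto simp: o_assoc)
  moreover have "convergent (s i \<circ> (r \<circ> r'))" using r'(2) by (auto simp: convergent_def o_assoc)
  moreover have "strict_mono (r \<circ> r')" by (rule strict_mono_o[OF r(1) r'(1)])
  ultimately show ?case by blast
qed

section \<open>Compactness of the eigenfunctions of the Bloch operators\<close>

text \<open>Right hand side of the first order system for the jet (y, y', ..., y^(n-1)); the
  component n - 1 contains l(y) = z y solved for the highest derivative.\<close>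

definition bloch_rhs ::
  "nat \<Rightarrow> (real \<Rightarrow> complex) \<Rightarrow> (nat \<Rightarrow> real \<Rightarrow> complex ^ 'm ^ 'm) \<Rightarrow> complex \<Rightarrow>
   (nat \<Rightarrow> real \<Rightarrow> complex ^ 'm) \<Rightarrow> nat \<Rightarrow> real \<Rightarrow> complex ^ 'm" where
  "bloch_rhs n p1 P z D \<nu> s =
     (if \<nu> = n - 1 then z *s D 0 s - p1 s *s D (n - 1) s - (\<Sum>\<mu>=2..n. P \<mu> s *v D (n - \<mu>) s)
      else D (Suc \<nu>) s)"

text \<open>Integral form of the system: with merely summable coefficients the top component
  satisfies the differential equation only almost everywhere.\<close>

definition bloch_solution ::
  "nat \<Rightarrow> (real \<Rightarrow> complex) \<Rightarrow> (nat \<Rightarrow> real \<Rightarrow> complex ^ 'm ^ 'm) \<Rightarrow> complex \<Rightarrow>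
   (nat \<Rightarrow> real \<Rightarrow> complex ^ 'm) \<Rightarrow> bool" where
  "bloch_solution n p1 P z D \<longleftrightarrow>
     (\<forall>\<nu><n. continuous_on {0..1} (D \<nu>) \<and>
        (\<forall>x\<in>{0..1}. D \<nu> x = D \<nu> 0 + (LINT s:{0..x}|lebesgue. bloch_rhs n p1 P z D \<nu> s)))"

text \<open>A Lipschitz constant of the system at \<open>s\<close>: the summand 1 accounts for the
  components that shift the jet, \<open>R\<close> for spectral parameters of modulus at most
  R.\<close>

definition coeff_bound ::
  "nat \<Rightarrow> (real \<Rightarrow> complex) \<Rightarrow> (nat \<Rightarrow> real \<Rightarrow> complex ^ 'm ^ 'm) \<Rightarrow> real \<Rightarrow> real \<Rightarrow> real" where
  "coeff_bound n p1 P R s =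
     1 + R + cmod (p1 s) + (\<Sum>\<mu>=2..n. \<Sum>i\<in>UNIV. \<Sum>j\<in>UNIV. cmod (P \<mu> s $ i $ j))"

definition jet_norm :: "nat \<Rightarrow> (nat \<Rightarrow> real \<Rightarrow> complex ^ 'm) \<Rightarrow> real \<Rightarrow> real" where
  "jet_norm n D s = (\<Sum>\<nu><n. norm (D \<nu> s))"

lemma set_integrable_sum':
  assumes "\<And>i. i \<in> I \<Longrightarrow> set_integrable M A (f i)"
  shows "set_integrable M A (\<lambda>x. \<Sum>i\<in>I. f i x)"
  using assms unfolding set_integrable_def scaleR_sum_right by (rule Bochner_Integration.integrable_sum)

lemma set_integral_sum':
  fixes f :: "'i \<Rightarrow> 'a \<Rightarrow> 'b::{banach, second_countable_topology}"
  assumes "\<And>i. i \<in> I \<Longrightarrow> set_integrable M A (f i)"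
  shows "(LINT x:A|M. \<Sum>i\<in>I. f i x) = (\<Sum>i\<in>I. LINT x:A|M. f i x)"
  using assms unfolding set_integrable_def set_lebesgue_integral_def scaleR_sum_right
  by (rule Bochner_Integration.integral_sum)

lemma jet_norm_nonneg [simp]: "0 \<le> jet_norm n D s"
  by (simp add: jet_norm_def sum_nonneg)

lemma norm_le_jet_norm: "\<nu> < n \<Longrightarrow> norm (D \<nu> s) \<le> jet_norm n D s"
  unfolding jet_norm_def by (rule member_le_sum) auto

lemma measurable_matrix_vector_mult:
  fixes A :: "real \<Rightarrow> complex ^ 'm::finite ^ 'm"
  assumes A: "\<And>i j. (\<lambda>s. A s $ i $ j) \<in> borel_measurable M" and w [measurable]: "w \<in> borel_measurable M"
  shows "(\<lambda>s. A s *v w s) \<in> borel_measurable M"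
proof -
  have [measurable]: "(\<lambda>s. w s $ j) \<in> borel_measurable M" for j
    by (rule measurable_compose[OF w borel_measurable_continuous_onI]) (intro continuous_intros)
  note A [measurable]
  have "A s *v w s = (\<Sum>i\<in>UNIV. (\<Sum>j\<in>UNIV. A s $ i $ j * w s $ j) *s axis i 1)" for s
    by (simp add: matrix_vector_mult_def vec_eq_iff axis_def if_distrib cong: if_cong)
  thus ?thesis by simp
qed

locale bloch_coefficients =
  fixes n :: nat and p1 :: "real \<Rightarrow> complex" and P :: "nat \<Rightarrow> real \<Rightarrow> complex ^ 'm::finite ^ 'm"
  assumes n: "n \<ge> 2" and p1: "continuous_on {0..1} p1"
    and P: "\<And>\<mu> i j. \<mu> \<in> {2..n} \<Longrightarrow> set_integrable lebesgue {0..1} (\<lambda>x. P \<mu> x $ i $ j)"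
begin

lemma coeff_bound_integrable: "set_integrable lebesgue {0..1} (coeff_bound n p1 P R)"
proof -
  have "set_integrable lebesgue {0..1} (\<lambda>s. cmod (P \<mu> s $ i $ j))" if "\<mu> \<in> {2..n}" for \<mu> i j
    using P[OF that] by (rule set_integrable_norm)
  moreover have "set_integrable lebesgue {0..1} (\<lambda>s. 1 + R + cmod (p1 s))"
    by (intro set_integrable_continuous continuous_intros p1)
  ultimately show ?thesis
    unfolding coeff_bound_def[abs_def] by (intro set_integral_add(1)[where f = "\<lambda>s. 1 + R + cmod (p1 s)"] set_integrable_sum') auto
qed

lemma coeff_bound_ge: "0 \<le> R \<Longrightarrow> 1 \<le> coeff_bound n p1 P R s"
  unfolding coeff_bound_def by (simp add: sum_nonneg add_increasing)

text \<open>Writing z D_0 - z' D'_0 as z (D_0 - D'_0) + (z - z') D'_0 isolates the change of the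
  spectral parameter as the only inhomogeneous term. The case \<open>D' = 0\<close> is the growth
  bound.\<close>

lemma bloch_rhs_diff_bound:
  assumes R: "cmod z \<le> R" and \<Delta>: "\<Delta> = (\<lambda>\<nu> s. D \<nu> s - D' \<nu> s)"
  shows "(\<Sum>\<nu><n. norm (bloch_rhs n p1 P z D \<nu> s - bloch_rhs n p1 P z' D' \<nu> s))
     \<le> coeff_bound n p1 P R s * jet_norm n \<Delta> s + cmod (z - z') * norm (D' 0 s)"
proof -
  obtain N where N: "n = Suc N" "N \<ge> 1" using n by (cases n) auto
  let ?r = "\<lambda>\<nu>. bloch_rhs n p1 P z D \<nu> s - bloch_rhs n p1 P z' D' \<nu> s" and ?u = "jet_norm n \<Delta> s"
  have u: "norm (D \<nu> s - D' \<nu> s) \<le> ?u" if "\<nu> < n" for \<nu> using norm_le_jet_norm[OF that, of \<Delta> s] by (simp add: \<Delta>)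
  have "(\<Sum>\<nu><N. norm (?r \<nu>)) = (\<Sum>\<nu><N. norm (\<Delta> (Suc \<nu>) s))"
    by (intro sum.cong) (auto simp: bloch_rhs_def N \<Delta>)
  also have "\<dots> \<le> ?u" unfolding jet_norm_def N sum.lessThan_Suc_shift by simp
  finally have 1: "(\<Sum>\<nu><N. norm (?r \<nu>)) \<le> ?u" .
  have "?r N = z *s (D 0 s - D' 0 s) + (z - z') *s D' 0 s - p1 s *s (D N s - D' N s)
      - (\<Sum>\<mu>=2..n. P \<mu> s *v (D (n - \<mu>) s - D' (n - \<mu>) s))"
    by (simp add: bloch_rhs_def N vector_ssub_ldistrib vector_sub_rdistrib matrix_vector_mult_diff_distrib sum_subtractf)
  also have "norm \<dots> \<le> norm (z *s (D 0 s - D' 0 s)) + norm ((z - z') *s D' 0 s) + norm (p1 s *s (D N s - D' N s))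
      + norm (\<Sum>\<mu>=2..n. P \<mu> s *v (D (n - \<mu>) s - D' (n - \<mu>) s))"
    by (intro order_trans[OF norm_triangle_ineq4] order_trans[OF norm_triangle_ineq] add_mono order_refl)
  also have "\<dots> \<le> R * ?u + cmod (z - z') * norm (D' 0 s) + cmod (p1 s) * ?u
      + (\<Sum>\<mu>=2..n. \<Sum>i\<in>UNIV. \<Sum>j\<in>UNIV. cmod (P \<mu> s $ i $ j)) * ?u"
  proof (intro add_mono)
    show "norm (z *s (D 0 s - D' 0 s)) \<le> R * ?u"
      unfolding norm_smult_vec using u[of 0] n R order_trans[OF norm_ge_zero R] by (intro mult_mono) auto
    show "norm (p1 s *s (D N s - D' N s)) \<le> cmod (p1 s) * ?u"
      unfolding norm_smult_vec using u[of N] N by (intro mult_left_mono) auto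
    have "norm (P \<mu> s *v (D (n - \<mu>) s - D' (n - \<mu>) s)) \<le> (\<Sum>i\<in>UNIV. \<Sum>j\<in>UNIV. cmod (P \<mu> s $ i $ j)) * ?u"
      if "\<mu> \<in> {2..n}" for \<mu>
      using that n by (intro order_trans[OF norm_matrix_vector_mult_le mult_left_mono[OF u]]) (auto intro!: sum_nonneg)
    thus "norm (\<Sum>\<mu>=2..n. P \<mu> s *v (D (n - \<mu>) s - D' (n - \<mu>) s))
        \<le> (\<Sum>\<mu>=2..n. \<Sum>i\<in>UNIV. \<Sum>j\<in>UNIV. cmod (P \<mu> s $ i $ j)) * ?u"
      unfolding sum_distrib_right[of _ "{2..n}"] by (rule sum_norm_le)
  qed (simp only: norm_smult_vec)
  finally have "(\<Sum>\<nu><n. norm (?r \<nu>)) \<le> ?u + (R * ?u + cmod (z - z') * norm (D' 0 s) + cmod (p1 s) * ?u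
      + (\<Sum>\<mu>=2..n. \<Sum>i\<in>UNIV. \<Sum>j\<in>UNIV. cmod (P \<mu> s $ i $ j)) * ?u)"
    using 1 unfolding N(1) sum.lessThan_Suc by (rule add_mono[rotated])
  thus ?thesis by (simp add: coeff_bound_def algebra_simps)
qed

lemma bloch_rhs_zero [simp]: "bloch_rhs n p1 P z (\<lambda>_ _. 0) \<nu> s = 0"
  by (simp add: bloch_rhs_def)

lemma bloch_rhs_bound:
  assumes R: "cmod z \<le> R" and \<nu>: "\<nu> < n"
  shows "norm (bloch_rhs n p1 P z D \<nu> s) \<le> coeff_bound n p1 P R s * jet_norm n D s"
proof -
  have "norm (bloch_rhs n p1 P z D \<nu> s) \<le> (\<Sum>\<nu><n. norm (bloch_rhs n p1 P z D \<nu> s))"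
    using \<nu> by (intro member_le_sum[of \<nu> _ "\<lambda>\<nu>. norm (bloch_rhs n p1 P z D \<nu> s)"]) auto
  also have "\<dots> \<le> coeff_bound n p1 P R s * jet_norm n D s"
    using bloch_rhs_diff_bound[OF R refl, where D = D and D' = "\<lambda>_ _. 0" and z' = z and s = s] by simp
  finally show ?thesis .
qed

lemma bloch_rhs_measurable:
  assumes D: "\<And>\<nu>. \<nu> < n \<Longrightarrow> continuous_on {0..1} (D \<nu>)" and \<nu>: "\<nu> < n"
  shows "bloch_rhs n p1 P z D \<nu> \<in> borel_measurable (lebesgue_on {0..1})"
proof -
  let ?M = "lebesgue_on {0..1::real}"
  have Dm: "D \<nu> \<in> borel_measurable ?M" if "\<nu> < n" for \<nu>
    by (rule continuous_imp_measurable_on_sets_lebesgue[OF D[OF that]]) auto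
  show ?thesis
  proof (cases "\<nu> = n - 1")
    case False thus ?thesis using \<nu> Dm[of "Suc \<nu>"] by (simp add: bloch_rhs_def[abs_def])
  next
    case True
    have D0: "D 0 \<in> borel_measurable ?M" "D (n - 1) \<in> borel_measurable ?M" using n by (auto intro: Dm)
    have p1m: "p1 \<in> borel_measurable ?M"
      by (rule continuous_imp_measurable_on_sets_lebesgue[OF p1]) auto
    have Pm: "(\<lambda>s. P \<mu> s *v D (n - \<mu>) s) \<in> borel_measurable ?M" if "\<mu> \<in> {2..n}" for \<mu>
    proof (rule measurable_matrix_vector_mult)
      show "(\<lambda>s. P \<mu> s $ i $ j) \<in> borel_measurable ?M" for i j
        using P[OF that, of i j] by (simp add: set_integrable_def borel_measurable_restrict_space_iff)
      show "D (n - \<mu>) \<in> borel_measurable ?M" using that by (intro Dm) auto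
    qed
    have "(\<lambda>s. z *s D 0 s - p1 s *s D (n - 1) s - (\<Sum>\<mu>=2..n. P \<mu> s *v D (n - \<mu>) s)) \<in> borel_measurable ?M"
      by (intro borel_measurable_diff borel_measurable_smult borel_measurable_sum D0 p1m Pm borel_measurable_const)
    with True show ?thesis by (simp add: bloch_rhs_def[abs_def])
  qed
qed

lemma continuous_on_jet_norm:
  "(\<And>\<nu>. \<nu> < n \<Longrightarrow> continuous_on {0..1} (D \<nu>)) \<Longrightarrow> continuous_on {0..1} (jet_norm n D)"
  unfolding jet_norm_def[abs_def] by (intro continuous_intros) auto

lemma bloch_rhs_integrable:
  assumes D: "\<And>\<nu>. \<nu> < n \<Longrightarrow> continuous_on {0..1} (D \<nu>)" and \<nu>: "\<nu> < n"
  shows "set_integrable lebesgue {0..1} (bloch_rhs n p1 P z D \<nu>)"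
proof (rule set_integrable_bound)
  show "set_integrable lebesgue {0..1} (\<lambda>s. coeff_bound n p1 P (cmod z) s * jet_norm n D s)"
    by (intro set_integrable_mult_continuous coeff_bound_integrable continuous_on_jet_norm D)
  show "set_borel_measurable lebesgue {0..1} (bloch_rhs n p1 P z D \<nu>)"
    using bloch_rhs_measurable[OF D \<nu>] by (simp add: set_borel_measurable_def borel_measurable_restrict_space_iff)
  show "AE x in lebesgue. x \<in> {0..1} \<longrightarrow> norm (bloch_rhs n p1 P z D \<nu> x)
      \<le> norm (coeff_bound n p1 P (cmod z) x * jet_norm n D x)"
  proof (intro AE_I2 impI)
    fix x show "norm (bloch_rhs n p1 P z D \<nu> x) \<le> norm (coeff_bound n p1 P (cmod z) x * jet_norm n D x)"
      using bloch_rhs_bound[OF order_refl \<nu>, of z D x] by simp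
  qed
qed

lemma bloch_solution_zero: "bloch_solution n p1 P z (\<lambda>_ _. 0)"
  by (simp add: bloch_solution_def)

lemma bloch_solution_continuous: "bloch_solution n p1 P z D \<Longrightarrow> \<nu> < n \<Longrightarrow> continuous_on {0..1} (D \<nu>)"
  by (simp add: bloch_solution_def)

text \<open>The shape required by \<open>Gronwall_L1\<close>: the initial discrepancy and the
  parameter discrepancy form the constant, the latter without a factor x because x is at most
  1.\<close>

lemma bloch_solution_diff_ineq:
  assumes D: "bloch_solution n p1 P z D" and D': "bloch_solution n p1 P z' D'" and R: "cmod z \<le> R"
    and M: "\<And>x. x \<in> {0..1} \<Longrightarrow> norm (D' 0 x) \<le> M" and x: "x \<in> {0..1}" and \<Delta>: "\<Delta> = (\<lambda>\<nu> s. D \<nu> s - D' \<nu> s)"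
  shows "jet_norm n \<Delta> x \<le> (jet_norm n \<Delta> 0 + cmod (z - z') * M)
     + (LINT s:{0..x}|lebesgue. coeff_bound n p1 P R s * jet_norm n \<Delta> s)"
proof -
  let ?r = "\<lambda>\<nu> s. bloch_rhs n p1 P z D \<nu> s - bloch_rhs n p1 P z' D' \<nu> s"
  have Dc: "continuous_on {0..1} (D \<nu>)" "continuous_on {0..1} (D' \<nu>)" if "\<nu> < n" for \<nu>
    using D D' that by (auto simp: bloch_solution_def)
  have \<Delta>c: "continuous_on {0..1} (\<Delta> \<nu>)" if "\<nu> < n" for \<nu>
    unfolding \<Delta> by (intro continuous_intros Dc that)
  have ri: "set_integrable lebesgue {0..x} (bloch_rhs n p1 P z D \<nu>)"
     "set_integrable lebesgue {0..x} (bloch_rhs n p1 P z' D' \<nu>)" if "\<nu> < n" for \<nu>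
    using x by (auto intro!: set_integrable_unit_subset bloch_rhs_integrable Dc that)
  have rii: "set_integrable lebesgue {0..x} (\<lambda>s. norm (?r \<nu> s))" if "\<nu> < n" for \<nu>
    by (intro set_integrable_norm set_integral_diff(1) ri that)
  have 1: "norm (\<Delta> \<nu> x) \<le> norm (\<Delta> \<nu> 0) + (LINT s:{0..x}|lebesgue. norm (?r \<nu> s))" if \<nu>: "\<nu> < n" for \<nu>
  proof -
    have "D \<nu> x = D \<nu> 0 + (LINT s:{0..x}|lebesgue. bloch_rhs n p1 P z D \<nu> s)"
      "D' \<nu> x = D' \<nu> 0 + (LINT s:{0..x}|lebesgue. bloch_rhs n p1 P z' D' \<nu> s)"
      using D D' \<nu> x unfolding bloch_solution_def by blast+
    hence "\<Delta> \<nu> x = \<Delta> \<nu> 0 + (LINT s:{0..x}|lebesgue. ?r \<nu> s)"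
      unfolding \<Delta> set_integral_diff(2)[OF ri[OF \<nu>]] by simp
    moreover have "norm (LINT s:{0..x}|lebesgue. ?r \<nu> s) \<le> (LINT s:{0..x}|lebesgue. norm (?r \<nu> s))"
      by (rule set_integral_norm_bound[OF set_integral_diff(1)[OF ri[OF \<nu>]]])
    ultimately show ?thesis
      by (simp only:) (intro order_trans[OF norm_triangle_ineq] add_left_mono)
  qed
  have I1: "set_integrable lebesgue {0..x} (\<lambda>s. coeff_bound n p1 P R s * jet_norm n \<Delta> s)"
    using x by (intro set_integrable_unit_subset[OF set_integrable_mult_continuous]
        coeff_bound_integrable continuous_on_jet_norm \<Delta>c) auto
  have I2: "set_integrable lebesgue {0..x} (\<lambda>s. cmod (z - z') * M)"
    by (intro set_integrable_continuous continuous_intros)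
  have "jet_norm n \<Delta> x \<le> (\<Sum>\<nu><n. norm (\<Delta> \<nu> 0) + (LINT s:{0..x}|lebesgue. norm (?r \<nu> s)))"
    unfolding jet_norm_def by (intro sum_mono 1) auto
  also have "\<dots> = jet_norm n \<Delta> 0 + (LINT s:{0..x}|lebesgue. (\<Sum>\<nu><n. norm (?r \<nu> s)))"
    unfolding jet_norm_def sum.distrib by (subst set_integral_sum'[OF rii]) auto
  also have "(LINT s:{0..x}|lebesgue. (\<Sum>\<nu><n. norm (?r \<nu> s)))
      \<le> (LINT s:{0..x}|lebesgue. coeff_bound n p1 P R s * jet_norm n \<Delta> s + cmod (z - z') * M)"
  proof (rule set_integral_mono)
    show "set_integrable lebesgue {0..x} (\<lambda>s. \<Sum>\<nu><n. norm (?r \<nu> s))"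
      by (intro set_integrable_sum' rii) auto
    show "set_integrable lebesgue {0..x} (\<lambda>s. coeff_bound n p1 P R s * jet_norm n \<Delta> s + cmod (z - z') * M)"
      by (rule set_integral_add(1)[OF I1 I2])
    fix s assume "s \<in> {0..x}"
    hence "norm (D' 0 s) \<le> M" using x by (intro M) auto
    hence "cmod (z - z') * norm (D' 0 s) \<le> cmod (z - z') * M" by (intro mult_left_mono) auto
    with bloch_rhs_diff_bound[OF R \<Delta>, of s z']
    show "(\<Sum>\<nu><n. norm (?r \<nu> s)) \<le> coeff_bound n p1 P R s * jet_norm n \<Delta> s + cmod (z - z') * M" by linarith
  qed
  also have "\<dots> = (LINT s:{0..x}|lebesgue. coeff_bound n p1 P R s * jet_norm n \<Delta> s) + x * (cmod (z - z') * M)"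
    unfolding set_integral_add(2)[OF I1 I2] using x by (simp add: set_lebesgue_integral_def)
  also have "x * (cmod (z - z') * M) \<le> cmod (z - z') * M"
    using x order_trans[OF norm_ge_zero M[OF x]] by (intro mult_left_le_one_le) auto
  finally show ?thesis by simp
qed

text \<open>Gronwall applied to differences turns convergence of initial jets and parameters into
  uniform Cauchy sequences; dominated convergence in the integral equation shows that the limit is a
  solution.\<close>

lemma bloch_solution_compact:
  assumes D: "\<And>i. bloch_solution n p1 P (z i) (D i)" and z: "z \<longlonglongrightarrow> z0"
    and D0: "\<And>\<nu>. \<nu> < n \<Longrightarrow> convergent (\<lambda>i. D i \<nu> 0)"
  obtains E where "bloch_solution n p1 P z0 E"
    "\<And>\<nu>. \<nu> < n \<Longrightarrow> uniform_limit {0..1} (\<lambda>i. D i \<nu>) (E \<nu>) sequentially"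
proof -
  obtain R where R: "\<And>i. cmod (z i) \<le> R" using convergent_imp_bounded[OF z] by (auto simp: bounded_iff)
  have R0: "0 \<le> R" using R[of 0] norm_ge_zero order_trans by blast
  have Rz0: "cmod z0 \<le> R" using LIMSEQ_le_const2[OF tendsto_norm[OF z]] R by blast
  obtain G where G: "0 \<le> G" and Gr: "\<And>u K x. continuous_on {0..1} u \<Longrightarrow> (\<And>x. x \<in> {0..1} \<Longrightarrow> 0 \<le> u x) \<Longrightarrow>
    (\<And>x. x \<in> {0..1} \<Longrightarrow> u x \<le> K + (LINT s:{0..x}|lebesgue. coeff_bound n p1 P R s * u s)) \<Longrightarrow> x \<in> {0..1} \<Longrightarrow> u x \<le> G * K"
  proof (rule Gronwall_L1[OF coeff_bound_integrable[of R]])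
    show "0 \<le> coeff_bound n p1 P R x" for x using coeff_bound_ge[OF R0, of x] by linarith
  qed blast
  have Dc: "continuous_on {0..1} (D i \<nu>)" if "\<nu> < n" for i \<nu>
    using D that by (simp add: bloch_solution_def)
  have jc: "continuous_on {0..1} (jet_norm n (D i))" for i by (intro continuous_on_jet_norm Dc)
  have "convergent (\<lambda>i. jet_norm n (D i) 0)"
    unfolding jet_norm_def by (intro convergent_sum convergent_norm D0) auto
  then obtain l where "(\<lambda>i. jet_norm n (D i) 0) \<longlonglongrightarrow> l" by (auto simp: convergent_def)
  from convergent_imp_bounded[OF this] obtain J where J: "\<And>i. jet_norm n (D i) 0 \<le> J"
    by (auto simp: bounded_iff)
  define M where "M = G * J"
  have J0: "0 \<le> J" using J[of 0] jet_norm_nonneg order_trans by blast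
  \<comment> \<open>Comparison with the zero solution at the same parameter leaves no inhomogeneity,
    so all members share one bound.\<close>
  have jM: "jet_norm n (D i) x \<le> M" if x: "x \<in> {0..1}" for i x
  proof -
    have "jet_norm n (D i) x \<le> G * jet_norm n (D i) 0"
    proof (rule Gr[OF jc _ _ x])
      fix x :: real assume x: "x \<in> {0..1}"
      show "jet_norm n (D i) x \<le> jet_norm n (D i) 0 + (LINT s:{0..x}|lebesgue. coeff_bound n p1 P R s * jet_norm n (D i) s)"
        using bloch_solution_diff_ineq[OF D[of i] bloch_solution_zero[of "z i"] R[of i] _ x, of 0] by simp
    qed auto
    also have "\<dots> \<le> M" unfolding M_def using J G by (intro mult_left_mono)
    finally show ?thesis .
  qed
  define \<Delta> where "\<Delta> i j = (\<lambda>\<nu> s. D i \<nu> s - D j \<nu> s)" for i j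
  have dist: "jet_norm n (\<Delta> i j) x \<le> G * (jet_norm n (\<Delta> i j) 0 + cmod (z i - z j) * M)" if x: "x \<in> {0..1}" for i j x
  proof (rule Gr[OF _ _ _ x])
    show "continuous_on {0..1} (jet_norm n (\<Delta> i j))"
      unfolding \<Delta>_def by (intro continuous_on_jet_norm continuous_intros Dc)
    fix x :: real assume x: "x \<in> {0..1}"
    show "jet_norm n (\<Delta> i j) x \<le> jet_norm n (\<Delta> i j) 0 + cmod (z i - z j) * M
        + (LINT s:{0..x}|lebesgue. coeff_bound n p1 P R s * jet_norm n (\<Delta> i j) s)"
    proof (rule bloch_solution_diff_ineq[OF D D R _ x])
      fix x :: real assume "x \<in> {0..1}"
      thus "norm (D j 0 x) \<le> M" using norm_le_jet_norm[of 0 n "D j" x] jM[of x j] n by linarith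
    qed (simp add: \<Delta>_def)
  qed auto
  have unif: "\<exists>l. \<forall>e>0. \<exists>N. \<forall>i x. N \<le> i \<and> x \<in> {0..1} \<longrightarrow> dist (D i \<nu> x) (l x) < e" if \<nu>: "\<nu> < n" for \<nu>
    unfolding uniformly_convergent_eq_cauchy
  proof (intro allI impI)
    fix e :: real assume e: "0 < e"
    \<comment> \<open>Makes G (n d + d M) less than e; the added ones keep the denominator positive
      and the inequality strict.\<close>
    define d where "d = e / ((G + 1) * (real n + M + 1))"
    have M0: "0 \<le> M" using G J0 by (simp add: M_def)
    have d: "0 < d" using e G M0 by (simp add: d_def)
    have "\<exists>N. \<forall>i\<ge>N. \<forall>j\<ge>N. dist (D i \<nu> 0) (D j \<nu> 0) < d" if "\<nu> < n" for \<nu>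
      using convergent_Cauchy[OF D0[OF that]] d unfolding Cauchy_def by blast
    then obtain N where N: "\<And>\<nu> i j. \<nu> < n \<Longrightarrow> i \<ge> N \<nu> \<Longrightarrow> j \<ge> N \<nu> \<Longrightarrow> dist (D i \<nu> 0) (D j \<nu> 0) < d" by metis
    obtain N' where N': "\<And>i j. i \<ge> N' \<Longrightarrow> j \<ge> N' \<Longrightarrow> dist (z i) (z j) < d"
      using LIMSEQ_imp_Cauchy[OF z] d unfolding Cauchy_def by blast
    define L where "L = Max (insert N' (N ` {..<n}))"
    have "dist (D i \<nu> x) (D j \<nu> x) < e" if ij: "L \<le> i" "L \<le> j" and x: "x \<in> {0..1}" for i j x
    proof -
      have L: "N' \<le> L" "\<And>\<nu>. \<nu> < n \<Longrightarrow> N \<nu> \<le> L" unfolding L_def by (auto intro!: Max_ge)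
      have "norm (\<Delta> i j \<nu> 0) \<le> d" if "\<nu> < n" for \<nu>
        using N[OF that, of i j] L(2)[OF that] ij by (simp add: \<Delta>_def dist_norm)
      hence "jet_norm n (\<Delta> i j) 0 \<le> (\<Sum>\<nu><n. d)" unfolding jet_norm_def by (intro sum_mono) auto
      moreover have "cmod (z i - z j) * M \<le> d * M"
        using N'[of i j] L(1) ij M0 by (intro mult_right_mono) (auto simp: dist_norm)
      ultimately have *: "jet_norm n (\<Delta> i j) 0 + cmod (z i - z j) * M \<le> d * (real n + M)"
        by (simp add: algebra_simps)
      have "dist (D i \<nu> x) (D j \<nu> x) \<le> jet_norm n (\<Delta> i j) x"
        using norm_le_jet_norm[OF \<nu>, of "\<Delta> i j" x] by (simp add: \<Delta>_def dist_norm)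
      also have "\<dots> \<le> G * (d * (real n + M))"
        using dist[OF x, of i j] mult_left_mono[OF * G] by linarith
      also have "\<dots> < (G + 1) * (d * (real n + M + 1))"
        using G d M0 by (intro mult_strict_mono mult_strict_left_mono mult_nonneg_nonneg) auto
      also have "\<dots> = d * ((G + 1) * (real n + M + 1))" by simp
      also have "\<dots> = e" using G M0 by (simp add: d_def)
      finally show ?thesis .
    qed
    thus "\<exists>N. \<forall>m n x. N \<le> m \<and> N \<le> n \<and> x \<in> {0..1} \<longrightarrow> dist (D m \<nu> x) (D n \<nu> x) < e" by blast
  qed
  then obtain E where E: "\<And>\<nu> e. \<nu> < n \<Longrightarrow> 0 < e \<Longrightarrow> \<exists>N. \<forall>i x. N \<le> i \<and> x \<in> {0..1} \<longrightarrow> dist (D i \<nu> x) (E \<nu> x) < e"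
    by metis
  have UE: "uniform_limit {0..1} (\<lambda>i. D i \<nu>) (E \<nu>) sequentially" if "\<nu> < n" for \<nu>
    unfolding uniform_limit_sequentially_iff using E[OF that] by metis
  have Ec: "continuous_on {0..1} (E \<nu>)" if "\<nu> < n" for \<nu>
    by (rule uniform_limit_theorem[OF _ UE[OF that]]) (auto intro!: Dc that always_eventually)
  have Ep: "(\<lambda>i. D i \<nu> x) \<longlonglongrightarrow> E \<nu> x" if "\<nu> < n" "x \<in> {0..1}" for \<nu> x
    by (rule tendsto_uniform_limitI[OF UE[OF that(1)] that(2)])
  have rhs: "(\<lambda>i. bloch_rhs n p1 P (z i) (D i) \<nu> s) \<longlonglongrightarrow> bloch_rhs n p1 P z0 E \<nu> s" if "\<nu> < n" "s \<in> {0..1}" for \<nu> s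
  proof (cases "\<nu> = n - 1")
    case False thus ?thesis using that Ep[of "Suc \<nu>" s] by (simp add: bloch_rhs_def)
  next
    case True
    have mv: "(\<lambda>i. P \<mu> s *v D i (n - \<mu>) s) \<longlonglongrightarrow> P \<mu> s *v E (n - \<mu>) s" if "\<mu> \<in> {2..n}" for \<mu>
    proof -
      have "isCont ((*v) (P \<mu> s)) w" for w
        by (intro linear_continuous_at matrix_vector_mul_bounded_linear)
      thus ?thesis using that \<open>s \<in> {0..1}\<close> by (intro isCont_tendsto_compose[of _ "(*v) (P \<mu> s)"] Ep) auto
    qed
    show ?thesis using True that n mv
      unfolding bloch_rhs_def
      by (auto intro!: tendsto_diff tendsto_sum bounded_bilinear.tendsto[OF bounded_bilinear_smult] z Ep)
  qed
  have "E \<nu> x = E \<nu> 0 + (LINT s:{0..x}|lebesgue. bloch_rhs n p1 P z0 E \<nu> s)" if \<nu>: "\<nu> < n" and x: "x \<in> {0..1}" for \<nu> x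
  proof (rule LIMSEQ_unique)
    show "(\<lambda>i. D i \<nu> x) \<longlonglongrightarrow> E \<nu> x" using Ep \<nu> x by blast
    have "(\<lambda>i. LINT s:{0..x}|lebesgue. bloch_rhs n p1 P (z i) (D i) \<nu> s) \<longlonglongrightarrow> (LINT s:{0..x}|lebesgue. bloch_rhs n p1 P z0 E \<nu> s)"
    proof (rule set_dominated_convergence(1)[where w = "\<lambda>s. coeff_bound n p1 P R s * M"])
      have "set_integrable lebesgue {0..x} (bloch_rhs n p1 P (z i) (D i) \<nu>)" for i
        using x by (intro set_integrable_unit_subset[OF bloch_rhs_integrable] Dc \<nu>) auto
      thus "set_borel_measurable lebesgue {0..x} (bloch_rhs n p1 P (z i) (D i) \<nu>)" for i
        by (simp add: set_integrable_def set_borel_measurable_def)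
      show "set_integrable lebesgue {0..x} (\<lambda>s. coeff_bound n p1 P R s * M)"
        using x by (intro set_integrable_unit_subset[OF set_integrable_mult_continuous]
            coeff_bound_integrable continuous_intros) auto
      fix s assume "s \<in> {0..x}"
      hence s: "s \<in> {0..1}" using x by auto
      show "(\<lambda>i. bloch_rhs n p1 P (z i) (D i) \<nu> s) \<longlonglongrightarrow> bloch_rhs n p1 P z0 E \<nu> s" by (rule rhs[OF \<nu> s])
      fix i
      show "norm (bloch_rhs n p1 P (z i) (D i) \<nu> s) \<le> coeff_bound n p1 P R s * M"
        using bloch_rhs_bound[OF R[of i] \<nu>, of "D i" s] coeff_bound_ge[OF R0, of s]
          mult_left_mono[OF jM[OF s, of i], of "coeff_bound n p1 P R s"] by linarith
    qed simp
    hence "(\<lambda>i. D i \<nu> 0 + (LINT s:{0..x}|lebesgue. bloch_rhs n p1 P (z i) (D i) \<nu> s))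
        \<longlonglongrightarrow> E \<nu> 0 + (LINT s:{0..x}|lebesgue. bloch_rhs n p1 P z0 E \<nu> s)"
      using Ep[OF \<nu>, of 0] by (intro tendsto_add) auto
    moreover have "D i \<nu> 0 + (LINT s:{0..x}|lebesgue. bloch_rhs n p1 P (z i) (D i) \<nu> s) = D i \<nu> x" for i
      using D[of i] \<nu> x unfolding bloch_solution_def by metis
    ultimately show "(\<lambda>i. D i \<nu> x) \<longlonglongrightarrow> E \<nu> 0 + (LINT s:{0..x}|lebesgue. bloch_rhs n p1 P z0 E \<nu> s)" by simp
  qed
  hence "bloch_solution n p1 P z0 E" unfolding bloch_solution_def using Ec by blast
  thus thesis using that UE by blast
qed

end

section \<open>From the operator domain to integral equations\<close>

lemma vanishing_primitive:
  fixes g :: "real \<Rightarrow> 'a::euclidean_space"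
  assumes g: "continuous_on {0..1} g" and 0: "\<And>x. x \<in> {0..1} \<Longrightarrow> (LINT s:{0..x}|lebesgue. g s) = 0" and x: "x \<in> {0..1}"
  shows "g x = 0"
proof (rule vector_derivative_unique_within_closed_interval[where a = 0 and b = 1])
  have "integral {0..u} g = 0" if "u \<in> {0..1}" for u
    using 0[OF that] set_lebesgue_integral_eq_integral(2)[of "{0..u}" g]
      set_integrable_continuous[OF continuous_on_subset[OF g, of "{0..u}"]] that by simp
  thus "((\<lambda>_. 0) has_vector_derivative g x) (at x within cbox 0 1)"
    using has_vector_derivative_transform[OF x _ integral_has_vector_derivative[OF g x], of "\<lambda>_. 0"] by simp
qed (use x in \<open>auto intro: derivative_eq_intros\<close>)

text \<open>The way back from L2 to pointwise statements: an almost everywhere zero function has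
  zero primitive, and continuity permits differentiating it.\<close>

lemma continuous_AE_zero:
  fixes g :: "real \<Rightarrow> 'a::euclidean_space"
  assumes g: "continuous_on {0..1} g" and 0: "AE x\<in>{0..1} in lebesgue. g x = 0" and x: "x \<in> {0..1}"
  shows "g x = 0"
proof (rule vanishing_primitive[OF g _ x])
  fix x :: real assume x: "x \<in> {0..1}"
  have "AE s in lebesgue. indicator {0..x} s *\<^sub>R g s = 0"
    using 0 by eventually_elim (use x in \<open>auto simp: indicator_def\<close>)
  thus "(LINT s:{0..x}|lebesgue. g s) = 0" unfolding set_lebesgue_integral_def by (rule integral_eq_zero_AE)
qed

text \<open>Below the order n - 1 the integral identity is the fundamental theorem of calculus; at
  the order n - 1 it is the absolute continuity built into the domain.\<close>

lemma derivatives_up_toD: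
  fixes D :: "nat \<Rightarrow> real \<Rightarrow> complex ^ 'm::finite"
  assumes D: "derivatives_up_to n y D" and n: "n \<ge> 2" and \<nu>: "\<nu> < n"
  shows "continuous_on {0..1} (D \<nu>)"
    and "\<And>x. x \<in> {0..1} \<Longrightarrow> D \<nu> x = D \<nu> 0 + (LINT s:{0..x}|lebesgue. D (Suc \<nu>) s)"
proof -
  have d: "(D i has_vector_derivative D (Suc i) x) (at x within {0..1})" if "i < n - 1" "x \<in> {0..1}" for i x
    using D that by (auto simp: derivatives_up_to_def)
  have Dn: "set_integrable lebesgue {0..1} (D n)" and top: "\<And>x. x \<in> {0..1} \<Longrightarrow> D (n - 1) x = D (n - 1) 0 + (LINT s:{0..x}|lebesgue. D n s)"
    using D unfolding derivatives_up_to_def by blast+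
  have c: "continuous_on {0..1} (D i)" if "i < n" for i
  proof (cases "i < n - 1")
    case True show ?thesis by (rule continuous_on_vector_derivative[OF d[OF True]])
  next
    case False
    hence i: "i = n - 1" using that by simp
    have "continuous_on {0..1} (\<lambda>x. integral {0..x} (D n))"
      by (rule indefinite_integral_continuous_1[OF set_lebesgue_integral_eq_integral(1)[OF Dn]])
    hence "continuous_on {0..1} (\<lambda>x. D (n - 1) 0 + integral {0..x} (D n))" by (intro continuous_intros)
    moreover have "D (n - 1) 0 + integral {0..x} (D n) = D (n - 1) x" if "x \<in> {0..1}" for x
      using top[OF that] set_lebesgue_integral_eq_integral(2)[OF set_integrable_unit_subset[OF Dn, of x]] that by simp
    ultimately show ?thesis unfolding i by (rule continuous_on_eq)
  qed
  show "continuous_on {0..1} (D \<nu>)" by (rule c[OF \<nu>])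
  fix x :: real assume x: "x \<in> {0..1}"
  show "D \<nu> x = D \<nu> 0 + (LINT s:{0..x}|lebesgue. D (Suc \<nu>) s)"
  proof (cases "\<nu> < n - 1")
    case False
    hence "\<nu> = n - 1" using \<nu> by simp
    thus ?thesis using top[OF x] n by simp
  next
    case True
    have "(D (Suc \<nu>) has_integral D \<nu> x - D \<nu> 0) {0..x}"
      using x True by (intro fundamental_theorem_of_calculus)
        (auto intro: has_vector_derivative_within_subset[OF d])
    moreover have "set_integrable lebesgue {0..x} (D (Suc \<nu>))"
      using True x by (intro set_integrable_continuous continuous_on_subset[OF c]) auto
    ultimately show ?thesis by (simp add: set_lebesgue_integral_eq_integral has_integral_iff)
  qed
qed

lemma derivatives_up_to_basic:
  assumes "derivatives_up_to n y D"
  shows "\<And>x. x \<in> {0..1} \<Longrightarrow> D 0 x = y x"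
    and "\<And>i x. i < n - 1 \<Longrightarrow> x \<in> {0..1} \<Longrightarrow> (D i has_vector_derivative D (Suc i) x) (at x within {0..1})"
    and "set_integrable lebesgue {0..1} (D n)"
    and "\<And>x. x \<in> {0..1} \<Longrightarrow> D (n - 1) x = D (n - 1) 0 + (LINT s:{0..x}|lebesgue. D n s)"
  using assms unfolding derivatives_up_to_def by blast+

lemma uniform_limit_const_fun: "c \<longlonglongrightarrow> l \<Longrightarrow> uniform_limit S (\<lambda>i _. c i) (\<lambda>_. l) sequentially"
  by (rule uniform_limitI) (auto dest: tendstoD)

section \<open>Linearity of the Bloch operators; eigenfunctions as solutions of the system\<close>

context bloch_coefficients
begin

abbreviation bloch :: "real \<Rightarrow> 'm operator" where
  "bloch t \<equiv> bloch_operator n p1 P (of_real t)"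

lemma bloch_operator_scale:
  assumes "bloch t y w" shows "bloch t (\<lambda>x. c *s y x) (\<lambda>x. c *s w x)"
proof -
  obtain D where L: "L2_on {0..1} y" "L2_on {0..1} w" and D: "derivatives_up_to n y D"
    and bc: "\<forall>\<nu><n. D \<nu> 1 = exp (\<i> * t) *s D \<nu> 0"
    and eq: "AE x\<in>{0..1} in lebesgue. w x = D n x + p1 x *s D (n - 1) x + (\<Sum>\<nu>=2..n. P \<nu> x *v D (n - \<nu>) x)"
    using assms unfolding bloch_operator_def by blast
  have bl: "bounded_linear ((*s) c :: complex ^ 'm \<Rightarrow> _)"
    by (rule bounded_bilinear.bounded_linear_right[OF bounded_bilinear_smult])
  have "derivatives_up_to n (\<lambda>x. c *s y x) (\<lambda>\<nu> x. c *s D \<nu> x)"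
    unfolding derivatives_up_to_def
  proof (intro conjI allI impI ballI)
    have Dn: "set_integrable lebesgue {0..1} (D n)" by (rule derivatives_up_to_basic[OF D])
    have si: "set_integrable lebesgue A (\<lambda>x. c *s D n x)" "(LINT x:A|lebesgue. c *s D n x) = c *s (LINT x:A|lebesgue. D n x)"
      if "set_integrable lebesgue A (D n)" for A
      using that integrable_bounded_linear[OF bl] integral_bounded_linear[OF bl]
      unfolding set_integrable_def set_lebesgue_integral_def
      by (auto simp: linear_scale[OF bounded_linear.linear[OF bl], symmetric])
    show "set_integrable lebesgue {0..1} (\<lambda>x. c *s D n x)" by (rule si(1)[OF Dn])
    fix x :: real assume x: "x \<in> {0..1}"
    show "c *s D (n - 1) x = c *s D (n - 1) 0 + (LINT s:{0..x}|lebesgue. c *s D n s)"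
    proof -
      have top: "D (n - 1) x = D (n - 1) 0 + (LINT s:{0..x}|lebesgue. D n s)"
        using D x unfolding derivatives_up_to_def by blast
      have i: "set_integrable lebesgue {0..x} (D n)" using x by (intro set_integrable_unit_subset[OF Dn]) auto
      show ?thesis unfolding si(2)[OF i] vector_add_ldistrib[symmetric] by (rule arg_cong[OF top])
    qed
  next
    fix i x assume "i < n - 1" "x \<in> {0..1::real}"
    thus "((\<lambda>x. c *s D i x) has_vector_derivative c *s D (Suc i) x) (at x within {0..1})"
      by (intro bounded_linear.has_vector_derivative[OF bl] derivatives_up_to_basic(2)[OF D])
  qed (simp add: derivatives_up_to_basic(1)[OF D])
  moreover have "\<forall>\<nu><n. c *s D \<nu> 1 = exp (\<i> * t) *s (c *s D \<nu> 0)"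
    using bc by (simp add: vector_smult_assoc mult.commute)
  moreover have "AE x\<in>{0..1} in lebesgue. c *s w x = c *s D n x + p1 x *s (c *s D (n - 1) x)
      + (\<Sum>\<nu>=2..n. P \<nu> x *v (c *s D (n - \<nu>) x))"
    using eq
  proof eventually_elim
    case (elim x)
    have "A *v (c *s d) = c *s (A *v d)" for A :: "complex ^ 'm ^ 'm" and d
      by (simp add: vec_eq_iff matrix_vector_mult_def sum_distrib_left mult_ac)
    with elim show ?case
      by (simp add: vector_add_ldistrib vector_smult_assoc mult.commute vec.scale_sum_right)
  qed
  ultimately show ?thesis using L unfolding bloch_operator_def
    by (intro conjI L2_on_scale[OF unit_interval_sets] exI[of _ "\<lambda>\<nu> x. c *s D \<nu> x"])
qed

lemma bloch_operator_add:
  assumes "bloch t y w" "bloch t y' w'" shows "bloch t (\<lambda>x. y x + y' x) (\<lambda>x. w x + w' x)"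
proof -
  obtain D where L: "L2_on {0..1} y" "L2_on {0..1} w" and D: "derivatives_up_to n y D"
    and bc: "\<forall>\<nu><n. D \<nu> 1 = exp (\<i> * t) *s D \<nu> 0"
    and eq: "AE x\<in>{0..1} in lebesgue. w x = D n x + p1 x *s D (n - 1) x + (\<Sum>\<nu>=2..n. P \<nu> x *v D (n - \<nu>) x)"
    using assms(1) unfolding bloch_operator_def by blast
  obtain D' where L': "L2_on {0..1} y'" "L2_on {0..1} w'" and D': "derivatives_up_to n y' D'"
    and bc': "\<forall>\<nu><n. D' \<nu> 1 = exp (\<i> * t) *s D' \<nu> 0"
    and eq': "AE x\<in>{0..1} in lebesgue. w' x = D' n x + p1 x *s D' (n - 1) x + (\<Sum>\<nu>=2..n. P \<nu> x *v D' (n - \<nu>) x)"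
    using assms(2) unfolding bloch_operator_def by blast
  have "derivatives_up_to n (\<lambda>x. y x + y' x) (\<lambda>\<nu> x. D \<nu> x + D' \<nu> x)"
    unfolding derivatives_up_to_def
  proof (intro conjI allI impI ballI)
    have Dn: "set_integrable lebesgue {0..1} (D n)" "set_integrable lebesgue {0..1} (D' n)"
      by (rule derivatives_up_to_basic[OF D] derivatives_up_to_basic[OF D'])+
    show "set_integrable lebesgue {0..1} (\<lambda>x. D n x + D' n x)" by (rule set_integral_add(1)[OF Dn])
    fix x :: real assume x: "x \<in> {0..1}"
    have "D (n - 1) x = D (n - 1) 0 + (LINT s:{0..x}|lebesgue. D n s)"
      "D' (n - 1) x = D' (n - 1) 0 + (LINT s:{0..x}|lebesgue. D' n s)"
      using D D' x unfolding derivatives_up_to_def by blast+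
    thus "D (n - 1) x + D' (n - 1) x = D (n - 1) 0 + D' (n - 1) 0 + (LINT s:{0..x}|lebesgue. D n s + D' n s)"
      using set_integral_add(2)[OF Dn[THEN set_integrable_unit_subset, of x]] x by simp
  qed (auto simp: derivatives_up_to_basic(1)[OF D] derivatives_up_to_basic(1)[OF D']
      intro!: has_vector_derivative_add derivatives_up_to_basic(2)[OF D] derivatives_up_to_basic(2)[OF D'])
  moreover have "\<forall>\<nu><n. D \<nu> 1 + D' \<nu> 1 = exp (\<i> * t) *s (D \<nu> 0 + D' \<nu> 0)"
    using bc bc' by (simp add: vector_add_ldistrib)
  moreover have "AE x\<in>{0..1} in lebesgue. w x + w' x = (D n x + D' n x) + p1 x *s (D (n - 1) x + D' (n - 1) x)
      + (\<Sum>\<nu>=2..n. P \<nu> x *v (D (n - \<nu>) x + D' (n - \<nu>) x))"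
    using eq eq' by eventually_elim (auto simp: vector_add_ldistrib matrix_vector_right_distrib sum.distrib)
  ultimately show ?thesis using L L' unfolding bloch_operator_def
    by (intro conjI L2_on_add[OF unit_interval_sets] exI[of _ "\<lambda>\<nu> x. D \<nu> x + D' \<nu> x"])
qed

lemma bloch_operator_lincomb:
  assumes "finite I" "\<And>i. i \<in> I \<Longrightarrow> bloch t (y i) (w i)"
  shows "bloch t (\<lambda>x. \<Sum>i\<in>I. c i *s y i x) (\<lambda>x. \<Sum>i\<in>I. c i *s w i x)"
  using assms
proof (induction I)
  case empty
  have "bloch t (\<lambda>_. 0) (\<lambda>_. 0)"
    unfolding bloch_operator_def derivatives_up_to_def by (auto intro!: exI[of _ "\<lambda>_ _. 0"] simp: set_integrable_def)
  thus ?case by simp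
next
  case (insert i I)
  thus ?case using bloch_operator_add[OF bloch_operator_scale] by simp
qed

lemma bloch_operator_continuous: "bloch t y w \<Longrightarrow> continuous_on {0..1} y"
proof -
  assume "bloch t y w"
  then obtain D where D: "derivatives_up_to n y D" unfolding bloch_operator_def by blast
  have "continuous_on {0..1} (D 0)" using derivatives_up_toD(1)[OF D n, of 0] n by simp
  thus ?thesis by (rule continuous_on_eq) (rule derivatives_up_to_basic(1)[OF D])
qed

text \<open>Single-valuedness of the graph at y = 0. All derivatives below n vanish one after the
  other, so \<open>w\<close> equals the n-th derivative almost everywhere and has zero primitive;
  continuity of \<open>w\<close> gives the pointwise claim.\<close>

lemma bloch_operator_zero:
  assumes T: "bloch t y w" and y: "\<And>x. x \<in> {0..1} \<Longrightarrow> y x = 0" and w: "continuous_on {0..1} w" and x: "x \<in> {0..1}"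
  shows "w x = 0"
proof -
  obtain D where D: "derivatives_up_to n y D"
    and eq: "AE x\<in>{0..1} in lebesgue. w x = D n x + p1 x *s D (n - 1) x + (\<Sum>\<nu>=2..n. P \<nu> x *v D (n - \<nu>) x)"
    using T unfolding bloch_operator_def by blast
  have D0: "\<forall>x\<in>{0..1}. D \<nu> x = 0" if "\<nu> < n" for \<nu>
    using that
  proof (induction \<nu>)
    case 0 show ?case using derivatives_up_to_basic(1)[OF D] y by simp
  next
    case (Suc \<nu>)
    have "(LINT s:{0..x}|lebesgue. D (Suc \<nu>) s) = 0" if "x \<in> {0..1}" for x
      using derivatives_up_toD(2)[OF D n, of \<nu> x] Suc that by simp
    thus ?case using vanishing_primitive derivatives_up_toD(1)[OF D n Suc.prems] by blast
  qed
  have "(LINT s:{0..x}|lebesgue. w s) = 0" if x: "x \<in> {0..1}" for x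
  proof -
    have "AE x\<in>{0..1} in lebesgue. w x = D n x"
      using eq
    proof eventually_elim
      case (elim x)
      have "P \<nu> x *v D (n - \<nu>) x = 0" if "x \<in> {0..1}" "\<nu> \<in> {2..n}" for \<nu>
        using D0[of "n - \<nu>"] that by simp
      with elim D0[of "n - 1"] n show ?case by simp
    qed
    hence ae: "AE s in lebesgue. indicator {0..x} s *\<^sub>R w s = indicator {0..x} s *\<^sub>R D n s"
      by eventually_elim (use x in \<open>auto simp: indicator_def\<close>)
    have "set_integrable lebesgue {0..1} (D n)" by (rule derivatives_up_to_basic[OF D])
    hence "set_integrable lebesgue {0..x} (D n)" by (rule set_integrable_unit_subset) (use x in auto)
    moreover have "set_integrable lebesgue {0..x} w"
      using x by (intro set_integrable_continuous continuous_on_subset[OF w]) auto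
    ultimately have "(LINT s:{0..x}|lebesgue. w s) = (LINT s:{0..x}|lebesgue. D n s)"
      unfolding set_lebesgue_integral_def set_integrable_def
      by (intro integral_cong_AE ae) (auto dest: borel_measurable_integrable)
    also have "\<dots> = 0"
      using derivatives_up_toD(2)[OF D n, of "n - 1" x] D0[of "n - 1"] n x by simp
    finally show ?thesis .
  qed
  thus ?thesis by (rule vanishing_primitive[OF w _ x])
qed

text \<open>The equation in the domain holds almost everywhere, which is enough under the integral
  sign.\<close>

lemma eigenfunction_imp_solution:
  assumes "bloch t y (\<lambda>x. z *s y x)"
  obtains D where "bloch_solution n p1 P z D" "\<And>x. x \<in> {0..1} \<Longrightarrow> D 0 x = y x"
    "\<And>\<nu>. \<nu> < n \<Longrightarrow> D \<nu> 1 = exp (\<i> * t) *s D \<nu> 0"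
proof -
  obtain D where D: "derivatives_up_to n y D"
    and bc: "\<forall>\<nu><n. D \<nu> 1 = exp (\<i> * t) *s D \<nu> 0"
    and eq: "AE x\<in>{0..1} in lebesgue. z *s y x = D n x + p1 x *s D (n - 1) x + (\<Sum>\<nu>=2..n. P \<nu> x *v D (n - \<nu>) x)"
    using assms unfolding bloch_operator_def by blast
  have D0: "\<And>x. x \<in> {0..1} \<Longrightarrow> D 0 x = y x" by (rule derivatives_up_to_basic[OF D])
  note Dc = derivatives_up_toD(1)[OF D n]
  have "bloch_solution n p1 P z D"
    unfolding bloch_solution_def
  proof (intro allI impI conjI ballI)
    fix \<nu> and x :: real assume \<nu>: "\<nu> < n" and x: "x \<in> {0..1}"
    have "(LINT s:{0..x}|lebesgue. D (Suc \<nu>) s) = (LINT s:{0..x}|lebesgue. bloch_rhs n p1 P z D \<nu> s)"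
    proof (cases "\<nu> = n - 1")
      case False thus ?thesis by (simp add: bloch_rhs_def)
    next
      case True
      have ae: "AE s in lebesgue. indicator {0..x} s *\<^sub>R D n s = indicator {0..x} s *\<^sub>R bloch_rhs n p1 P z D (n - 1) s"
        using eq
      proof eventually_elim
        case (elim s)
        show ?case using elim D0[of s] x
          by (cases "s \<in> {0..x}") (auto simp: bloch_rhs_def algebra_simps)
      qed
      have "set_integrable lebesgue {0..1} (D n)" by (rule derivatives_up_to_basic[OF D])
      hence 1: "set_integrable lebesgue {0..x} (D n)" by (rule set_integrable_unit_subset) (use x in auto)
      have 2: "set_integrable lebesgue {0..x} (bloch_rhs n p1 P z D (n - 1))"
        using x n by (intro set_integrable_unit_subset[OF bloch_rhs_integrable] Dc) auto
      show ?thesis using 1 2 True n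
        unfolding set_lebesgue_integral_def set_integrable_def
        by (simp, intro integral_cong_AE) (use ae in \<open>auto dest: borel_measurable_integrable\<close>)
    qed
    thus "D \<nu> x = D \<nu> 0 + (LINT s:{0..x}|lebesgue. bloch_rhs n p1 P z D \<nu> s)"
      using derivatives_up_toD(2)[OF D n \<nu> x] by simp
  qed (rule Dc)
  thus thesis using that D0 bc by blast
qed

lemma solution_imp_eigenfunction:
  assumes D: "bloch_solution n p1 P z D" and bc: "\<And>\<nu>. \<nu> < n \<Longrightarrow> D \<nu> 1 = exp (\<i> * t) *s D \<nu> 0"
  shows "bloch t (D 0) (\<lambda>x. z *s D 0 x)"
proof -
  \<comment> \<open>\<open>bloch_solution\<close> constrains the orders below n only; the slot n
    receives the value that the equation assigns to the highest derivative.\<close>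
  define E where "E = D(n := bloch_rhs n p1 P z D (n - 1))"
  have Dc: "continuous_on {0..1} (D \<nu>)" if "\<nu> < n" for \<nu> using D that by (simp add: bloch_solution_def)
  have int: "D \<nu> x = D \<nu> 0 + (LINT s:{0..x}|lebesgue. bloch_rhs n p1 P z D \<nu> s)" if "\<nu> < n" "x \<in> {0..1}" for \<nu> x
    using D that unfolding bloch_solution_def by blast
  have E: "E \<nu> = D \<nu>" if "\<nu> < n" for \<nu> using that by (simp add: E_def)
  have "derivatives_up_to n (D 0) E"
    unfolding derivatives_up_to_def
  proof (intro conjI allI impI ballI)
    show "set_integrable lebesgue {0..1} (E n)"
      using n by (simp add: E_def bloch_rhs_integrable Dc)
    fix x :: real assume x: "x \<in> {0..1}"
    show "E (n - 1) x = E (n - 1) 0 + (LINT s:{0..x}|lebesgue. E n s)"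
    proof -
      have "n - 1 \<noteq> n" "n - 1 < n" using n by auto
      thus ?thesis using int[of "n - 1" x] x by (simp add: E_def)
    qed
  next
    fix i and x :: real assume i: "i < n - 1" and x: "x \<in> {0..1}"
    have c: "continuous_on {0..1} (D (Suc i))" using i by (intro Dc) auto
    have der: "((\<lambda>u. D i 0 + integral {0..u} (D (Suc i))) has_vector_derivative D (Suc i) x) (at x within {0..1})"
      using has_vector_derivative_add[OF has_vector_derivative_const integral_has_vector_derivative[OF c x]] by simp
    have eq: "D i u = D i 0 + integral {0..u} (D (Suc i))" if u: "u \<in> {0..1}" for u
    proof -
      have "set_integrable lebesgue {0..u} (D (Suc i))"
        using u by (intro set_integrable_continuous continuous_on_subset[OF c]) auto
      thus ?thesis using int[of i u] u i by (simp add: bloch_rhs_def set_lebesgue_integral_eq_integral)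
    qed
    have "(D i has_vector_derivative D (Suc i) x) (at x within {0..1})"
      by (rule has_vector_derivative_transform[OF x eq der])
    moreover have "i < n" "Suc i < n" using i by auto
    ultimately show "(E i has_vector_derivative E (Suc i) x) (at x within {0..1})" by (simp only: E)
  qed (use n in \<open>auto simp: E\<close>)
  moreover have "\<forall>\<nu><n. E \<nu> 1 = exp (\<i> * t) *s E \<nu> 0" using bc by (simp add: E)
  moreover have "z *s D 0 x = E n x + p1 x *s E (n - 1) x + (\<Sum>\<nu>=2..n. P \<nu> x *v E (n - \<nu>) x)" for x
  proof -
    have "(\<Sum>\<nu>=2..n. P \<nu> x *v E (n - \<nu>) x) = (\<Sum>\<nu>=2..n. P \<nu> x *v D (n - \<nu>) x)"
      using n by (intro sum.cong refl) (auto simp: E)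
    moreover have "E (n - 1) = D (n - 1)" using n by (intro E) auto
    moreover have "E n = bloch_rhs n p1 P z D (n - 1)" by (simp add: E_def)
    ultimately show ?thesis by (simp add: bloch_rhs_def)
  qed
  moreover have "L2_on {0..1} (D 0)" using Dc n by (intro L2_on_continuous) auto
  ultimately show ?thesis unfolding bloch_operator_def
    by (intro conjI L2_on_scale[OF unit_interval_sets] exI[of _ E] AE_I2) auto
qed

lemma bloch_solution_scale:
  assumes D: "bloch_solution n p1 P z D"
  shows "bloch_solution n p1 P z (\<lambda>\<nu> x. c *s D \<nu> x)"
  unfolding bloch_solution_def
proof (intro allI impI conjI ballI)
  have Dc: "continuous_on {0..1} (D \<nu>)" if "\<nu> < n" for \<nu> using D that by (simp add: bloch_solution_def)
  thus "continuous_on {0..1} (\<lambda>x. c *s D \<nu> x)" if "\<nu> < n" for \<nu> using that by (intro continuous_intros)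
  have bl: "bounded_linear ((*s) c :: complex ^ 'm \<Rightarrow> _)"
    by (rule bounded_bilinear.bounded_linear_right[OF bounded_bilinear_smult])
  fix \<nu> and x :: real assume \<nu>: "\<nu> < n" and x: "x \<in> {0..1}"
  have mv: "A *v (c *s d) = c *s (A *v d)" for A :: "complex ^ 'm ^ 'm" and d
    by (simp add: vec_eq_iff matrix_vector_mult_def sum_distrib_left mult_ac)
  have r: "bloch_rhs n p1 P z (\<lambda>\<nu> x. c *s D \<nu> x) \<nu> s = c *s bloch_rhs n p1 P z D \<nu> s" for s
    by (simp add: bloch_rhs_def mv vector_ssub_ldistrib vector_smult_assoc mult.commute vec.scale_sum_right)
  have "set_integrable lebesgue {0..x} (bloch_rhs n p1 P z D \<nu>)"
    using x by (intro set_integrable_unit_subset[OF bloch_rhs_integrable] Dc \<nu>) auto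
  hence "(LINT s:{0..x}|lebesgue. c *s bloch_rhs n p1 P z D \<nu> s) = c *s (LINT s:{0..x}|lebesgue. bloch_rhs n p1 P z D \<nu> s)"
    using integral_bounded_linear[OF bl] unfolding set_integrable_def set_lebesgue_integral_def
    by (auto simp: linear_scale[OF bounded_linear.linear[OF bl], symmetric])
  moreover have "D \<nu> x = D \<nu> 0 + (LINT s:{0..x}|lebesgue. bloch_rhs n p1 P z D \<nu> s)"
    using D \<nu> x unfolding bloch_solution_def by blast
  ultimately show "c *s D \<nu> x = c *s D \<nu> 0 + (LINT s:{0..x}|lebesgue. bloch_rhs n p1 P z (\<lambda>\<nu> x. c *s D \<nu> x) \<nu> s)"
    unfolding r by (simp add: vector_add_ldistrib)
qed

lemma bloch_solution_jet_zero:
  assumes D: "bloch_solution n p1 P z D" and 0: "\<And>x. x \<in> {0..1} \<Longrightarrow> D 0 x = 0" and \<nu>: "\<nu> < n"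
  shows "\<forall>x\<in>{0..1}. D \<nu> x = 0"
  using \<nu>
proof (induction \<nu>)
  case (Suc \<nu>)
  have "(LINT s:{0..x}|lebesgue. D (Suc \<nu>) s) = 0" if x: "x \<in> {0..1}" for x
  proof -
    have "D \<nu> x = D \<nu> 0 + (LINT s:{0..x}|lebesgue. bloch_rhs n p1 P z D \<nu> s)"
      using D Suc.prems x unfolding bloch_solution_def by (meson Suc_lessD)
    moreover have "\<nu> \<noteq> n - 1" using Suc.prems by simp
    ultimately show ?thesis using Suc x by (simp add: bloch_rhs_def del: One_nat_def)
  qed
  thus ?case using vanishing_primitive bloch_solution_continuous[OF D Suc.prems] by blast
qed (use 0 in auto)

text \<open>Gronwall against the zero solution. In particular a solution with vanishing initial jet
  is zero.\<close>

lemma bloch_solution_bound: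
  assumes D: "bloch_solution n p1 P z D"
  shows "\<exists>G. \<forall>x\<in>{0..1}. jet_norm n D x \<le> G * jet_norm n D 0"
proof -
  obtain G where G: "\<And>u K x. continuous_on {0..1} u \<Longrightarrow> (\<And>x. x \<in> {0..1} \<Longrightarrow> 0 \<le> u x) \<Longrightarrow>
    (\<And>x. x \<in> {0..1} \<Longrightarrow> u x \<le> K + (LINT s:{0..x}|lebesgue. coeff_bound n p1 P (cmod z) s * u s)) \<Longrightarrow> x \<in> {0..1} \<Longrightarrow> u x \<le> G * K"
  proof (rule Gronwall_L1[OF coeff_bound_integrable[of "cmod z"]])
    show "0 \<le> coeff_bound n p1 P (cmod z) x" for x using coeff_bound_ge[of "cmod z" x] by simp
  qed blast
  have c: "continuous_on {0..1} (jet_norm n D)"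
    by (intro continuous_on_jet_norm bloch_solution_continuous[OF D])
  have ineq: "jet_norm n D x \<le> jet_norm n D 0 + (LINT s:{0..x}|lebesgue. coeff_bound n p1 P (cmod z) s * jet_norm n D s)"
    if "x \<in> {0..1}" for x
    using bloch_solution_diff_ineq[OF D bloch_solution_zero[of z] order_refl _ that, of 0] by simp
  show ?thesis by (intro exI[of _ G] ballI G[OF c _ ineq]) auto
qed

text \<open>Norm 1 in L2 is no direct bound on the initial jets, which
  \<open>bloch_solution_compact\<close> requires to converge. The solutions are therefore rescaled
  to initial jets of norm 1, a convergent subsequence is chosen, and the limit is normalised in L2
  again.\<close>

lemma normalized_eigenfunction_compact:
  assumes y: "\<And>i. normalized_eigenfunction (bloch (t i)) (z i) (y i)" and t: "t \<longlonglongrightarrow> t0" and z: "z \<longlonglongrightarrow> z0"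
  obtains r y0 where "strict_mono r" "normalized_eigenfunction (bloch t0) z0 y0"
    "uniform_limit {0..1} (\<lambda>i. y (r i)) y0 sequentially"
proof -
  have "\<exists>D. bloch_solution n p1 P (z i) D \<and> (\<forall>x\<in>{0..1}. D 0 x = y i x) \<and>
      (\<forall>\<nu><n. D \<nu> 1 = exp (\<i> * t i) *s D \<nu> 0)" for i
    using y[of i] eigenfunction_imp_solution[of "t i" "y i" "z i"]
    unfolding normalized_eigenfunction_def eigenfunction_def by metis
  then obtain D where D: "\<And>i. bloch_solution n p1 P (z i) (D i)" and Dy: "\<And>i x. x \<in> {0..1} \<Longrightarrow> D i 0 x = y i x"
    and bc: "\<And>i \<nu>. \<nu> < n \<Longrightarrow> D i \<nu> 1 = exp (\<i> * t i) *s D i \<nu> 0" by metis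
  have y1: "L2_norm {0..1} (y i) = 1" for i using y[of i] by (simp add: normalized_eigenfunction_def)
  have Dc: "continuous_on {0..1} (D i \<nu>)" if "\<nu> < n" for i \<nu> by (rule bloch_solution_continuous[OF D that])
  define s where "s i = jet_norm n (D i) 0" for i
  have s: "0 < s i" for i
  proof (rule ccontr)
    assume "\<not> 0 < s i"
    hence "s i = 0" using jet_norm_nonneg[of n "D i" 0] by (simp add: s_def)
    moreover obtain G where "\<And>x. x \<in> {0..1} \<Longrightarrow> jet_norm n (D i) x \<le> G * jet_norm n (D i) 0"
      using bloch_solution_bound[OF D[of i]] by blast
    ultimately have "jet_norm n (D i) x \<le> 0" if "x \<in> {0..1}" for x using that by (simp add: s_def)
    hence "norm (D i 0 x) \<le> 0" if "x \<in> {0..1}" for x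
      using n that by (intro order_trans[OF norm_le_jet_norm[of 0 n]]) auto
    hence "y i x = 0" if "x \<in> {0..1}" for x using Dy[OF that, of i] that by simp
    hence "L2_norm {0..1} (y i) = L2_norm {0..1} (\<lambda>_. 0 :: complex ^ 'm)" by (rule L2_norm_cong[OF unit_interval_sets])
    with y1[of i] show False by simp
  qed
  define E where "E i = (\<lambda>\<nu> x. of_real (1 / s i) *s D i \<nu> x)" for i
  have E: "bloch_solution n p1 P (z i) (E i)" for i unfolding E_def by (rule bloch_solution_scale[OF D])
  have jE: "jet_norm n (E i) 0 = 1" for i
  proof -
    have "jet_norm n (E i) 0 = cmod (of_real (1 / s i)) * s i"
      by (simp only: E_def s_def jet_norm_def norm_smult_vec sum_distrib_left)
    thus ?thesis using s[of i] by (simp add: norm_divide)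
  qed
  have "bounded (range (\<lambda>i. E i \<nu> 0))" if "\<nu> < n" for \<nu>
    using norm_le_jet_norm[OF that, of "E _" 0] jE by (auto simp: bounded_iff intro!: exI[of _ 1])
  from finite_family_convergent_subseq[of "{..<n}" "\<lambda>\<nu> i. E i \<nu> 0", OF _ this]
  obtain r where r: "strict_mono r" and conv: "\<And>\<nu>. \<nu> < n \<Longrightarrow> convergent (\<lambda>i. E (r i) \<nu> 0)" by (auto simp: o_def)
  have zr: "(\<lambda>i. z (r i)) \<longlonglongrightarrow> z0" using LIMSEQ_subseq_LIMSEQ[OF z r] by (simp add: o_def)
  have tr: "(\<lambda>i. t (r i)) \<longlonglongrightarrow> t0" using LIMSEQ_subseq_LIMSEQ[OF t r] by (simp add: o_def)
  obtain H where H: "bloch_solution n p1 P z0 H" and UH: "\<And>\<nu>. \<nu> < n \<Longrightarrow> uniform_limit {0..1} (\<lambda>i. E (r i) \<nu>) (H \<nu>) sequentially"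
    using bloch_solution_compact[of "\<lambda>i. z (r i)" "\<lambda>i. E (r i)", OF E zr conv] by metis
  have Hp: "(\<lambda>i. E (r i) \<nu> x) \<longlonglongrightarrow> H \<nu> x" if "\<nu> < n" "x \<in> {0..1}" for \<nu> x
    by (rule tendsto_uniform_limitI[OF UH[OF that(1)] that(2)])
  have bcH: "H \<nu> 1 = exp (\<i> * t0) *s H \<nu> 0" if "\<nu> < n" for \<nu>
  proof (rule LIMSEQ_unique)
    show "(\<lambda>i. E (r i) \<nu> 1) \<longlonglongrightarrow> H \<nu> 1" using Hp[OF that] by simp
    have "(\<lambda>i. exp (\<i> * t (r i)) *s E (r i) \<nu> 0) \<longlonglongrightarrow> exp (\<i> * t0) *s H \<nu> 0"
      by (intro bounded_bilinear.tendsto[OF bounded_bilinear_smult] tendsto_intros tr Hp that) auto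
    moreover have "E i \<nu> 1 = exp (\<i> * t i) *s E i \<nu> 0" for i
      using bc[OF that, of i] by (simp add: E_def vector_smult_assoc mult.commute)
    ultimately show "(\<lambda>i. E (r i) \<nu> 1) \<longlonglongrightarrow> exp (\<i> * t0) *s H \<nu> 0" by simp
  qed
  have Hc: "continuous_on {0..1} (H \<nu>)" if "\<nu> < n" for \<nu> by (rule bloch_solution_continuous[OF H that])
  define l where "l = L2_norm {0..1} (H 0)"
  have LH: "L2_on {0..1} (H 0)" using Hc n by (intro L2_on_continuous) auto
  \<comment> \<open>The limit keeps an initial jet of norm 1. If it vanished in L2 it would vanish
    identically, together with its jet.\<close>
  have "l \<noteq> 0"
  proof
    assume "l = 0"
    hence "AE x\<in>{0..1} in lebesgue. H 0 x = 0" using LH L2_norm_eq_0_iff[OF unit_interval_sets LH] by (simp add: l_def)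
    hence "H 0 x = 0" if "x \<in> {0..1}" for x using continuous_AE_zero[OF Hc[of 0] _ that] n by simp
    from bloch_solution_jet_zero[OF H this] have "jet_norm n H 0 = 0" by (simp add: jet_norm_def)
    moreover have "(\<lambda>i. jet_norm n (E (r i)) 0) \<longlonglongrightarrow> jet_norm n H 0"
      unfolding jet_norm_def by (intro tendsto_sum tendsto_norm Hp) auto
    ultimately show False using jE by (simp add: LIMSEQ_const_iff)
  qed
  moreover have "0 \<le> l" unfolding l_def by (rule L2_norm_nonneg[OF unit_interval_sets])
  ultimately have l: "0 < l" by simp
  have LE: "L2_on {0..1} (E i 0)" for i using bloch_solution_continuous[OF E] n by (intro L2_on_continuous) auto
  have nE: "L2_norm {0..1} (E i 0) = 1 / s i" for i
  proof -
    have "L2_norm {0..1} (E i 0) = cmod (of_real (1 / s i)) * L2_norm {0..1} (D i 0)"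
      unfolding E_def by (rule L2_norm_scale[OF unit_interval_sets])
    also have "L2_norm {0..1} (D i 0) = 1" using Dy y1[of i] L2_norm_cong[OF unit_interval_sets, of "D i 0" "y i"] by simp
    finally show ?thesis using s[of i] by (simp add: norm_divide)
  qed
  have "(\<lambda>i. L2_norm {0..1} (E (r i) 0)) \<longlonglongrightarrow> l"
  proof (rule LIMSEQ_I)
    fix e :: real assume e: "0 < e"
    have "0 < n" using n by simp
    from uniform_limitD[OF UH[OF this] half_gt_zero[OF e]]
    obtain N where N: "\<And>i x. i \<ge> N \<Longrightarrow> x \<in> {0..1} \<Longrightarrow> dist (E (r i) 0 x) (H 0 x) < e / 2"
      unfolding eventually_sequentially by blast
    have "norm (L2_norm {0..1} (E (r i) 0) - l) < e" if i: "i \<ge> N" for i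
    proof -
      have d: "L2_on {0..1} (\<lambda>x. E (r i) 0 x - H 0 x)" by (intro L2_on_diff unit_interval_sets LE LH)
      have d': "L2_on {0..1} (\<lambda>x. H 0 x - E (r i) 0 x)" by (intro L2_on_diff unit_interval_sets LE LH)
      have "L2_norm {0..1} (\<lambda>x. E (r i) 0 x - H 0 x) \<le> e / 2" "L2_norm {0..1} (\<lambda>x. H 0 x - E (r i) 0 x) \<le> e / 2"
      proof -
        have "norm (E (r i) 0 x - H 0 x) \<le> e / 2" "norm (H 0 x - E (r i) 0 x) \<le> e / 2" if "x \<in> {0..1}" for x
          using N[OF i that] by (simp_all add: dist_norm norm_minus_commute)
        thus "L2_norm {0..1} (\<lambda>x. E (r i) 0 x - H 0 x) \<le> e / 2" "L2_norm {0..1} (\<lambda>x. H 0 x - E (r i) 0 x) \<le> e / 2"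
          using e d d' by (intro L2_norm_le_bound; simp)+
      qed
      moreover have "L2_norm {0..1} (E (r i) 0) \<le> L2_norm {0..1} (\<lambda>x. E (r i) 0 x - H 0 x) + l"
        using L2_norm_triangle[OF unit_interval_sets d LH] by (simp add: l_def)
      moreover have "l \<le> L2_norm {0..1} (\<lambda>x. H 0 x - E (r i) 0 x) + L2_norm {0..1} (E (r i) 0)"
        using L2_norm_triangle[OF unit_interval_sets d' LE, of "r i"] by (simp add: l_def)
      ultimately show ?thesis using e by (simp add: abs_if) 
    qed
    thus "\<exists>N. \<forall>i\<ge>N. norm (L2_norm {0..1} (E (r i) 0) - l) < e" by blast
  qed
  hence "(\<lambda>i. inverse (L2_norm {0..1} (E (r i) 0))) \<longlonglongrightarrow> inverse l" using l by (intro tendsto_inverse) auto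
  \<comment> \<open>The L2 norm of \<open>E i 0\<close> is 1 / s i, so convergence of norms to l > 0
    is convergence of the scaling factors, and undoing the scaling keeps the uniform limit.\<close>
  hence sl: "(\<lambda>i. complex_of_real (s (r i))) \<longlonglongrightarrow> of_real (1 / l)"
    unfolding nE by (intro tendsto_of_real) (simp add: inverse_eq_divide)
  define y0 where "y0 x = of_real (1 / l) *s H 0 x" for x
  have "uniform_limit {0..1} (\<lambda>i x. of_real (s (r i)) *s E (r i) 0 x) (\<lambda>x. of_real (1 / l) *s H 0 x) sequentially"
  proof (rule bounded_bilinear.bounded_uniform_limit[OF bounded_bilinear_smult uniform_limit_const_fun[OF sl]])
    show "uniform_limit {0..1} (\<lambda>i. E (r i) 0) (H 0) sequentially" using UH n by simp
    show "bounded (H 0 ` {0..1})" using Hc[of 0] n by (intro compact_imp_bounded compact_continuous_image) auto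
  qed (auto intro!: finite_imp_bounded finite_imageI simp: image_constant_conv)
  moreover have "of_real (s i) *s E i 0 x = y i x" if "x \<in> {0..1}" for i x
    using s[of i] Dy[OF that, of i] by (simp add: E_def vector_smult_assoc)
  ultimately have u: "uniform_limit {0..1} (\<lambda>i. y (r i)) y0 sequentially"
    unfolding y0_def[abs_def] by (elim uniform_limit_cong'[THEN iffD1, rotated -1]) auto
  have "bloch t0 y0 (\<lambda>x. z0 *s y0 x)"
    using solution_imp_eigenfunction[OF bloch_solution_scale[OF H, of "of_real (1 / l)"], of t0] bcH
    by (simp add: y0_def[abs_def] vector_smult_assoc mult.commute)
  moreover have "L2_norm {0..1} y0 = 1"
    unfolding y0_def[abs_def] L2_norm_scale[OF unit_interval_sets] using l by (simp add: l_def[symmetric] norm_divide)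
  ultimately have "normalized_eigenfunction (bloch t0) z0 y0"
    by (simp add: normalized_eigenfunction_def eigenfunction_def)
  with r u that show thesis by blast
qed

end

section \<open>Perturbation of a Riesz basis\<close>

text \<open>Gaussian elimination: a pivot \<open>A i q\<close> removes one equation together with
  one unknown. This is the only linear algebra behind the dimension counts.\<close>

lemma underdetermined_system:
  fixes A :: "'i \<Rightarrow> 'v \<Rightarrow> 'a::field"
  assumes "finite I" "finite V" "card I < card V"
  shows "\<exists>d. (\<exists>p\<in>V. d p \<noteq> 0) \<and> (\<forall>i\<in>I. (\<Sum>p\<in>V. d p * A i p) = 0)"
  using assms
proof (induction I arbitrary: V A)
  case empty
  then obtain p where "p \<in> V" by fastforce
  thus ?case by (intro exI[of _ "\<lambda>_. 1"]) auto
next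
  case (insert i I)
  show ?case
  proof (cases "\<forall>p\<in>V. A i p = 0")
    case True
    obtain d where "\<exists>p\<in>V. d p \<noteq> 0" "\<forall>k\<in>I. (\<Sum>p\<in>V. d p * A k p) = 0"
      using insert.IH[of V A] insert.prems insert.hyps by auto
    with True show ?thesis by (intro exI[of _ d]) auto
  next
    case False
    then obtain q where q: "q \<in> V" "A i q \<noteq> 0" by blast
    let ?V = "V - {q}"
    have "card I < card ?V" using insert q by simp
    then obtain d where d: "\<exists>p\<in>?V. d p \<noteq> 0" "\<forall>k\<in>I. (\<Sum>p\<in>?V. d p * (A k p - A k q * A i p / A i q)) = 0"
      using insert.IH[of ?V "\<lambda>k p. A k p - A k q * A i p / A i q"] insert.prems by auto
    define s where "s = (\<Sum>p\<in>?V. d p * A i p)"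
    define d' where "d' = d(q := - s / A i q)"
    have split: "(\<Sum>p\<in>V. d' p * A k p) = - s / A i q * A k q + (\<Sum>p\<in>?V. d p * A k p)" for k
      using insert.prems(1) q by (subst sum.remove[of V q]) (auto simp: d'_def intro!: sum.cong)
    have "(\<Sum>p\<in>V. d' p * A k p) = 0" if k: "k \<in> insert i I" for k
    proof (cases "k = i")
      case True thus ?thesis using q by (simp add: split s_def)
    next
      case False
      have "(\<Sum>p\<in>?V. d p * A k p) = (\<Sum>p\<in>?V. d p * (A k p - A k q * A i p / A i q)) + A k q / A i q * s"
        by (simp add: s_def sum_distrib_left sum.distrib[symmetric] algebra_simps)
      with False k d(2) q show ?thesis by (simp add: split)
    qed
    moreover have "\<exists>p\<in>V. d' p \<noteq> 0" using d(1) by (auto simp: d'_def)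
    ultimately show ?thesis by blast
  qed
qed

text \<open>Nonnegative terms with bounded finite sums are summable; the Cauchy criterion then
  controls every finite set beyond some index.\<close>

lemma tail_sum_small:
  fixes a :: "nat \<Rightarrow> real"
  assumes a: "\<And>p. p > N \<Longrightarrow> 0 \<le> a p" and B: "\<And>S. finite S \<Longrightarrow> S \<subseteq> {N<..} \<Longrightarrow> sum a S \<le> B" and e: "0 < e"
  shows "\<exists>K\<ge>N. \<forall>S. finite S \<longrightarrow> S \<subseteq> {K<..} \<longrightarrow> sum a S \<le> e"
proof -
  define b where "b p = (if p > N then a p else 0)" for p
  have "summable b"
  proof (rule summableI_nonneg_bounded)
    show "0 \<le> b p" for p using a by (simp add: b_def)
    show "sum b {..<k} \<le> B" for k
    proof -
      have "sum b {..<k} = sum a ({..<k} \<inter> {N<..})" unfolding b_def by (simp add: sum.inter_restrict)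
      thus ?thesis using B[of "{..<k} \<inter> {N<..}"] by simp
    qed
  qed
  then obtain K where K: "\<And>m n. m \<ge> K \<Longrightarrow> norm (sum b {m..<n}) < e"
    using e unfolding summable_Cauchy by blast
  have "sum a S \<le> e" if S: "finite S" "S \<subseteq> {max K N<..}" for S
  proof -
    have "sum a S = sum b S" using S by (intro sum.cong) (auto simp: b_def)
    also have "\<dots> \<le> sum b {K..<Suc (Max (insert 0 S))}"
      using S by (intro sum_mono2) (auto simp: b_def a less_Suc_eq_le)
    also have "\<dots> \<le> e" using K[of K "Suc (Max (insert 0 S))"] by simp
    finally show ?thesis .
  qed
  thus ?thesis by (intro exI[of _ "max K N"]) auto
qed

lemmas unit_L2_add = L2_on_add[OF unit_interval_sets]
  and unit_L2_diff = L2_on_diff[OF unit_interval_sets]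
  and unit_L2_scale = L2_on_scale[OF unit_interval_sets]
  and unit_L2_lincomb = L2_on_lincomb[OF unit_interval_sets]
  and unit_inner_add_left = L2_inner_add_left[OF unit_interval_sets]
  and unit_inner_diff_left = L2_inner_diff_left[OF unit_interval_sets]
  and unit_inner_diff_right = L2_inner_diff_right[OF unit_interval_sets]
  and unit_inner_scale_left = L2_inner_scale_left[OF unit_interval_sets]
  and unit_inner_scale_right = L2_inner_scale_right[OF unit_interval_sets]
  and unit_inner_lincomb = L2_inner_lincomb_left[OF unit_interval_sets]
  and unit_inner_self = L2_inner_self[OF unit_interval_sets]
  and unit_inner_le = norm_L2_inner_le[OF unit_interval_sets]
  and unit_norm_triangle = L2_norm_triangle[OF unit_interval_sets]
  and unit_norm_triangle_diff = L2_norm_triangle_diff[OF unit_interval_sets]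
  and unit_norm_sum_le = L2_norm_sum_le[OF unit_interval_sets]
  and unit_norm_scale = L2_norm_scale[OF unit_interval_sets]
  and unit_norm_nonneg [simp] = L2_norm_nonneg[OF unit_interval_sets]
  and unit_norm_eq_0 = L2_norm_eq_0_iff[OF unit_interval_sets]

lemma square_add_le: "(a + b)\<^sup>2 \<le> 2 * a\<^sup>2 + 2 * (b :: real)\<^sup>2"
  using sum_squares_bound[of a b] by (simp add: power2_sum)

text \<open>The data of one fibre. \<open>phi\<close> is the model basis with coefficient
  functionals \<open>chi\<close>; \<open>psi\<close> and \<open>psi_star\<close> are eigenfunctions
  of the operator and of its adjoint. The functions \<open>X\<close> come from the asymptotics and
  are available beyond \<open>N1\<close> only, yet are biorthogonal to all \<open>psi p\<close>.
  Frame bounds are phrased through finite sums, which avoids any question of ordering series. That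
  \<open>psi p\<close> and \<open>psi_star p\<close> have nonzero pairing is a conclusion,
  \<open>inner_star_nonzero\<close>.\<close>

locale riesz_perturbation =
  fixes phi chi psi X psi_star :: "nat \<Rightarrow> real \<Rightarrow> complex ^ 'm::finite"
    and eps :: "nat \<Rightarrow> real" and N1 :: nat and B1 B2 B3 Es :: real
  assumes L2_phi: "\<And>p. p \<ge> 1 \<Longrightarrow> L2_on {0..1} (phi p)" and L2_chi: "\<And>p. p \<ge> 1 \<Longrightarrow> L2_on {0..1} (chi p)"
    and L2_psi: "\<And>p. p \<ge> 1 \<Longrightarrow> L2_on {0..1} (psi p)" and L2_X: "\<And>p. p > N1 \<Longrightarrow> L2_on {0..1} (X p)"
    and nonneg: "0 \<le> B1" "0 \<le> B2" "0 \<le> B3"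
    and upper: "\<And>f S. L2_on {0..1} f \<Longrightarrow> finite S \<Longrightarrow> S \<subseteq> {1..} \<Longrightarrow>
       (\<Sum>p\<in>S. (cmod (L2_inner {0..1} f (chi p)))\<^sup>2) \<le> B1 * (L2_norm {0..1} f)\<^sup>2"
    and lower: "\<And>f B. L2_on {0..1} f \<Longrightarrow>
       (\<And>S. finite S \<Longrightarrow> S \<subseteq> {1..} \<Longrightarrow> (\<Sum>p\<in>S. (cmod (L2_inner {0..1} f (chi p)))\<^sup>2) \<le> B) \<Longrightarrow>
       (L2_norm {0..1} f)\<^sup>2 \<le> B2 * B"
    and synthesis: "\<And>c S. finite S \<Longrightarrow> S \<subseteq> {1..} \<Longrightarrow>
       (L2_norm {0..1} (\<lambda>x. \<Sum>p\<in>S. c p *s phi p x))\<^sup>2 \<le> B3 * (\<Sum>p\<in>S. (cmod (c p))\<^sup>2)"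
    and err: "\<And>p. p > N1 \<Longrightarrow> L2_norm {0..1} (\<lambda>x. psi p x - phi p x) \<le> eps p"
       "\<And>p. p > N1 \<Longrightarrow> L2_norm {0..1} (\<lambda>x. X p x - chi p x) \<le> eps p"
    and eps: "\<And>S. finite S \<Longrightarrow> S \<subseteq> {N1<..} \<Longrightarrow> (\<Sum>p\<in>S. (eps p)\<^sup>2) \<le> Es"
    and biorth: "\<And>p q. p \<ge> 1 \<Longrightarrow> q > N1 \<Longrightarrow> L2_inner {0..1} (psi p) (X q) = (if p = q then 1 else 0)"
    and indep: "\<And>S d p. finite S \<Longrightarrow> S \<subseteq> {1..} \<Longrightarrow> L2_norm {0..1} (\<lambda>x. \<Sum>p\<in>S. d p *s psi p x) = 0 \<Longrightarrow>
       p \<in> S \<Longrightarrow> d p = 0"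
    and star: "\<And>p. p \<ge> 1 \<Longrightarrow> L2_on {0..1} (psi_star p)" "\<And>p. p \<ge> 1 \<Longrightarrow> L2_norm {0..1} (psi_star p) \<noteq> 0"
       "\<And>p q. p \<ge> 1 \<Longrightarrow> q \<ge> 1 \<Longrightarrow> p \<noteq> q \<Longrightarrow> L2_inner {0..1} (psi q) (psi_star p) = 0"
begin

abbreviation nrm :: "(real \<Rightarrow> complex ^ 'm) \<Rightarrow> real" where "nrm \<equiv> L2_norm {0..1}"
abbreviation ip :: "(real \<Rightarrow> complex ^ 'm) \<Rightarrow> (real \<Rightarrow> complex ^ 'm) \<Rightarrow> complex" where "ip \<equiv> L2_inner {0..1}"

lemma Es_nonneg: "0 \<le> Es"
  using eps[of "{}"] by simp

lemma ip_chi_X: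
  assumes f: "L2_on {0..1} f" and p: "p > N1"
  shows "(cmod (ip f (X p)))\<^sup>2 \<le> 2 * (cmod (ip f (chi p)))\<^sup>2 + 2 * ((nrm f)\<^sup>2 * (eps p)\<^sup>2)"
    and "(cmod (ip f (chi p)))\<^sup>2 \<le> 2 * (cmod (ip f (X p)))\<^sup>2 + 2 * ((nrm f)\<^sup>2 * (eps p)\<^sup>2)"
proof -
  have L: "L2_on {0..1} (X p)" "L2_on {0..1} (chi p)" "L2_on {0..1} (\<lambda>x. X p x - chi p x)"
    using L2_X[OF p] L2_chi[of p] p by (auto intro: unit_L2_diff)
  have "cmod (ip f (X p) - ip f (chi p)) \<le> nrm f * nrm (\<lambda>x. X p x - chi p x)"
    using unit_inner_le[OF f L(3)] unit_inner_diff_right[OF L(1,2) f] by simp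
  also have "\<dots> \<le> nrm f * eps p" by (rule mult_left_mono[OF err(2)[OF p]]) simp
  finally have d: "cmod (ip f (X p) - ip f (chi p)) \<le> nrm f * eps p" .
  hence "cmod (ip f (X p)) \<le> cmod (ip f (chi p)) + nrm f * eps p" 
    using norm_triangle_sub[of "ip f (X p)" "ip f (chi p)"] by linarith
  hence "(cmod (ip f (X p)))\<^sup>2 \<le> (cmod (ip f (chi p)) + nrm f * eps p)\<^sup>2" by (intro power_mono) auto
  also note square_add_le
  finally show "(cmod (ip f (X p)))\<^sup>2 \<le> 2 * (cmod (ip f (chi p)))\<^sup>2 + 2 * ((nrm f)\<^sup>2 * (eps p)\<^sup>2)"
    by (simp add: power_mult_distrib)
  have "cmod (ip f (chi p)) \<le> cmod (ip f (X p)) + nrm f * eps p" 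
    using d norm_triangle_sub[of "ip f (chi p)" "ip f (X p)"] by (simp add: norm_minus_commute)
  hence "(cmod (ip f (chi p)))\<^sup>2 \<le> (cmod (ip f (X p)) + nrm f * eps p)\<^sup>2" by (intro power_mono) auto
  also note square_add_le
  finally show "(cmod (ip f (chi p)))\<^sup>2 \<le> 2 * (cmod (ip f (X p)))\<^sup>2 + 2 * ((nrm f)\<^sup>2 * (eps p)\<^sup>2)"
    by (simp add: power_mult_distrib)
qed

lemma tail_coefficients:
  assumes f: "L2_on {0..1} f" and S: "finite S" "S \<subseteq> {N1<..}"
  shows "(\<Sum>p\<in>S. (cmod (ip f (X p)))\<^sup>2) \<le> 2 * (B1 + Es) * (nrm f)\<^sup>2"
proof -
  have "(\<Sum>p\<in>S. (cmod (ip f (X p)))\<^sup>2) \<le> (\<Sum>p\<in>S. 2 * (cmod (ip f (chi p)))\<^sup>2 + 2 * ((nrm f)\<^sup>2 * (eps p)\<^sup>2))"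
    using S by (intro sum_mono ip_chi_X f) auto
  also have "\<dots> = 2 * (\<Sum>p\<in>S. (cmod (ip f (chi p)))\<^sup>2) + 2 * ((nrm f)\<^sup>2 * (\<Sum>p\<in>S. (eps p)\<^sup>2))"
    by (simp add: sum.distrib sum_distrib_left)
  also have "\<dots> \<le> 2 * (B1 * (nrm f)\<^sup>2) + 2 * ((nrm f)\<^sup>2 * Es)"
  proof -
    have "S \<subseteq> {1..}" using S by force
    thus ?thesis using upper[OF f S(1)] eps[OF S] by (intro add_mono mult_left_mono) auto
  qed
  finally show ?thesis by (simp add: algebra_simps)
qed

lemma tail_synthesis:
  assumes S: "finite S" "S \<subseteq> {N1<..}"
  shows "(nrm (\<lambda>x. \<Sum>p\<in>S. c p *s psi p x))\<^sup>2 \<le> 2 * (B3 + Es) * (\<Sum>p\<in>S. (cmod (c p))\<^sup>2)"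
proof -
  have L: "L2_on {0..1} (phi p)" "L2_on {0..1} (\<lambda>x. psi p x - phi p x)" if "p \<in> S" for p
    using that S by (auto intro!: unit_L2_diff L2_phi L2_psi)
  let ?a = "nrm (\<lambda>x. \<Sum>p\<in>S. c p *s phi p x)" and ?b = "\<Sum>p\<in>S. cmod (c p) * eps p"
  have "nrm (\<lambda>x. \<Sum>p\<in>S. c p *s psi p x)
      = nrm (\<lambda>x. (\<Sum>p\<in>S. c p *s phi p x) + (\<Sum>p\<in>S. c p *s (psi p x - phi p x)))"
    by (simp add: sum.distrib[symmetric] vector_add_ldistrib[symmetric])
  also have "\<dots> \<le> ?a + nrm (\<lambda>x. \<Sum>p\<in>S. c p *s (psi p x - phi p x))"
    by (intro unit_norm_triangle unit_L2_lincomb L)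
  also have "nrm (\<lambda>x. \<Sum>p\<in>S. c p *s (psi p x - phi p x)) \<le> (\<Sum>p\<in>S. nrm (\<lambda>x. c p *s (psi p x - phi p x)))"
    by (intro unit_norm_sum_le unit_L2_scale L)
  also have "\<dots> \<le> ?b"
    unfolding unit_norm_scale using S by (intro sum_mono mult_left_mono err) auto
  finally have "(nrm (\<lambda>x. \<Sum>p\<in>S. c p *s psi p x))\<^sup>2 \<le> (?a + ?b)\<^sup>2" by (intro power_mono) auto
  also note square_add_le
  also have "?b\<^sup>2 \<le> (\<Sum>p\<in>S. (cmod (c p))\<^sup>2) * (\<Sum>p\<in>S. (eps p)\<^sup>2)" by (rule Cauchy_Schwarz_ineq_sum)
  also have "\<dots> \<le> (\<Sum>p\<in>S. (cmod (c p))\<^sup>2) * Es" by (intro mult_left_mono eps S sum_nonneg) auto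
  also have "?a\<^sup>2 \<le> B3 * (\<Sum>p\<in>S. (cmod (c p))\<^sup>2)" using S by (intro synthesis) auto
  finally show ?thesis by (simp add: algebra_simps)
qed

text \<open>Analysis followed by synthesis; the factor is the square root of the product of the two
  constants 2 (B1 + Es) and 2 (B3 + Es). No datum of an individual eigenfunction enters it, whence
  uniformity over the fibres.\<close>

lemma tail_projection_bound:
  assumes f: "L2_on {0..1} f" and S: "finite S" "S \<subseteq> {N1<..}"
  shows "nrm (\<lambda>x. \<Sum>p\<in>S. ip f (X p) *s psi p x) \<le> 2 * sqrt ((B3 + Es) * (B1 + Es)) * nrm f"
proof (rule power2_le_imp_le)
  have "(nrm (\<lambda>x. \<Sum>p\<in>S. ip f (X p) *s psi p x))\<^sup>2 \<le> 2 * (B3 + Es) * (\<Sum>p\<in>S. (cmod (ip f (X p)))\<^sup>2)"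
    by (rule tail_synthesis[OF S])
  also have "\<dots> \<le> 2 * (B3 + Es) * (2 * (B1 + Es) * (nrm f)\<^sup>2)"
    using nonneg Es_nonneg by (intro mult_left_mono tail_coefficients f S) auto
  also have "\<dots> = (2 * sqrt ((B3 + Es) * (B1 + Es)) * nrm f)\<^sup>2"
    using nonneg Es_nonneg by (simp add: power_mult_distrib) (simp add: algebra_simps)
  finally show "(nrm (\<lambda>x. \<Sum>p\<in>S. ip f (X p) *s psi p x))\<^sup>2 \<le> (2 * sqrt ((B3 + Es) * (B1 + Es)) * nrm f)\<^sup>2" .
  show "0 \<le> 2 * sqrt ((B3 + Es) * (B1 + Es)) * nrm f" using nonneg Es_nonneg by simp
qed

lemma ex_cutoff: "\<exists>K\<ge>N1. \<forall>S. finite S \<longrightarrow> S \<subseteq> {K<..} \<longrightarrow> 4 * B2 * (\<Sum>p\<in>S. (eps p)\<^sup>2) \<le> 1"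
proof -
  obtain K where K: "K \<ge> N1" "\<And>S. finite S \<Longrightarrow> S \<subseteq> {K<..} \<Longrightarrow> (\<Sum>p\<in>S. (eps p)\<^sup>2) \<le> 1 / (4 * B2 + 1)"
    using tail_sum_small[of N1 "\<lambda>p. (eps p)\<^sup>2" Es "1 / (4 * B2 + 1)"] eps nonneg by auto
  have "4 * B2 * (\<Sum>p\<in>S. (eps p)\<^sup>2) \<le> 1" if "finite S" "S \<subseteq> {K<..}" for S
  proof -
    have "4 * B2 * (\<Sum>p\<in>S. (eps p)\<^sup>2) \<le> 4 * B2 * (1 / (4 * B2 + 1))"
      using nonneg K(2)[OF that] by (intro mult_left_mono) auto
    also have "\<dots> \<le> 1" using nonneg by (simp add: field_simps)
    finally show ?thesis .
  qed
  with K(1) show ?thesis by blast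
qed

text \<open>Beyond this index the perturbation is harmless for the lower frame bound:
  \<open>B2\<close> times 2 |g|^2 times the sum of eps^2 is at most |g|^2 / 2.\<close>

definition K0 :: nat where
  "K0 = (SOME K. K \<ge> N1 \<and> (\<forall>S. finite S \<longrightarrow> S \<subseteq> {K<..} \<longrightarrow> 4 * B2 * (\<Sum>p\<in>S. (eps p)\<^sup>2) \<le> 1))"

lemma K0: "K0 \<ge> N1" "\<And>S. finite S \<Longrightarrow> S \<subseteq> {K0<..} \<Longrightarrow> 4 * B2 * (\<Sum>p\<in>S. (eps p)\<^sup>2) \<le> 1"
  using someI_ex[OF ex_cutoff] unfolding K0_def[symmetric] by blast+

text \<open>When the first \<open>K0\<close> model coefficients vanish, only indices remain at which
  \<open>chi\<close> may be exchanged for \<open>X\<close>; the error is at most half of |g|^2 and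
  is absorbed on the left.\<close>

lemma lower_tail:
  assumes g: "L2_on {0..1} g" and head: "\<And>p. p \<in> {1..K0} \<Longrightarrow> ip g (chi p) = 0"
    and B: "\<And>S. finite S \<Longrightarrow> S \<subseteq> {K0<..} \<Longrightarrow> (\<Sum>p\<in>S. (cmod (ip g (X p)))\<^sup>2) \<le> B"
  shows "(nrm g)\<^sup>2 \<le> 4 * B2 * B"
proof (cases "B2 = 0")
  case True
  \<comment> \<open>For \<open>B2 = 0\<close> the cutoff carries no information, but the lower frame
    bound with any finite bound on the sums already forces norm 0.\<close>
  with lower[OF g upper[OF g]] show ?thesis by simp
next
  case False
  hence B2: "0 < B2" using nonneg by simp
  have "(nrm g)\<^sup>2 \<le> B2 * (2 * B + (nrm g)\<^sup>2 / (2 * B2))"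
  proof (rule lower[OF g])
    fix S :: "nat set" assume S: "finite S" "S \<subseteq> {1..}"
    let ?T = "S \<inter> {K0<..}"
    have T: "finite ?T" "?T \<subseteq> {K0<..}" using S by auto
    have "(\<Sum>p\<in>S. (cmod (ip g (chi p)))\<^sup>2) = (\<Sum>p\<in>?T. (cmod (ip g (chi p)))\<^sup>2)"
    proof (intro sum.mono_neutral_right ballI)
      fix p assume "p \<in> S - ?T"
      hence "p \<in> {1..K0}" using S by auto
      thus "(cmod (ip g (chi p)))\<^sup>2 = 0" by (simp add: head)
    qed (use S in auto)
    also have "\<dots> \<le> (\<Sum>p\<in>?T. 2 * (cmod (ip g (X p)))\<^sup>2 + 2 * ((nrm g)\<^sup>2 * (eps p)\<^sup>2))"
      using K0(1) by (intro sum_mono ip_chi_X g) auto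
    also have "\<dots> = 2 * (\<Sum>p\<in>?T. (cmod (ip g (X p)))\<^sup>2) + 2 * ((nrm g)\<^sup>2 * (\<Sum>p\<in>?T. (eps p)\<^sup>2))"
      by (simp add: sum.distrib sum_distrib_left)
    also have "\<dots> \<le> 2 * B + 2 * ((nrm g)\<^sup>2 * (1 / (4 * B2)))"
      using B[OF T] K0(2)[OF T] B2 by (intro add_mono mult_left_mono) (auto simp: field_simps)
    finally show "(\<Sum>p\<in>S. (cmod (ip g (chi p)))\<^sup>2) \<le> 2 * B + (nrm g)\<^sup>2 / (2 * B2)" by simp
  qed
  also have "\<dots> = 2 * B2 * B + (nrm g)\<^sup>2 / 2" using B2 by (simp add: field_simps)
  finally show ?thesis by simp
qed

text \<open>The dimension count. The remainder \<open>r\<close> left by the projections with K0 < p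
  \<le> K, together with \<open>psi 1\<close>, ..., \<open>psi K0\<close>, makes K0 + 1 elements,
  and some nontrivial combination \<open>g\<close> is annihilated by \<open>chi 1\<close>, ...,
  \<open>chi K0\<close>. Against \<open>X q\<close> with q > K0 only multiples of the coefficients
  of \<open>f\<close> with q > K survive in \<open>g\<close>, so \<open>lower_tail\<close> makes it
  small. Dividing by the coefficient of \<open>r\<close> gives the claim.\<close>

lemma approximation:
  assumes f: "L2_on {0..1} f" and e: "0 < e"
  shows "\<exists>K1\<ge>K0. \<forall>K\<ge>K1. \<exists>d. nrm (\<lambda>x. (f x - (\<Sum>p\<in>{K0<..K}. ip f (X p) *s psi p x)) - (\<Sum>p=1..K0. d p *s psi p x)) < e"
proof -
  define \<tau> where "\<tau> = (e / 2)\<^sup>2 / (4 * B2 + 1)"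
  have \<tau>: "0 < \<tau>" using e nonneg by (simp add: \<tau>_def)
  obtain K2 where K2: "K2 \<ge> N1" "\<And>S. finite S \<Longrightarrow> S \<subseteq> {K2<..} \<Longrightarrow> (\<Sum>p\<in>S. (cmod (ip f (X p)))\<^sup>2) \<le> \<tau>"
    using tail_sum_small[of N1 "\<lambda>p. (cmod (ip f (X p)))\<^sup>2", OF _ tail_coefficients[OF f] \<tau>] by auto
  have "\<exists>d. nrm (\<lambda>x. (f x - (\<Sum>p\<in>{K0<..K}. ip f (X p) *s psi p x)) - (\<Sum>p=1..K0. d p *s psi p x)) < e"
    if K: "K \<ge> max K0 K2" for K
  proof -
    define r where "r x = f x - (\<Sum>p\<in>{K0<..K}. ip f (X p) *s psi p x)" for x
    define w where "w p = (if p = 0 then r else psi p)" for p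
    have Ls: "L2_on {0..1} (\<lambda>x. \<Sum>p\<in>{K0<..K}. ip f (X p) *s psi p x)"
      by (intro unit_L2_lincomb L2_psi) auto
    have Lr: "L2_on {0..1} r" unfolding r_def by (intro unit_L2_diff f Ls)
    have Lw: "L2_on {0..1} (w p)" for p unfolding w_def using Lr L2_psi[of p] by auto
    \<comment> \<open>K0 conditions on K0 + 1 unknowns: the index 0 stands for the remainder, the
      others for eigenfunctions.\<close>
    have "\<exists>d. (\<exists>p\<in>{0..K0}. d p \<noteq> 0) \<and> (\<forall>q\<in>{1..K0}. (\<Sum>p\<in>{0..K0}. d p * ip (w p) (chi q)) = 0)"
      by (rule underdetermined_system) auto
    then obtain d where d: "\<exists>p\<in>{0..K0}. d p \<noteq> 0"
      "\<And>q. q \<in> {1..K0} \<Longrightarrow> (\<Sum>p\<in>{0..K0}. d p * ip (w p) (chi q)) = 0" by blast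
    define g where "g x = (\<Sum>p\<in>{0..K0}. d p *s w p x)" for x
    have Lg: "L2_on {0..1} g" unfolding g_def by (intro unit_L2_lincomb Lw)
    have ghead: "ip g (chi q) = 0" if "q \<in> {1..K0}" for q
      unfolding g_def using d(2)[OF that] that by (subst unit_inner_lincomb) (auto intro: Lw L2_chi)
    have rX: "ip r (X q) = (if q \<le> K then 0 else ip f (X q))" if q: "q > K0" for q
    proof -
      have q': "q > N1" using q K0(1) by simp
      have "ip r (X q) = ip f (X q) - (\<Sum>p\<in>{K0<..K}. ip f (X p) * ip (psi p) (X q))"
        unfolding r_def using q'
        by (subst unit_inner_diff_left[OF f Ls L2_X], simp, subst unit_inner_lincomb) (auto intro: L2_psi L2_X)
      also have "(\<Sum>p\<in>{K0<..K}. ip f (X p) * ip (psi p) (X q)) = (\<Sum>p\<in>{K0<..K}. if p = q then ip f (X p) else 0)"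
        using q' by (intro sum.cong) (auto simp: biorth)
      finally show ?thesis using q by simp
    qed
    have gX: "ip g (X q) = (if q \<le> K then 0 else d 0 * ip f (X q))" if q: "q > K0" for q
    proof -
      have q': "q > N1" using q K0(1) by simp
      have "ip g (X q) = (\<Sum>p\<in>{0..K0}. d p * ip (w p) (X q))"
        unfolding g_def using q' by (subst unit_inner_lincomb) (auto intro: Lw L2_X)
      also have "\<dots> = (\<Sum>p\<in>{0..K0}. if p = 0 then d 0 * ip r (X q) else 0)"
        using q q' by (intro sum.cong) (auto simp: w_def biorth)
      finally show ?thesis using rX[OF q] by simp
    qed
    have "(nrm g)\<^sup>2 \<le> 4 * B2 * ((cmod (d 0))\<^sup>2 * \<tau>)"
    proof (rule lower_tail[OF Lg ghead])
      fix S :: "nat set" assume S: "finite S" "S \<subseteq> {K0<..}"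
      have "(\<Sum>p\<in>S. (cmod (ip g (X p)))\<^sup>2) = (\<Sum>p\<in>S \<inter> {K<..}. (cmod (ip g (X p)))\<^sup>2)"
      proof (intro sum.mono_neutral_right ballI)
        fix p assume "p \<in> S - S \<inter> {K<..}"
        hence "p > K0" "p \<le> K" using S by auto
        thus "(cmod (ip g (X p)))\<^sup>2 = 0" by (simp add: gX)
      qed (use S in auto)
      also have "\<dots> = (cmod (d 0))\<^sup>2 * (\<Sum>p\<in>S \<inter> {K<..}. (cmod (ip f (X p)))\<^sup>2)"
        unfolding sum_distrib_left using S by (intro sum.cong) (auto simp: gX norm_mult power_mult_distrib)
      also have "\<dots> \<le> (cmod (d 0))\<^sup>2 * \<tau>"
        using S K by (intro mult_left_mono K2) auto
      finally show "(\<Sum>p\<in>S. (cmod (ip g (X p)))\<^sup>2) \<le> (cmod (d 0))\<^sup>2 * \<tau>" .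
    qed
    hence ng: "(nrm g)\<^sup>2 \<le> (cmod (d 0))\<^sup>2 * (4 * B2 * \<tau>)" by (simp add: mult_ac)
    have g_split: "g x = d 0 *s r x + (\<Sum>p=1..K0. d p *s psi p x)" for x
    proof -
      have "g x = d 0 *s w 0 x + (\<Sum>p=Suc 0..K0. d p *s w p x)"
        unfolding g_def by (rule sum.atLeast_Suc_atMost) simp
      also have "(\<Sum>p=Suc 0..K0. d p *s w p x) = (\<Sum>p=1..K0. d p *s psi p x)"
        by (intro sum.cong) (auto simp: w_def)
      finally show ?thesis by (simp add: w_def)
    qed
    \<comment> \<open>Otherwise the estimate gives g = 0, a vanishing nontrivial combination of
      eigenfunctions, against their independence.\<close>
    have d0: "d 0 \<noteq> 0"
    proof
      assume d0: "d 0 = 0"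
      hence "nrm g = 0" using ng by simp
      moreover have "g x = (\<Sum>p=1..K0. d p *s psi p x)" for x using g_split[of x] d0 by simp
      ultimately have "nrm (\<lambda>x. \<Sum>p=1..K0. d p *s psi p x) = 0" by (simp add: fun_eq_iff[symmetric] cong: L2_norm_cong)
      hence "d p = 0" if "p \<in> {1..K0}" for p using indep[of "{1..K0}" d p] that by auto
      with d(1) d0 show False by (metis One_nat_def atLeastAtMost_iff less_Suc0 linorder_not_le)
    qed
    define d' where "d' p = - d p / d 0" for p
    have "(f x - (\<Sum>p\<in>{K0<..K}. ip f (X p) *s psi p x)) - (\<Sum>p=1..K0. d' p *s psi p x) = (1 / d 0) *s g x" for x
      unfolding r_def[symmetric] g_split d'_def using d0
      by (simp add: vector_add_ldistrib vector_smult_assoc vec.scale_sum_right sum_negf[symmetric] vector_smult_lneg)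
    hence "nrm (\<lambda>x. (f x - (\<Sum>p\<in>{K0<..K}. ip f (X p) *s psi p x)) - (\<Sum>p=1..K0. d' p *s psi p x)) = cmod (1 / d 0) * nrm g"
      by (simp only: unit_norm_scale)
    also have "\<dots> < e"
    proof (rule power2_less_imp_less)
      have "(cmod (1 / d 0) * nrm g)\<^sup>2 \<le> 4 * B2 * \<tau>"
        using ng d0 by (simp add: power_mult_distrib norm_divide power_divide field_simps)
      also have "\<dots> \<le> (4 * B2 + 1) * \<tau>" using \<tau> by simp
      also have "\<dots> = (e / 2)\<^sup>2" using nonneg by (simp add: \<tau>_def)
      also have "\<dots> < e\<^sup>2" using e by (intro power_strict_mono) auto
      finally show "(cmod (1 / d 0) * nrm g)\<^sup>2 < e\<^sup>2" .
    qed (use e in simp)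
    finally show ?thesis by blast
  qed
  thus ?thesis by (intro exI[of _ "max K0 K2"]) auto
qed

text \<open>\<open>g\<close> is orthogonal to every approximating combination, so |g|^2 is the
  pairing of \<open>g\<close> with an arbitrarily small error.\<close>

lemma total:
  assumes g: "L2_on {0..1} g" and orth: "\<And>p. p \<ge> 1 \<Longrightarrow> ip (psi p) g = 0"
  shows "nrm g = 0"
proof -
  have "nrm g * nrm g \<le> e * nrm g" if e: "0 < e" for e
  proof -
    obtain K d where d: "nrm (\<lambda>x. (g x - (\<Sum>p\<in>{K0<..K}. ip g (X p) *s psi p x)) - (\<Sum>p=1..K0. d p *s psi p x)) < e"
      using approximation[OF g e] by blast
    let ?a = "\<lambda>x. \<Sum>p\<in>{K0<..K}. ip g (X p) *s psi p x" and ?b = "\<lambda>x. \<Sum>p=1..K0. d p *s psi p x"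
    have L: "L2_on {0..1} ?a" "L2_on {0..1} ?b" by (intro unit_L2_lincomb L2_psi; simp)+
    have "ip ?a g = 0" "ip ?b g = 0"
      using orth g by (subst unit_inner_lincomb; auto intro!: L2_psi sum.neutral)+
    hence "ip (\<lambda>x. (g x - ?a x) - ?b x) g = ip g g"
      using L g by (simp add: unit_inner_diff_left unit_L2_diff)
    hence "nrm g * nrm g = cmod (ip (\<lambda>x. (g x - ?a x) - ?b x) g)"
      by (simp add: unit_inner_self power2_eq_square norm_mult)
    also have "\<dots> \<le> nrm (\<lambda>x. (g x - ?a x) - ?b x) * nrm g"
      by (intro unit_inner_le unit_L2_diff g L)
    also have "\<dots> \<le> e * nrm g" using d by (intro mult_right_mono) auto
    finally show ?thesis .
  qed
  from this[of "nrm g / 2"] show ?thesis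
    by (cases "nrm g = 0") (use unit_norm_nonneg[of g] in \<open>auto simp: less_le\<close>)
qed

section \<open>Biorthogonal functions and the expansion in one fibre\<close>

definition dual :: "nat \<Rightarrow> real \<Rightarrow> complex ^ 'm" where
  "dual p = dual_eigenfunction (psi p) (psi_star p)"

text \<open>A vanishing pairing would make \<open>psi_star p\<close> orthogonal to all
  eigenfunctions and hence zero by totality. Only now is the division in
  \<open>dual_eigenfunction\<close> meaningful.\<close>

lemma inner_star_nonzero:
  assumes p: "p \<ge> 1" shows "ip (psi p) (psi_star p) \<noteq> 0"
proof
  assume "ip (psi p) (psi_star p) = 0"
  hence "ip (psi q) (psi_star p) = 0" if "q \<ge> 1" for q using star(3)[OF p that] by (cases "p = q") auto
  from total[OF star(1)[OF p] this] star(2)[OF p] show False by simp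
qed

lemma L2_dual: "p \<ge> 1 \<Longrightarrow> L2_on {0..1} (dual p)"
  unfolding dual_def dual_eigenfunction_def by (intro unit_L2_scale star)

lemma inner_dual:
  assumes "p \<ge> 1" "q \<ge> 1" shows "ip (psi q) (dual p) = (if p = q then 1 else 0)"
  using inner_star_nonzero[OF assms(1)] star(3)[OF assms]
  unfolding dual_def dual_eigenfunction_def unit_inner_scale_right by (cases "p = q") auto

text \<open>Both functions are biorthogonal to the eigenfunctions, so their difference is orthogonal
  to a total system. This transfers the tail bounds from \<open>X\<close> to the functions of the
  theorem.\<close>

lemma inner_dual_tail:
  assumes p: "p > N1" and f: "L2_on {0..1} f" shows "ip f (dual p) = ip f (X p)"
proof -
  have p1: "p \<ge> 1" using p by simp
  have L: "L2_on {0..1} (\<lambda>x. dual p x - X p x)" by (intro unit_L2_diff L2_dual L2_X p p1)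
  have "nrm (\<lambda>x. dual p x - X p x) = 0"
  proof (rule total[OF L])
    fix q :: nat assume q: "q \<ge> 1"
    show "ip (psi q) (\<lambda>x. dual p x - X p x) = 0"
      using p p1 q by (subst unit_inner_diff_right) (auto simp: inner_dual biorth L2_dual L2_X L2_psi)
  qed
  hence "cmod (ip f (\<lambda>x. dual p x - X p x)) \<le> 0" using unit_inner_le[OF f L] by simp
  thus ?thesis using p p1 f by (simp add: unit_inner_diff_right L2_dual L2_X)
qed

text \<open>\<open>approximation\<close> yields unspecified coefficients for p \<le> K0. Pairing the
  error \<open>g\<close> with \<open>dual p\<close> shows that they miss the right ones by
  \<open>ip g (dual p)\<close>, so correcting them multiplies the error by at most the fixed factor
  \<open>M\<close>.\<close>

lemma expansion:
  assumes f: "L2_on {0..1} f"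
  shows "(\<lambda>K. nrm (\<lambda>x. f x - (\<Sum>p=1..K. ip f (dual p) *s psi p x))) \<longlonglongrightarrow> 0"
proof (rule LIMSEQ_I)
  fix e :: real assume e: "0 < e"
  define M where "M = 1 + (\<Sum>p=1..K0. nrm (dual p) * nrm (psi p))"
  have M: "1 \<le> M" unfolding M_def by (simp add: sum_nonneg)
  have e': "0 < e / M" using e M by simp
  obtain K1 where K1: "K1 \<ge> K0" "\<And>K. K \<ge> K1 \<Longrightarrow> \<exists>d. nrm (\<lambda>x. (f x - (\<Sum>p\<in>{K0<..K}. ip f (X p) *s psi p x)) - (\<Sum>p=1..K0. d p *s psi p x)) < e / M"
    using approximation[OF f e'] by blast
  have "norm (nrm (\<lambda>x. f x - (\<Sum>p=1..K. ip f (dual p) *s psi p x)) - 0) < e" if K: "K \<ge> K1" for K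
  proof -
    obtain d where d: "nrm (\<lambda>x. (f x - (\<Sum>p\<in>{K0<..K}. ip f (X p) *s psi p x)) - (\<Sum>p=1..K0. d p *s psi p x)) < e / M"
      using K1(2)[OF K] by blast
    define a b where "a x = (\<Sum>p\<in>{K0<..K}. ip f (X p) *s psi p x)" and "b x = (\<Sum>p=1..K0. d p *s psi p x)" for x
    define g where "g x = (f x - a x) - b x" for x
    have L: "L2_on {0..1} a" "L2_on {0..1} b" unfolding a_def b_def by (intro unit_L2_lincomb L2_psi; simp)+
    have Lg: "L2_on {0..1} g" unfolding g_def by (intro unit_L2_diff f L)
    have ng: "nrm g < e / M" using d by (simp add: g_def[abs_def] a_def b_def)
    have gd: "ip g (dual p) = ip f (dual p) - d p" if p: "p \<in> {1..K0}" for p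
    proof -
      have "ip a (dual p) = 0" unfolding a_def using p
        by (subst unit_inner_lincomb) (auto simp: L2_psi L2_dual inner_dual intro!: sum.neutral)
      moreover have "ip b (dual p) = (\<Sum>q=1..K0. d q * ip (psi q) (dual p))" unfolding b_def using p
        by (subst unit_inner_lincomb) (auto simp: L2_psi L2_dual)
      moreover have "\<dots> = (\<Sum>q=1..K0. if q = p then d q else 0)"
        using p by (intro sum.cong) (auto simp: inner_dual)
      ultimately show ?thesis
        unfolding g_def using p f L by (simp add: unit_inner_diff_left unit_L2_diff L2_dual)
    qed
    have "f x - (\<Sum>p=1..K. ip f (dual p) *s psi p x) = g x - (\<Sum>p=1..K0. ip g (dual p) *s psi p x)" for x
    proof -
      have "{1..K} = {1..K0} \<union> {K0<..K}" using K K1(1) by auto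
      hence "(\<Sum>p=1..K. ip f (dual p) *s psi p x) = (\<Sum>p=1..K0. ip f (dual p) *s psi p x) + (\<Sum>p\<in>{K0<..K}. ip f (dual p) *s psi p x)"
        by (simp only:, subst sum.union_disjoint) auto
      also have "(\<Sum>p\<in>{K0<..K}. ip f (dual p) *s psi p x) = a x"
        unfolding a_def using K0(1) by (intro sum.cong) (auto simp: inner_dual_tail f)
      also have "(\<Sum>p=1..K0. ip f (dual p) *s psi p x) = (\<Sum>p=1..K0. ip g (dual p) *s psi p x) + b x"
        unfolding b_def sum.distrib[symmetric] by (intro sum.cong) (auto simp: gd vector_sadd_rdistrib[symmetric])
      finally show ?thesis by (simp add: g_def)
    qed
    hence "nrm (\<lambda>x. f x - (\<Sum>p=1..K. ip f (dual p) *s psi p x)) = nrm (\<lambda>x. g x - (\<Sum>p=1..K0. ip g (dual p) *s psi p x))"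
      by presburger
    also have "\<dots> \<le> nrm g + nrm (\<lambda>x. \<Sum>p=1..K0. ip g (dual p) *s psi p x)"
      by (intro unit_norm_triangle_diff unit_L2_lincomb Lg L2_psi) auto
    also have "nrm (\<lambda>x. \<Sum>p=1..K0. ip g (dual p) *s psi p x) \<le> (\<Sum>p=1..K0. nrm (\<lambda>x. ip g (dual p) *s psi p x))"
      by (intro unit_norm_sum_le unit_L2_scale L2_psi) auto
    also have "\<dots> \<le> (\<Sum>p=1..K0. nrm g * (nrm (dual p) * nrm (psi p)))"
      unfolding unit_norm_scale mult.assoc[symmetric]
      by (intro sum_mono mult_right_mono unit_inner_le Lg L2_dual) auto
    also have "nrm g + \<dots> = nrm g * M" by (simp add: M_def sum_distrib_left algebra_simps)
    also have "\<dots> < e" using ng M by (simp add: pos_less_divide_eq)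
    finally show ?thesis by simp
  qed
  thus "\<exists>K1. \<forall>K\<ge>K1. norm (nrm (\<lambda>x. f x - (\<Sum>p=1..K. ip f (dual p) *s psi p x)) - 0) < e" by blast
qed

end

section \<open>The unperturbed basis\<close>

text \<open>With \<open>index_branch\<close> the inverse of \<open>eigenvalue_index\<close>. Blocks
  of m consecutive indices, starting at p = 1, carry the frequencies 0, -1, 1, -2, 2, ...; the
  frequency 0 occupies block 0 because the subtraction in \<open>eigenvalue_index\<close> is
  truncated.\<close>

definition index_freq :: "nat \<Rightarrow> nat \<Rightarrow> int" where
  "index_freq m p = (let b = (p - 1) div m in if odd b then - int (Suc b div 2) else int (b div 2))"

definition index_branch :: "nat \<Rightarrow> nat \<Rightarrow> nat" where
  "index_branch m p = (p - 1) mod m + 1"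

lemma eigenvalue_index_block:
  "eigenvalue_index m k j = (if k > 0 then 2 * nat \<bar>k\<bar> else 2 * nat \<bar>k\<bar> - 1) * m + j"
  by (simp add: eigenvalue_index_def)

context
  fixes m :: nat assumes m: "m \<ge> 1"
begin

lemma index_branch_in: "index_branch m p \<in> {1..m}"
  using m by (auto simp: index_branch_def Suc_le_eq)

lemma eigenvalue_index_pos: "j \<in> {1..m} \<Longrightarrow> eigenvalue_index m k j \<ge> 1"
  by (auto simp: eigenvalue_index_block)

lemma eigenvalue_index_freq_branch:
  assumes "p \<ge> 1" shows "eigenvalue_index m (index_freq m p) (index_branch m p) = p"
proof -
  define b where "b = (p - 1) div m"
  have "(if index_freq m p > 0 then 2 * nat \<bar>index_freq m p\<bar> else 2 * nat \<bar>index_freq m p\<bar> - 1) = b"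
  proof (cases "odd b")
    case True
    then obtain c where "b = 2 * c + 1" by (elim oddE)
    thus ?thesis unfolding index_freq_def b_def[symmetric] by (auto simp: Let_def)
  next
    case False
    then obtain c where "b = 2 * c" by (auto elim: evenE)
    thus ?thesis unfolding index_freq_def b_def[symmetric] by (auto simp: Let_def)
  qed
  hence "eigenvalue_index m (index_freq m p) (index_branch m p) = b * m + ((p - 1) mod m + 1)"
    by (simp add: eigenvalue_index_block index_branch_def)
  also have "\<dots> = p" using assms div_mult_mod_eq[of "p - 1" m] by (simp add: b_def)
  finally show ?thesis .
qed

lemma index_freq_branch_eigenvalue_index:
  assumes j: "j \<in> {1..m}"
  shows "index_freq m (eigenvalue_index m k j) = k" "index_branch m (eigenvalue_index m k j) = j"
proof -
  define b where "b = (if k > 0 then 2 * nat \<bar>k\<bar> else 2 * nat \<bar>k\<bar> - 1)"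
  have e: "eigenvalue_index m k j - 1 = b * m + (j - 1)" using j by (auto simp: eigenvalue_index_block b_def)
  have d: "(eigenvalue_index m k j - 1) div m = b" unfolding e using j m
    using div_mult_self3[of m b "j - 1"] by auto
  have "(eigenvalue_index m k j - 1) mod m = j - 1" unfolding e mod_mult_self3 using j by (intro mod_less) auto
  thus "index_branch m (eigenvalue_index m k j) = j" using j by (simp add: index_branch_def)
  show "index_freq m (eigenvalue_index m k j) = k"
    unfolding index_freq_def d Let_def b_def by (cases k rule: int_cases2) auto
qed

text \<open>The first 2 N - 1 blocks are exactly those of the frequencies of modulus below
  N.\<close>

lemma index_freq_ge:
  assumes p: "p > num_exceptional m N" and N: "N \<ge> 1" shows "\<bar>index_freq m p\<bar> \<ge> int N"
proof -
  define b where "b = (p - 1) div m"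
  have "(2 * N - 1) * m \<le> p - 1" using p by (simp add: num_exceptional_def)
  hence "2 * N - 1 \<le> b" unfolding b_def using m by (simp add: less_eq_div_iff_mult_less_eq)
  thus ?thesis unfolding index_freq_def b_def[symmetric] Let_def using N
    by (cases "odd b") (auto elim!: oddE evenE)
qed

lemma inj_on_index_freq: "inj_on (index_freq m) {p \<in> {1..}. index_branch m p = j}"
proof (rule inj_onI)
  fix p q assume "p \<in> {p \<in> {1..}. index_branch m p = j}" "q \<in> {p \<in> {1..}. index_branch m p = j}"
    "index_freq m p = index_freq m q"
  thus "p = q" using eigenvalue_index_freq_branch[of p] eigenvalue_index_freq_branch[of q] by auto
qed

end

text \<open>The m + 1 vectors y, v_1, ..., v_m are dependent in dimension m. Pairing a relation with
  \<open>u j\<close> expresses its coefficients by that of y, which therefore is nonzero and can be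
  divided out.\<close>

lemma biorthogonal_expansion:
  fixes v u :: "nat \<Rightarrow> complex ^ 'm::finite"
  assumes "\<And>i j. i \<in> {1..CARD('m)} \<Longrightarrow> j \<in> {1..CARD('m)} \<Longrightarrow> cinner (v i) (u j) = (if i = j then 1 else 0)"
  shows "y = (\<Sum>j=1..CARD('m). cinner y (u j) *s v j)"
proof -
  let ?m = "CARD('m)"
  define w where "w p = (if p = 0 then y else v p)" for p
  have "\<exists>d. (\<exists>p\<in>{0..?m}. d p \<noteq> 0) \<and> (\<forall>i\<in>(UNIV :: 'm set). (\<Sum>p\<in>{0..?m}. d p * w p $ i) = 0)"
    by (rule underdetermined_system) auto
  then obtain d where d: "\<exists>p\<in>{0..?m}. d p \<noteq> 0" "\<And>i. (\<Sum>p\<in>{0..?m}. d p * w p $ i) = 0" by blast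
  have "(\<Sum>p\<in>{0..?m}. d p *s w p) = 0" using d(2) by (simp add: vec_eq_iff)
  moreover have "(\<Sum>p\<in>{0..?m}. d p *s w p) = d 0 *s w 0 + (\<Sum>p=Suc 0..?m. d p *s w p)"
    by (rule sum.atLeast_Suc_atMost) simp
  moreover have "(\<Sum>p=Suc 0..?m. d p *s w p) = (\<Sum>p=1..?m. d p *s v p)"
    by (intro sum.cong) (auto simp: w_def)
  ultimately have eq: "d 0 *s y + (\<Sum>p=1..?m. d p *s v p) = 0" by (simp add: w_def)
  have "cinner (\<Sum>p\<in>I. d p *s v p) z = (\<Sum>p\<in>I. d p * cinner (v p) z)" for I z
    by (induction I rule: infinite_finite_induct) (auto simp: cinner_add_left cinner_scale_left)
  hence e1: "cinner (d 0 *s y + (\<Sum>p=1..?m. d p *s v p)) (u j) = d 0 * cinner y (u j) + (\<Sum>p=1..?m. d p * cinner (v p) (u j))" for j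
    by (simp add: cinner_add_left cinner_scale_left)
  have e2: "(\<Sum>p=1..?m. d p * cinner (v p) (u j)) = (\<Sum>p=1..?m. if p = j then d p else 0)" if "j \<in> {1..?m}" for j
    using assms that by (intro sum.cong) auto
  have c: "d 0 * cinner y (u j) + d j = 0" if "j \<in> {1..?m}" for j
    using e1[of j] e2[OF that] that unfolding eq by simp
  have d0: "d 0 \<noteq> 0"
  proof
    assume "d 0 = 0"
    with c have "d j = 0" if "j \<in> {0..?m}" for j using that by (cases "j = 0") auto
    with d(1) show False by blast
  qed
  have "d 0 *s y = - (\<Sum>p=1..?m. d p *s v p)" using eq by (simp add: eq_neg_iff_add_eq_0)
  also have "\<dots> = (\<Sum>p=1..?m. (d 0 * cinner y (u p)) *s v p)"
    unfolding sum_negf[symmetric]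
  proof (intro sum.cong refl)
    fix p assume "p \<in> {1..?m}"
    hence "d p = - (d 0 * cinner y (u p))" using c[of p] by (simp add: eq_neg_iff_add_eq_0 add.commute)
    thus "- (d p *s v p) = (d 0 * cinner y (u p)) *s v p" by (simp add: vector_smult_lneg)
  qed
  also have "\<dots> = d 0 *s (\<Sum>p=1..?m. cinner y (u p) *s v p)"
    by (simp add: vec.scale_sum_right vector_smult_assoc)
  finally show ?thesis using d0 by (simp add: vec_eq_iff)
qed

lemma L2_norm_le_mult:
  fixes f :: "real \<Rightarrow> 'a::euclidean_space" and g :: "real \<Rightarrow> 'b::euclidean_space"
  assumes "L2_on {0..1} f" "L2_on {0..1} g" "0 \<le> C" "\<And>x. x \<in> {0..1} \<Longrightarrow> norm (f x) \<le> C * norm (g x)"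
  shows "L2_norm {0..1} f \<le> C * L2_norm {0..1} g"
proof -
  have "(\<integral>x. (norm (f x))\<^sup>2 \<partial>lebesgue_on {0..1}) \<le> (\<integral>x. C\<^sup>2 * (norm (g x))\<^sup>2 \<partial>lebesgue_on {0..1})"
  proof (rule integral_mono)
    fix x assume "x \<in> space (lebesgue_on {0..1::real})"
    hence "(norm (f x))\<^sup>2 \<le> (C * norm (g x))\<^sup>2" using assms(4)[of x] by (intro power_mono) auto
    thus "(norm (f x))\<^sup>2 \<le> C\<^sup>2 * (norm (g x))\<^sup>2" by (simp add: power_mult_distrib)
  qed (use assms in \<open>auto simp: L2_on_iff\<close>)
  hence "(L2_norm {0..1} f)\<^sup>2 \<le> (C * L2_norm {0..1} g)\<^sup>2"
    by (simp add: L2_norm_squared power_mult_distrib)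
  thus ?thesis by (rule power2_le_imp_le) (use assms(3) in simp)
qed

lemma L2_on_mult_continuous:
  fixes f :: "real \<Rightarrow> complex ^ 'm::finite"
  assumes f: "L2_on {0..1} f" and c: "continuous_on {0..1} c"
  shows "L2_on {0..1} (\<lambda>x. c x *s f x)" "L2_on {0..1} (\<lambda>x. c x * cinner (f x) w)"
proof -
  let ?M = "lebesgue_on {0..1::real}"
  obtain C where C: "\<And>x. x \<in> {0..1} \<Longrightarrow> cmod (c x) \<le> C"
    using compact_imp_bounded[OF compact_continuous_image[OF c compact_Icc]] by (metis bounded_iff image_eqI)
  have [measurable]: "c \<in> borel_measurable ?M" by (rule continuous_imp_measurable_on_sets_lebesgue[OF c]) auto
  have [measurable]: "f \<in> borel_measurable ?M" using f by (simp add: L2_on_iff)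
  have i: "integrable ?M (\<lambda>x. C\<^sup>2 * (norm (f x))\<^sup>2)" "integrable ?M (\<lambda>x. (C * norm w)\<^sup>2 * (norm (f x))\<^sup>2)"
    using f by (simp_all add: L2_on_iff)
  have "integrable ?M (\<lambda>x. (norm (c x *s f x))\<^sup>2)"
  proof (rule Bochner_Integration.integrable_bound[OF i(1)])
    show "AE x in ?M. norm ((norm (c x *s f x))\<^sup>2) \<le> norm (C\<^sup>2 * (norm (f x))\<^sup>2)"
      using C by (intro AE_I2) (auto simp: norm_smult_vec power_mult_distrib intro!: mult_right_mono power_mono)
  qed measurable
  thus "L2_on {0..1} (\<lambda>x. c x *s f x)" by (simp add: L2_on_iff)
  have "integrable ?M (\<lambda>x. (cmod (c x * cinner (f x) w))\<^sup>2)"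
  proof (rule Bochner_Integration.integrable_bound[OF i(2)])
    have "cmod (c x * cinner (f x) w) \<le> (C * norm w) * norm (f x)" if x: "x \<in> {0..1}" for x
    proof -
      have "cmod (c x * cinner (f x) w) \<le> C * (norm (f x) * norm w)"
        unfolding norm_mult using C[OF x] order_trans[OF norm_ge_zero C[OF x]]
        by (intro mult_mono norm_cinner_le) auto
      thus ?thesis by (simp add: mult_ac)
    qed
    hence "(cmod (c x * cinner (f x) w))\<^sup>2 \<le> (C * norm w)\<^sup>2 * (norm (f x))\<^sup>2" if x: "x \<in> {0..1}" for x
      unfolding power_mult_distrib[symmetric] using x by (intro power_mono) auto
    thus "AE x in ?M. norm ((cmod (c x * cinner (f x) w))\<^sup>2) \<le> norm ((C * norm w)\<^sup>2 * (norm (f x))\<^sup>2)"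
      by (intro AE_I2) auto
  qed measurable
  thus "L2_on {0..1} (\<lambda>x. c x * cinner (f x) w)" by (simp add: L2_on_iff)
qed

section \<open>Frame bounds of the leading terms of the asymptotics\<close>

locale model_basis =
  fixes h :: "real \<Rightarrow> complex" and a :: real and v u :: "nat \<Rightarrow> complex ^ 'm::finite"
  assumes h: "continuous_on {0..1} h" and h0: "\<And>x. x \<in> {0..1} \<Longrightarrow> h x \<noteq> 0" and a: "0 < a"
    and vu: "\<And>i j. i \<in> {1..CARD('m)} \<Longrightarrow> j \<in> {1..CARD('m)} \<Longrightarrow> cinner (v i) (u j) = (if i = j then 1 else 0)"
begin

definition model_phi :: "real \<Rightarrow> nat \<Rightarrow> real \<Rightarrow> complex ^ 'm" where
  "model_phi t p x = (h x / a * wave t (index_freq CARD('m) p) x) *s v (index_branch CARD('m) p)"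

definition model_chi :: "real \<Rightarrow> nat \<Rightarrow> real \<Rightarrow> complex ^ 'm" where
  "model_chi t p x = (a / cnj (h x) * wave t (index_freq CARD('m) p) x) *s u (index_branch CARD('m) p)"

text \<open>The scalar function multiplying (h / a) v_j when f is expanded along the eigenvectors;
  its Fourier coefficients are the pairings of f with \<open>model_chi\<close>.\<close>

definition coord :: "(real \<Rightarrow> complex ^ 'm) \<Rightarrow> nat \<Rightarrow> real \<Rightarrow> complex" where
  "coord f j x = a / h x * cinner (f x) (u j)"

lemma m1: "CARD('m) \<ge> 1" by (simp add: Suc_le_eq)

lemma continuous_quot: "continuous_on {0..1} (\<lambda>x. h x / a)" "continuous_on {0..1} (\<lambda>x. a / h x)"
  "continuous_on {0..1} (\<lambda>x. a / cnj (h x))"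
  using h h0 a by (auto intro!: continuous_intros)

lemma continuous_model: "continuous_on {0..1} (model_phi t p)" "continuous_on {0..1} (model_chi t p)"
  unfolding model_phi_def[abs_def] model_chi_def[abs_def] by (intro continuous_intros continuous_quot)+

definition hmax :: real where
  "hmax = (SOME C. 0 \<le> C \<and> (\<forall>x\<in>{0..1}. cmod (h x / a) \<le> C \<and> cmod (a / h x) \<le> C))"

lemma hmax: "0 \<le> hmax" "\<And>x. x \<in> {0..1} \<Longrightarrow> cmod (h x / a) \<le> hmax" "\<And>x. x \<in> {0..1} \<Longrightarrow> cmod (a / h x) \<le> hmax"
proof -
  obtain C where C: "\<And>x. x \<in> {0..1} \<Longrightarrow> cmod (h x / a) \<le> C"
    using compact_imp_bounded[OF compact_continuous_image[OF continuous_quot(1) compact_Icc]]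
    unfolding bounded_iff by blast
  obtain C' where C': "\<And>x. x \<in> {0..1} \<Longrightarrow> cmod (a / h x) \<le> C'"
    using compact_imp_bounded[OF compact_continuous_image[OF continuous_quot(2) compact_Icc]]
    unfolding bounded_iff by blast
  have "\<exists>C. 0 \<le> C \<and> (\<forall>x\<in>{0..1}. cmod (h x / a) \<le> C \<and> cmod (a / h x) \<le> C)"
  proof (intro exI[of _ "max C C'"] conjI ballI)
    show "0 \<le> max C C'" using order_trans[OF norm_ge_zero C[of 0]] by simp
  qed (use C C' in \<open>simp_all add: le_max_iff_disj del: norm_divide\<close>)
  from someI_ex[OF this] show "0 \<le> hmax" "\<And>x. x \<in> {0..1} \<Longrightarrow> cmod (h x / a) \<le> hmax" "\<And>x. x \<in> {0..1} \<Longrightarrow> cmod (a / h x) \<le> hmax"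
    unfolding hmax_def[symmetric] by blast+
qed

definition Cv :: real where "Cv = (\<Sum>j=1..CARD('m). hmax * norm (v j))"
definition Cu :: real where "Cu = (\<Sum>j=1..CARD('m). (hmax * norm (u j))\<^sup>2)"

lemma Cv_nonneg: "0 \<le> Cv" and Cu_nonneg: "0 \<le> Cu"
  unfolding Cv_def Cu_def using hmax(1) by (auto intro!: sum_nonneg)

text \<open>Indices are grouped by branch. Within a branch the frequencies are distinct, so
  orthonormality gives the norm of the exponential sum exactly; multiplication by h / a and by v_j
  costs a bounded factor.\<close>

lemma model_synthesis:
  assumes S: "finite S" "S \<subseteq> {1..}"
  shows "(L2_norm {0..1} (\<lambda>x. \<Sum>p\<in>S. c p *s model_phi t p x))\<^sup>2 \<le> Cv\<^sup>2 * (\<Sum>p\<in>S. (cmod (c p))\<^sup>2)"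
proof -
  define Q where "Q = (\<Sum>p\<in>S. (cmod (c p))\<^sup>2)"
  define T where "T j = {p \<in> S. index_branch CARD('m) p = j}" for j
  define s where "s j x = (\<Sum>p\<in>T j. c p * wave t (index_freq CARD('m) p) x)" for j x
  have T: "finite (T j)" "T j \<subseteq> {p \<in> {1..}. index_branch CARD('m) p = j}" for j using S by (auto simp: T_def)
  have Ls: "L2_on {0..1} (s j)" for j unfolding s_def by (intro L2_on_continuous continuous_intros)
  have ns: "L2_norm {0..1} (s j) \<le> sqrt Q" for j
  proof -
    let ?f = "the_inv_into (T j) (index_freq CARD('m))"
    have inj: "inj_on (index_freq CARD('m)) (T j)" by (rule inj_on_subset[OF inj_on_index_freq[OF m1] T(2)])
    have "s j x = (\<Sum>k\<in>index_freq CARD('m) ` T j. c (?f k) * wave t k x)" for x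
      unfolding s_def sum.reindex[OF inj] by (intro sum.cong) (auto simp: the_inv_into_f_f[OF inj])
    hence "(L2_norm {0..1} (s j))\<^sup>2 = (\<Sum>k\<in>index_freq CARD('m) ` T j. (cmod (c (?f k)))\<^sup>2)"
      using L2_norm_wave_sum[of "index_freq CARD('m) ` T j" "\<lambda>k. c (?f k)" t] T(1)
      by (simp add: s_def[abs_def])
    also have "\<dots> = (\<Sum>p\<in>T j. (cmod (c p))\<^sup>2)"
      unfolding sum.reindex[OF inj] by (intro sum.cong) (auto simp: the_inv_into_f_f[OF inj])
    also have "\<dots> \<le> Q" unfolding Q_def T_def using S by (intro sum_mono2) auto
    finally show ?thesis by (rule real_le_rsqrt)
  qed
  have eq: "(\<Sum>p\<in>S. c p *s model_phi t p x) = (\<Sum>j=1..CARD('m). (h x / a * s j x) *s v j)" for x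
  proof -
    have "(\<Sum>p\<in>S. c p *s model_phi t p x) = (\<Sum>j=1..CARD('m). \<Sum>p\<in>T j. c p *s model_phi t p x)"
      unfolding T_def using S index_branch_in[OF m1] by (intro sum.group[symmetric]) auto
    also have "\<dots> = (\<Sum>j=1..CARD('m). (h x / a * s j x) *s v j)"
    proof (intro sum.cong refl)
      fix j
      have "(\<Sum>p\<in>T j. c p *s model_phi t p x) = (\<Sum>p\<in>T j. (h x / a * (c p * wave t (index_freq CARD('m) p) x)) *s v j)"
        by (intro sum.cong) (auto simp: T_def model_phi_def vector_smult_assoc mult_ac)
      thus "(\<Sum>p\<in>T j. c p *s model_phi t p x) = (h x / a * s j x) *s v j"
        by (simp add: s_def sum_distrib_left vec.scale_sum_left)
    qed
    finally show ?thesis .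
  qed
  have cs: "continuous_on {0..1} (s j)" for j unfolding s_def by (intro continuous_intros)
  have L: "L2_on {0..1} (\<lambda>x. (h x / a * s j x) *s v j)" for j
    by (intro L2_on_continuous continuous_intros continuous_quot cs)
  have "L2_norm {0..1} (\<lambda>x. \<Sum>p\<in>S. c p *s model_phi t p x) \<le> (\<Sum>j=1..CARD('m). L2_norm {0..1} (\<lambda>x. (h x / a * s j x) *s v j))"
    unfolding eq by (intro unit_norm_sum_le L)
  also have "\<dots> \<le> (\<Sum>j=1..CARD('m). (hmax * norm (v j)) * sqrt Q)"
  proof (rule sum_mono)
    fix j
    have "L2_norm {0..1} (\<lambda>x. (h x / a * s j x) *s v j) \<le> (hmax * norm (v j)) * L2_norm {0..1} (s j)"
    proof (rule L2_norm_le_mult[OF L Ls])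
      fix x :: real assume x: "x \<in> {0..1}"
      have "norm ((h x / a * s j x) *s v j) = (cmod (h x / a) * norm (v j)) * cmod (s j x)"
        by (simp only: norm_smult_vec norm_mult mult_ac)
      also have "\<dots> \<le> (hmax * norm (v j)) * cmod (s j x)" using hmax(2)[OF x] by (intro mult_right_mono) auto
      finally show "norm ((h x / a * s j x) *s v j) \<le> (hmax * norm (v j)) * norm (s j x)" by simp
    qed (use hmax(1) in auto)
    also have "\<dots> \<le> (hmax * norm (v j)) * sqrt Q" using ns hmax(1) by (intro mult_left_mono) auto
    finally show "L2_norm {0..1} (\<lambda>x. (h x / a * s j x) *s v j) \<le> (hmax * norm (v j)) * sqrt Q" .
  qed
  also have "\<dots> = Cv * sqrt Q" by (simp add: Cv_def sum_distrib_right)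
  finally have "(L2_norm {0..1} (\<lambda>x. \<Sum>p\<in>S. c p *s model_phi t p x))\<^sup>2 \<le> (Cv * sqrt Q)\<^sup>2"
    by (intro power_mono) auto
  also have "\<dots> = Cv\<^sup>2 * Q" by (simp add: power_mult_distrib Q_def sum_nonneg)
  finally show ?thesis by (simp add: Q_def)
qed

lemma L2_coord: "L2_on {0..1} f \<Longrightarrow> L2_on {0..1} (coord f j)"
  unfolding coord_def[abs_def] by (rule L2_on_mult_continuous(2)[OF _ continuous_quot(2)])

text \<open>Conjugation in the second argument turns a / cnj h into a / h, the weight in
  \<open>coord\<close>.\<close>

lemma inner_chi: "L2_inner {0..1} f (model_chi t p) = wave_coeff t (index_freq CARD('m) p) (coord f (index_branch CARD('m) p))"
  unfolding L2_inner_eq[OF unit_interval_sets] wave_coeff_def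
  by (rule Bochner_Integration.integral_cong) (auto simp: model_chi_def coord_def cinner_scale_right)

lemma model_upper:
  assumes f: "L2_on {0..1} f" and S: "finite S" "S \<subseteq> {1..}"
  shows "(\<Sum>p\<in>S. (cmod (L2_inner {0..1} f (model_chi t p)))\<^sup>2) \<le> Cu * (L2_norm {0..1} f)\<^sup>2"
proof -
  define T where "T j = {p \<in> S. index_branch CARD('m) p = j}" for j
  have T: "finite (T j)" "T j \<subseteq> {p \<in> {1..}. index_branch CARD('m) p = j}" for j using S by (auto simp: T_def)
  have "(\<Sum>p\<in>S. (cmod (L2_inner {0..1} f (model_chi t p)))\<^sup>2)
      = (\<Sum>j=1..CARD('m). \<Sum>p\<in>T j. (cmod (L2_inner {0..1} f (model_chi t p)))\<^sup>2)"
    unfolding T_def using S index_branch_in[OF m1] by (intro sum.group[symmetric]) auto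
  also have "\<dots> \<le> (\<Sum>j=1..CARD('m). (hmax * norm (u j))\<^sup>2 * (L2_norm {0..1} f)\<^sup>2)"
  proof (rule sum_mono)
    fix j
    have inj: "inj_on (index_freq CARD('m)) (T j)" by (rule inj_on_subset[OF inj_on_index_freq[OF m1] T(2)])
    have "(\<Sum>p\<in>T j. (cmod (L2_inner {0..1} f (model_chi t p)))\<^sup>2)
        = (\<Sum>k\<in>index_freq CARD('m) ` T j. (cmod (wave_coeff t k (coord f j)))\<^sup>2)"
      unfolding sum.reindex[OF inj] inner_chi by (intro sum.cong) (auto simp: T_def)
    also have "\<dots> \<le> (L2_norm {0..1} (coord f j))\<^sup>2" using T(1) by (intro Bessel_wave L2_coord f) auto
    also have "\<dots> \<le> ((hmax * norm (u j)) * L2_norm {0..1} f)\<^sup>2"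
    proof (intro power_mono L2_norm_le_mult L2_coord f)
      fix x :: real assume x: "x \<in> {0..1}"
      have "cmod (coord f j x) \<le> hmax * (norm (f x) * norm (u j))"
        unfolding coord_def norm_mult using hmax x by (intro mult_mono norm_cinner_le) auto
      thus "norm (coord f j x) \<le> (hmax * norm (u j)) * norm (f x)" by (simp add: mult_ac)
    qed (use hmax(1) in auto)
    finally show "(\<Sum>p\<in>T j. (cmod (L2_inner {0..1} f (model_chi t p)))\<^sup>2) \<le> (hmax * norm (u j))\<^sup>2 * (L2_norm {0..1} f)\<^sup>2"
      by (simp add: power_mult_distrib)
  qed
  finally show ?thesis by (simp add: Cu_def sum_distrib_right)
qed

text \<open>Parseval in each branch bounds the coordinate functions, from which f is recovered by
  \<open>biorthogonal_expansion\<close> at every point.\<close>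

lemma model_lower:
  assumes f: "L2_on {0..1} f"
    and B: "\<And>S. finite S \<Longrightarrow> S \<subseteq> {1..} \<Longrightarrow> (\<Sum>p\<in>S. (cmod (L2_inner {0..1} f (model_chi t p)))\<^sup>2) \<le> B"
  shows "(L2_norm {0..1} f)\<^sup>2 \<le> Cv\<^sup>2 * B"
proof -
  have B0: "0 \<le> B" using B[of "{}"] by simp
  have nc: "L2_norm {0..1} (coord f j) \<le> sqrt B" if j: "j \<in> {1..CARD('m)}" for j
  proof (rule real_le_rsqrt, rule Parseval_wave[OF L2_coord[OF f], where t = t])
    fix K :: "int set" assume K: "finite K"
    let ?i = "\<lambda>k. eigenvalue_index CARD('m) k j"
    note fb = index_freq_branch_eigenvalue_index[OF m1 j]
    have inj: "inj_on ?i K" by (rule inj_on_inverseI[where g = "index_freq CARD('m)"]) (rule fb)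
    have "(\<Sum>k\<in>K. (cmod (wave_coeff t k (coord f j)))\<^sup>2) = (\<Sum>p\<in>?i ` K. (cmod (L2_inner {0..1} f (model_chi t p)))\<^sup>2)"
      unfolding sum.reindex[OF inj] inner_chi by (simp add: fb)
    also have "\<dots> \<le> B" using K eigenvalue_index_pos[OF m1 j] by (intro B) auto
    finally show "(\<Sum>k\<in>K. (cmod (wave_coeff t k (coord f j)))\<^sup>2) \<le> B" .
  qed
  have c1: "continuous_on {0..1} (\<lambda>_::real. 1 :: complex)" by (intro continuous_intros)
  have c: "L2_on {0..1} (\<lambda>x. cinner (f x) (u j) *s v j)" for j
  proof -
    have "(\<lambda>x. cinner (f x) (u j)) \<in> borel_measurable (lebesgue_on {0..1})"
      using L2_on_mult_continuous(2)[OF f c1, of "u j"] by (simp add: L2_on_iff)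
    hence "(\<lambda>x. cinner (f x) (u j) *s v j) \<in> borel_measurable (lebesgue_on {0..1})" by measurable
    moreover have "integrable (lebesgue_on {0..1}) (\<lambda>x. (norm (v j))\<^sup>2 * (cmod (cinner (f x) (u j)))\<^sup>2)"
      using L2_on_mult_continuous(2)[OF f c1, of "u j"] by (simp add: L2_on_iff)
    ultimately show ?thesis by (simp add: L2_on_iff norm_smult_vec power_mult_distrib mult.commute)
  qed
  have "f = (\<lambda>x. \<Sum>j=1..CARD('m). cinner (f x) (u j) *s v j)" by (rule ext, rule biorthogonal_expansion[OF vu])
  hence "L2_norm {0..1} f = L2_norm {0..1} (\<lambda>x. \<Sum>j=1..CARD('m). cinner (f x) (u j) *s v j)" by simp
  also have "\<dots> \<le> (\<Sum>j=1..CARD('m). L2_norm {0..1} (\<lambda>x. cinner (f x) (u j) *s v j))"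
    by (intro unit_norm_sum_le c)
  also have "\<dots> \<le> (\<Sum>j=1..CARD('m). (hmax * norm (v j)) * sqrt B)"
  proof (rule sum_mono)
    fix j assume j: "j \<in> {1..CARD('m)}"
    have "L2_norm {0..1} (\<lambda>x. cinner (f x) (u j) *s v j) \<le> (hmax * norm (v j)) * L2_norm {0..1} (coord f j)"
    proof (rule L2_norm_le_mult[OF c L2_coord[OF f]])
      fix x :: real assume x: "x \<in> {0..1}"
      have "cinner (f x) (u j) = h x / a * coord f j x" using h0[OF x] a by (simp add: coord_def)
      hence "norm (cinner (f x) (u j) *s v j) = (cmod (h x / a) * norm (v j)) * cmod (coord f j x)"
        by (simp only: norm_smult_vec norm_mult mult_ac)
      also have "\<dots> \<le> (hmax * norm (v j)) * cmod (coord f j x)" using hmax(2)[OF x] by (intro mult_right_mono) auto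
      finally show "norm (cinner (f x) (u j) *s v j) \<le> (hmax * norm (v j)) * norm (coord f j x)" by simp
    qed (use hmax(1) in auto)
    also have "\<dots> \<le> (hmax * norm (v j)) * sqrt B" using nc[OF j] hmax(1) by (intro mult_left_mono) auto
    finally show "L2_norm {0..1} (\<lambda>x. cinner (f x) (u j) *s v j) \<le> (hmax * norm (v j)) * sqrt B" .
  qed
  also have "\<dots> = Cv * sqrt B" by (simp add: Cv_def sum_distrib_right)
  finally have "(L2_norm {0..1} f)\<^sup>2 \<le> (Cv * sqrt B)\<^sup>2" by (intro power_mono) auto
  thus ?thesis using B0 by (simp add: power_mult_distrib)
qed

end

section \<open>Square summability of the asymptotic errors\<close>

lemma summable_log_error: "summable (\<lambda>k. ((1 + ln (real k)) / real k)\<^sup>2)"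
proof (rule summable_comparison_test)
  \<comment> \<open>The estimate ln y \<le> y - 1 at y = k^(1/4) gives 1 + ln k \<le> 4 k^(1/4);
    squaring leaves the exponent 1/2 - 2.\<close>
  have "norm (((1 + ln (real k)) / real k)\<^sup>2) \<le> 16 * real k powr (- 3 / 2)" if k: "k \<ge> 1" for k
  proof -
    have "ln (real k powr (1 / 4)) \<le> real k powr (1 / 4) - 1" using k by (intro ln_le_minus_one) auto
    hence "1 + ln (real k) \<le> 4 * real k powr (1 / 4)" using k by (simp add: ln_powr)
    moreover have "0 \<le> 1 + ln (real k)" using k by simp
    ultimately have "(1 + ln (real k))\<^sup>2 \<le> (4 * real k powr (1 / 4))\<^sup>2" by (intro power_mono)
    also have "\<dots> = 16 * real k powr (1 / 2)" by (simp add: power_mult_distrib power2_eq_square powr_add[symmetric])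
    finally have "(1 + ln (real k))\<^sup>2 / (real k)\<^sup>2 \<le> 16 * real k powr (1 / 2) / (real k)\<^sup>2" by (intro divide_right_mono) auto
    also have "\<dots> = 16 * (real k powr (1 / 2) / real k powr 2)" using k by simp
    also have "\<dots> = 16 * real k powr (1 / 2 - 2)" by (simp only: powr_diff)
    also have "1 / 2 - 2 = (- 3 / 2 :: real)" by simp
    finally show ?thesis by (simp add: power_divide)
  qed
  thus "\<exists>N. \<forall>k\<ge>N. norm (((1 + ln (real k)) / real k)\<^sup>2) \<le> 16 * real k powr (- 3 / 2)" by blast
  show "summable (\<lambda>k. 16 * real k powr (- 3 / 2))" by (intro summable_mult) (simp add: summable_real_powr_iff)
qed

text \<open>At most 2 m indices share the same modulus of the frequency, so the sum is at most 2 m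
  times the series. The frequency 0 contributes 0, the default value of the quotient.\<close>

lemma log_error_sum_bounded:
  assumes m: "m \<ge> 1"
  shows "\<exists>E. \<forall>S. finite S \<longrightarrow> S \<subseteq> {1..} \<longrightarrow>
     (\<Sum>p\<in>S. (C * ((1 + ln (of_int \<bar>index_freq m p\<bar>)) / of_int \<bar>index_freq m p\<bar>))\<^sup>2) \<le> (E :: real)"
proof -
  define b where "b k = ((1 + ln (real k)) / real k)\<^sup>2" for k
  have "(\<Sum>p\<in>S. (C * ((1 + ln (of_int \<bar>index_freq m p\<bar>)) / of_int \<bar>index_freq m p\<bar>))\<^sup>2) \<le> C\<^sup>2 * (real (2 * m) * (\<Sum>k. b k))"
    if S: "finite S" "S \<subseteq> {1..}" for S
  proof -
    let ?g = "\<lambda>p. nat \<bar>index_freq m p\<bar>"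
    have card: "card {p \<in> S. ?g p = k} \<le> 2 * m" for k
    proof -
      have "{p \<in> S. ?g p = k} \<subseteq> (\<lambda>(s, j). eigenvalue_index m s j) ` ({int k, - int k} \<times> {1..m})"
      proof
        fix p assume p: "p \<in> {p \<in> S. ?g p = k}"
        hence "p = eigenvalue_index m (index_freq m p) (index_branch m p)"
          using eigenvalue_index_freq_branch[OF m, of p] S by auto
        moreover have "index_freq m p \<in> {int k, - int k}" using p by auto
        ultimately show "p \<in> (\<lambda>(s, j). eigenvalue_index m s j) ` ({int k, - int k} \<times> {1..m})"
          using index_branch_in[OF m, of p] by (force intro!: image_eqI[where x = "(index_freq m p, index_branch m p)"])
      qed
      hence "card {p \<in> S. ?g p = k} \<le> card ({int k, - int k} \<times> {1..m})"
        by (meson card_image_le card_mono finite_SigmaI finite_atLeastAtMost finite.emptyI finite.insertI finite_imageI order_trans)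
      also have "\<dots> \<le> 2 * m" by (auto simp: card_cartesian_product card_insert_if)
      finally show ?thesis .
    qed
    have "(\<Sum>p\<in>S. b (?g p)) = (\<Sum>k\<in>?g ` S. \<Sum>p\<in>{p \<in> S. ?g p = k}. b (?g p))"
      using S by (intro sum.image_gen) auto
    also have "\<dots> = (\<Sum>k\<in>?g ` S. real (card {p \<in> S. ?g p = k}) * b k)" by (intro sum.cong) auto
    also have "\<dots> \<le> (\<Sum>k\<in>?g ` S. real (2 * m) * b k)"
      using card by (intro sum_mono mult_right_mono) (auto simp: b_def simp del: of_nat_mult)
    also have "\<dots> = real (2 * m) * (\<Sum>k\<in>?g ` S. b k)" by (simp add: sum_distrib_left)
    also have "\<dots> \<le> real (2 * m) * (\<Sum>k. b k)"
      using summable_log_error S by (intro mult_left_mono sum_le_suminf) (auto simp: b_def[abs_def])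
    finally have "(\<Sum>p\<in>S. b (?g p)) \<le> real (2 * m) * (\<Sum>k. b k)" .
    hence "C\<^sup>2 * (\<Sum>p\<in>S. b (?g p)) \<le> C\<^sup>2 * (real (2 * m) * (\<Sum>k. b k))" by (intro mult_left_mono) auto
    moreover have "(C * ((1 + ln (of_int \<bar>index_freq m p\<bar>)) / of_int \<bar>index_freq m p\<bar>))\<^sup>2 = C\<^sup>2 * b (?g p)" for p
      by (simp add: b_def power_mult_distrib power_divide)
    ultimately show ?thesis by (simp only: sum_distrib_left)
  qed
  thus ?thesis by blast
qed

section \<open>The inverse Gelfand transform\<close>

text \<open>Sections and iterated integrals are handled with Borel functions on product spaces;
  Lebesgue measurable data are first replaced by such versions.\<close>

lemma lebesgue_measurable_ex_borel:
  fixes f :: "'a::euclidean_space \<Rightarrow> 'b::euclidean_space"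
  assumes f: "f \<in> borel_measurable lebesgue"
  shows "\<exists>g\<in>borel_measurable borel. AE x in lborel. f x = g x"
proof -
  have "\<exists>g\<in>borel_measurable lborel. AE x in lborel. f x \<bullet> b = g x" for b
    by (rule completion_ex_borel_measurable_real) (use f in measurable)
  then obtain g where g: "\<And>b. g b \<in> borel_measurable lborel" "\<And>b. AE x in lborel. f x \<bullet> b = g b x" by metis
  have "AE x in lborel. \<forall>b\<in>Basis. f x \<bullet> b = g b x" using g(2) by (intro AE_finite_allI) auto
  hence ae: "AE x in lborel. f x = (\<Sum>b\<in>Basis. g b x *\<^sub>R b)"
    by eventually_elim (metis (no_types, lifting) euclidean_representation sum.cong)
  have "(\<lambda>x. \<Sum>b\<in>Basis. g b x *\<^sub>R b) \<in> borel_measurable borel" using g(1) by simp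
  with ae show ?thesis by (rule bexI)
qed

lemma L2_on_iff_nn_integral:
  fixes g :: "real \<Rightarrow> 'a::euclidean_space"
  assumes g [measurable]: "g \<in> borel_measurable borel" and S [measurable]: "S \<in> sets borel"
  shows "L2_on S g \<longleftrightarrow> (\<integral>\<^sup>+t. indicator S t * ennreal ((norm (g t))\<^sup>2) \<partial>lborel) < \<infinity>"
    and "L2_on S g \<Longrightarrow> (\<integral>\<^sup>+t. indicator S t * ennreal ((norm (g t))\<^sup>2) \<partial>lborel) = ennreal ((L2_norm S g)\<^sup>2)"
proof -
  have gm: "(\<lambda>x. indicator S x *\<^sub>R g x) \<in> borel_measurable lborel"
    "(\<lambda>x. indicator S x *\<^sub>R (norm (g x))\<^sup>2) \<in> borel_measurable lborel" by measurable
  have e: "ennreal (norm (indicator S t *\<^sub>R (norm (g t))\<^sup>2)) = indicator S t * ennreal ((norm (g t))\<^sup>2)" for t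
    by (auto simp: indicator_def)
  have i: "set_integrable lebesgue S (\<lambda>x. (norm (g x))\<^sup>2) \<longleftrightarrow> integrable lborel (\<lambda>x. indicator S x *\<^sub>R (norm (g x))\<^sup>2)"
    unfolding set_integrable_def by (rule integrable_completion[OF gm(2)])
  have m: "set_borel_measurable lebesgue S g"
    unfolding set_borel_measurable_def by (rule measurable_completion[OF gm(1)])
  show "L2_on S g \<longleftrightarrow> (\<integral>\<^sup>+t. indicator S t * ennreal ((norm (g t))\<^sup>2) \<partial>lborel) < \<infinity>"
    unfolding L2_on_def i integrable_iff_bounded e using m gm(2) by simp
  assume "L2_on S g"
  hence "integrable lborel (\<lambda>x. indicator S x *\<^sub>R (norm (g x))\<^sup>2)" by (simp add: L2_on_def i)
  hence "(\<integral>\<^sup>+t. ennreal (indicator S t *\<^sub>R (norm (g t))\<^sup>2) \<partial>lborel) = ennreal (\<integral>x. indicator S x *\<^sub>R (norm (g x))\<^sup>2 \<partial>lborel)"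
    by (rule nn_integral_eq_integral) simp
  also have "(\<integral>x. indicator S x *\<^sub>R (norm (g x))\<^sup>2 \<partial>lborel) = (LINT x:S|lebesgue. (norm (g x))\<^sup>2)"
    unfolding set_lebesgue_integral_def by (rule integral_completion[OF gm(2), symmetric])
  also have "\<dots> = (L2_norm S g)\<^sup>2"
    unfolding L2_norm_def by (simp add: set_lebesgue_integral_def)
  also have "(\<integral>\<^sup>+t. ennreal (indicator S t *\<^sub>R (norm (g t))\<^sup>2) \<partial>lborel) = (\<integral>\<^sup>+t. indicator S t * ennreal ((norm (g t))\<^sup>2) \<partial>lborel)"
    by (intro nn_integral_cong) (auto simp: indicator_def)
  finally show "(\<integral>\<^sup>+t. indicator S t * ennreal ((norm (g t))\<^sup>2) \<partial>lborel) = ennreal ((L2_norm S g)\<^sup>2)" .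
qed

text \<open>Squared norm in L2 of \<open>J\<close> times the unit interval. As an iterated integral
  with values in \<open>ennreal\<close> it makes sense before any integrability is known, and
  Tonelli's theorem applies freely.\<close>

definition energy :: "real set \<Rightarrow> (real \<Rightarrow> real \<Rightarrow> 'a::euclidean_space) \<Rightarrow> ennreal" where
  "energy J H = (\<integral>\<^sup>+t. \<integral>\<^sup>+x. indicator (J \<times> {0..1}) (t, x) * ennreal ((norm (H t x))\<^sup>2) \<partial>lborel \<partial>lborel)"

text \<open>2 pi times the inverse Gelfand transform: the fibres are extended quasiperiodically and
  integrated over \<open>J\<close>.\<close>

definition inverse_gelfand :: "real set \<Rightarrow> (real \<Rightarrow> real \<Rightarrow> complex ^ 'm) \<Rightarrow> real \<Rightarrow> complex ^ 'm" where
  "inverse_gelfand J H x = (LINT t:J|lebesgue. exp (\<i> * of_real t * of_int \<lfloor>x\<rfloor>) *s H t (frac x))"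

lemma measurable_frac [measurable]: "frac \<in> borel_measurable (borel :: real measure)"
  unfolding frac_def by measurable

locale inverse_gelfand_transform =
  fixes J :: "real set"
  assumes J [measurable]: "J \<in> sets borel" and J_sub: "J \<subseteq> {-pi<..pi}" and J_fin: "finite ({-pi<..pi} - J)"
begin

definition phase :: "(real \<Rightarrow> real \<Rightarrow> complex ^ 'm::finite) \<Rightarrow> real \<Rightarrow> real \<Rightarrow> complex ^ 'm" where
  "phase H x t = indicator J t *\<^sub>R (exp (\<i> * of_real t * of_int \<lfloor>x\<rfloor>) *s H t (frac x))"

lemma norm_phase: "norm (phase H x t) = indicator J t * norm (H t (frac x))"
  by (simp add: phase_def norm_smult_vec indicator_def)

lemma measurable_phase:
  assumes H: "case_prod H \<in> borel_measurable (borel :: (real \<times> real) measure)"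
  shows "(\<lambda>(x, t). phase H x t) \<in> borel_measurable (lborel \<Otimes>\<^sub>M lborel)"
proof -
  have H' [measurable]: "case_prod H \<in> borel_measurable (borel \<Otimes>\<^sub>M borel)" using H by (simp add: borel_prod)
  have "(\<lambda>(x, t). phase H x t) \<in> borel_measurable (borel \<Otimes>\<^sub>M borel)"
    unfolding phase_def by measurable
  thus ?thesis by simp
qed

lemma inverse_gelfand_eq:
  assumes H: "case_prod H \<in> borel_measurable (borel :: (real \<times> real) measure)"
  shows "inverse_gelfand J H x = (\<integral>t. phase H x t \<partial>lborel)"
    and "set_integrable lebesgue J (\<lambda>t. exp (\<i> * of_real t * of_int \<lfloor>x\<rfloor>) *s H t (frac x)) \<longleftrightarrow> integrable lborel (phase H x)"
proof -
  have "phase H x \<in> borel_measurable lborel"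
    using measurable_compose[OF measurable_Pair1' measurable_phase[OF H], of x] by simp
  thus "inverse_gelfand J H x = (\<integral>t. phase H x t \<partial>lborel)"
    "set_integrable lebesgue J (\<lambda>t. exp (\<i> * of_real t * of_int \<lfloor>x\<rfloor>) *s H t (frac x)) \<longleftrightarrow> integrable lborel (phase H x)"
    unfolding inverse_gelfand_def set_lebesgue_integral_def set_integrable_def
    using integral_completion[of "phase H x" lborel] integrable_completion[of "phase H x" lborel]
    by (simp_all add: phase_def[abs_def])
qed

lemma measurable_inverse_gelfand:
  assumes H: "case_prod H \<in> borel_measurable (borel :: (real \<times> real) measure)"
  shows "inverse_gelfand J H \<in> borel_measurable borel"
proof -
  have "(\<lambda>x. \<integral>t. phase H x t \<partial>lborel) \<in> borel_measurable lborel"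
    by (rule lborel.borel_measurable_lebesgue_integral[OF measurable_phase[OF H]])
  thus ?thesis by (simp add: inverse_gelfand_eq[OF H, abs_def])
qed

definition fibre :: "(real \<Rightarrow> real \<Rightarrow> complex ^ 'm::finite) \<Rightarrow> real \<Rightarrow> ennreal" where
  "fibre H y = (\<integral>\<^sup>+t. indicator J t * ennreal ((norm (H t y))\<^sup>2) \<partial>lborel)"

lemma measurable_fibre:
  assumes H: "case_prod H \<in> borel_measurable (borel :: (real \<times> real) measure)"
  shows "fibre H \<in> borel_measurable borel"
proof -
  have H' [measurable]: "case_prod H \<in> borel_measurable (borel \<Otimes>\<^sub>M borel)" using H by (simp add: borel_prod)
  show ?thesis unfolding fibre_def[abs_def] by measurable
qed

lemma emeasure_J: "emeasure lborel J \<le> ennreal (2 * pi)"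
proof -
  have "emeasure lborel J \<le> emeasure lborel {-pi<..pi}" using J_sub by (intro emeasure_mono) auto
  thus ?thesis by simp
qed

text \<open>Cauchy-Schwarz in t against the constant 1, whose squared norm over \<open>J\<close> is
  at most 2 pi. If the fibre integral is infinite, the bound is trivial.\<close>

lemma inverse_gelfand_pointwise:
  assumes H: "case_prod H \<in> borel_measurable (borel :: (real \<times> real) measure)"
  shows "ennreal ((norm (inverse_gelfand J H x))\<^sup>2) \<le> ennreal (2 * pi) * fibre H (frac x)"
    and "fibre H (frac x) < \<infinity> \<Longrightarrow> integrable lborel (phase H x)"
proof -
  have pm [measurable]: "phase H x \<in> borel_measurable lborel"
    using measurable_compose[OF measurable_Pair1' measurable_phase[OF H], of x] by simp
  let ?g = "\<lambda>t. norm (phase H x t)"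
  have "?g \<in> borel_measurable lborel" by measurable
  hence gm: "?g \<in> borel_measurable borel" by simp
  have fin: "(\<integral>\<^sup>+t. indicator J t * ennreal ((norm (?g t))\<^sup>2) \<partial>lborel) = fibre H (frac x)"
    unfolding fibre_def by (intro nn_integral_cong) (auto simp: norm_phase indicator_def)
  have Jl: "J \<in> sets lebesgue" by (simp add: J)
  have one: "L2_on J (\<lambda>t. 1 :: real)" "(L2_norm J (\<lambda>t. 1 :: real))\<^sup>2 \<le> 2 * pi"
  proof -
    have e: "(\<integral>\<^sup>+t. indicator J t * ennreal ((norm (1 :: real))\<^sup>2) \<partial>lborel) = emeasure lborel J"
      by (simp add: J)
    show L: "L2_on J (\<lambda>t. 1 :: real)"
      using emeasure_J by (subst L2_on_iff_nn_integral(1)) (auto simp: J e less_top[symmetric] top_unique intro: le_less_trans)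
    have "ennreal ((L2_norm J (\<lambda>t. 1 :: real))\<^sup>2) \<le> ennreal (2 * pi)"
      using L2_on_iff_nn_integral(2)[of "\<lambda>_. 1 :: real" J] L e emeasure_J by (simp add: J)
    thus "(L2_norm J (\<lambda>t. 1 :: real))\<^sup>2 \<le> 2 * pi" by simp
  qed
  have *: "integrable lborel (phase H x) \<and> ennreal ((norm (inverse_gelfand J H x))\<^sup>2) \<le> ennreal (2 * pi) * fibre H (frac x)"
    if A: "fibre H (frac x) < \<infinity>"
  proof -
    have Lg: "L2_on J ?g" using A fin by (simp add: L2_on_iff_nn_integral(1)[OF gm J])
    have gi: "integrable (lebesgue_on J) ?g"
      using integrable_norm_mult_L2[OF Jl Lg one(1)] by simp
    have "(\<integral>t. ?g t \<partial>lebesgue_on J) \<le> L2_norm J ?g * L2_norm J (\<lambda>t. 1 :: real)"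
      using Cauchy_Schwarz_L2[OF Jl Lg one(1)] by simp
    moreover have "integrable lebesgue ?g" "(\<integral>t. ?g t \<partial>lebesgue_on J) = (\<integral>t. ?g t \<partial>lebesgue)"
    proof -
      have e: "indicator J t *\<^sub>R ?g t = ?g t" for t by (auto simp: norm_phase indicator_def)
      show "integrable lebesgue ?g" using gi Jl by (simp add: integrable_restrict_space e del: real_scaleR_def)
      show "(\<integral>t. ?g t \<partial>lebesgue_on J) = (\<integral>t. ?g t \<partial>lebesgue)"
        using Jl by (simp add: integral_restrict_space e del: real_scaleR_def)
    qed
    ultimately have gi: "integrable lborel ?g" and CS: "(\<integral>t. ?g t \<partial>lborel) \<le> L2_norm J ?g * L2_norm J (\<lambda>t. 1 :: real)"
      using gm integrable_completion[of ?g lborel] integral_completion[of ?g lborel] by auto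
    have i: "integrable lborel (phase H x)" using gi pm by (simp add: integrable_norm_iff)
    have "norm (inverse_gelfand J H x) \<le> L2_norm J ?g * L2_norm J (\<lambda>t. 1 :: real)"
      unfolding inverse_gelfand_eq(1)[OF H] by (rule order_trans[OF Bochner_Integration.integral_norm_bound CS])
    hence "(norm (inverse_gelfand J H x))\<^sup>2 \<le> (L2_norm J ?g)\<^sup>2 * (L2_norm J (\<lambda>t. 1 :: real))\<^sup>2"
      unfolding power_mult_distrib[symmetric] by (intro power_mono) auto
    also have "\<dots> \<le> (L2_norm J ?g)\<^sup>2 * (2 * pi)" using one(2) by (intro mult_left_mono) auto
    finally have "ennreal ((norm (inverse_gelfand J H x))\<^sup>2) \<le> ennreal (2 * pi * (L2_norm J ?g)\<^sup>2)"
      by (intro ennreal_leI) (simp add: mult.commute)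
    also have "\<dots> = ennreal (2 * pi) * fibre H (frac x)"
      using L2_on_iff_nn_integral(2)[OF gm J Lg] fin by (subst ennreal_mult) auto
    finally show ?thesis using i by simp
  qed
  thus "fibre H (frac x) < \<infinity> \<Longrightarrow> integrable lborel (phase H x)" by simp
  show "ennreal ((norm (inverse_gelfand J H x))\<^sup>2) \<le> ennreal (2 * pi) * fibre H (frac x)"
  proof (cases "fibre H (frac x) < \<infinity>")
    case False
    hence "ennreal (2 * pi) * fibre H (frac x) = \<infinity>" by (simp add: not_less top_unique ennreal_mult_top)
    thus ?thesis by simp
  qed (use * in simp)
qed

lemma fibre_integral:
  assumes H: "case_prod H \<in> borel_measurable (borel :: (real \<times> real) measure)"
  shows "(\<integral>\<^sup>+y. indicator {0..1} y * fibre H y \<partial>lborel) = energy J H"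
proof -
  have H' [measurable]: "case_prod H \<in> borel_measurable (borel \<Otimes>\<^sub>M borel)" using H by (simp add: borel_prod)
  have "energy J H = (\<integral>\<^sup>+t. \<integral>\<^sup>+x. indicator {0..1} x * (indicator J t * ennreal ((norm (H t x))\<^sup>2)) \<partial>lborel \<partial>lborel)"
    unfolding energy_def by (intro nn_integral_cong) (auto simp: indicator_def)
  also have "\<dots> = (\<integral>\<^sup>+x. \<integral>\<^sup>+t. indicator {0..1} x * (indicator J t * ennreal ((norm (H t x))\<^sup>2)) \<partial>lborel \<partial>lborel)"
    by (rule lborel_pair.Fubini'[symmetric]) measurable
  also have "\<dots> = (\<integral>\<^sup>+y. indicator {0..1} y * fibre H y \<partial>lborel)"
    unfolding fibre_def by (intro nn_integral_cong nn_integral_cmult) measurable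
  finally show ?thesis by simp
qed

text \<open>Each of the 2 B unit cells contributes at most the integral over one period.\<close>

lemma periodic_nn_integral:
  fixes g :: "real \<Rightarrow> ennreal"
  assumes g [measurable]: "g \<in> borel_measurable borel"
  shows "(\<integral>\<^sup>+x. indicator {- real B..<real B} x * g (frac x) \<partial>lborel) \<le> of_nat (2 * B) * (\<integral>\<^sup>+y. indicator {0..1} y * g y \<partial>lborel)"
proof -
  let ?I = "{- int B..<int B}"
  have cell: "(\<integral>\<^sup>+x. indicator {of_int q..<of_int q + 1} x * g (frac x) \<partial>lborel) \<le> (\<integral>\<^sup>+y. indicator {0..1} y * g y \<partial>lborel)" for q :: int
  proof -
    have "(\<integral>\<^sup>+x. indicator {of_int q..<of_int q + 1} x * g (frac x) \<partial>lborel)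
        = (\<integral>\<^sup>+x. indicator {of_int q..<of_int q + 1} x * g (x - of_int q) \<partial>lborel)"
    proof (rule nn_integral_cong)
      fix x :: real
      have "frac x = x - of_int q" if "x \<in> {of_int q..<of_int q + 1}"
        using that floor_unique[of q x] by (simp add: frac_def)
      thus "indicator {of_int q..<of_int q + 1} x * g (frac x) = indicator {of_int q..<of_int q + 1} x * g (x - of_int q)"
        by (auto simp: indicator_def)
    qed
    also have "\<dots> = (\<integral>\<^sup>+y. indicator {of_int q..<of_int q + 1} (of_int q + 1 * y) * g (of_int q + 1 * y - of_int q) \<partial>lborel)"
      by (subst nn_integral_real_affine[where c = 1 and t = "of_int q"]) auto
    also have "\<dots> \<le> (\<integral>\<^sup>+y. indicator {0..1} y * g y \<partial>lborel)"
      by (intro nn_integral_mono) (auto simp: indicator_def)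
    finally show ?thesis .
  qed
  have "(\<integral>\<^sup>+x. indicator {- real B..<real B} x * g (frac x) \<partial>lborel)
      \<le> (\<integral>\<^sup>+x. (\<Sum>q\<in>?I. indicator {of_int q..<of_int q + 1} x * g (frac x)) \<partial>lborel)"
  proof (rule nn_integral_mono)
    fix x :: real
    show "indicator {- real B..<real B} x * g (frac x) \<le> (\<Sum>q\<in>?I. indicator {of_int q..<of_int q + 1} x * g (frac x))"
    proof (cases "x \<in> {- real B..<real B}")
      case True
      hence q: "\<lfloor>x\<rfloor> \<in> ?I" by (auto simp: le_floor_iff floor_less_iff)
      have "g (frac x) = indicator {of_int \<lfloor>x\<rfloor>..<of_int \<lfloor>x\<rfloor> + 1} x * g (frac x)" by (simp add: indicator_def)
      also have "\<dots> \<le> (\<Sum>q\<in>?I. indicator {of_int q..<of_int q + 1} x * g (frac x))"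
        by (rule member_le_sum[OF q]) auto
      finally show ?thesis using True by simp
    qed simp
  qed
  also have "\<dots> = (\<Sum>q\<in>?I. \<integral>\<^sup>+x. indicator {of_int q..<of_int q + 1} x * g (frac x) \<partial>lborel)"
    by (rule nn_integral_sum) measurable
  also have "\<dots> \<le> (\<Sum>q\<in>?I. \<integral>\<^sup>+y. indicator {0..1} y * g y \<partial>lborel)" by (intro sum_mono cell)
  also have "\<dots> = of_nat (card ?I) * (\<integral>\<^sup>+y. indicator {0..1} y * g y \<partial>lborel)" by (rule sum_constant)
  also have "card ?I = 2 * B" unfolding card_atLeastLessThan_int by linarith
  finally show ?thesis .
qed

lemma inverse_gelfand_bound:
  assumes H: "case_prod H \<in> borel_measurable (borel :: (real \<times> real) measure)"
  shows "(\<integral>\<^sup>+x. indicator {- real B..<real B} x * ennreal ((norm (inverse_gelfand J H x))\<^sup>2) \<partial>lborel)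
     \<le> of_nat (2 * B) * (ennreal (2 * pi) * energy J H)"
proof -
  have [measurable]: "fibre H \<in> borel_measurable borel" by (rule measurable_fibre[OF H])
  have "(\<integral>\<^sup>+x. indicator {- real B..<real B} x * ennreal ((norm (inverse_gelfand J H x))\<^sup>2) \<partial>lborel)
      \<le> (\<integral>\<^sup>+x. indicator {- real B..<real B} x * (ennreal (2 * pi) * fibre H (frac x)) \<partial>lborel)"
    by (intro nn_integral_mono mult_left_mono inverse_gelfand_pointwise[OF H]) auto
  also have "\<dots> \<le> of_nat (2 * B) * (\<integral>\<^sup>+y. indicator {0..1} y * (ennreal (2 * pi) * fibre H y) \<partial>lborel)"
    by (rule periodic_nn_integral) measurable
  also have "(\<integral>\<^sup>+y. indicator {0..1} y * (ennreal (2 * pi) * fibre H y) \<partial>lborel) = ennreal (2 * pi) * energy J H"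
    unfolding fibre_integral[OF H, symmetric] mult.left_commute[of "indicator _ _"]
    by (rule nn_integral_cmult) measurable
  finally show ?thesis .
qed

lemma AE_bounded_cells:
  assumes "\<And>B::nat. AE x in lborel. x \<in> {- real B..<real B} \<longrightarrow> Q x"
  shows "AE x in lborel. Q x"
proof -
  have "AE x in lborel. \<forall>B::nat. x \<in> {- real B..<real B} \<longrightarrow> Q x"
    using assms by (subst AE_all_countable) blast
  thus ?thesis
  proof eventually_elim
    case (elim x)
    obtain B where "\<bar>x\<bar> < real B" using reals_Archimedean2 by blast
    hence "x \<in> {- real B..<real B}" by (auto simp: abs_less_iff)
    with elim show ?case by blast
  qed
qed

lemma AE_integrable_phase:
  assumes H: "case_prod H \<in> borel_measurable (borel :: (real \<times> real) measure)" and E: "energy J H < \<infinity>"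
  shows "AE x in lborel. integrable lborel (phase H x)"
proof (rule AE_bounded_cells)
  fix B :: nat
  have [measurable]: "fibre H \<in> borel_measurable borel" by (rule measurable_fibre[OF H])
  have "(\<integral>\<^sup>+x. indicator {- real B..<real B} x * fibre H (frac x) \<partial>lborel) \<le> of_nat (2 * B) * energy J H"
    using periodic_nn_integral[of "fibre H" B] by (simp add: fibre_integral[OF H])
  also have "\<dots> < \<infinity>" using E by (simp add: ennreal_mult_less_top of_nat_less_top)
  finally have "AE x in lborel. indicator {- real B..<real B} x * fibre H (frac x) \<noteq> \<infinity>"
    by (intro nn_integral_noteq_infinite) auto
  thus "AE x in lborel. x \<in> {- real B..<real B} \<longrightarrow> integrable lborel (phase H x)"
    by eventually_elim (auto intro!: inverse_gelfand_pointwise(2)[OF H] simp: less_top)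
qed

lemma L2_inverse_gelfand:
  assumes H: "case_prod H \<in> borel_measurable (borel :: (real \<times> real) measure)" and E: "energy J H < \<infinity>"
  shows "L2_on {a<..<b} (inverse_gelfand J H)"
proof -
  obtain B where B: "\<bar>a\<bar> + \<bar>b\<bar> < real B" using reals_Archimedean2 by blast
  have "(\<integral>\<^sup>+t. indicator {a<..<b} t * ennreal ((norm (inverse_gelfand J H t))\<^sup>2) \<partial>lborel)
      \<le> (\<integral>\<^sup>+x. indicator {- real B..<real B} x * ennreal ((norm (inverse_gelfand J H x))\<^sup>2) \<partial>lborel)"
    using B by (intro nn_integral_mono mult_right_mono) (auto simp: indicator_def)
  also note inverse_gelfand_bound[OF H]
  also have "of_nat (2 * B) * (ennreal (2 * pi) * energy J H) < \<infinity>"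
    using E by (simp add: ennreal_mult_less_top of_nat_less_top)
  finally show ?thesis by (subst L2_on_iff_nn_integral(1)[OF measurable_inverse_gelfand[OF H]]) auto
qed

lemma L2_norm_inverse_gelfand_tendsto:
  assumes H: "\<And>K. case_prod (H K) \<in> borel_measurable (borel :: (real \<times> real) measure)"
    and lim: "(\<lambda>K. energy J (H K)) \<longlonglongrightarrow> 0" and E: "\<And>K. energy J (H K) < \<infinity>"
  shows "(\<lambda>K. L2_norm {a<..<b} (inverse_gelfand J (H K))) \<longlonglongrightarrow> 0"
proof -
  obtain B where B: "\<bar>a\<bar> + \<bar>b\<bar> < real B" using reals_Archimedean2 by blast
  have le: "ennreal ((L2_norm {a<..<b} (inverse_gelfand J (H K)))\<^sup>2) \<le> of_nat (2 * B) * (ennreal (2 * pi) * energy J (H K))" for K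
  proof -
    have "ennreal ((L2_norm {a<..<b} (inverse_gelfand J (H K)))\<^sup>2)
        = (\<integral>\<^sup>+t. indicator {a<..<b} t * ennreal ((norm (inverse_gelfand J (H K) t))\<^sup>2) \<partial>lborel)"
      by (rule L2_on_iff_nn_integral(2)[OF measurable_inverse_gelfand[OF H] _ L2_inverse_gelfand[OF H E], symmetric]) auto
    also have "\<dots> \<le> (\<integral>\<^sup>+x. indicator {- real B..<real B} x * ennreal ((norm (inverse_gelfand J (H K) x))\<^sup>2) \<partial>lborel)"
      using B by (intro nn_integral_mono mult_right_mono) (auto simp: indicator_def)
    also note inverse_gelfand_bound[OF H]
    finally show ?thesis .
  qed
  have lim': "(\<lambda>K. of_nat (2 * B) * (ennreal (2 * pi) * energy J (H K))) \<longlonglongrightarrow> of_nat (2 * B) * (ennreal (2 * pi) * 0)"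
    by (intro ennreal_tendsto_cmult lim of_nat_less_top) auto
  have "(\<lambda>K. ennreal ((L2_norm {a<..<b} (inverse_gelfand J (H K)))\<^sup>2)) \<longlonglongrightarrow> 0"
    by (intro tendsto_sandwich[OF _ _ tendsto_const lim'[unfolded mult_zero_right]] always_eventually allI le zero_le)
  hence "(\<lambda>K. (L2_norm {a<..<b} (inverse_gelfand J (H K)))\<^sup>2) \<longlonglongrightarrow> 0"
    by (subst tendsto_ennreal_iff[symmetric]) auto
  from tendsto_real_sqrt[OF this] show ?thesis by simp
qed

end

lemma energy_add_le:
  fixes G H :: "real \<Rightarrow> real \<Rightarrow> 'a::euclidean_space"
  assumes J: "J \<in> sets borel" and G: "case_prod G \<in> borel_measurable (borel :: (real \<times> real) measure)"
    and H: "case_prod H \<in> borel_measurable (borel :: (real \<times> real) measure)"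
  shows "energy J (\<lambda>t x. G t x + H t x) \<le> 2 * energy J G + 2 * energy J H"
proof -
  have [measurable]: "case_prod G \<in> borel_measurable (borel \<Otimes>\<^sub>M borel)" "case_prod H \<in> borel_measurable (borel \<Otimes>\<^sub>M borel)"
    "J \<in> sets borel" using G H J by (simp_all add: borel_prod)
  let ?w = "\<lambda>t x::real. indicator (J \<times> {0..1}) (t, x) :: ennreal"
  have [measurable]: "(\<lambda>(t, x). ?w t x) \<in> borel_measurable (borel \<Otimes>\<^sub>M borel)"
  proof -
    have "J \<times> {0..1::real} \<in> sets (borel \<Otimes>\<^sub>M borel)" using J by (intro pair_measureI) auto
    hence "(indicator (J \<times> {0..1}) :: real \<times> real \<Rightarrow> ennreal) \<in> borel_measurable (borel \<Otimes>\<^sub>M borel)"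
      by (rule borel_measurable_indicator)
    thus ?thesis by (simp add: split_def)
  qed
  have le: "ennreal ((norm (G t x + H t x))\<^sup>2) \<le> 2 * ennreal ((norm (G t x))\<^sup>2) + 2 * ennreal ((norm (H t x))\<^sup>2)" for t x
  proof -
    have "(norm (G t x + H t x))\<^sup>2 \<le> (norm (G t x) + norm (H t x))\<^sup>2"
      by (intro power_mono norm_triangle_ineq) auto
    also note square_add_le
    finally have "ennreal ((norm (G t x + H t x))\<^sup>2) \<le> ennreal (2 * (norm (G t x))\<^sup>2 + 2 * (norm (H t x))\<^sup>2)"
      by (rule ennreal_leI)
    thus ?thesis by (simp add: ennreal_mult)
  qed
  have "energy J (\<lambda>t x. G t x + H t x)
      \<le> (\<integral>\<^sup>+t. \<integral>\<^sup>+x. 2 * (?w t x * ennreal ((norm (G t x))\<^sup>2)) + 2 * (?w t x * ennreal ((norm (H t x))\<^sup>2)) \<partial>lborel \<partial>lborel)"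
    unfolding energy_def
  proof (intro nn_integral_mono)
    fix t x
    show "?w t x * ennreal ((norm (G t x + H t x))\<^sup>2)
        \<le> 2 * (?w t x * ennreal ((norm (G t x))\<^sup>2)) + 2 * (?w t x * ennreal ((norm (H t x))\<^sup>2))"
      using le[of t x] by (cases "(t, x) \<in> J \<times> {0..1}") auto
  qed
  also have "\<dots> = (\<integral>\<^sup>+t. 2 * (\<integral>\<^sup>+x. ?w t x * ennreal ((norm (G t x))\<^sup>2) \<partial>lborel) + 2 * (\<integral>\<^sup>+x. ?w t x * ennreal ((norm (H t x))\<^sup>2) \<partial>lborel) \<partial>lborel)"
    by (intro nn_integral_cong, subst nn_integral_add; (subst nn_integral_cmult)?) (auto simp: nn_integral_cmult)
  also have "\<dots> = 2 * energy J G + 2 * energy J H"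
    unfolding energy_def by (subst nn_integral_add; (subst nn_integral_cmult)?) (auto simp: nn_integral_cmult)
  finally show ?thesis .
qed

section \<open>Recovering a function from its Gelfand transform\<close>

context inverse_gelfand_transform
begin

text \<open>\<open>J\<close> differs from the closed interval from -pi to pi by finitely many
  points, so this is orthogonality of exponentials over a full period.\<close>

lemma integral_exp_period:
  "integrable lborel (\<lambda>t. indicator J t *\<^sub>R exp (\<i> * of_real t * of_int k))"
  "(\<integral>t. indicator J t *\<^sub>R exp (\<i> * of_real t * of_int k) \<partial>lborel) = (if k = 0 then 2 * of_real pi else 0)"
proof -
  let ?e = "\<lambda>t::real. exp (\<i> * of_real t * of_int k)"
  have m [measurable]: "?e \<in> borel_measurable borel" by (intro borel_measurable_continuous_onI continuous_intros)
  have ae: "AE t in lborel. indicator J t *\<^sub>R ?e t = indicator {-pi..pi} t *\<^sub>R ?e t"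
  proof -
    have "finite (insert (- pi) ({-pi<..pi} - J))" using J_fin by simp
    hence "AE t in lborel. t \<notin> insert (- pi) ({-pi<..pi} - J)"
      by (intro AE_not_in finite_imp_null_set_lborel)
    thus ?thesis
    proof eventually_elim
      case (elim t)
      hence "t \<in> J \<longleftrightarrow> t \<in> {-pi..pi}" using J_sub by force
      thus ?case by (simp add: indicator_def)
    qed
  qed
  have c: "continuous_on {-pi..pi} ?e" by (intro continuous_intros)
  have si: "set_integrable lborel {-pi..pi} ?e" by (rule borel_integrable_atLeastAtMost'[OF c])
  thus "integrable lborel (\<lambda>t. indicator J t *\<^sub>R ?e t)"
    using ae unfolding set_integrable_def by (subst integrable_cong_AE) (auto intro: J)
  have "(\<integral>t. indicator J t *\<^sub>R ?e t \<partial>lborel) = (LINT t:{-pi..pi}|lborel. ?e t)"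
    unfolding set_lebesgue_integral_def by (rule integral_cong_AE) (use ae J in auto)
  also have "\<dots> = integral {-pi..pi} ?e" by (rule set_borel_integral_eq_integral(2)[OF si])
  also have "\<dots> = (if k = 0 then 2 * of_real pi else 0)"
  proof (cases "k = 0")
    case True thus ?thesis by (simp add: scaleR_conv_of_real)
  next
    case False
    define c where "c = \<i> * of_int k"
    have c: "c \<noteq> 0" using False by (simp add: c_def)
    have e: "?e t = exp (c * of_real t)" for t by (simp add: c_def mult_ac)
    have "((\<lambda>t. exp (c * of_real t) / c) has_vector_derivative exp (c * of_real t)) (at t within {-pi..pi})" for t :: real
    proof -
      have "((\<lambda>z. exp (c * z) / c) has_field_derivative exp (c * of_real t)) (at (of_real t))"
        using c by (auto intro!: derivative_eq_intros)
      thus ?thesis using has_vector_derivative_real_field has_vector_derivative_at_within by blast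
    qed
    hence "((\<lambda>t. exp (c * of_real t)) has_integral (exp (c * of_real pi) / c - exp (c * of_real (- pi)) / c)) {-pi..pi}"
      by (intro fundamental_theorem_of_calculus) auto
    moreover have "exp (c * of_real pi) = exp (c * of_real (- pi))"
      unfolding exp_eq by (intro exI[of _ k]) (simp add: c_def algebra_simps)
    ultimately show ?thesis using False by (simp add: e[abs_def] has_integral_iff)
  qed
  finally show "(\<integral>t. indicator J t *\<^sub>R ?e t \<partial>lborel) = (if k = 0 then 2 * of_real pi else 0)" .
qed

definition gelfand_sum :: "(real \<Rightarrow> complex ^ 'm::finite) \<Rightarrow> nat \<Rightarrow> real \<Rightarrow> real \<Rightarrow> complex ^ 'm" where
  "gelfand_sum g Q t x = (\<Sum>q = - int Q..int Q. exp (- \<i> * of_int q * of_real t) *s g (x + of_int q))"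

lemma measurable_gelfand_sum:
  assumes [measurable]: "g \<in> borel_measurable borel"
  shows "case_prod (gelfand_sum g Q) \<in> borel_measurable (borel :: (real \<times> real) measure)"
  unfolding gelfand_sum_def borel_prod[symmetric] by measurable

lemma phase_gelfand_sum:
  "phase (gelfand_sum g Q) x t = (\<Sum>q = - int Q..int Q. (indicator J t *\<^sub>R exp (\<i> * of_real t * of_int (\<lfloor>x\<rfloor> - q))) *s g (frac x + of_int q))"
proof -
  have "exp (\<i> * of_real t * of_int \<lfloor>x\<rfloor>) * exp (- \<i> * of_int q * of_real t) = exp (\<i> * of_real t * of_int (\<lfloor>x\<rfloor> - q))" for q
    unfolding exp_add[symmetric] by (simp add: algebra_simps)
  thus ?thesis unfolding phase_def gelfand_sum_def
    by (simp add: vec.scale_sum_right vector_smult_assoc scaleR_sum_right vec_eq_iff)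
qed

text \<open>Integration over a period selects the term q = floor x, at which frac x + q is x. The
  identity is exact as soon as the partial sum contains that term.\<close>

lemma inverse_gelfand_sum:
  fixes g :: "real \<Rightarrow> complex ^ 'm::finite"
  assumes g: "g \<in> borel_measurable borel"
  shows "integrable lborel (phase (gelfand_sum g Q) x)"
    and "\<bar>\<lfloor>x\<rfloor>\<bar> \<le> int Q \<Longrightarrow> inverse_gelfand J (gelfand_sum g Q) x = (2 * of_real pi) *s g x"
proof -
  have bl: "bounded_linear (\<lambda>c. c *s w)" for w :: "complex ^ 'm"
    by (rule bounded_bilinear.bounded_linear_left[OF bounded_bilinear_smult])
  let ?c = "\<lambda>q t. indicator J t *\<^sub>R exp (\<i> * of_real t * of_int (\<lfloor>x\<rfloor> - q))"
  have i: "integrable lborel (\<lambda>t. ?c q t *s w)" "(\<integral>t. ?c q t *s w \<partial>lborel) = (if q = \<lfloor>x\<rfloor> then 2 * of_real pi else 0) *s w"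
    for q and w :: "complex ^ 'm"
    using integrable_bounded_linear[OF bl integral_exp_period(1)[of "\<lfloor>x\<rfloor> - q"], of w]
      integral_bounded_linear[OF bl integral_exp_period(1)[of "\<lfloor>x\<rfloor> - q"], of w] integral_exp_period(2)[of "\<lfloor>x\<rfloor> - q"]
    by auto
  show "integrable lborel (phase (gelfand_sum g Q) x)"
    unfolding phase_gelfand_sum[abs_def] by (intro Bochner_Integration.integrable_sum i)
  assume Q: "\<bar>\<lfloor>x\<rfloor>\<bar> \<le> int Q"
  have "inverse_gelfand J (gelfand_sum g Q) x = (\<Sum>q = - int Q..int Q. (if q = \<lfloor>x\<rfloor> then 2 * of_real pi else 0) *s g (frac x + of_int q))"
    unfolding inverse_gelfand_eq(1)[OF measurable_gelfand_sum[OF g]] phase_gelfand_sum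
    by (subst Bochner_Integration.integral_sum[OF i(1)]) (simp only: i(2))
  also have "\<dots> = (\<Sum>q = - int Q..int Q. if q = \<lfloor>x\<rfloor> then (2 * of_real pi) *s g (frac x + of_int q) else 0)"
    by (intro sum.cong) auto
  also have "\<dots> = (2 * of_real pi) *s g x" using Q by (simp add: frac_def abs_le_iff)
  finally show "inverse_gelfand J (gelfand_sum g Q) x = (2 * of_real pi) *s g x" .
qed

lemma phase_diff: "phase (\<lambda>t x. G t x - H t x) x t = phase G x t - phase H x t"
  by (simp add: phase_def vector_ssub_ldistrib scaleR_right_diff_distrib)

lemma phase_sum: "phase (\<lambda>t x. \<Sum>k\<in>I. H k t x) x t = (\<Sum>k\<in>I. phase (H k) x t)"
  by (simp add: phase_def vec.scale_sum_right scaleR_sum_right)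

lemma energy_gelfand_sum:
  assumes g: "g \<in> borel_measurable borel" and L: "L2_on UNIV g"
  shows "energy J (gelfand_sum g Q) < \<infinity>"
proof -
  have sh: "(\<lambda>x. g (x + c)) \<in> borel_measurable borel" for c using g by measurable
  define T where "T q t x = exp (- \<i> * of_int q * of_real t) *s g (x + of_int q)" for q :: int and t x
  have T: "case_prod (T q) \<in> borel_measurable (borel :: (real \<times> real) measure)" for q
  proof -
    note sh[measurable] g[measurable]
    show ?thesis unfolding T_def borel_prod[symmetric] by measurable
  qed
  have ET: "energy J (T q) < \<infinity>" for q
  proof -
    have "energy J (T q) \<le> (\<integral>\<^sup>+t. indicator J t * (\<integral>\<^sup>+x. ennreal ((norm (g (x + of_int q)))\<^sup>2) \<partial>lborel) \<partial>lborel)"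
      unfolding energy_def
    proof (rule nn_integral_mono)
      fix t
      have "(\<integral>\<^sup>+x. indicator (J \<times> {0..1}) (t, x) * ennreal ((norm (T q t x))\<^sup>2) \<partial>lborel)
          \<le> (\<integral>\<^sup>+x. indicator J t * ennreal ((norm (g (x + of_int q)))\<^sup>2) \<partial>lborel)"
        by (intro nn_integral_mono) (auto simp: T_def norm_smult_vec indicator_def)
      also have "\<dots> = indicator J t * (\<integral>\<^sup>+x. ennreal ((norm (g (x + of_int q)))\<^sup>2) \<partial>lborel)"
        using sh[of "of_int q"] by (intro nn_integral_cmult) measurable
      finally show "(\<integral>\<^sup>+x. indicator (J \<times> {0..1}) (t, x) * ennreal ((norm (T q t x))\<^sup>2) \<partial>lborel) \<le> \<dots>" .
    qed
    also have "(\<integral>\<^sup>+x. ennreal ((norm (g (x + of_int q)))\<^sup>2) \<partial>lborel) = (\<integral>\<^sup>+x. ennreal ((norm (g x))\<^sup>2) \<partial>lborel)"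
      using nn_integral_real_affine[of "\<lambda>x. ennreal ((norm (g x))\<^sup>2)" 1 "of_int q"] g by (simp add: add.commute)
    also have "(\<integral>\<^sup>+t. indicator J t * (\<integral>\<^sup>+x. ennreal ((norm (g x))\<^sup>2) \<partial>lborel) \<partial>lborel)
        = emeasure lborel J * (\<integral>\<^sup>+x. ennreal ((norm (g x))\<^sup>2) \<partial>lborel)"
      by (subst nn_integral_multc) (auto simp: J)
    also have "\<dots> < \<infinity>"
      using L emeasure_J L2_on_iff_nn_integral(1)[OF g, of UNIV]
      by (auto simp: ennreal_mult_less_top intro: le_less_trans)
    finally show ?thesis .
  qed
  have "case_prod (\<lambda>t x. \<Sum>q\<in>I. T q t x) \<in> borel_measurable (borel :: (real \<times> real) measure) \<and> energy J (\<lambda>t x. \<Sum>q\<in>I. T q t x) < \<infinity>" if "finite I" for I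
    using that
  proof induction
    case empty show ?case by (simp add: energy_def split_def)
  next
    case (insert q I)
    hence IH: "case_prod (\<lambda>t x. \<Sum>q\<in>I. T q t x) \<in> borel_measurable (borel :: (real \<times> real) measure)" "energy J (\<lambda>t x. \<Sum>q\<in>I. T q t x) < \<infinity>" by auto
    have "2 * energy J (T q) + 2 * energy J (\<lambda>t x. \<Sum>q\<in>I. T q t x) < \<infinity>"
      using ET[of q] IH(2) by (simp add: ennreal_mult_less_top)
    moreover have "case_prod (\<lambda>t x. T q t x + (\<Sum>q\<in>I. T q t x)) \<in> borel_measurable (borel :: (real \<times> real) measure)"
      using borel_measurable_add[OF T[of q] IH(1)] by (simp add: split_def)
    ultimately show ?case using insert energy_add_le[OF J T[of q] IH(1)] by (auto intro: le_less_trans)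
  qed
  from conjunct2[OF this[of "{- int Q..int Q}"]] show ?thesis by (simp add: T_def gelfand_sum_def[abs_def])
qed

text \<open>On a bounded interval the partial sums are inverted exactly for large Q, so the error of
  the reconstruction is the inverse transform of \<open>H\<close> minus a partial sum.\<close>

lemma gelfand_reconstruction:
  assumes g: "g \<in> borel_measurable borel" and H: "case_prod H \<in> borel_measurable (borel :: (real \<times> real) measure)"
    and L: "L2_on UNIV g" and lim: "(\<lambda>Q. energy J (\<lambda>t x. H t x - gelfand_sum g Q t x)) \<longlonglongrightarrow> 0"
  shows "energy J H < \<infinity>" and "AE x in lborel. inverse_gelfand J H x = (2 * of_real pi) *s g x"
proof -
  let ?D = "\<lambda>Q t x. H t x - gelfand_sum g Q t x"
  have D: "case_prod (?D Q) \<in> borel_measurable (borel :: (real \<times> real) measure)" for Q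
    using borel_measurable_diff[OF H measurable_gelfand_sum[OF g]] by (simp add: split_def)
  have "\<forall>\<^sub>F Q in sequentially. energy J (?D Q) < 1" by (rule order_tendstoD(2)[OF lim]) simp
  then obtain Q0 where Q0: "\<And>Q. Q \<ge> Q0 \<Longrightarrow> energy J (?D Q) < 1" by (auto simp: eventually_sequentially)
  hence fin: "energy J (?D Q) < \<infinity>" if "Q \<ge> Q0" for Q using order.strict_trans[OF Q0[OF that] ennreal_one_less_top] by simp
  have "energy J (\<lambda>t x. ?D Q0 t x + gelfand_sum g Q0 t x) \<le> 2 * energy J (?D Q0) + 2 * energy J (gelfand_sum g Q0)"
    by (rule energy_add_le[OF J D measurable_gelfand_sum[OF g]])
  also have "\<dots> < \<infinity>" using fin[of Q0] energy_gelfand_sum[OF g L, of Q0] by (simp add: ennreal_mult_less_top)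
  finally show E: "energy J H < \<infinity>" by simp
  have IHm: "inverse_gelfand J H \<in> borel_measurable borel" by (rule measurable_inverse_gelfand[OF H])
  show "AE x in lborel. inverse_gelfand J H x = (2 * of_real pi) *s g x"
  proof (rule AE_bounded_cells)
    fix B :: nat
    let ?R = "\<lambda>x. indicator {- real B..<real B} x * ennreal ((norm (inverse_gelfand J H x - (2 * of_real pi) *s g x))\<^sup>2)"
    have Rm: "?R \<in> borel_measurable lborel" using IHm g by measurable
    \<comment> \<open>The left side does not depend on Q, while the right side tends to 0.\<close>
    have le: "(\<integral>\<^sup>+x. ?R x \<partial>lborel) \<le> of_nat (2 * B) * (ennreal (2 * pi) * energy J (?D Q))" if Q: "Q \<ge> max Q0 B" for Q
    proof -
      have "AE x in lborel. ?R x = indicator {- real B..<real B} x * ennreal ((norm (inverse_gelfand J (?D Q) x))\<^sup>2)"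
        using AE_integrable_phase[OF H E]
      proof eventually_elim
        case (elim x)
        show ?case
        proof (cases "x \<in> {- real B..<real B}")
          case True
          hence "- int B \<le> \<lfloor>x\<rfloor>" "\<lfloor>x\<rfloor> < int B" by (auto simp: le_floor_iff floor_less_iff)
          hence "\<bar>\<lfloor>x\<rfloor>\<bar> \<le> int Q" using Q by auto
          from inverse_gelfand_sum(2)[OF g this]
          have "inverse_gelfand J (?D Q) x = inverse_gelfand J H x - (2 * of_real pi) *s g x"
            using elim inverse_gelfand_sum(1)[OF g, of Q x]
            by (simp add: inverse_gelfand_eq(1)[OF D] inverse_gelfand_eq(1)[OF H] phase_diff
                inverse_gelfand_eq(1)[OF measurable_gelfand_sum[OF g]])
          thus ?thesis by simp
        qed simp
      qed
      hence "(\<integral>\<^sup>+x. ?R x \<partial>lborel) = (\<integral>\<^sup>+x. indicator {- real B..<real B} x * ennreal ((norm (inverse_gelfand J (?D Q) x))\<^sup>2) \<partial>lborel)"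
        by (rule nn_integral_cong_AE)
      thus ?thesis using inverse_gelfand_bound[OF D[of Q], of B] by simp
    qed
    have "(\<lambda>Q. of_nat (2 * B) * (ennreal (2 * pi) * energy J (?D Q))) \<longlonglongrightarrow> of_nat (2 * B) * (ennreal (2 * pi) * 0)"
      by (intro ennreal_tendsto_cmult lim of_nat_less_top) auto
    hence "(\<integral>\<^sup>+x. ?R x \<partial>lborel) \<le> of_nat (2 * B) * (ennreal (2 * pi) * 0)"
      by (rule LIMSEQ_le_const) (use le in blast)
    hence "(\<integral>\<^sup>+x. ?R x \<partial>lborel) = 0" by simp
    hence "AE x in lborel. ?R x = 0" using Rm by (simp add: nn_integral_0_iff_AE)
    thus "AE x in lborel. x \<in> {- real B..<real B} \<longrightarrow> inverse_gelfand J H x = (2 * of_real pi) *s g x"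
      by eventually_elim (auto simp: indicator_def)
  qed
qed

end

section \<open>Integrating the fibrewise expansions\<close>

text \<open>What the analysis of single fibres passes on to the integration over t. The constant
  \<open>C\<close> is independent of t, as domination demands; dependence on t enters only through
  the kernels, which are blind to the phases.\<close>

locale bloch_expansion = inverse_gelfand_transform J for J +
  fixes Psi Psi_star :: "nat \<Rightarrow> real \<Rightarrow> real \<Rightarrow> complex ^ 'm::finite" and N1 :: nat and C :: real
  assumes Psi_cont: "\<And>p t. p \<ge> 1 \<Longrightarrow> t \<in> J \<Longrightarrow> continuous_on {0..1} (Psi p t)"
    and kernel_cont: "\<And>p q i. p \<ge> 1 \<Longrightarrow> q \<in> {0..1} \<Longrightarrow>
      continuous_on (J \<times> {0..1}) (\<lambda>(t, x). cnj (Psi p t q $ i) *s Psi p t x)"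
    and L2_dual: "\<And>p t. p \<ge> 1 \<Longrightarrow> t \<in> J \<Longrightarrow> L2_on {0..1} (dual_eigenfunction (Psi p t) (Psi_star p t))"
    and inner_dual: "\<And>p q t. p \<ge> 1 \<Longrightarrow> q \<ge> 1 \<Longrightarrow> t \<in> J \<Longrightarrow>
      L2_inner {0..1} (Psi q t) (dual_eigenfunction (Psi p t) (Psi_star p t)) = (if p = q then 1 else 0)"
    and fibre_expansion: "\<And>f t. L2_on {0..1} f \<Longrightarrow> t \<in> J \<Longrightarrow> (\<lambda>K. L2_norm {0..1} (\<lambda>x. f x -
      (\<Sum>p=1..K. L2_inner {0..1} f (dual_eigenfunction (Psi p t) (Psi_star p t)) *s Psi p t x))) \<longlonglongrightarrow> 0"
    and C: "0 \<le> C"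
    and tail: "\<And>f t S. L2_on {0..1} f \<Longrightarrow> t \<in> J \<Longrightarrow> finite S \<Longrightarrow> S \<subseteq> {N1<..} \<Longrightarrow> L2_norm {0..1} (\<lambda>x.
      \<Sum>p\<in>S. L2_inner {0..1} f (dual_eigenfunction (Psi p t) (Psi_star p t)) *s Psi p t x) \<le> C * L2_norm {0..1} f"
begin

section \<open>Borel versions of the projections\<close>

abbreviation dl :: "nat \<Rightarrow> real \<Rightarrow> real \<Rightarrow> complex ^ 'm" where
  "dl p t \<equiv> dual_eigenfunction (Psi p t) (Psi_star p t)"

definition component :: "(real \<Rightarrow> real \<Rightarrow> complex ^ 'm) \<Rightarrow> nat \<Rightarrow> real \<Rightarrow> real \<Rightarrow> complex ^ 'm" where
  "component G p t x = L2_inner {0..1} (G t) (dl p t) *s Psi p t x"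

text \<open>The functions \<open>cnj (\<Psi>\<^sub>p\<^sub>,\<^sub>t(q)\<^sub>i) \<Psi>\<^sub>p\<^sub>,\<^sub>t(x)\<close> do not depend on the choice of phases and are jointly
  continuous. Rational combinations of them, coded by lists, are dense in each fibre; choosing the
  first one in an enumeration that is close to \<open>G t\<close> makes its \<open>p\<close>-th part depend measurably on \<open>t\<close>.\<close>

definition atoms :: "(nat \<times> real \<times> 'm \<times> complex) set" where
  "atoms = {1..} \<times> (\<rat> \<inter> {0..1}) \<times> UNIV \<times> {c. Re c \<in> \<rat> \<and> Im c \<in> \<rat>}"

definition comb :: "(nat \<times> real \<times> 'm \<times> complex) list \<Rightarrow> real \<Rightarrow> real \<Rightarrow> complex ^ 'm" where
  "comb L t x = (\<Sum>(p, q, i, c)\<leftarrow>L. c *s (cnj (Psi p t q $ i) *s Psi p t x))"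

lemma countable_atoms: "countable atoms"
proof -
  have "{c. Re c \<in> \<rat> \<and> Im c \<in> \<rat>} = (\<lambda>(a, b). Complex a b) ` (\<rat> \<times> \<rat>)"
  proof (intro equalityI subsetI)
    fix c assume "c \<in> {c. Re c \<in> \<rat> \<and> Im c \<in> \<rat>}"
    thus "c \<in> (\<lambda>(a, b). Complex a b) ` (\<rat> \<times> \<rat>)" by (intro image_eqI[of _ _ "(Re c, Im c)"]) auto
  qed auto
  hence "countable {c. Re c \<in> \<rat> \<and> Im c \<in> \<rat>}" using countable_rat by auto
  moreover have "countable (\<rat> \<inter> {0..1 :: real})" using countable_rat by (rule countable_subset[rotated]) auto
  moreover have "countable (UNIV :: 'm set)" by (rule countable_finite) simp
  ultimately show ?thesis unfolding atoms_def by (intro countable_SIGMA) auto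
qed

lemma comb_simps: "comb [] t x = 0"
  "comb ((p, q, i, c) # L) t x = c *s (cnj (Psi p t q $ i) *s Psi p t x) + comb L t x"
  by (simp_all add: comb_def)

lemma continuous_comb: "L \<in> lists atoms \<Longrightarrow> continuous_on (J \<times> {0..1}) (\<lambda>(t, x). comb L t x)"
proof (induction L)
  case (Cons a L)
  obtain p q i c where a: "a = (p, q, i, c)" by (cases a)
  have "continuous_on (J \<times> {0..1}) (\<lambda>s. c *s (case s of (t, x) \<Rightarrow> cnj (Psi p t q $ i) *s Psi p t x) + (case s of (t, x) \<Rightarrow> comb L t x))"
    using Cons by (intro continuous_intros kernel_cont) (auto simp: a atoms_def)
  thus ?case by (simp add: a comb_simps split_def)
qed (simp add: comb_simps split_def)

lemma L2_comb: "L \<in> lists atoms \<Longrightarrow> t \<in> J \<Longrightarrow> L2_on {0..1} (comb L t)"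
proof (induction L)
  case Nil thus ?case by (simp add: comb_simps[abs_def] L2_on_zero)
next
  case (Cons a L)
  obtain p q i c where a: "a = (p, q, i, c)" by (cases a)
  have "L2_on {0..1} (\<lambda>x. c *s (cnj (Psi p t q $ i) *s Psi p t x) + comb L t x)"
    using Cons by (intro unit_L2_add unit_L2_scale L2_on_continuous[OF Psi_cont]) (auto simp: a atoms_def)
  thus ?case by (simp add: a comb_simps[abs_def])
qed

text \<open>Biorthogonality filters out the atoms of index p, so a projection of a combination is
  again a combination, and the dual function disappears from the formula.\<close>

lemma component_comb:
  assumes "t \<in> J" "p \<ge> 1"
  shows "L \<in> lists atoms \<Longrightarrow> L2_inner {0..1} (comb L t) (dl p t) *s Psi p t x = comb (filter (\<lambda>a. fst a = p) L) t x"
proof (induction L)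
  case Nil thus ?case by (simp add: comb_simps[abs_def] L2_inner_zero_left)
next
  case (Cons a L)
  obtain r q i c where a: "a = (r, q, i, c)" by (cases a)
  have r: "r \<ge> 1" and L: "L \<in> lists atoms" using Cons.prems by (auto simp: a atoms_def)
  have P: "L2_on {0..1} (Psi r t)" by (intro L2_on_continuous Psi_cont assms r)
  have "L2_inner {0..1} (comb (a # L) t) (dl p t)
      = L2_inner {0..1} (\<lambda>x. c *s (cnj (Psi r t q $ i) *s Psi r t x) + comb L t x) (dl p t)"
    by (simp add: a comb_simps[abs_def])
  also have "\<dots> = c * (cnj (Psi r t q $ i) * (if p = r then 1 else 0)) + L2_inner {0..1} (comb L t) (dl p t)"
    by (subst unit_inner_add_left)
      (auto intro!: unit_L2_scale P L2_comb L2_dual assms L simp: unit_inner_scale_left inner_dual[OF assms(2) r assms(1)])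
  finally have ip: "L2_inner {0..1} (comb (a # L) t) (dl p t)
      = c * (cnj (Psi r t q $ i) * (if p = r then 1 else 0)) + L2_inner {0..1} (comb L t) (dl p t)" .
  show ?case unfolding ip vector_sadd_rdistrib Cons.IH[OF L]
    by (auto simp: a comb_simps vector_smult_assoc)
qed

text \<open>A continuous function vanishing at all rational points would be zero, against its
  pairing 1 with the dual function. The nonzero value makes \<open>cnj (Psi p t q $ i)\<close>
  usable as a divisor.\<close>

lemma ex_rational_nonzero:
  assumes "p \<ge> 1" "t \<in> J" shows "\<exists>q\<in>\<rat> \<inter> {0..1}. \<exists>i. Psi p t q $ i \<noteq> 0"
proof (rule ccontr)
  assume "\<not> ?thesis"
  hence z: "Psi p t q = 0" if "q \<in> \<rat> \<inter> {0..1}" for q using that by (auto simp: vec_eq_iff)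
  have "{0..1::real} \<subseteq> closure (\<rat> \<inter> {0..1})"
  proof
    fix x :: real assume x: "x \<in> {0..1}"
    show "x \<in> closure (\<rat> \<inter> {0..1})"
      unfolding closure_approachable
    proof (intro allI impI)
      fix e :: real assume e: "0 < e"
      define a b where "a = max 0 (x - e)" and "b = min 1 (x + e)"
      have "a < b" using x e by (auto simp: a_def b_def)
      then obtain q where "q \<in> \<rat>" "a < q" "q < b" using Rats_dense_in_real by blast
      thus "\<exists>y\<in>\<rat> \<inter> {0..1}. dist y x < e" by (intro bexI[of _ q]) (auto simp: a_def b_def dist_real_def abs_less_iff)
    qed
  qed
  hence "closure (\<rat> \<inter> {0..1}) = {0..1::real}" by (intro equalityI closure_minimal) auto
  hence "continuous_on (closure (\<rat> \<inter> {0..1})) (Psi p t)" using Psi_cont[OF assms] by simp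
  hence "Psi p t x = 0" if "x \<in> {0..1}" for x
    using continuous_constant_on_closure[of "\<rat> \<inter> {0..1}" "Psi p t" 0 x] z that \<open>closure _ = _\<close> by simp
  hence "L2_inner {0..1} (Psi p t) (dl p t) = L2_inner {0..1} (\<lambda>x. 0) (dl p t)"
    unfolding L2_inner_eq[OF unit_interval_sets] by (intro Bochner_Integration.integral_cong) auto
  with inner_dual[OF assms(1,1,2)] show False by (simp add: L2_inner_zero_left)
qed

lemma complex_rational_approx: "0 < e \<Longrightarrow> \<exists>c. Re c \<in> \<rat> \<and> Im c \<in> \<rat> \<and> cmod (c - z) < e"
proof -
  assume e: "0 < e"
  obtain a where a: "a \<in> \<rat>" "Re z < a" "a < Re z + e / 2" using Rats_dense_in_real[of "Re z" "Re z + e / 2"] e by auto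
  obtain b where b: "b \<in> \<rat>" "Im z < b" "b < Im z + e / 2" using Rats_dense_in_real[of "Im z" "Im z + e / 2"] e by auto
  have "cmod (Complex a b - z) \<le> \<bar>a - Re z\<bar> + \<bar>b - Im z\<bar>" using cmod_le[of "Complex a b - z"] by simp
  thus ?thesis using a b by (intro exI[of _ "Complex a b"]) auto
qed

text \<open>A coefficient d_p of the fibre expansion is approximated by c times
  \<open>cnj (Psi p t q $ i)\<close> with c a rational approximation of the quotient, so that phase
  blind kernels reproduce the partial sums.\<close>

lemma comb_dense:
  assumes g: "L2_on {0..1} g" and t: "t \<in> J" and e: "0 < e"
  shows "\<exists>L\<in>lists atoms. L2_norm {0..1} (\<lambda>x. g x - comb L t x) < e"
proof -
  have P: "L2_on {0..1} (Psi p t)" if "p \<ge> 1" for p by (intro L2_on_continuous Psi_cont that t)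
  define d where "d p = L2_inner {0..1} g (dl p t)" for p
  have "\<forall>\<^sub>F K in sequentially. L2_norm {0..1} (\<lambda>x. g x - (\<Sum>p=1..K. d p *s Psi p t x)) < e / 2"
    unfolding d_def by (rule order_tendstoD(2)[OF fibre_expansion[OF g t]]) (use e in simp)
  then obtain K where K: "L2_norm {0..1} (\<lambda>x. g x - (\<Sum>p=1..K. d p *s Psi p t x)) < e / 2"
    by (auto simp: eventually_sequentially)
  \<comment> \<open>Distributes e / 2 over at most K terms; the added 1 keeps the denominator
    positive.\<close>
  define \<delta> where "\<delta> p = e / 2 / (real (Suc K) * (L2_norm {0..1} (Psi p t) + 1))" for p
  have \<delta>: "0 < \<delta> p" for p using e unit_norm_nonneg[of "Psi p t"] by (simp add: \<delta>_def add_nonneg_pos)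
  have "\<exists>q i c. q \<in> \<rat> \<inter> {0..1} \<and> Re c \<in> \<rat> \<and> Im c \<in> \<rat> \<and> cmod (c * cnj (Psi p t q $ i) - d p) < \<delta> p" if p: "p \<ge> 1" for p
  proof -
    obtain q i where q: "q \<in> \<rat> \<inter> {0..1}" "Psi p t q $ i \<noteq> 0" using ex_rational_nonzero[OF p t] by blast
    let ?w = "cnj (Psi p t q $ i)"
    obtain c where c: "Re c \<in> \<rat>" "Im c \<in> \<rat>" "cmod (c - d p / ?w) < \<delta> p / cmod ?w"
      using complex_rational_approx[of "\<delta> p / cmod ?w" "d p / ?w"] \<delta>[of p] q by auto
    have "c * ?w - d p = (c - d p / ?w) * ?w" using q by (simp add: field_simps)
    hence "cmod (c * ?w - d p) = cmod (c - d p / ?w) * cmod ?w" by (simp only: norm_mult)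
    also have "\<dots> < \<delta> p" using c(3) q by (simp add: pos_less_divide_eq)
    finally show ?thesis using q c by blast
  qed
  then obtain q i c where qic: "\<And>p. p \<ge> 1 \<Longrightarrow> q p \<in> \<rat> \<inter> {0..1}" "\<And>p. p \<ge> 1 \<Longrightarrow> Re (c p) \<in> \<rat>" "\<And>p. p \<ge> 1 \<Longrightarrow> Im (c p) \<in> \<rat>"
    "\<And>p. p \<ge> 1 \<Longrightarrow> cmod (c p * cnj (Psi p t (q p) $ i p) - d p) < \<delta> p" by metis
  define L where "L = map (\<lambda>p. (p, q p, i p, c p)) [1..<Suc K]"
  have L: "L \<in> lists atoms" using qic by (auto simp: L_def atoms_def)
  have cL: "comb L t x = (\<Sum>p=1..K. (c p * cnj (Psi p t (q p) $ i p)) *s Psi p t x)" for x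
    unfolding comb_def L_def
    by (simp add: o_def interv_sum_list_conv_sum_set_nat vector_smult_assoc atLeastLessThanSuc_atLeastAtMost del: upt_Suc)
  let ?s = "\<lambda>x. \<Sum>p=1..K. d p *s Psi p t x"
  let ?r = "\<lambda>x. \<Sum>p=1..K. (d p - c p * cnj (Psi p t (q p) $ i p)) *s Psi p t x"
  have Ls: "L2_on {0..1} ?s" by (intro unit_L2_lincomb P) auto
  have Lr: "L2_on {0..1} ?r" by (intro unit_L2_lincomb P) auto
  have eq: "g x - comb L t x = (g x - ?s x) + ?r x" for x
    unfolding cL by (simp add: vector_sub_rdistrib sum_subtractf)
  have "L2_norm {0..1} (\<lambda>x. g x - comb L t x) \<le> L2_norm {0..1} (\<lambda>x. g x - ?s x) + L2_norm {0..1} ?r"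
    unfolding eq by (rule unit_norm_triangle[OF unit_L2_diff[OF g Ls] Lr])
  also have "L2_norm {0..1} ?r \<le> (\<Sum>p=1..K. L2_norm {0..1} (\<lambda>x. (d p - c p * cnj (Psi p t (q p) $ i p)) *s Psi p t x))"
    by (intro unit_norm_sum_le unit_L2_scale P) auto
  also have "\<dots> \<le> (\<Sum>p=1..K. e / 2 / real (Suc K))"
    unfolding unit_norm_scale
  proof (rule sum_mono)
    fix p assume "p \<in> {1..K}"
    hence "cmod (d p - c p * cnj (Psi p t (q p) $ i p)) \<le> \<delta> p" using qic(4)[of p] by (simp add: norm_minus_commute)
    hence "cmod (d p - c p * cnj (Psi p t (q p) $ i p)) * L2_norm {0..1} (Psi p t) \<le> \<delta> p * (L2_norm {0..1} (Psi p t) + 1)"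
      using \<delta>[of p] by (intro mult_mono) auto
    also have "\<dots> = e / 2 / real (Suc K)"
    proof -
      have "L2_norm {0..1} (Psi p t) + 1 \<noteq> 0" using unit_norm_nonneg[of "Psi p t"] by linarith
      thus ?thesis by (simp add: \<delta>_def del: of_nat_Suc)
    qed
    finally show "cmod (d p - c p * cnj (Psi p t (q p) $ i p)) * L2_norm {0..1} (Psi p t) \<le> e / 2 / real (Suc K)" .
  qed
  also have "\<dots> \<le> e / 2" using e by (simp add: field_simps)
  finally show ?thesis using K L by (intro bexI[of _ L]) auto
qed

text \<open>Extension by zero turns continuity on \<open>J\<close> times the unit interval into
  Borel measurability on the plane.\<close>

definition cut :: "(real \<Rightarrow> real \<Rightarrow> complex ^ 'm) \<Rightarrow> real \<times> real \<Rightarrow> complex ^ 'm" where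
  "cut W s = indicator (J \<times> {0..1}) s *\<^sub>R (case s of (t, x) \<Rightarrow> W t x)"

lemma cut_eq [simp]: "t \<in> J \<Longrightarrow> x \<in> {0..1} \<Longrightarrow> cut W (t, x) = W t x"
  by (simp add: cut_def)

lemma measurable_cut_comb: "L \<in> lists atoms \<Longrightarrow> cut (comb L) \<in> borel_measurable borel"
  unfolding cut_def[abs_def]
proof (rule borel_measurable_continuous_on_indicator)
  have "J \<times> {0..1::real} \<in> sets (borel \<Otimes>\<^sub>M borel)" using J by (intro pair_measureI) auto
  thus "J \<times> {0..1::real} \<in> sets borel" by (simp only: borel_prod)
qed (rule continuous_comb)

definition nth_comb :: "nat \<Rightarrow> (nat \<times> real \<times> 'm \<times> complex) list" where
  "nth_comb = from_nat_into (lists atoms)"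

lemma nth_comb_in: "nth_comb n \<in> lists atoms"
  unfolding nth_comb_def by (rule from_nat_into) auto

definition dist2 :: "(real \<Rightarrow> real \<Rightarrow> complex ^ 'm) \<Rightarrow> nat \<Rightarrow> real \<Rightarrow> ennreal" where
  "dist2 G n t = (\<integral>\<^sup>+x. indicator {0..1} x * ennreal ((norm (G t x - cut (comb (nth_comb n)) (t, x)))\<^sup>2) \<partial>lborel)"

definition choice :: "(real \<Rightarrow> real \<Rightarrow> complex ^ 'm) \<Rightarrow> nat \<Rightarrow> real \<Rightarrow> nat" where
  "choice G j t = (LEAST n. dist2 G n t < ennreal ((1 / real (Suc j))\<^sup>2))"

definition approximant :: "(real \<Rightarrow> real \<Rightarrow> complex ^ 'm) \<Rightarrow> nat \<Rightarrow> nat \<Rightarrow> real \<times> real \<Rightarrow> complex ^ 'm" where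
  "approximant G p j s = cut (comb (filter (\<lambda>a. fst a = p) (nth_comb (choice G j (fst s))))) s"

text \<open>Borel on the whole plane, whatever \<open>lim\<close> yields where the sequence
  diverges; it coincides with \<open>component G p\<close> for p \<ge> 1 on the fibres over
  \<open>J\<close> with square integrable \<open>G t\<close>.\<close>

definition version :: "(real \<Rightarrow> real \<Rightarrow> complex ^ 'm) \<Rightarrow> nat \<Rightarrow> real \<Rightarrow> real \<Rightarrow> complex ^ 'm" where
  "version G p t x = lim (\<lambda>j. approximant G p j (t, x))"

context
  fixes G :: "real \<Rightarrow> real \<Rightarrow> complex ^ 'm"
  assumes G: "case_prod G \<in> borel_measurable (borel :: (real \<times> real) measure)"
begin

lemma measurable_dist2: "dist2 G n \<in> borel_measurable borel"
proof -
  have [measurable]: "case_prod G \<in> borel_measurable (borel \<Otimes>\<^sub>M borel)" using G by (simp add: borel_prod)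
  have [measurable]: "cut (comb (nth_comb n)) \<in> borel_measurable (borel \<Otimes>\<^sub>M borel)"
    using measurable_cut_comb[OF nth_comb_in] by (simp add: borel_prod)
  show ?thesis unfolding dist2_def[abs_def] by measurable
qed

lemma measurable_version: "case_prod (version G p) \<in> borel_measurable (borel :: (real \<times> real) measure)"
proof -
  have "choice G j \<in> measurable borel (count_space UNIV)" for j
    unfolding choice_def[abs_def]
    by (intro measurable_Least) (use measurable_dist2 in measurable)
  hence c: "(\<lambda>s. choice G j (fst s)) \<in> measurable (borel :: (real \<times> real) measure) (count_space UNIV)" for j
    using measurable_compose[of fst "borel :: (real \<times> real) measure" borel] by (auto simp: borel_prod[symmetric])
  have "approximant G p j \<in> borel_measurable borel" for j
    unfolding approximant_def[abs_def]
  proof (rule measurable_compose_countable[OF _ c])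
    fix n
    have "filter (\<lambda>a. fst a = p) (nth_comb n) \<in> lists atoms" using nth_comb_in[of n] by auto
    thus "cut (comb (filter (\<lambda>a. fst a = p) (nth_comb n))) \<in> borel_measurable borel" by (rule measurable_cut_comb)
  qed
  hence "(\<lambda>s. lim (\<lambda>j. approximant G p j s)) \<in> borel_measurable borel" by (rule borel_measurable_lim_metric)
  thus ?thesis by (simp add: version_def split_def)
qed

lemma measurable_section: "G t \<in> borel_measurable borel"
proof -
  have "case_prod G \<in> borel_measurable (borel \<Otimes>\<^sub>M borel)" using G by (simp add: borel_prod)
  from measurable_compose[OF measurable_Pair1' this, of t] show ?thesis by simp
qed

text \<open>The p-th coefficient is a bounded functional on the fibre and \<open>Psi p t x\<close> a
  fixed vector, so closeness in L2 gives convergence at every x of the unit interval, not merely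
  almost everywhere.\<close>

lemma version_eq:
  assumes t: "t \<in> J" and Gt: "L2_on {0..1} (G t)" and x: "x \<in> {0..1}" and p: "p \<ge> 1"
  shows "version G p t x = component G p t x"
proof -
  let ?n = "\<lambda>j. choice G j t"
  have Lc: "L2_on {0..1} (comb (nth_comb n) t)" for n by (rule L2_comb[OF nth_comb_in t])
  have d2: "dist2 G n t = ennreal ((L2_norm {0..1} (\<lambda>x. G t x - comb (nth_comb n) t x))\<^sup>2)" for n
  proof -
    have cm: "(\<lambda>x. cut (comb (nth_comb n)) (t, x)) \<in> borel_measurable borel"
    proof -
      have "cut (comb (nth_comb n)) \<in> borel_measurable (borel \<Otimes>\<^sub>M borel)"
        using measurable_cut_comb[OF nth_comb_in] by (simp add: borel_prod)
      from measurable_compose[OF measurable_Pair1' this, of t] show ?thesis by simp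
    qed
    let ?g = "\<lambda>x. G t x - cut (comb (nth_comb n)) (t, x)"
    have gm: "?g \<in> borel_measurable borel" using measurable_section[of t] cm by measurable
    have "L2_on {0..1} (\<lambda>x. G t x - comb (nth_comb n) t x)" by (rule unit_L2_diff[OF Gt Lc])
    hence "L2_on {0..1} ?g"
      by (rule L2_on_cong_AE[OF unit_interval_sets]) (use t in auto)
    from L2_on_iff_nn_integral(2)[OF gm _ this]
    have "dist2 G n t = ennreal ((L2_norm {0..1} ?g)\<^sup>2)" unfolding dist2_def by simp
    also have "L2_norm {0..1} ?g = L2_norm {0..1} (\<lambda>x. G t x - comb (nth_comb n) t x)"
      by (rule L2_norm_cong[OF unit_interval_sets]) (use t in auto)
    finally show ?thesis .
  qed
  have near: "L2_norm {0..1} (\<lambda>x. G t x - comb (nth_comb (?n j)) t x) < 1 / real (Suc j)" for j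
  proof -
    have "\<exists>n. dist2 G n t < ennreal ((1 / real (Suc j))\<^sup>2)"
    proof -
      obtain L where L: "L \<in> lists atoms" "L2_norm {0..1} (\<lambda>x. G t x - comb L t x) < 1 / real (Suc j)"
        using comb_dense[OF Gt t, of "1 / real (Suc j)"] by auto
      obtain n where "nth_comb n = L"
        unfolding nth_comb_def using from_nat_into_surj[OF countable_lists[OF countable_atoms] L(1)] by blast
      with L(2) have "dist2 G n t < ennreal ((1 / real (Suc j))\<^sup>2)"
        unfolding d2 by (intro ennreal_lessI power_strict_mono) auto
      thus ?thesis by blast
    qed
    from LeastI_ex[OF this] have "dist2 G (?n j) t < ennreal ((1 / real (Suc j))\<^sup>2)"
      unfolding choice_def .
    hence "ennreal ((L2_norm {0..1} (\<lambda>x. G t x - comb (nth_comb (?n j)) t x))\<^sup>2) < ennreal ((1 / real (Suc j))\<^sup>2)"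
      unfolding d2 .
    hence "(L2_norm {0..1} (\<lambda>x. G t x - comb (nth_comb (?n j)) t x))\<^sup>2 < (1 / real (Suc j))\<^sup>2"
      by (subst (asm) ennreal_less_iff) auto
    thus ?thesis by (rule power_less_imp_less_base) simp
  qed
  have "(\<lambda>j. approximant G p j (t, x)) \<longlonglongrightarrow> component G p t x"
  proof (rule Lim_null_comparison[THEN LIM_zero_cancel])
    let ?M = "L2_norm {0..1} (dl p t) * norm (Psi p t x)"
    show "\<forall>\<^sub>F j in sequentially. norm (approximant G p j (t, x) - component G p t x) \<le> 1 / real (Suc j) * ?M"
    proof (intro always_eventually allI)
      fix j
      have a: "approximant G p j (t, x) = L2_inner {0..1} (comb (nth_comb (?n j)) t) (dl p t) *s Psi p t x"
        using t x component_comb[OF t p nth_comb_in] by (simp add: approximant_def)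
      have "component G p t x - approximant G p j (t, x)
          = L2_inner {0..1} (\<lambda>x. G t x - comb (nth_comb (?n j)) t x) (dl p t) *s Psi p t x"
        unfolding a component_def unit_inner_diff_left[OF Gt Lc L2_dual[OF p t]] by (simp add: vector_sub_rdistrib)
      hence "norm (approximant G p j (t, x) - component G p t x)
          = cmod (L2_inner {0..1} (\<lambda>x. G t x - comb (nth_comb (?n j)) t x) (dl p t)) * norm (Psi p t x)"
        by (simp only: norm_minus_commute[of "approximant G p j (t, x)"] norm_smult_vec)
      also have "\<dots> \<le> (L2_norm {0..1} (\<lambda>x. G t x - comb (nth_comb (?n j)) t x) * L2_norm {0..1} (dl p t)) * norm (Psi p t x)"
        by (intro mult_right_mono unit_inner_le unit_L2_diff Gt Lc L2_dual p t) auto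
      also have "\<dots> \<le> (1 / real (Suc j) * L2_norm {0..1} (dl p t)) * norm (Psi p t x)"
        by (intro mult_right_mono less_imp_le[OF near]) auto
      finally show "norm (approximant G p j (t, x) - component G p t x) \<le> 1 / real (Suc j) * ?M" by (simp add: mult.assoc)
    qed
    have "(\<lambda>j. 1 / real (Suc j)) \<longlonglongrightarrow> 0" by (rule lim_1_over_n[THEN LIMSEQ_Suc])
    from tendsto_mult_right[OF this, of ?M] show "(\<lambda>j. 1 / real (Suc j) * ?M) \<longlonglongrightarrow> 0" by simp
  qed
  thus ?thesis unfolding version_def by (rule limI)
qed

end

end

section \<open>Uniform fibre bounds integrated over the quasimomentum\<close>

lemma scaleR_eq_smult: "r *\<^sub>R (v :: complex ^ 'm) = of_real r *s v"
  unfolding vec_eq_iff by (intro allI, subst vector_scaleR_component) (simp add: scaleR_conv_of_real)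

context bloch_expansion
begin

context
  fixes g :: "real \<Rightarrow> complex ^ 'm" and t :: real
  assumes g: "L2_on {0..1} g" and t: "t \<in> J"
begin

definition psum :: "nat set \<Rightarrow> real \<Rightarrow> complex ^ 'm" where
  "psum S x = (\<Sum>p\<in>S. L2_inner {0..1} g (dl p t) *s Psi p t x)"

lemma L2_psum: "S \<subseteq> {1..} \<Longrightarrow> L2_on {0..1} (psum S)"
  unfolding psum_def[abs_def] by (intro unit_L2_lincomb L2_on_continuous Psi_cont t) auto

lemma psum_split: "K \<ge> N1 \<Longrightarrow> psum {1..K} x = psum {1..N1} x + psum {N1<..K} x"
proof -
  assume K: "K \<ge> N1"
  have "{1..K} = {1..N1} \<union> {N1<..K}" using K by auto
  thus ?thesis unfolding psum_def by (simp only:, subst sum.union_disjoint) auto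
qed

lemma norm_psum_tail: "finite S \<Longrightarrow> S \<subseteq> {N1<..} \<Longrightarrow> L2_norm {0..1} (psum S) \<le> C * L2_norm {0..1} g"
  unfolding psum_def[abs_def] by (rule tail[OF g t])

lemma psum_tendsto: "(\<lambda>K. L2_norm {0..1} (\<lambda>x. g x - psum {1..K} x)) \<longlonglongrightarrow> 0"
  unfolding psum_def by (rule fibre_expansion[OF g t])

text \<open>Let K tend to infinity in g - head = (g - partial sum up to K) + tail, where the tail is
  bounded uniformly in K.\<close>

lemma norm_diff_head: "L2_norm {0..1} (\<lambda>x. g x - psum {1..N1} x) \<le> C * L2_norm {0..1} g"
proof (rule LIMSEQ_le_const)
  show "(\<lambda>K. L2_norm {0..1} (\<lambda>x. g x - psum {1..K} x) + C * L2_norm {0..1} g) \<longlonglongrightarrow> C * L2_norm {0..1} g"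
    using tendsto_add[OF psum_tendsto tendsto_const] by simp
  have "L2_norm {0..1} (\<lambda>x. g x - psum {1..N1} x) \<le> L2_norm {0..1} (\<lambda>x. g x - psum {1..K} x) + C * L2_norm {0..1} g"
    if K: "K \<ge> N1" for K
  proof -
    have L: "L2_on {0..1} (psum {1..K})" "L2_on {0..1} (psum {N1<..K})" by (rule L2_psum; auto)+
    have eq: "g x - psum {1..N1} x = (g x - psum {1..K} x) + psum {N1<..K} x" for x
      unfolding psum_split[OF K] by simp
    have "L2_norm {0..1} (\<lambda>x. g x - psum {1..N1} x) \<le> L2_norm {0..1} (\<lambda>x. g x - psum {1..K} x) + L2_norm {0..1} (psum {N1<..K})"
      unfolding eq by (rule unit_norm_triangle[OF unit_L2_diff[OF g L(1)] L(2)])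
    also have "L2_norm {0..1} (psum {N1<..K}) \<le> C * L2_norm {0..1} g" by (rule norm_psum_tail) auto
    finally show ?thesis by simp
  qed
  thus "\<exists>N. \<forall>K\<ge>N. L2_norm {0..1} (\<lambda>x. g x - psum {1..N1} x) \<le> L2_norm {0..1} (\<lambda>x. g x - psum {1..K} x) + C * L2_norm {0..1} g"
    by blast
qed

lemma norm_diff_psum: "K \<ge> N1 \<Longrightarrow> L2_norm {0..1} (\<lambda>x. g x - psum {1..K} x) \<le> 2 * C * L2_norm {0..1} g"
proof -
  assume K: "K \<ge> N1"
  have L: "L2_on {0..1} (psum {1..N1})" "L2_on {0..1} (psum {N1<..K})" by (rule L2_psum; auto)+
  have eq: "g x - psum {1..K} x = (g x - psum {1..N1} x) - psum {N1<..K} x" for x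
    unfolding psum_split[OF K] by simp
  have "L2_norm {0..1} (\<lambda>x. g x - psum {1..K} x) \<le> L2_norm {0..1} (\<lambda>x. g x - psum {1..N1} x) + L2_norm {0..1} (psum {N1<..K})"
    unfolding eq by (rule unit_norm_triangle_diff[OF unit_L2_diff[OF g L(1)] L(2)])
  also have "\<dots> \<le> C * L2_norm {0..1} g + C * L2_norm {0..1} g"
    by (intro add_mono norm_diff_head norm_psum_tail) auto
  finally show ?thesis by simp
qed

lemma norm_psum_head: "L2_norm {0..1} (psum {1..N1}) \<le> (1 + C) * L2_norm {0..1} g"
proof -
  have L: "L2_on {0..1} (psum {1..N1})" by (rule L2_psum) auto
  have "L2_norm {0..1} (\<lambda>x. g x - (g x - psum {1..N1} x)) \<le> L2_norm {0..1} g + L2_norm {0..1} (\<lambda>x. g x - psum {1..N1} x)"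
    by (intro unit_norm_triangle_diff unit_L2_diff g L)
  with norm_diff_head show ?thesis by (simp add: algebra_simps)
qed

end

lemma measurable_energy_density:
  assumes W: "case_prod W \<in> borel_measurable (borel :: (real \<times> real) measure)"
  shows "(\<lambda>t. \<integral>\<^sup>+x. indicator (J \<times> {0..1}) (t, x) * ennreal ((norm (W t x :: complex ^ 'm))\<^sup>2) \<partial>lborel) \<in> borel_measurable lborel"
proof -
  have [measurable]: "case_prod W \<in> borel_measurable (borel \<Otimes>\<^sub>M borel)" using W by (simp add: borel_prod)
  have e: "indicator (J \<times> {0..1}) (t, x) = (indicator J t * indicator {0..1} x :: ennreal)" for t x :: real
    by (simp add: indicator_def)
  show ?thesis unfolding e by measurable
qed

lemma energy_density:
  assumes W: "case_prod W \<in> borel_measurable (borel :: (real \<times> real) measure)" and t: "t \<in> J" and L: "L2_on {0..1} (W t)"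
  shows "(\<integral>\<^sup>+x. indicator (J \<times> {0..1}) (t, x) * ennreal ((norm (W t x :: complex ^ 'm))\<^sup>2) \<partial>lborel) = ennreal ((L2_norm {0..1} (W t))\<^sup>2)"
  using L2_on_iff_nn_integral(2)[OF measurable_section[OF W] _ L] t by (simp add: indicator_times)

context
  fixes G :: "real \<Rightarrow> real \<Rightarrow> complex ^ 'm"
  assumes G: "case_prod G \<in> borel_measurable (borel :: (real \<times> real) measure)" and EG: "energy J G < \<infinity>"
begin

lemma AE_L2_fibre: "AE t in lborel. t \<in> J \<longrightarrow> L2_on {0..1} (G t)"
proof -
  have "AE t in lborel. (\<integral>\<^sup>+x. indicator (J \<times> {0..1}) (t, x) * ennreal ((norm (G t x))\<^sup>2) \<partial>lborel) \<noteq> \<infinity>"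
    by (rule nn_integral_noteq_infinite[OF measurable_energy_density[OF G]]) (use EG in \<open>simp add: energy_def\<close>)
  thus ?thesis
  proof eventually_elim
    case (elim t)
    show ?case
    proof
      assume "t \<in> J"
      with elim show "L2_on {0..1} (G t)"
        by (subst L2_on_iff_nn_integral(1)[OF measurable_section[OF G]]) (auto simp: indicator_times less_top)
    qed
  qed
qed

text \<open>Integrates a fibre bound whose constant is independent of t. The first conclusion serves
  as domination for limits under the integral over t.\<close>

lemma energy_le:
  assumes W: "case_prod W \<in> borel_measurable (borel :: (real \<times> real) measure)" and c: "0 \<le> c"
    and le: "\<And>t. t \<in> J \<Longrightarrow> L2_on {0..1} (G t) \<Longrightarrow> L2_on {0..1} (W t) \<and> L2_norm {0..1} (W t :: real \<Rightarrow> complex ^ 'm) \<le> c * L2_norm {0..1} (G t)"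
  shows "AE t in lborel. (\<integral>\<^sup>+x. indicator (J \<times> {0..1}) (t, x) * ennreal ((norm (W t x))\<^sup>2) \<partial>lborel)
           \<le> ennreal (c\<^sup>2) * (\<integral>\<^sup>+x. indicator (J \<times> {0..1}) (t, x) * ennreal ((norm (G t x))\<^sup>2) \<partial>lborel)"
    and "energy J W < \<infinity>"
proof -
  show ae: "AE t in lborel. (\<integral>\<^sup>+x. indicator (J \<times> {0..1}) (t, x) * ennreal ((norm (W t x))\<^sup>2) \<partial>lborel)
           \<le> ennreal (c\<^sup>2) * (\<integral>\<^sup>+x. indicator (J \<times> {0..1}) (t, x) * ennreal ((norm (G t x))\<^sup>2) \<partial>lborel)"
    using AE_L2_fibre
  proof eventually_elim
    case (elim t)
    show ?case
    proof (cases "t \<in> J")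
      case True
      hence L: "L2_on {0..1} (G t)" using elim by blast
      have "(L2_norm {0..1} (W t))\<^sup>2 \<le> (c * L2_norm {0..1} (G t))\<^sup>2"
        using le[OF True L] by (intro power_mono) auto
      hence "ennreal ((L2_norm {0..1} (W t))\<^sup>2) \<le> ennreal (c\<^sup>2 * (L2_norm {0..1} (G t))\<^sup>2)"
        by (intro ennreal_leI) (simp add: power_mult_distrib)
      thus ?thesis using le[OF True L] by (simp add: energy_density[OF W True] energy_density[OF G True L] ennreal_mult)
    qed (simp add: indicator_times)
  qed
  have "energy J W \<le> (\<integral>\<^sup>+t. ennreal (c\<^sup>2) * (\<integral>\<^sup>+x. indicator (J \<times> {0..1}) (t, x) * ennreal ((norm (G t x))\<^sup>2) \<partial>lborel) \<partial>lborel)"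
    unfolding energy_def by (rule nn_integral_mono_AE[OF ae])
  also have "\<dots> = ennreal (c\<^sup>2) * energy J G"
    unfolding energy_def by (rule nn_integral_cmult[OF measurable_energy_density[OF G]])
  also have "\<dots> < \<infinity>" using EG by (simp add: ennreal_mult_less_top)
  finally show "energy J W < \<infinity>" .
qed

lemma measurable_version_sum: "case_prod (\<lambda>t x. \<Sum>p\<in>S. version G p t x) \<in> borel_measurable (borel :: (real \<times> real) measure)"
  using borel_measurable_sum[of S "\<lambda>p. case_prod (version G p)" "borel :: (real \<times> real) measure"] measurable_version[OF G]
  by (simp add: split_def)

lemma version_sum_eq:
  assumes t: "t \<in> J" and L: "L2_on {0..1} (G t)" and S: "S \<subseteq> {1..}" and x: "x \<in> {0..1}"
  shows "(\<Sum>p\<in>S. version G p t x) = psum (G t) t S x"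
proof -
  have "(\<Sum>p\<in>S. version G p t x) = (\<Sum>p\<in>S. component G p t x)"
    using S by (intro sum.cong refl version_eq[OF G t L x]) auto
  thus ?thesis by (simp add: psum_def[OF L t] component_def)
qed

lemma fibre_version_sum:
  assumes t: "t \<in> J" and L: "L2_on {0..1} (G t)" and S: "S \<subseteq> {1..}"
  shows "L2_on {0..1} (\<lambda>x. \<Sum>p\<in>S. version G p t x)"
    and "L2_norm {0..1} (\<lambda>x. \<Sum>p\<in>S. version G p t x) = L2_norm {0..1} (psum (G t) t S)"
    and "L2_on {0..1} (\<lambda>x. G t x - (\<Sum>p\<in>S. version G p t x))"
    and "L2_norm {0..1} (\<lambda>x. G t x - (\<Sum>p\<in>S. version G p t x)) = L2_norm {0..1} (\<lambda>x. G t x - psum (G t) t S x)"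
proof -
  show 1: "L2_on {0..1} (\<lambda>x. \<Sum>p\<in>S. version G p t x)"
    by (rule L2_on_cong_AE[OF unit_interval_sets L2_psum[OF L t S]])
      (auto intro!: AE_I2 simp: version_sum_eq[OF t L S])
  show "L2_on {0..1} (\<lambda>x. G t x - (\<Sum>p\<in>S. version G p t x))" by (rule unit_L2_diff[OF L 1])
  show "L2_norm {0..1} (\<lambda>x. \<Sum>p\<in>S. version G p t x) = L2_norm {0..1} (psum (G t) t S)"
    "L2_norm {0..1} (\<lambda>x. G t x - (\<Sum>p\<in>S. version G p t x)) = L2_norm {0..1} (\<lambda>x. G t x - psum (G t) t S x)"
    by (rule L2_norm_cong[OF unit_interval_sets]; simp add: version_sum_eq[OF t L S])+
qed

lemma energy_version_head: "energy J (\<lambda>t x. \<Sum>p=1..N1. version G p t x) < \<infinity>"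
  by (rule energy_le(2)[OF measurable_version_sum, of "1 + C"])
    (use C in \<open>auto simp: fibre_version_sum norm_psum_head simp del: One_nat_def\<close>)

lemma energy_version_tail: "p > N1 \<Longrightarrow> energy J (version G p) < \<infinity>"
proof -
  assume p: "p > N1"
  have S: "{p} \<subseteq> {1..}" "{p} \<subseteq> {N1<..}" using p by auto
  have "energy J (\<lambda>t x. \<Sum>p\<in>{p}. version G p t x) < \<infinity>"
    by (rule energy_le(2)[OF measurable_version_sum, of C])
      (use C S in \<open>auto simp only: fibre_version_sum norm_psum_tail finite.intros\<close>)
  thus ?thesis by simp
qed

text \<open>Dominated convergence in t: the squared fibre remainders tend to 0 and stay below (2
  C)^2 |G t|^2. The bound is for partial sums containing the whole block up to \<open>N1\<close>,
  hence the shift.\<close>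

lemma energy_remainder:
  "K \<ge> N1 \<Longrightarrow> energy J (\<lambda>t x. G t x - (\<Sum>p=1..K. version G p t x)) < \<infinity>"
  "(\<lambda>K. energy J (\<lambda>t x. G t x - (\<Sum>p=1..K + N1. version G p t x))) \<longlonglongrightarrow> 0"
proof -
  let ?W = "\<lambda>K t x. G t x - (\<Sum>p=1..K. version G p t x)"
  have W: "case_prod (?W K) \<in> borel_measurable (borel :: (real \<times> real) measure)" for K
    using borel_measurable_diff[OF G measurable_version_sum] by (simp add: split_def)
  have sub: "{1..K} \<subseteq> {1::nat..}" for K by auto
  have le: "L2_on {0..1} (?W K t) \<and> L2_norm {0..1} (?W K t) \<le> (2 * C) * L2_norm {0..1} (G t)"
    if "K \<ge> N1" "t \<in> J" "L2_on {0..1} (G t)" for K t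
    using fibre_version_sum(3,4)[OF that(2,3) sub] norm_diff_psum[OF that(3,2,1)] by simp
  have C2: "0 \<le> 2 * C" using C by simp
  show "K \<ge> N1 \<Longrightarrow> energy J (?W K) < \<infinity>" by (rule energy_le(2)[OF W C2 le])
  let ?u = "\<lambda>W t. \<integral>\<^sup>+x. indicator (J \<times> {0..1}) (t, x) * ennreal ((norm (W t x :: complex ^ 'm))\<^sup>2) \<partial>lborel"
  have "(\<lambda>K. \<integral>\<^sup>+t. ?u (?W (K + N1)) t \<partial>lborel) \<longlonglongrightarrow> (\<integral>\<^sup>+t. 0 \<partial>(lborel :: real measure))"
  proof (rule nn_integral_dominated_convergence[where w = "\<lambda>t. ennreal ((2 * C)\<^sup>2) * ?u G t"])
    show "?u (?W (K + N1)) \<in> borel_measurable lborel" for K by (rule measurable_energy_density[OF W])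
    show "(\<lambda>t. ennreal ((2 * C)\<^sup>2) * ?u G t) \<in> borel_measurable lborel"
      using measurable_energy_density[OF G] by measurable
    show "AE t in lborel. ?u (?W (K + N1)) t \<le> ennreal ((2 * C)\<^sup>2) * ?u G t" for K
      by (rule energy_le(1)[OF W C2 le]) auto
    have "(\<integral>\<^sup>+t. ennreal ((2 * C)\<^sup>2) * ?u G t \<partial>lborel) = ennreal ((2 * C)\<^sup>2) * energy J G"
      unfolding energy_def by (rule nn_integral_cmult[OF measurable_energy_density[OF G]])
    thus "(\<integral>\<^sup>+t. ennreal ((2 * C)\<^sup>2) * ?u G t \<partial>lborel) < \<infinity>"
      using EG by (simp add: ennreal_mult_less_top)
    show "AE t in lborel. (\<lambda>K. ?u (?W (K + N1)) t) \<longlonglongrightarrow> 0"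
      using AE_L2_fibre
    proof eventually_elim
      case (elim t)
      show ?case
      proof (cases "t \<in> J")
        case True
        hence L: "L2_on {0..1} (G t)" using elim by blast
        have "?u (?W (K + N1)) t = ennreal ((L2_norm {0..1} (\<lambda>x. G t x - psum (G t) t {1..K + N1} x))\<^sup>2)" for K
          using energy_density[OF W True conjunct1[OF le[of "K + N1", OF _ True L]]]
            fibre_version_sum(4)[OF True L sub] by simp
        moreover have "(\<lambda>K. ennreal ((L2_norm {0..1} (\<lambda>x. G t x - psum (G t) t {1..K + N1} x))\<^sup>2)) \<longlonglongrightarrow> ennreal (0\<^sup>2)"
          by (intro tendsto_ennrealI tendsto_power LIMSEQ_ignore_initial_segment[OF psum_tendsto[OF L True]])
        ultimately show ?thesis by simp
      qed (simp add: indicator_times)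
    qed
  qed simp
  thus "(\<lambda>K. energy J (?W (K + N1))) \<longlonglongrightarrow> 0" unfolding energy_def by simp
qed

end

end

section \<open>Borel versions of the given function and of its transform\<close>

lemma AE_lborel_shift:
  assumes "AE x in lborel. Q x" shows "AE x in lborel. Q (x + c :: real)"
proof -
  obtain N where N: "{x \<in> space lborel. \<not> Q x} \<subseteq> N" "N \<in> null_sets lborel"
    using assms by (auto simp: eventually_ae_filter)
  have "{x. x - (- c) \<in> N} \<in> null_sets lborel" by (rule null_sets_translation[OF N(2)])
  thus ?thesis by (rule AE_I') (use N in auto)
qed

lemma AE_snd:
  assumes "AE x in lborel. Q x" shows "AE s in lborel \<Otimes>\<^sub>M lborel. Q (snd (s :: real \<times> real))"
proof -
  obtain N where N: "{x \<in> space lborel. \<not> Q x} \<subseteq> N" "N \<in> null_sets lborel"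
    using assms by (auto simp: eventually_ae_filter)
  have "emeasure (lborel \<Otimes>\<^sub>M lborel) ((UNIV :: real set) \<times> N) = emeasure lborel (UNIV :: real set) * emeasure lborel N"
    using N(2) by (intro lborel.emeasure_pair_measure_Times) auto
  hence "(UNIV :: real set) \<times> N \<in> null_sets (lborel \<Otimes>\<^sub>M lborel)" using N(2) by (auto simp: null_sets_def)
  thus ?thesis by (rule AE_I') (use N in auto)
qed

context inverse_gelfand_transform
begin

text \<open>Convergence of the partial sums in L2 of the cell is insensitive to null sets, so it
  survives the exchange of \<open>f\<close> and \<open>F\<close> for Borel functions and the
  restriction to \<open>J\<close>.\<close>

lemma gelfand_transform_borel:
  fixes f :: "real \<Rightarrow> complex ^ 'm::finite"
  assumes f: "L2_on UNIV f" and F: "gelfand_transform f F"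
  obtains g H where "g \<in> borel_measurable borel" "AE x in lborel. f x = g x" "L2_on UNIV g"
    "case_prod H \<in> borel_measurable (borel :: (real \<times> real) measure)"
    "AE t in lborel. t \<in> J \<longrightarrow> (AE x\<in>{0..1} in lebesgue. F t x = H t x)"
    "(\<lambda>Q. energy J (\<lambda>t x. H t x - gelfand_sum g Q t x)) \<longlonglongrightarrow> 0"
proof -
  let ?R = "quasimomenta \<times> {0..1::real}"
  have "f \<in> borel_measurable lebesgue" using f by (simp add: L2_on_def set_borel_measurable_def)
  then obtain g where g: "g \<in> borel_measurable borel" and fg: "AE x in lborel. f x = g x"
    using lebesgue_measurable_ex_borel by blast
  have Lg: "L2_on UNIV g" by (rule L2_on_cong_AE[OF _ f]) (use fg in \<open>auto intro: AE_completion\<close>)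
  have "(\<lambda>s. indicator ?R s *\<^sub>R (case s of (t, x) \<Rightarrow> F t x)) \<in> borel_measurable lebesgue"
    using F by (simp add: gelfand_transform_def set_borel_measurable_def)
  from lebesgue_measurable_ex_borel[OF this] obtain H0 where H0: "H0 \<in> borel_measurable borel"
    and FH0: "AE s in lborel. indicator ?R s *\<^sub>R (case s of (t, x) \<Rightarrow> F t x) = H0 s" by blast
  define H where "H t x = H0 (t, x)" for t x
  have H: "case_prod H \<in> borel_measurable (borel :: (real \<times> real) measure)" using H0 by (simp add: H_def split_def)
  have FH: "AE s in lborel \<Otimes>\<^sub>M lborel. indicator ?R s *\<^sub>R (case s of (t, x) \<Rightarrow> F t x) = H0 s"
    unfolding lborel_prod by (rule FH0)
  have "AE t in lborel. AE x in lborel. indicator ?R (t, x) *\<^sub>R F t x = H t x"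
    using lborel_pair.AE_pair[OF FH] by (simp add: H_def)
  hence FH': "AE t in lborel. t \<in> J \<longrightarrow> (AE x\<in>{0..1} in lebesgue. F t x = H t x)"
  proof eventually_elim
    case (elim t)
    show ?case
    proof
      assume "t \<in> J"
      hence t: "t \<in> quasimomenta" using J_sub by auto
      from elim have "AE x in lebesgue. indicator ?R (t, x) *\<^sub>R F t x = H t x" by (rule AE_completion)
      thus "AE x\<in>{0..1} in lebesgue. F t x = H t x" by eventually_elim (use t in auto)
    qed
  qed
  \<comment> \<open>The partial sums evaluate f at all integer translates; countably many null sets
    of x remain null in the plane when spread over all t.\<close>
  have shifts: "AE s in lborel \<Otimes>\<^sub>M lborel. \<forall>q::int. f (snd s + of_int q) = g (snd (s :: real \<times> real) + of_int q)"
    by (subst AE_all_countable) (intro allI AE_snd[of "\<lambda>x. f (x + of_int _) = g (x + of_int _)"] AE_lborel_shift fg)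
  let ?D = "\<lambda>Q t x. H t x - gelfand_sum g Q t x"
  have D: "case_prod (?D Q) \<in> borel_measurable (borel :: (real \<times> real) measure)" for Q
    using borel_measurable_diff[OF H measurable_gelfand_sum[OF g]] by (simp add: split_def)
  let ?T = "\<lambda>Q. \<integral>\<^sup>+ (t, x) \<in> ?R. ennreal ((norm (F t x - (\<Sum>q = - int Q..int Q.
          exp (- \<i> * of_int q * of_real t) *s f (x + of_int q))))\<^sup>2) \<partial>lebesgue"
  have le: "energy J (?D Q) \<le> ?T Q" for Q
  proof -
    have m: "(\<lambda>(t, x). indicator ?R (t, x) * ennreal ((norm (?D Q t x))\<^sup>2)) \<in> borel_measurable (lborel \<Otimes>\<^sub>M lborel)"
    proof -
      have [measurable]: "case_prod (?D Q) \<in> borel_measurable (borel \<Otimes>\<^sub>M borel)" using D by (simp only: borel_prod)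
      have e: "indicator ?R (t, x) = (indicator quasimomenta t * indicator {0..1} x :: ennreal)" for t x :: real
        by (simp add: indicator_def)
      have "(\<lambda>(t, x). indicator ?R (t, x) * ennreal ((norm (?D Q t x))\<^sup>2)) \<in> borel_measurable (borel \<Otimes>\<^sub>M borel)"
        unfolding e by measurable
      thus ?thesis by simp
    qed
    have "energy J (?D Q) \<le> (\<integral>\<^sup>+t. \<integral>\<^sup>+x. indicator ?R (t, x) * ennreal ((norm (?D Q t x))\<^sup>2) \<partial>lborel \<partial>lborel)"
      unfolding energy_def using J_sub by (intro nn_integral_mono mult_right_mono) (auto simp: indicator_def)
    also have "\<dots> = (\<integral>\<^sup>+s. (case s of (t, x) \<Rightarrow> indicator ?R (t, x) * ennreal ((norm (?D Q t x))\<^sup>2)) \<partial>(lborel \<Otimes>\<^sub>M lborel))"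
      using lborel.nn_integral_fst[OF m] by simp
    also have "\<dots> = (\<integral>\<^sup>+s. (case s of (t, x) \<Rightarrow> ennreal ((norm (F t x - (\<Sum>q = - int Q..int Q.
          exp (- \<i> * of_int q * of_real t) *s f (x + of_int q))))\<^sup>2)) * indicator ?R s \<partial>(lborel \<Otimes>\<^sub>M lborel))"
    proof (rule nn_integral_cong_AE)
      show "AE s in lborel \<Otimes>\<^sub>M lborel. (case s of (t, x) \<Rightarrow> indicator ?R (t, x) * ennreal ((norm (?D Q t x))\<^sup>2))
        = (case s of (t, x) \<Rightarrow> ennreal ((norm (F t x - (\<Sum>q = - int Q..int Q.
          exp (- \<i> * of_int q * of_real t) *s f (x + of_int q))))\<^sup>2)) * indicator ?R s"
        using FH shifts
      proof eventually_elim
        case (elim s)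
        show ?case
        proof (cases "s \<in> ?R")
          case True
          obtain t x where s: "s = (t, x)" by (cases s)
          have "F t x = H t x" using elim(1) True by (simp add: s H_def)
          moreover have "f (x + of_int q) = g (x + of_int q)" for q using elim(2) by (simp add: s)
          ultimately show ?thesis using True by (simp add: s gelfand_sum_def)
        qed (auto simp: split_def)
      qed
    qed
    also have "\<dots> = ?T Q" by (simp only: lborel_prod nn_integral_completion)
    finally show ?thesis .
  qed
  have T: "?T \<longlonglongrightarrow> 0" using F by (simp only: gelfand_transform_def)
  have "(\<lambda>Q. energy J (?D Q)) \<longlonglongrightarrow> 0"
    by (rule tendsto_sandwich[OF always_eventually always_eventually tendsto_const T]) (intro allI le zero_le)+
  from that[OF g fg Lg H FH' this] show thesis .
qed

text \<open>\<open>e\<close> agrees for almost every t in \<open>J\<close> with a Borel function;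
  completeness of Lebesgue measure makes it measurable, and integral and integrability are those of
  \<open>phase W x\<close>.\<close>

lemma integral_eq_inverse_gelfand:
  fixes W :: "real \<Rightarrow> real \<Rightarrow> complex ^ 'm::finite"
  assumes W: "case_prod W \<in> borel_measurable (borel :: (real \<times> real) measure)"
    and e: "AE t in lborel. t \<in> J \<longrightarrow> e t = exp (\<i> * of_real t * of_int \<lfloor>x\<rfloor>) *s W t (frac x)"
  shows "(LINT t:J|lebesgue. e t) = inverse_gelfand J W x"
    and "set_integrable lebesgue J e \<longleftrightarrow> integrable lborel (phase W x)"
proof -
  have "phase W x \<in> borel_measurable lborel"
    using measurable_compose[OF measurable_Pair1' measurable_phase[OF W], of x] by simp
  hence pm: "phase W x \<in> borel_measurable lebesgue" by (rule measurable_completion)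
  have ae: "AE t in lebesgue. phase W x t = indicator J t *\<^sub>R e t"
    using AE_completion[OF e] by eventually_elim (auto simp: phase_def indicator_def)
  have em: "(\<lambda>t. indicator J t *\<^sub>R e t) \<in> borel_measurable lebesgue" by (rule borel_measurable_AE[OF pm ae])
  have i: "(\<lambda>t. indicator J t *\<^sub>R (exp (\<i> * of_real t * of_int \<lfloor>x\<rfloor>) *s W t (frac x))) = phase W x"
    by (simp add: phase_def[abs_def])
  show "(LINT t:J|lebesgue. e t) = inverse_gelfand J W x"
    unfolding set_lebesgue_integral_def inverse_gelfand_def i using ae
    by (intro integral_cong_AE em pm) (auto elim: eventually_mono)
  show "set_integrable lebesgue J e \<longleftrightarrow> integrable lborel (phase W x)"
    unfolding inverse_gelfand_eq(2)[OF W, symmetric] set_integrable_def i using ae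
    by (intro integrable_cong_AE em pm) (auto elim: eventually_mono)
qed

end

context bloch_expansion
begin

text \<open>One exceptional set of t serves all k and all x, because \<open>version_eq\<close> holds
  at every point. This permits integrating over t at a fixed x.\<close>

lemma expansion_term_version:
  assumes H: "case_prod H \<in> borel_measurable (borel :: (real \<times> real) measure)" and E: "energy J H < \<infinity>"
    and FH: "AE t in lborel. t \<in> J \<longrightarrow> (AE x\<in>{0..1} in lebesgue. F t x = H t x)"
  shows "AE t in lborel. t \<in> J \<longrightarrow> (\<forall>k\<ge>1. \<forall>x. expansion_term F Psi Psi_star k t x
     = exp (\<i> * of_real t * of_int \<lfloor>x\<rfloor>) *s version H k t (frac x))"
  using FH AE_L2_fibre[OF H E]
proof eventually_elim
  case (elim t)
  show ?case
  proof (intro impI allI)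
    fix k :: nat and x :: real assume t: "t \<in> J" and k: "1 \<le> k"
    have L: "L2_on {0..1} (H t)" using elim t by blast
    have x: "frac x \<in> {0..1}" using frac_lt_1[of x] by (simp add: less_imp_le)
    have "L2_inner {0..1} (H t) (dl k t) = L2_inner {0..1} (F t) (dl k t)"
      using elim(1) t by (intro L2_inner_cong_AE[OF unit_interval_sets] L L2_dual k) (auto elim: eventually_mono)
    thus "expansion_term F Psi Psi_star k t x = exp (\<i> * of_real t * of_int \<lfloor>x\<rfloor>) *s version H k t (frac x)"
      unfolding version_eq[OF H t L x k]
      by (simp add: expansion_term_def quasiperiodic_extension_def component_def vector_smult_assoc mult.commute)
  qed
qed

text \<open>At almost every x all phases involved are integrable at once, and linearity identifies
  the remainder with 1 / (2 pi) times the inverse transform of \<open>H\<close> minus a partial sum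
  of its projections, whose energy tends to 0.\<close>

theorem integrated_expansion:
  assumes f: "L2_on UNIV f" and F: "gelfand_transform f F"
  defines "E \<equiv> expansion_term F Psi Psi_star"
  defines "low \<equiv> (\<lambda>x. (1 / (2 * pi)) *\<^sub>R (LINT t:J|lebesgue. (\<Sum>k = 1..N1. E k t x)))"
    and "high \<equiv> (\<lambda>k x. LINT t:J|lebesgue. E k t x)"
  shows "AE x in lebesgue. set_integrable lebesgue J (\<lambda>t. \<Sum>k = 1..N1. E k t x)"
    and "k > N1 \<Longrightarrow> AE x in lebesgue. set_integrable lebesgue J (\<lambda>t. E k t x)"
    and "L2_on {a<..<b} low" and "k > N1 \<Longrightarrow> L2_on {a<..<b} (high k)"
    and "(\<lambda>K. L2_norm {a<..<b} (\<lambda>x. f x - (low x + (1 / (2 * pi)) *\<^sub>R (\<Sum>k = N1 + 1..K. high k x)))) \<longlonglongrightarrow> 0"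
proof -
  obtain g H where g: "g \<in> borel_measurable borel" and fg: "AE x in lborel. f x = g x" and Lg: "L2_on UNIV g"
    and H: "case_prod H \<in> borel_measurable (borel :: (real \<times> real) measure)"
    and FH: "AE t in lborel. t \<in> J \<longrightarrow> (AE x\<in>{0..1} in lebesgue. F t x = H t x)"
    and lim: "(\<lambda>Q. energy J (\<lambda>t x. H t x - gelfand_sum g Q t x)) \<longlonglongrightarrow> 0"
    by (rule gelfand_transform_borel[OF f F]) (rule that)
  have EH: "energy J H < \<infinity>" and rec: "AE x in lborel. inverse_gelfand J H x = (2 * of_real pi) *s g x"
    using gelfand_reconstruction[OF g H Lg lim] by auto
  define V where "V = version H"
  define Low where "Low t x = (\<Sum>p=1..N1. V p t x)" for t x
  have V: "case_prod (V p) \<in> borel_measurable (borel :: (real \<times> real) measure)" for p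
    unfolding V_def by (rule measurable_version[OF H])
  have VS: "case_prod (\<lambda>t x. \<Sum>p\<in>S. V p t x) \<in> borel_measurable (borel :: (real \<times> real) measure)" for S
    unfolding V_def by (rule measurable_version_sum[OF H EH])
  have Lowm: "case_prod Low \<in> borel_measurable (borel :: (real \<times> real) measure)"
    unfolding Low_def by (rule VS)
  have ELow: "energy J Low < \<infinity>" unfolding Low_def[abs_def] V_def by (rule energy_version_head[OF H EH])
  have EV: "energy J (V p) < \<infinity>" if "p > N1" for p unfolding V_def by (rule energy_version_tail[OF H EH that])
  have ev: "AE t in lborel. t \<in> J \<longrightarrow> (\<forall>k\<ge>1. \<forall>x. E k t x = exp (\<i> * of_real t * of_int \<lfloor>x\<rfloor>) *s V k t (frac x))"
    unfolding E_def V_def by (rule expansion_term_version[OF H EH FH])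
  have ek: "AE t in lborel. t \<in> J \<longrightarrow> E k t x = exp (\<i> * of_real t * of_int \<lfloor>x\<rfloor>) *s V k t (frac x)" if "k \<ge> 1" for k x
    using ev by eventually_elim (use that in auto)
  have el: "AE t in lborel. t \<in> J \<longrightarrow> (\<Sum>k = 1..N1. E k t x) = exp (\<i> * of_real t * of_int \<lfloor>x\<rfloor>) *s Low t (frac x)" for x
    using ev by eventually_elim (auto simp: Low_def vec.scale_sum_right intro!: sum.cong)
  have high: "high k = inverse_gelfand J (V k)" if "k \<ge> 1" for k
    unfolding high_def by (intro ext integral_eq_inverse_gelfand(1)[OF V ek[OF that]])
  have low: "low = (\<lambda>x. (1 / (2 * pi)) *\<^sub>R inverse_gelfand J Low x)"
    unfolding low_def by (intro ext arg_cong[where f = "scaleR _"] integral_eq_inverse_gelfand(1)[OF Lowm el])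
  show "AE x in lebesgue. set_integrable lebesgue J (\<lambda>t. \<Sum>k = 1..N1. E k t x)"
    using AE_completion[OF AE_integrable_phase[OF Lowm ELow]]
    by eventually_elim (simp only: integral_eq_inverse_gelfand(2)[OF Lowm el])
  show "AE x in lebesgue. set_integrable lebesgue J (\<lambda>t. E k t x)" if k: "k > N1" for k
  proof -
    have k1: "k \<ge> 1" using k by simp
    show ?thesis using AE_completion[OF AE_integrable_phase[OF V EV[OF k]]]
      by eventually_elim (simp only: integral_eq_inverse_gelfand(2)[OF V ek[OF k1]])
  qed
  have ab: "{a<..<b} \<in> sets lebesgue" for a b :: real by simp
  show "L2_on {a<..<b} low" for a b
    unfolding low scaleR_eq_smult by (rule L2_on_scale[OF ab L2_inverse_gelfand[OF Lowm ELow]])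
  show "L2_on {a<..<b} (high k)" if k: "k > N1" for k a b
  proof -
    have k1: "k \<ge> 1" using k by simp
    show ?thesis unfolding high[OF k1] by (rule L2_inverse_gelfand[OF V EV[OF k]])
  qed
  let ?D = "\<lambda>K t x. H t x - (\<Sum>p=1..K + N1. V p t x)"
  have D: "case_prod (?D K) \<in> borel_measurable (borel :: (real \<times> real) measure)" for K
    using borel_measurable_diff[OF H VS] by (simp add: split_def)
  have ED: "energy J (?D K) < \<infinity>" for K unfolding V_def by (rule energy_remainder(1)[OF H EH]) simp
  have limD: "(\<lambda>K. energy J (?D K)) \<longlonglongrightarrow> 0" unfolding V_def by (rule energy_remainder(2)[OF H EH])
  let ?r = "\<lambda>K x. f x - (low x + (1 / (2 * pi)) *\<^sub>R (\<Sum>k = N1 + 1..K + N1. high k x))"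
  have r: "AE x in lborel. ?r K x = of_real (1 / (2 * pi)) *s inverse_gelfand J (?D K) x" for K
  proof -
    have "AE x in lborel. \<forall>k\<in>{N1 + 1..K + N1}. integrable lborel (phase (V k) x)"
      by (intro AE_finite_allI AE_integrable_phase V EV) auto
    with AE_integrable_phase[OF H EH] AE_integrable_phase[OF Lowm ELow] rec fg show ?thesis
    proof eventually_elim
      case (elim x)
      have ph: "phase (?D K) x = (\<lambda>t. phase H x t - (phase Low x t + (\<Sum>k = N1 + 1..K + N1. phase (V k) x t)))"
      proof
        fix t
        have "{1..K + N1} = {1..N1} \<union> {N1 + 1..K + N1}" by auto
        hence "(\<Sum>p=1..K + N1. phase (V p) x t) = (\<Sum>p=1..N1. phase (V p) x t) + (\<Sum>k = N1 + 1..K + N1. phase (V k) x t)"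
          by (simp only:, subst sum.union_disjoint) auto
        thus "phase (?D K) x t = phase H x t - (phase Low x t + (\<Sum>k = N1 + 1..K + N1. phase (V k) x t))"
          unfolding phase_diff phase_sum Low_def[abs_def] by simp
      qed
      let ?S = "\<lambda>t. \<Sum>k = N1 + 1..K + N1. phase (V k) x t"
      have i: "integrable lborel (phase H x)" "integrable lborel (phase Low x)" "integrable lborel ?S"
        using elim by (auto intro!: Bochner_Integration.integrable_sum)
      have "integral\<^sup>L lborel (phase (?D K) x) = integral\<^sup>L lborel (phase H x) - (integral\<^sup>L lborel (phase Low x) + integral\<^sup>L lborel ?S)"
        unfolding ph Bochner_Integration.integral_diff[OF i(1) Bochner_Integration.integrable_add[OF i(2,3)]]
          Bochner_Integration.integral_add[OF i(2,3)] ..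
      moreover have "integral\<^sup>L lborel ?S = (\<Sum>k = N1 + 1..K + N1. integral\<^sup>L lborel (phase (V k) x))"
        using elim by (intro Bochner_Integration.integral_sum) auto
      ultimately have "inverse_gelfand J (?D K) x = inverse_gelfand J H x - (inverse_gelfand J Low x + (\<Sum>k = N1 + 1..K + N1. inverse_gelfand J (V k) x))"
        unfolding inverse_gelfand_eq(1)[OF D] inverse_gelfand_eq(1)[OF H] inverse_gelfand_eq(1)[OF Lowm] inverse_gelfand_eq(1)[OF V]
        by (simp only:)
      moreover have "of_real (1 / (2 * pi)) *s inverse_gelfand J H x = f x"
        using elim by (simp add: vector_smult_assoc)
      moreover have "(\<Sum>k = N1 + 1..K + N1. high k x) = (\<Sum>k = N1 + 1..K + N1. inverse_gelfand J (V k) x)"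
        by (intro sum.cong) (auto simp: high)
      ultimately show ?case
        by (simp add: low scaleR_eq_smult vector_ssub_ldistrib vector_add_ldistrib)
    qed
  qed
  show "(\<lambda>K. L2_norm {a<..<b} (\<lambda>x. f x - (low x + (1 / (2 * pi)) *\<^sub>R (\<Sum>k = N1 + 1..K. high k x)))) \<longlonglongrightarrow> 0" for a b
  \<comment> \<open>The estimates concern upper limits K + N1, at which the tail sum starts
    empty.\<close>
  proof (rule LIMSEQ_offset[of _ N1])
    have "L2_norm {a<..<b} (?r K) = 1 / (2 * pi) * L2_norm {a<..<b} (inverse_gelfand J (?D K))" for K
    proof -
      let ?I = "\<lambda>x. of_real (1 / (2 * pi)) *s inverse_gelfand J (?D K) x"
      have L: "L2_on {a<..<b} ?I" by (rule L2_on_scale[OF ab L2_inverse_gelfand[OF D ED]])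
      have ae: "AE x\<in>{a<..<b} in lebesgue. ?I x = ?r K x"
        using AE_completion[OF r[of K]] by eventually_elim simp
      have "L2_norm {a<..<b} (?r K) = L2_norm {a<..<b} ?I"
        using L2_on_cong_AE[OF ab L ae] L ae
        by (intro L2_norm_cong_AE[OF ab]) (auto simp: L2_on_iff[OF ab] elim: eventually_mono)
      also have "\<dots> = cmod (of_real (1 / (2 * pi))) * L2_norm {a<..<b} (inverse_gelfand J (?D K))"
        by (rule L2_norm_scale[OF ab])
      finally show ?thesis by (simp add: norm_divide norm_mult)
    qed
    moreover have "(\<lambda>K. 1 / (2 * pi) * L2_norm {a<..<b} (inverse_gelfand J (?D K))) \<longlonglongrightarrow> 1 / (2 * pi) * 0"
      by (intro tendsto_mult tendsto_const L2_norm_inverse_gelfand_tendsto D limD ED)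
    ultimately show "(\<lambda>K. L2_norm {a<..<b} (?r K)) \<longlonglongrightarrow> 0" by simp
  qed
qed

end

section \<open>Simple eigenvalues of the Bloch operators\<close>

lemma eigenfunction_imp_root_function: "eigenfunction T z y \<Longrightarrow> root_function T z y"
  unfolding root_function_def eigenfunction_def
  by (intro exI[of _ "Suc 0"]) (auto intro!: exI[of _ "\<lambda>_. 0"])

lemma has_multiplicity_oneD:
  assumes "has_multiplicity T z 1"
  obtains b where "root_function T z b" "\<not> (AE x\<in>{0..1} in lebesgue. b x = 0)"
    "\<And>y. root_function T z y \<Longrightarrow> \<exists>c. AE x\<in>{0..1} in lebesgue. y x = c *s b x"
proof -
  obtain b where b0: "\<forall>i<1::nat. root_function T z (b i)"
    and ex: "\<forall>y. root_function T z y \<longrightarrow> (\<exists>!c. (\<forall>i\<ge>1. c i = 0) \<and> (AE x\<in>{0..1} in lebesgue. y x = (\<Sum>i<1. c i *s b i x)))"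
    using assms unfolding has_multiplicity_def by (elim exE conjE) (rule that)
  have b: "root_function T z (b 0)" using b0 by simp
  have nz: "\<not> (AE x\<in>{0..1} in lebesgue. b 0 x = 0)"
  proof
    assume z: "AE x\<in>{0..1} in lebesgue. b 0 x = 0"
    define P where "P c \<longleftrightarrow> (\<forall>i\<ge>1. c i = 0) \<and> (AE x\<in>{0..1} in lebesgue. b 0 x = (\<Sum>i<1. c i *s b i x))"
      for c :: "nat \<Rightarrow> complex"
    \<comment> \<open>If \<open>b 0\<close> were zero almost everywhere, every multiple of it would
      represent it, against uniqueness of the coefficients.\<close>
    define w where "w r i = (if i = 0 then r else 0)" for r :: complex and i :: nat
    have ex1: "\<exists>!c. P c" unfolding P_def by (rule ex[rule_format, OF b])
    have Pw: "P (w r)" for r unfolding P_def w_def using z by (auto elim: eventually_mono)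
    have "w 0 = w 1" using ex1 Pw[of 0] Pw[of 1] by blast
    hence "w 0 0 = w 1 0" by (rule fun_cong)
    thus False by (simp add: w_def)
  qed
  have "\<exists>c. AE x\<in>{0..1} in lebesgue. y x = c *s b 0 x" if "root_function T z y" for y
    using ex1_implies_ex[OF ex[rule_format, OF that]] by auto
  from that[OF b nz this] show thesis .
qed

text \<open>Dimension is well defined in the case at hand. It lets a count of indices in the
  numbering be compared with simplicity of the eigenvalue.\<close>

lemma has_multiplicity_one_unique:
  assumes 1: "has_multiplicity T z 1" and N: "has_multiplicity T z N"
  shows "N = 1"
proof -
  obtain b where b: "root_function T z b" "\<not> (AE x\<in>{0..1} in lebesgue. b x = 0)"
    and ex: "\<And>y. root_function T z y \<Longrightarrow> \<exists>c. AE x\<in>{0..1} in lebesgue. y x = c *s b x"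
    using has_multiplicity_oneD[OF 1] by blast
  obtain d where d: "\<And>i. i < N \<Longrightarrow> root_function T z (d i)"
    and ex': "\<And>y. root_function T z y \<Longrightarrow> \<exists>!c. (\<forall>i\<ge>N. c i = 0) \<and> (AE x\<in>{0..1} in lebesgue. y x = (\<Sum>i<N. c i *s d i x))"
    using N unfolding has_multiplicity_def by blast
  have "N \<noteq> 0"
  proof
    assume "N = 0"
    with ex1_implies_ex[OF ex'[OF b(1)]] have "AE x\<in>{0..1} in lebesgue. b x = 0" by simp
    with b(2) show False by blast
  qed
  moreover have "\<not> N > 1"
  proof
    assume N1: "N > 1"
    obtain c0 c1 where c: "AE x\<in>{0..1} in lebesgue. d 0 x = c0 *s b x" "AE x\<in>{0..1} in lebesgue. d 1 x = c1 *s b x"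
      using ex[OF d[of 0]] ex[OF d[of 1]] N1 by auto
    define P where "P w \<longleftrightarrow> (\<forall>i\<ge>N. w i = 0) \<and> (AE x\<in>{0..1} in lebesgue. d 0 x = (\<Sum>i<N. w i *s d i x))" for w :: "nat \<Rightarrow> complex"
    \<comment> \<open>As d_0 = c0 b and d_1 = c1 b, adding r (c1 d_0 - c0 d_1) = 0 changes the
      coefficients of d_0 but not the function; uniqueness forces c0 = c1 = 0, hence d_0 =
      0.\<close>
    define w where "w r i = (if i = 0 then 1 + r * c1 else if i = 1 then - r * c0 else 0 :: complex)" for r and i :: nat
    define w' where "w' i = (if i = 1 then 1 else 0 :: complex)" for i :: nat
    have sum: "(\<Sum>i<N. v i *s d i x) = v 0 *s d 0 x + v 1 *s d 1 x" if "\<And>i. i \<ge> 2 \<Longrightarrow> v i = 0" for v x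
    proof -
      have "(\<Sum>i<N. v i *s d i x) = (\<Sum>i\<in>{0, 1}. v i *s d i x)"
      proof (rule sum.mono_neutral_right)
        show "\<forall>i\<in>{..<N} - {0, 1}. v i *s d i x = 0" using that by (auto simp: numeral_2_eq_2 Suc_le_eq)
      qed (use N1 in auto)
      thus ?thesis by simp
    qed
    have Pw: "P (w r)" for r
    proof -
      have "AE x\<in>{0..1} in lebesgue. d 0 x = (\<Sum>i<N. w r i *s d i x)"
        using c
      proof eventually_elim
        case (elim x)
        have "(\<Sum>i<N. w r i *s d i x) = (1 + r * c1) *s d 0 x + (- r * c0) *s d 1 x"
          by (subst sum) (auto simp: w_def)
        moreover have "x \<in> {0..1} \<Longrightarrow> (1 + r * c1) *s d 0 x + (- r * c0) *s d 1 x = d 0 x"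
          using elim by (simp add: vec_eq_iff algebra_simps)
        ultimately show ?case by simp
      qed
      thus ?thesis using N1 by (auto simp: P_def w_def)
    qed
    have uniq: "v = v'" if "P v" "P v'" for v v'
      using ex'[OF d[of 0]] N1 that unfolding P_def by blast
    from uniq[OF Pw[of 0] Pw[of 1]] have "w 0 0 = w 1 0" "w 0 1 = w 1 1" by simp_all
    hence "c1 = 0" "c0 = 0" by (simp_all add: w_def)
    hence "P (\<lambda>_. 0)" using c by (auto simp: P_def elim: eventually_mono)
    from uniq[OF this Pw[of 0]] have "(0 :: complex) = w 0 0" by metis
    thus False by (simp add: w_def)
  qed
  ultimately show ?thesis by simp
qed

text \<open>Converts compactness into convergence once the limit does not depend on the
  subsequence.\<close>

lemma tendsto_if_subsequences:
  assumes "\<And>r. strict_mono r \<Longrightarrow> \<exists>r'. strict_mono r' \<and> (\<lambda>i. u (r (r' i :: nat))) \<longlonglongrightarrow> (l :: 'a::metric_space)"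
  shows "u \<longlonglongrightarrow> l"
proof (rule ccontr)
  assume "\<not> u \<longlonglongrightarrow> l"
  then obtain e where e: "0 < e" "\<And>N. \<exists>n\<ge>N. dist (u n) l \<ge> e"
    unfolding lim_sequentially by (meson not_le)
  hence "infinite {n. dist (u n) l \<ge> e}" unfolding infinite_nat_iff_unbounded_le by blast
  then obtain r where r: "strict_mono r" "\<And>n::nat. dist (u (r n)) l \<ge> e"
    using infinite_enumerate by blast
  obtain r' where "(\<lambda>i. u (r (r' i))) \<longlonglongrightarrow> l" using assms[OF r(1)] by blast
  then obtain i where "dist (u (r (r' i))) l < e" using e(1) unfolding lim_sequentially by blast
  with r(2)[of "r' i"] show False by simp
qed

section \<open>Orthogonality, independence and continuity in t of eigenfunctions\<close>

lemma adjoint_orthogonal: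
  assumes y: "eigenfunction T z y" and X: "eigenfunction (adjoint_operator T) (cnj z') X" and "z \<noteq> z'"
  shows "L2_inner {0..1} y X = 0"
proof -
  have "L2_inner {0..1} (\<lambda>x. z *s y x) X = L2_inner {0..1} y (\<lambda>x. cnj z' *s X x)"
    using y X unfolding eigenfunction_def adjoint_operator_def by blast
  hence "(z - z') * L2_inner {0..1} y X = 0"
    by (simp add: unit_inner_scale_left unit_inner_scale_right algebra_simps)
  with \<open>z \<noteq> z'\<close> show ?thesis by simp
qed

context bloch_coefficients
begin

lemma eigenfunction_continuous: "eigenfunction (bloch t) z y \<Longrightarrow> continuous_on {0..1} y"
  unfolding eigenfunction_def using bloch_operator_continuous by blast

lemma eigenfunction_L2: "eigenfunction (bloch t) z y \<Longrightarrow> L2_on {0..1} y"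
  by (rule L2_on_continuous[OF eigenfunction_continuous])

lemma eigenfunction_nonzero: "eigenfunction (bloch t) z y \<Longrightarrow> \<exists>x\<in>{0..1}. y x \<noteq> 0"
  unfolding eigenfunction_def
  using L2_norm_cong[OF unit_interval_sets, of y "\<lambda>_. 0"] L2_norm_zero[OF unit_interval_sets] by metis

text \<open>A root space of dimension 1 gives proportionality almost everywhere, continuity
  everywhere on the interval, and the normalisation a factor of modulus 1.\<close>

lemma simple_eigenfunctions_proportional:
  assumes m: "has_multiplicity (bloch t) z 1"
    and y: "normalized_eigenfunction (bloch t) z y" "normalized_eigenfunction (bloch t) z y'"
  shows "\<exists>c. cmod c = 1 \<and> (\<forall>x\<in>{0..1}. y x = c *s y' x)"
proof -
  have e: "eigenfunction (bloch t) z y" "eigenfunction (bloch t) z y'"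
    and nrm: "L2_norm {0..1} y = 1" "L2_norm {0..1} y' = 1"
    using y by (auto simp: normalized_eigenfunction_def)
  obtain b where b: "\<And>y. root_function (bloch t) z y \<Longrightarrow> \<exists>c. AE x\<in>{0..1} in lebesgue. y x = c *s b x"
    using has_multiplicity_oneD[OF m] by blast
  obtain d d' where d: "AE x\<in>{0..1} in lebesgue. y x = d *s b x" "AE x\<in>{0..1} in lebesgue. y' x = d' *s b x"
    using b[OF eigenfunction_imp_root_function[OF e(1)]] b[OF eigenfunction_imp_root_function[OF e(2)]] by blast
  have d'0: "d' \<noteq> 0"
  proof
    assume "d' = 0"
    hence "AE x\<in>{0..1} in lebesgue. y' x = 0" using d(2) by (auto elim: eventually_mono)
    with nrm(2) unit_norm_eq_0[OF eigenfunction_L2[OF e(2)]] show False by simp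
  qed
  have ae: "AE x\<in>{0..1} in lebesgue. y x - (d / d') *s y' x = 0"
    using d by eventually_elim (use d'0 in \<open>auto simp: vector_smult_assoc\<close>)
  have eq: "y x = (d / d') *s y' x" if "x \<in> {0..1}" for x
  proof -
    have "continuous_on {0..1} (\<lambda>x. y x - (d / d') *s y' x)"
      by (intro continuous_intros eigenfunction_continuous[OF e(1)] eigenfunction_continuous[OF e(2)])
    from continuous_AE_zero[OF this ae that] show ?thesis by simp
  qed
  hence "L2_norm {0..1} y = L2_norm {0..1} (\<lambda>x. (d / d') *s y' x)" by (intro L2_norm_cong[OF unit_interval_sets])
  hence "cmod (d / d') = 1" using nrm by (simp only: unit_norm_scale)
  with eq show ?thesis by blast
qed

text \<open>Applying the operator to the relation and subtracting z_q times the relation removes the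
  term q and multiplies the others by nonzero differences; \<open>bloch_operator_zero\<close>
  justifies the application.\<close>

lemma eigenfunctions_independent:
  assumes e: "\<And>p. p \<in> I \<Longrightarrow> eigenfunction (bloch t) (z p) (y p)" and inj: "inj_on z I" and S: "finite S" "S \<subseteq> I"
    and zero: "\<And>x. x \<in> {0..1} \<Longrightarrow> (\<Sum>p\<in>S. d p *s y p x) = 0" and p: "p \<in> S"
  shows "d p = 0"
  using S zero p
proof (induction S arbitrary: d p)
  case (insert q S)
  have T: "bloch t (y p) (\<lambda>x. z p *s y p x)" if "p \<in> insert q S" for p
    using e[of p] insert.prems(1) that by (auto simp: eigenfunction_def)
  have yc: "continuous_on {0..1} (y p)" if "p \<in> insert q S" for p
    by (rule bloch_operator_continuous[OF T[OF that]])
  have "bloch t (\<lambda>x. \<Sum>p\<in>insert q S. d p *s y p x) (\<lambda>x. \<Sum>p\<in>insert q S. d p *s (z p *s y p x))"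
    using insert.hyps by (intro bloch_operator_lincomb T) auto
  hence z0: "(\<Sum>p\<in>insert q S. d p *s (z p *s y p x)) = 0" if "x \<in> {0..1}" for x
    using insert.prems(2) that by (elim bloch_operator_zero) (auto intro!: continuous_intros yc)
  have "(\<Sum>p\<in>S. (d p * (z p - z q)) *s y p x) = 0" if x: "x \<in> {0..1}" for x
  proof -
    have "(\<Sum>p\<in>insert q S. (d p * (z p - z q)) *s y p x)
        = (\<Sum>p\<in>insert q S. d p *s (z p *s y p x)) - z q *s (\<Sum>p\<in>insert q S. d p *s y p x)"
      unfolding vec.scale_sum_right sum_subtractf[symmetric]
      by (intro sum.cong) (auto simp: vector_smult_assoc vector_sub_rdistrib right_diff_distrib mult.commute)
    also have "\<dots> = 0" using z0[OF x] insert.prems(2)[OF x] by simp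
    finally show ?thesis using insert.hyps by simp
  qed
  hence *: "d p * (z p - z q) = 0" if "p \<in> S" for p
    using insert.IH[of "\<lambda>p. d p * (z p - z q)" p] insert.prems(1) that by auto
  have S0: "d p = 0" if "p \<in> S" for p
  proof -
    have "p \<noteq> q" "p \<in> I" "q \<in> I" using that insert.hyps insert.prems(1) by auto
    hence "z p \<noteq> z q" using inj by (auto dest: inj_onD)
    thus ?thesis using *[OF that] by simp
  qed
  have "d q = 0"
  proof -
    obtain x where x: "x \<in> {0..1}" "y q x \<noteq> 0" using eigenfunction_nonzero[OF e[of q]] insert.prems(1) by auto
    have "(\<Sum>p\<in>S. d p *s y p x) = 0" using S0 by (intro sum.neutral) auto
    with insert.prems(2)[OF x(1)] insert.hyps have "d q *s y q x = 0" by simp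
    with x(2) show ?thesis by (auto simp: vec_eq_iff)
  qed
  with S0 insert.prems(3) show ?case by blast
qed auto

text \<open>Every subsequence has a further one along which the eigenfunctions converge uniformly to
  a normalised eigenfunction at t0. Simplicity makes it a unimodular multiple of
  \<open>y t0\<close>, and the kernel does not see that factor, so all subsequential limits
  agree.\<close>

lemma kernel_continuous:
  assumes z: "continuous_on J z" and y: "\<And>t. t \<in> J \<Longrightarrow> normalized_eigenfunction (bloch t) (z t) (y t)"
    and m: "\<And>t. t \<in> J \<Longrightarrow> has_multiplicity (bloch t) (z t) 1" and q: "q \<in> {0..1}"
  shows "continuous_on (J \<times> {0..1}) (\<lambda>(t, x). cnj (y t q $ i) *s y t x)"
  unfolding continuous_on_sequentially
proof (intro allI ballI impI, elim conjE)
  let ?f = "\<lambda>(t, x). cnj (y t q $ i) *s y t x"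
  fix s :: "nat \<Rightarrow> real \<times> real" and a :: "real \<times> real"
  assume a: "a \<in> J \<times> {0..1}" and s: "\<forall>n. s n \<in> J \<times> {0..1}" and lim: "s \<longlonglongrightarrow> a"
  define t0 x0 where "t0 = fst a" and "x0 = snd a"
  have t0: "t0 \<in> J" and x0: "x0 \<in> {0..1}" using a by (auto simp: t0_def x0_def)
  have tJ: "fst (s n) \<in> J" and xI: "snd (s n) \<in> {0..1}" for n using s[rule_format, of n] by auto
  show "(?f \<circ> s) \<longlonglongrightarrow> ?f a"
  proof (rule tendsto_if_subsequences)
    fix r :: "nat \<Rightarrow> nat" assume r: "strict_mono r"
    have sr: "(\<lambda>i. s (r i)) \<longlonglongrightarrow> a" using LIMSEQ_subseq_LIMSEQ[OF lim r] by (simp add: o_def)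
    have tr: "(\<lambda>i. fst (s (r i))) \<longlonglongrightarrow> t0" using tendsto_fst[OF sr] by (simp add: t0_def)
    have zr: "(\<lambda>i. z (fst (s (r i)))) \<longlonglongrightarrow> z t0"
      by (rule continuous_on_tendsto_compose[OF z tr t0]) (simp add: tJ)
    obtain r' y0 where r': "strict_mono r'" and y0: "normalized_eigenfunction (bloch t0) (z t0) y0"
      and U: "uniform_limit {0..1} (\<lambda>i. y (fst (s (r (r' i))))) y0 sequentially"
      using normalized_eigenfunction_compact[OF y[OF tJ] tr zr] by metis
    obtain c where c: "cmod c = 1" "\<And>x. x \<in> {0..1} \<Longrightarrow> y0 x = c *s y t0 x"
      using simple_eigenfunctions_proportional[OF m[OF t0] y0 y[OF t0]] by blast
    have y0c: "continuous_on {0..1} y0"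
      using y0 eigenfunction_continuous by (auto simp: normalized_eigenfunction_def)
    have xr: "(\<lambda>i. snd (s (r (r' i)))) \<longlonglongrightarrow> x0"
      using tendsto_snd[OF LIMSEQ_subseq_LIMSEQ[OF sr r']] by (simp add: x0_def o_def)
    have A: "(\<lambda>i. y (fst (s (r (r' i)))) q) \<longlonglongrightarrow> y0 q" by (rule tendsto_uniform_limitI[OF U q])
    \<comment> \<open>Here the point moves together with t: uniform convergence handles the
      function, continuity of \<open>y0\<close> the argument.\<close>
    have B: "(\<lambda>i. y (fst (s (r (r' i)))) (snd (s (r (r' i))))) \<longlonglongrightarrow> y0 x0"
    proof (rule LIMSEQ_I)
      fix e :: real assume e: "0 < e"
      have y0x: "(\<lambda>i. y0 (snd (s (r (r' i))))) \<longlonglongrightarrow> y0 x0"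
        by (rule continuous_on_tendsto_compose[OF y0c xr x0]) (intro always_eventually allI xI)
      obtain N1 where N1: "\<And>i x. i \<ge> N1 \<Longrightarrow> x \<in> {0..1} \<Longrightarrow> dist (y (fst (s (r (r' i)))) x) (y0 x) < e / 2"
        using uniform_limitD[OF U half_gt_zero[OF e]] unfolding eventually_sequentially by blast
      obtain N2 where N2: "\<And>i. i \<ge> N2 \<Longrightarrow> norm (y0 (snd (s (r (r' i)))) - y0 x0) < e / 2"
        using LIMSEQ_D[OF y0x half_gt_zero[OF e]] by blast
      have "norm (y (fst (s (r (r' i)))) (snd (s (r (r' i)))) - y0 x0) < e" if "i \<ge> max N1 N2" for i
      proof -
        let ?x = "snd (s (r (r' i)))"
        have "norm (y (fst (s (r (r' i)))) ?x - y0 ?x) < e / 2" using N1[of i ?x] that xI by (simp add: dist_norm)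
        moreover have "norm (y0 ?x - y0 x0) < e / 2" using N2[of i] that by simp
        ultimately show ?thesis
          using norm_triangle_ineq[of "y (fst (s (r (r' i)))) ?x - y0 ?x" "y0 ?x - y0 x0"] by simp
      qed
      thus "\<exists>N. \<forall>i\<ge>N. norm (y (fst (s (r (r' i)))) (snd (s (r (r' i)))) - y0 x0) < e" by blast
    qed
    have "(\<lambda>k. cnj (y (fst (s (r (r' k)))) q $ i) *s y (fst (s (r (r' k)))) (snd (s (r (r' k))))) \<longlonglongrightarrow> cnj (y0 q $ i) *s y0 x0"
      by (intro bounded_bilinear.tendsto[OF bounded_bilinear_smult] tendsto_cnj tendsto_vec_nth A B)
    moreover have "cnj (y0 q $ i) *s y0 x0 = ?f a"
    proof -
      have "cnj c * c = 1" using c(1) complex_norm_square[of c] by (simp add: mult.commute)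
      hence "cnj (c * y t0 q $ i) * c = cnj (y t0 q $ i)" by (simp add: mult.assoc mult.left_commute[of "cnj c"])
      thus ?thesis using c(2)[OF q] c(2)[OF x0]
        by (simp add: vector_smult_assoc split_def t0_def[symmetric] x0_def[symmetric])
    qed
    ultimately have "(\<lambda>i'. (?f \<circ> s) (r (r' i'))) \<longlonglongrightarrow> ?f a" by (simp add: split_def)
    with r' show "\<exists>r'. strict_mono r' \<and> (\<lambda>i. (?f \<circ> s) (r (r' i))) \<longlonglongrightarrow> ?f a" by blast
  qed
qed

end

section \<open>Verifying the fibre hypotheses for the Bloch operators\<close>

lemma times_cont_diff_continuous:
  assumes "times_cont_diff k f" shows "continuous_on UNIV f"
proof -
  obtain D where D: "D 0 = f" "\<And>i x. i < k \<Longrightarrow> (D i has_vector_derivative D (Suc i) x) (at x)" "continuous_on UNIV (D k)"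
    using assms unfolding times_cont_diff_def by blast
  show ?thesis
  proof (cases "k = 0")
    case True with D show ?thesis by simp
  next
    case False
    hence "isCont f x" for x using D(1) has_vector_derivative_continuous[OF D(2)[of 0 x]] by simp
    thus ?thesis by (simp add: continuous_on_eq_continuous_at)
  qed
qed

lemma continuous_gauge:
  assumes p1: "continuous_on {0..1} p1" shows "continuous_on {0..1} (gauge n p1)"
proof -
  have si: "set_integrable lebesgue {0..1} p1" by (rule set_integrable_continuous[OF p1])
  have "continuous_on {0..1} (\<lambda>x. integral {0..x} p1)"
    by (rule indefinite_integral_continuous_1[OF set_lebesgue_integral_eq_integral(1)[OF si]])
  moreover have "integral {0..x} p1 = (LINT s:{0..x}|lebesgue. p1 s)" if "x \<in> {0..1}" for x
    using set_lebesgue_integral_eq_integral(2)[OF set_integrable_unit_subset[OF si, of x]] that by simp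
  ultimately have c: "continuous_on {0..1} (\<lambda>x. LINT s:{0..x}|lebesgue. p1 s)" by (rule continuous_on_eq)
  show ?thesis unfolding gauge_def[abs_def] divide_inverse by (intro continuous_intros c)
qed

lemma cinner_matrix_adjoint: "cinner (M *v x) y = cinner x (adjoint_matrix M *v y)"
proof -
  have "cinner (M *v x) y = (\<Sum>i\<in>UNIV. \<Sum>j\<in>UNIV. M $ i $ j * x $ j * cnj (y $ i))"
    by (simp add: cinner_def matrix_vector_mult_def sum_distrib_right)
  also have "\<dots> = (\<Sum>j\<in>UNIV. \<Sum>i\<in>UNIV. M $ i $ j * x $ j * cnj (y $ i))" by (rule sum.swap)
  also have "\<dots> = cinner x (adjoint_matrix M *v y)"
    by (simp add: cinner_def matrix_vector_mult_def adjoint_matrix_def sum_distrib_left mult_ac)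
  finally show ?thesis .
qed

lemma matrix_eigenvectors_orthogonal:
  assumes "matrix_eigenvector M z v" "matrix_eigenvector (adjoint_matrix M) (cnj z') u" "z \<noteq> z'"
  shows "cinner v u = 0"
proof -
  have "z * cinner v u = z' * cinner v u"
    using cinner_matrix_adjoint[of M v u] assms(1,2)
    by (simp add: matrix_eigenvector_def cinner_scale_left cinner_scale_right)
  with assms(3) show ?thesis by simp
qed

text \<open>The dual function scales by 1 / cnj c, hence the coefficient by 1 / c, which cancels the
  factor c of \<open>psi\<close>.\<close>

lemma projection_phase_invariant:
  assumes c: "cmod c = 1" and eq: "\<And>x. x \<in> {0..1} \<Longrightarrow> psi x = c *s psi' x" and x: "x \<in> {0..1}"
  shows "L2_inner {0..1} f (dual_eigenfunction psi s) *s psi x = L2_inner {0..1} f (dual_eigenfunction psi' s) *s psi' x"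
proof -
  have c0: "c \<noteq> 0" using c by auto
  have "L2_inner {0..1} psi s = L2_inner {0..1} (\<lambda>x. c *s psi' x) s"
    unfolding L2_inner_eq[OF unit_interval_sets] by (intro Bochner_Integration.integral_cong) (auto simp: eq)
  hence a: "L2_inner {0..1} psi s = c * L2_inner {0..1} psi' s" by (simp add: unit_inner_scale_left)
  have "dual_eigenfunction psi s = (\<lambda>x. (1 / cnj c) *s dual_eigenfunction psi' s x)"
    unfolding dual_eigenfunction_def a by (simp add: vector_smult_assoc)
  hence "L2_inner {0..1} f (dual_eigenfunction psi s) = (1 / c) * L2_inner {0..1} f (dual_eigenfunction psi' s)"
    by (simp only: unit_inner_scale_right) simp
  thus ?thesis using c0 by (simp add: eq[OF x] vector_smult_assoc)
qed

theorem theorem2: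
  fixes n N0 :: nat
    and p1 :: "real \<Rightarrow> complex"
    and P :: "nat \<Rightarrow> real \<Rightarrow> complex ^ 'm::finite ^ 'm"
    and mu :: "nat \<Rightarrow> complex"
    and v u :: "nat \<Rightarrow> complex ^ 'm"
    and lam :: "nat \<Rightarrow> real \<Rightarrow> complex"
    and Psi Psi_star :: "nat \<Rightarrow> real \<Rightarrow> real \<Rightarrow> complex ^ 'm"
    and f :: "real \<Rightarrow> complex ^ 'm"
    and F :: "real \<Rightarrow> real \<Rightarrow> complex ^ 'm"
  assumes n: "n \<ge> 2"
    and p1: "times_cont_diff (n - 1) p1" "\<And>x. p1 (x + 1) = p1 x"
    and P: "\<And>\<nu> i j. \<nu> \<in> {2..n} \<Longrightarrow> set_integrable lebesgue {0..1} (\<lambda>x. P \<nu> x $ i $ j)"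
           "\<And>\<nu> x. \<nu> \<in> {2..n} \<Longrightarrow> P \<nu> (x + 1) = P \<nu> x"
    and condition:
      "(odd n \<and> simple_matrix_eigenvalues (mean_matrix (P 2))) \<or>
       (even n \<and> simple_matrix_eigenvalues (mean_matrix (P 2)) \<and>
          Re (LINT x:{0..1}|lebesgue. p1 x) \<noteq> 0)"
    and mu: "bij_betw mu {1..CARD('m)} (matrix_eigenvalues (mean_matrix (P 2)))"
    and v: "\<And>j. j \<in> {1..CARD('m)} \<Longrightarrow> matrix_eigenvector (mean_matrix (P 2)) (mu j) (v j)"
           "\<And>j. j \<in> {1..CARD('m)} \<Longrightarrow> norm (v j) = 1"
    and u: "\<And>j. j \<in> {1..CARD('m)} \<Longrightarrow>
              matrix_eigenvector (adjoint_matrix (mean_matrix (P 2))) (cnj (mu j)) (u j)"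
           "\<And>j. j \<in> {1..CARD('m)} \<Longrightarrow> cinner (u j) (v j) = 1"
    and N0: "N0 \<ge> 1"
    and numbering: "eigenvalue_numbering (\<lambda>t. bloch_operator n p1 P (of_real t)) N0 lam"
    and eigenvalues: "eigenvalue_asymptotics n p1 CARD('m) mu N0 lam"
    and eigenfunctions:
      "eigenfunction_asymptotics n p1 (\<lambda>t. bloch_operator n p1 P (of_real t)) v u N0 lam"
    and finite: "finite (all_multiple_eigenvalues (\<lambda>t. bloch_operator n p1 P (of_real t)))"
                "finite (exceptional_quasimomenta (\<lambda>t. bloch_operator n p1 P (of_real t)))"
    and Psi: "\<And>k t. k \<ge> 1 \<Longrightarrow>
        t \<in> quasimomenta - exceptional_quasimomenta (\<lambda>t. bloch_operator n p1 P (of_real t)) \<Longrightarrow>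
        normalized_eigenfunction (bloch_operator n p1 P (of_real t)) (lam k t) (Psi k t)"
    and Psi_star: "\<And>k t. k \<ge> 1 \<Longrightarrow>
        t \<in> quasimomenta - exceptional_quasimomenta (\<lambda>t. bloch_operator n p1 P (of_real t)) \<Longrightarrow>
        normalized_eigenfunction (adjoint_operator (bloch_operator n p1 P (of_real t)))
          (cnj (lam k t)) (Psi_star k t)"
    and f: "L2_on UNIV f"
    and F: "gelfand_transform f F"
  shows
    "let J = quasimomenta - exceptional_quasimomenta (\<lambda>t. bloch_operator n p1 P (of_real t));
         N1 = num_exceptional CARD('m) N0;
         E = expansion_term F Psi Psi_star;
         low = (\<lambda>x. (1 / (2 * pi)) *\<^sub>R (LINT t:J|lebesgue. (\<Sum>k = 1..N1. E k t x)));
         high = (\<lambda>k x. LINT t:J|lebesgue. E k t x)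
     in (AE x in lebesgue. set_integrable lebesgue J (\<lambda>t. \<Sum>k = 1..N1. E k t x)) \<and>
        (\<forall>k>N1. AE x in lebesgue. set_integrable lebesgue J (\<lambda>t. E k t x)) \<and>
        (\<forall>a b. L2_on {a<..<b} low \<and>
               (\<forall>k>N1. L2_on {a<..<b} (high k)) \<and>
               (\<lambda>K. L2_norm {a<..<b}
                  (\<lambda>x. f x - (low x + (1 / (2 * pi)) *\<^sub>R (\<Sum>k = N1 + 1..K. high k x))))
                 \<longlonglongrightarrow> 0)"
proof -
  let ?T = "\<lambda>t. bloch_operator n p1 P (of_real t)" and ?m = "CARD('m)"
  define A where "A = exceptional_quasimomenta ?T"
  define J where "J = quasimomenta - A"
  define N1 where "N1 = num_exceptional ?m N0"
  have m1: "?m \<ge> 1" by (simp add: Suc_le_eq)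
  have p1c: "continuous_on {0..1} p1"
    using continuous_on_subset[OF times_cont_diff_continuous[OF p1(1)]] by simp
  interpret bloch_coefficients n p1 P by unfold_locales (use n p1c P(1) in auto)
  have A_fin: "finite A" using finite(2) by (simp add: A_def)
  interpret inverse_gelfand_transform J
  proof
    show "J \<in> sets borel" unfolding J_def using A_fin by (intro sets.Diff) (auto intro: borel_closed finite_imp_closed)
    have "quasimomenta - J \<subseteq> A" by (auto simp: J_def)
    thus "finite (quasimomenta - J)" using A_fin by (rule finite_subset)
  qed (simp add: J_def)
  have Psi_n: "normalized_eigenfunction (bloch t) (lam p t) (Psi p t)" if "p \<ge> 1" "t \<in> J" for p t
    using Psi[of p t] that by (simp add: J_def A_def)
  have star_n: "normalized_eigenfunction (adjoint_operator (bloch t)) (cnj (lam p t)) (Psi_star p t)" if "p \<ge> 1" "t \<in> J" for p t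
    using Psi_star[of p t] that by (simp add: J_def A_def)
  have Psi_e: "eigenfunction (bloch t) (lam p t) (Psi p t)" if "p \<ge> 1" "t \<in> J" for p t
    using Psi_n[OF that] by (simp add: normalized_eigenfunction_def)
  have star_e: "eigenfunction (adjoint_operator (bloch t)) (cnj (lam p t)) (Psi_star p t)"
    "L2_norm {0..1} (Psi_star p t) = 1" "L2_on {0..1} (Psi_star p t)" if "p \<ge> 1" "t \<in> J" for p t
    using star_n[OF that] by (auto simp: normalized_eigenfunction_def eigenfunction_def adjoint_operator_def)
  \<comment> \<open>A multiple eigenvalue at t would put t into the exceptional set
    \<open>A\<close>, which \<open>J\<close> excludes.\<close>
  have simple: "has_multiplicity (bloch t) (lam p t) 1" if p: "p \<ge> 1" and t: "t \<in> J" for p t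
  proof (rule ccontr)
    assume "\<not> has_multiplicity (bloch t) (lam p t) 1"
    moreover have ev: "eigenvalue (bloch t) (lam p t)" using Psi_e[OF p t] by (auto simp: eigenvalue_def)
    ultimately have "lam p t \<in> all_multiple_eigenvalues ?T"
      using t by (auto simp: all_multiple_eigenvalues_def multiple_eigenvalue_def J_def)
    hence "t \<in> A" using ev t by (auto simp: A_def exceptional_quasimomenta_def J_def)
    thus False using t by (simp add: J_def)
  qed
  \<comment> \<open>The multiplicity of an eigenvalue is the number of its indices in the numbering,
    here 1.\<close>
  have inj: "inj_on (\<lambda>p. lam p t) {1..}" if t: "t \<in> J" for t
  proof (rule inj_onI)
    fix p q :: nat assume p: "p \<in> {1..}" and q: "q \<in> {1..}" and eq: "lam p t = lam q t"
    let ?S = "{r. r \<ge> 1 \<and> lam r t = lam p t}"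
    have S: "finite ?S" "has_multiplicity (bloch t) (lam p t) (card ?S)"
      using numbering t by (auto simp: eigenvalue_numbering_def J_def)
    have "card ?S = 1" using has_multiplicity_one_unique[OF simple S(2)] p t by simp
    then obtain s where s: "?S = {s}" by (rule card_1_singletonE)
    have "p \<in> {s}" "q \<in> {s}" unfolding s[symmetric] using p q eq by auto
    thus "p = q" by simp
  qed
  have lam_ne: "lam p t \<noteq> lam q t" if "p \<ge> 1" "q \<ge> 1" "p \<noteq> q" "t \<in> J" for p q t
    using inj_onD[OF inj[OF that(4)], of p q] that by auto

  define h where "h = gauge n p1"
  define a where "a = L2_norm {0..1} h"
  have hc: "continuous_on {0..1} h" unfolding h_def by (rule continuous_gauge[OF p1c])
  have h0: "h x \<noteq> 0" for x by (simp add: h_def gauge_def)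
  have a0: "0 < a"
  proof -
    have "a \<noteq> 0"
    proof
      assume "a = 0"
      hence "AE x\<in>{0..1} in lebesgue. h x = 0" using unit_norm_eq_0[OF L2_on_continuous[OF hc]] by (simp add: a_def)
      from continuous_AE_zero[OF hc this, of 0] h0 show False by simp
    qed
    thus ?thesis using unit_norm_nonneg[of h] by (simp add: a_def less_le)
  qed
  interpret model_basis h a v u
  proof
    fix i j assume i: "i \<in> {1..?m}" and j: "j \<in> {1..?m}"
    show "cinner (v i) (u j) = (if i = j then 1 else 0)"
    proof (cases "i = j")
      case True
      thus ?thesis using u(2)[OF j] cinner_commute[of "v j" "u j"] by simp
    next
      case False
      hence "mu i \<noteq> mu j" using mu i j by (auto simp: bij_betw_def dest: inj_onD)
      from matrix_eigenvectors_orthogonal[OF v(1)[OF i] u(1)[OF j] this] False show ?thesis by simp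
    qed
  qed (use hc h0 a0 in auto)

  obtain PsiA XA c where as: "\<And>t k j. t \<in> quasimomenta \<Longrightarrow> \<bar>k\<bar> \<ge> int N0 \<Longrightarrow> j \<in> {1..?m} \<Longrightarrow>
        normalized_eigenfunction (bloch t) (lam (eigenvalue_index ?m k j) t) (PsiA k j t) \<and>
        eigenfunction (adjoint_operator (bloch t)) (cnj (lam (eigenvalue_index ?m k j) t)) (XA k j t) \<and>
        L2_inner {0..1} (XA k j t) (PsiA k j t) = 1 \<and>
        (\<forall>x\<in>{0..1}. norm (PsiA k j t x - (h x / a * wave t k x) *s v j) \<le> c * ((1 + ln (of_int \<bar>k\<bar>)) / of_int \<bar>k\<bar>) \<and>
                    norm (XA k j t x - (a / cnj (h x) * wave t k x) *s u j) \<le> c * ((1 + ln (of_int \<bar>k\<bar>)) / of_int \<bar>k\<bar>))"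
    using eigenfunctions unfolding eigenfunction_asymptotics_def Let_def h_def[symmetric] a_def[symmetric] wave_def[symmetric]
    by blast
  define kk where "kk = index_freq ?m"
  define jj where "jj = index_branch ?m"
  \<comment> \<open>Beyond \<open>N1\<close> the eigenfunctions phased as in the asymptotics replace
    \<open>Psi\<close>, since only they are close to the model.\<close>
  define psi where "psi t p = (if p > N1 then PsiA (kk p) (jj p) t else Psi p t)" for t p
  define X where "X t p = XA (kk p) (jj p) t" for t p
  define eps where "eps p = c * ((1 + ln (of_int \<bar>kk p\<bar>)) / of_int \<bar>kk p\<bar>)" for p
  have asp: "normalized_eigenfunction (bloch t) (lam p t) (psi t p)"
      "eigenfunction (adjoint_operator (bloch t)) (cnj (lam p t)) (X t p)"
      "L2_inner {0..1} (X t p) (psi t p) = 1"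
      "\<And>x. x \<in> {0..1} \<Longrightarrow> norm (psi t p x - model_phi t p x) \<le> eps p"
      "\<And>x. x \<in> {0..1} \<Longrightarrow> norm (X t p x - model_chi t p x) \<le> eps p"
    if p: "p > N1" and t: "t \<in> J" for p t
  proof -
    have p1: "p \<ge> 1" using p by simp
    have idx: "eigenvalue_index ?m (kk p) (jj p) = p"
      unfolding kk_def jj_def by (rule eigenvalue_index_freq_branch[OF m1 p1])
    have k: "\<bar>kk p\<bar> \<ge> int N0" unfolding kk_def using p N0 by (intro index_freq_ge[OF m1]) (auto simp: N1_def)
    have j: "jj p \<in> {1..?m}" unfolding jj_def by (rule index_branch_in[OF m1])
    have t': "t \<in> quasimomenta" using t by (simp add: J_def)
    note * = as[OF t' k j, unfolded idx]
    show "normalized_eigenfunction (bloch t) (lam p t) (psi t p)"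
      "eigenfunction (adjoint_operator (bloch t)) (cnj (lam p t)) (X t p)"
      "L2_inner {0..1} (X t p) (psi t p) = 1"
      "\<And>x. x \<in> {0..1} \<Longrightarrow> norm (psi t p x - model_phi t p x) \<le> eps p"
      "\<And>x. x \<in> {0..1} \<Longrightarrow> norm (X t p x - model_chi t p x) \<le> eps p"
      using * p by (simp_all add: psi_def X_def eps_def model_phi_def model_chi_def kk_def[symmetric] jj_def[symmetric])
  qed
  have psi_n: "normalized_eigenfunction (bloch t) (lam p t) (psi t p)" if "p \<ge> 1" "t \<in> J" for p t
    using asp(1)[of p t] Psi_n[OF that] that by (cases "p > N1") (auto simp: psi_def)
  have psi_e: "eigenfunction (bloch t) (lam p t) (psi t p)" if "p \<ge> 1" "t \<in> J" for p t
    using psi_n[OF that] by (simp add: normalized_eigenfunction_def)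
  obtain Es where Es: "\<And>S. finite S \<Longrightarrow> S \<subseteq> {1..} \<Longrightarrow> (\<Sum>p\<in>S. (eps p)\<^sup>2) \<le> Es"
    using log_error_sum_bounded[OF m1, of c] unfolding eps_def kk_def by blast
  \<comment> \<open>The constants \<open>Cu\<close>, \<open>Cv\<close> and \<open>Es\<close> carry
    no t; this is where uniformity in the quasimomentum enters.\<close>
  have riesz: "riesz_perturbation (model_phi t) (model_chi t) (psi t) (X t) (\<lambda>p. Psi_star p t) eps N1 Cu (Cv\<^sup>2) (Cv\<^sup>2) Es"
    if t: "t \<in> J" for t
  proof
    show L_phi: "L2_on {0..1} (model_phi t p)" "L2_on {0..1} (model_chi t p)" for p
      by (rule L2_on_continuous[OF continuous_model(1)], rule L2_on_continuous[OF continuous_model(2)])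
    show L_psi: "L2_on {0..1} (psi t p)" if "p \<ge> 1" for p by (rule eigenfunction_L2[OF psi_e[OF that t]])
    show L_X: "L2_on {0..1} (X t p)" if "p > N1" for p
      using asp(2)[OF that t] by (simp add: eigenfunction_def adjoint_operator_def)
    have eps0: "0 \<le> eps p" if "p > N1" for p
      using order_trans[OF norm_ge_zero asp(4)[OF that t, of 0]] by simp
    show "L2_norm {0..1} (\<lambda>x. psi t p x - model_phi t p x) \<le> eps p" if p: "p > N1" for p
      using p by (intro L2_norm_le_bound asp(4)[OF p t] unit_L2_diff L_phi L_psi eps0) auto
    show "L2_norm {0..1} (\<lambda>x. X t p x - model_chi t p x) \<le> eps p" if p: "p > N1" for p
      using p by (intro L2_norm_le_bound asp(5)[OF p t] unit_L2_diff L_phi L_X eps0) auto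
    show "(\<Sum>p\<in>S. (eps p)\<^sup>2) \<le> Es" if "finite S" "S \<subseteq> {N1<..}" for S
      using that by (intro Es) force+
    show "L2_inner {0..1} (psi t p) (X t q) = (if p = q then 1 else 0)" if p: "p \<ge> 1" and q: "q > N1" for p q
    proof (cases "p = q")
      case True
      thus ?thesis using asp(3)[OF q t] L2_inner_commute[OF unit_interval_sets, of "psi t q" "X t q"] by simp
    next
      case False
      have "lam p t \<noteq> lam q t" using lam_ne[OF p _ False t] q by simp
      from adjoint_orthogonal[OF psi_e[OF p t] asp(2)[OF q t] this] False show ?thesis by simp
    qed
    show "d p = 0" if S: "finite S" "S \<subseteq> {1..}" and z: "L2_norm {0..1} (\<lambda>x. \<Sum>p\<in>S. d p *s psi t p x) = 0" and p: "p \<in> S"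
      for S and d :: "nat \<Rightarrow> complex" and p
    proof (rule eigenfunctions_independent[OF psi_e inj[OF t] S _ p])
      have c: "continuous_on {0..1} (\<lambda>x. \<Sum>p\<in>S. d p *s psi t p x)"
        using S by (intro continuous_intros eigenfunction_continuous[OF psi_e[OF _ t]]) auto
      have "AE x\<in>{0..1} in lebesgue. (\<Sum>p\<in>S. d p *s psi t p x) = 0"
        using z unit_norm_eq_0[OF L2_on_continuous[OF c]] by simp
      from continuous_AE_zero[OF c this] show "(\<Sum>p\<in>S. d p *s psi t p x) = 0" if "x \<in> {0..1}" for x using that .
    qed (use t in auto)
    show "L2_on {0..1} (Psi_star p t)" "L2_norm {0..1} (Psi_star p t) \<noteq> 0" if "p \<ge> 1" for p
      using star_e[OF that t] by auto
    show "L2_inner {0..1} (psi t q) (Psi_star p t) = 0" if "p \<ge> 1" "q \<ge> 1" "p \<noteq> q" for p q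
      using adjoint_orthogonal[OF psi_e[OF that(2) t] star_e(1)[OF that(1) t]] lam_ne[of q p t] that t by auto
    show "(\<Sum>p\<in>S. (cmod (L2_inner {0..1} f (model_chi t p)))\<^sup>2) \<le> Cu * (L2_norm {0..1} f)\<^sup>2"
      if "L2_on {0..1} f" "finite S" "S \<subseteq> {1..}" for f S by (rule model_upper[OF that])
    show "(L2_norm {0..1} f)\<^sup>2 \<le> Cv\<^sup>2 * B"
      if "L2_on {0..1} f" "\<And>S. finite S \<Longrightarrow> S \<subseteq> {1..} \<Longrightarrow> (\<Sum>p\<in>S. (cmod (L2_inner {0..1} f (model_chi t p)))\<^sup>2) \<le> B"
      for f B by (rule model_lower[OF that])
    show "(L2_norm {0..1} (\<lambda>x. \<Sum>p\<in>S. c p *s model_phi t p x))\<^sup>2 \<le> Cv\<^sup>2 * (\<Sum>p\<in>S. (cmod (c p))\<^sup>2)"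
      if "finite S" "S \<subseteq> {1..}" for c S by (rule model_synthesis[OF that])
  qed (simp_all add: Cu_nonneg)

  have phase: "\<exists>c. cmod c = 1 \<and> (\<forall>x\<in>{0..1}. Psi p t x = c *s psi t p x)" if "p \<ge> 1" "t \<in> J" for p t
    by (rule simple_eigenfunctions_proportional[OF simple[OF that] Psi_n[OF that] psi_n[OF that]])
  let ?d = "\<lambda>p t. dual_eigenfunction (psi t p) (Psi_star p t)" and ?dl = "\<lambda>p t. dual_eigenfunction (Psi p t) (Psi_star p t)"
  have proj: "L2_inner {0..1} g (?dl p t) *s Psi p t x = L2_inner {0..1} g (?d p t) *s psi t p x"
    if p: "p \<ge> 1" and t: "t \<in> J" and x: "x \<in> {0..1}" for g p t x
  proof -
    obtain c where "cmod c = 1" "\<forall>x\<in>{0..1}. Psi p t x = c *s psi t p x" using phase[OF p t] by blast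
    thus ?thesis by (intro projection_phase_invariant[OF _ _ x]) auto
  qed
  define C where "C = 2 * sqrt ((Cv\<^sup>2 + Es) * (Cu + Es))"
  have Es0: "0 \<le> Es" using Es[of "{}"] by simp
  interpret bloch_expansion J Psi Psi_star N1 C
  proof
    show "continuous_on {0..1} (Psi p t)" if "p \<ge> 1" "t \<in> J" for p t
      by (rule eigenfunction_continuous[OF Psi_e[OF that]])
    show "continuous_on (J \<times> {0..1}) (\<lambda>(t, x). cnj (Psi p t q $ i) *s Psi p t x)" if "p \<ge> 1" "q \<in> {0..1}" for p q i
    proof (rule kernel_continuous[OF _ Psi_n simple that(2)])
      have "continuous_on quasimomenta (lam p)" using numbering that(1) by (simp add: eigenvalue_numbering_def)
      thus "continuous_on J (lam p)" by (rule continuous_on_subset) (simp add: J_def)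
    qed (use that in auto)
    show L2d: "L2_on {0..1} (?dl p t)" if "p \<ge> 1" "t \<in> J" for p t
      unfolding dual_eigenfunction_def by (intro unit_L2_scale star_e(3) that)
    show "L2_inner {0..1} (Psi q t) (?dl p t) = (if p = q then 1 else 0)" if p: "p \<ge> 1" and q: "q \<ge> 1" and t: "t \<in> J" for p q t
    proof (cases "p = q")
      case False
      have "L2_inner {0..1} (Psi q t) (Psi_star p t) = 0"
        using adjoint_orthogonal[OF Psi_e[OF q t] star_e(1)[OF p t]] lam_ne[OF q p _ t] False by auto
      thus ?thesis using False by (simp add: dual_eigenfunction_def[abs_def] unit_inner_scale_right)
    next
      case True
      interpret R: riesz_perturbation "model_phi t" "model_chi t" "psi t" "X t" "\<lambda>p. Psi_star p t" eps N1 Cu "Cv\<^sup>2" "Cv\<^sup>2" Es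
        by (rule riesz[OF t])
      obtain c where c: "cmod c = 1" "\<forall>x\<in>{0..1}. Psi p t x = c *s psi t p x" using phase[OF p t] by blast
      have "L2_inner {0..1} (Psi p t) (Psi_star p t) = L2_inner {0..1} (\<lambda>x. c *s psi t p x) (Psi_star p t)"
        unfolding L2_inner_eq[OF unit_interval_sets] by (intro Bochner_Integration.integral_cong) (auto simp: c)
      \<comment> \<open>Totality excludes a vanishing pairing for the phased eigenfunction; the
        unimodular \<open>c\<close> transfers this to \<open>Psi\<close>.\<close>
      also have "\<dots> \<noteq> 0" using R.inner_star_nonzero[OF p] c(1) by (auto simp: unit_inner_scale_left)
      finally show ?thesis using True by (simp add: dual_eigenfunction_def[abs_def] unit_inner_scale_right)
    qed
    show "(\<lambda>K. L2_norm {0..1} (\<lambda>x. g x - (\<Sum>p=1..K. L2_inner {0..1} g (?dl p t) *s Psi p t x))) \<longlonglongrightarrow> 0"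
      if g: "L2_on {0..1} g" and t: "t \<in> J" for g t
    proof -
      interpret R: riesz_perturbation "model_phi t" "model_chi t" "psi t" "X t" "\<lambda>p. Psi_star p t" eps N1 Cu "Cv\<^sup>2" "Cv\<^sup>2" Es
        by (rule riesz[OF t])
      have "L2_norm {0..1} (\<lambda>x. g x - (\<Sum>p=1..K. L2_inner {0..1} g (?dl p t) *s Psi p t x))
          = L2_norm {0..1} (\<lambda>x. g x - (\<Sum>p=1..K. L2_inner {0..1} g (R.dual p) *s psi t p x))" for K
        unfolding R.dual_def
        by (rule L2_norm_cong[OF unit_interval_sets]) (auto intro!: sum.cong proj t)
      thus ?thesis using R.expansion[OF g] by simp
    qed
    show "0 \<le> C" using Es0 Cu_nonneg by (simp add: C_def)
    show "L2_norm {0..1} (\<lambda>x. \<Sum>p\<in>S. L2_inner {0..1} g (?dl p t) *s Psi p t x) \<le> C * L2_norm {0..1} g"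
      if g: "L2_on {0..1} g" and t: "t \<in> J" and S: "finite S" "S \<subseteq> {N1<..}" for g t S
    proof -
      interpret R: riesz_perturbation "model_phi t" "model_chi t" "psi t" "X t" "\<lambda>p. Psi_star p t" eps N1 Cu "Cv\<^sup>2" "Cv\<^sup>2" Es
        by (rule riesz[OF t])
      have "L2_norm {0..1} (\<lambda>x. \<Sum>p\<in>S. L2_inner {0..1} g (?dl p t) *s Psi p t x)
          = L2_norm {0..1} (\<lambda>x. \<Sum>p\<in>S. L2_inner {0..1} g (X t p) *s psi t p x)"
      proof (rule L2_norm_cong[OF unit_interval_sets], intro sum.cong refl)
        fix x :: real and p assume x: "x \<in> {0..1}" and p: "p \<in> S"
        have p': "p \<ge> 1" "p > N1" using p S by auto
        show "L2_inner {0..1} g (?dl p t) *s Psi p t x = L2_inner {0..1} g (X t p) *s psi t p x"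
          unfolding proj[OF p'(1) t x] using R.inner_dual_tail[OF p'(2) g] by (simp add: R.dual_def)
      qed
      also have "\<dots> \<le> C * L2_norm {0..1} g" unfolding C_def by (rule R.tail_projection_bound[OF g S])
      finally show ?thesis .
    qed
  qed
  show ?thesis
    unfolding Let_def A_def[symmetric] J_def[symmetric] N1_def[symmetric]
    using integrated_expansion[OF f F] by blast
qed

end
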